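(* Let $\mathfrak g$ be a simple complex Lie algebra with a fixed numeration of positive roots and a fixed monomial order, let $\lambda_1,\dots,\lambda_m$ be dominant weights, and let $S$ be the semigroup they generate. Then $\Sigma(S)=\Sigma^{(\lambda_1,\ldots,\lambda_m)}$ if and only if $\operatorname{lt}(I)=J$.
   Context: Notation for $\mathfrak g$: triangular decomposition $\mathfrak g=\mathfrak u^-\oplus\mathfrak t\oplus\mathfrak u$, positive roots $\Delta_+=\{\alpha_1,\dots,\alpha_N\}$ in the fixed numeration, root vectors $e_{\pm\alpha}$, fundamental weights $\omega_1,\dots,\omega_n$, irreducible modules $V(\lambda)$ with highest weight vectors $v_\lambda$. A monomial order on $\mathbb Z_{\ge0}^N$ is a total order compatible with addition, with $0$ least. Signatures. A signature is $\sigma=(\lambda;p_1,\dots,p_N)$ with $\lambda$ dominant (its highest weight) and $p_i\in\mathbb Z_{\ge0}$; $v(\sigma)=\frac{e_{-\alpha_1}^{p_1}}{p_1!}\cdots\frac{e_{-\alpha_N}^{p_N}}{p_N!}v_\lambda$. Order on signatures: for $\lambda=\sum k_i\omega_i$, $\lambda'=\sum k_i'\omega_i$, compare first $(k_1,\dots,k_n)$ and $(k'_1,\dots,k'_n)$ by the degree lexicographic order, and if $\lambda=\lambda'$ compare exponent tuples by the fixed monomial order. $\sigma$ of highest weight $\lambda$ is essential if $v(\sigma)$ is not in the span of the $v(\tau)$ with $\tau<\sigma$ of highest weight $\lambda$. For each $\lambda$ the vectors $v(\sigma)$, $\sigma$ essential of highest weight $\lambda$, form a basis of $V(\lambda)$;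 the essential signatures form a semigroup under componentwise addition. $\Sigma(S)$ is the semigroup of essential signatures with highest weight in $S$; $\Sigma^{(\lambda_1,\dots,\lambda_m)}$ is the semigroup generated by the essential signatures with highest weight in $\{\lambda_1,\dots,\lambda_m\}$. Geometry. $G$ is the simply connected simple algebraic group with Lie algebra $\mathfrak g$; $T$, $U$, $U^-$ are the subgroups with Lie algebras $\mathfrak t,\mathfrak u,\mathfrak u^-$. Let $V=V(\lambda_1)\oplus\dots\oplus V(\lambda_m)$ and let $X=\overline{G(v_{\lambda_1}+\dots+v_{\lambda_m})}\subseteq V$, which is isomorphic to $\operatorname{Spec}\bigoplus_{\lambda\in S}\mathbb C[G/U]^{(B)}_\lambda$, where $B=TU$ and $\mathbb C[G/U]_\lambda^{(B)}=\{f\in\mathbb C[G]: f(gtu)=\lambda(t)f(g)\ \forall g\in G,t\in T,u\in U\}$. $I\subset\mathbb C[V]$ is the vanishing ideal of $X$, and $x_i$ are the coordinates on $V$ dual to the basis $\{v(\sigma_i)\}$ of $V$, where $\sigma_i$ runs over the essential signatures of highest weights $\lambda_1,\dots,\lambda_m$. The signature of a monomial is $\operatorname{sign}(x_{i_1}\cdots x_{i_k})=\sigma_{i_1}+\dots+\sigma_{i_k}$; this grades $\mathbb C[V]$ by $\Sigma^{(\lambda_1,\dots,\lambda_m)}$. For $f\in\mathbb C[V]$, $\operatorname{lt}(f)$ is the nonzero homogeneous component of $f$ of least signature. $\operatorname{lt}(I)$ is the ideal spanned by $\operatorname{lt}(f)$, $f\in I$. $J$ is the ideal of $\mathbb C[V]$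 spanned by all binomials $x_{i_1}\cdots x_{i_k}-x_{j_1}\cdots x_{j_l}$ with $\operatorname{sign}(x_{i_1}\cdots x_{i_k})=\operatorname{sign}(x_{j_1}\cdots x_{j_l})$. *)

theory Defs
  imports "HOL-Analysis.Analysis" "HOL-Library.Poly_Mapping"
begin

class complex_vector = ab_group_add +
  fixes scaleC :: "complex \<Rightarrow> 'a \<Rightarrow> 'a"  (infixr \<open>*\<^sub>C\<close> 75)
  assumes scaleC_add_right: "c *\<^sub>C (x + y) = c *\<^sub>C x + c *\<^sub>C y"
    and scaleC_add_left: "(c + d) *\<^sub>C x = c *\<^sub>C x + d *\<^sub>C x"
    and scaleC_scaleC: "c *\<^sub>C d *\<^sub>C x = (c * d) *\<^sub>C x"
    and scaleC_one: "1 *\<^sub>C x = x"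

global_interpretation cv: vector_space "scaleC :: complex \<Rightarrow> 'a \<Rightarrow> 'a::complex_vector"
  by unfold_locales
    (simp_all add: scaleC_add_right scaleC_add_left scaleC_scaleC scaleC_one)

class complex_lie_algebra = complex_vector +
  fixes bracket :: "'a \<Rightarrow> 'a \<Rightarrow> 'a"
  assumes bracket_add_left: "bracket (x + y) z = bracket x z + bracket y z"
    and bracket_add_right: "bracket x (y + z) = bracket x y + bracket x z"
    and bracket_scaleC_left: "bracket (c *\<^sub>C x) y = c *\<^sub>C bracket x y"
    and bracket_scaleC_right: "bracket x (c *\<^sub>C y) = c *\<^sub>C bracket x y"
    and bracket_self: "bracket x x = 0"
    and jacobi: "bracket x (bracket y z) + bracket y (bracket z x) + bracket z (bracket x y) = 0"

definition lie_ideal :: "'g::complex_lie_algebra set \<Rightarrow> bool" where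
  "lie_ideal I \<longleftrightarrow> cv.subspace I \<and> (\<forall>x. \<forall>y\<in>I. bracket x y \<in> I)"

definition simple_lie_algebra :: "'g::complex_lie_algebra itself \<Rightarrow> bool" where
  "simple_lie_algebra _ \<longleftrightarrow>
     (\<exists>B::'g set. finite B \<and> cv.span B = UNIV) \<and>
     (\<exists>x y::'g. bracket x y \<noteq> 0) \<and>
     (\<forall>I::'g set. lie_ideal I \<longrightarrow> I = {0} \<or> I = UNIV)"

text \<open>
  A Cartan subalgebra (of a semisimple algebra) is a self-centralising abelian subalgebra
  all of whose elements are ad-diagonalisable.
\<close>

definition cartan_subalgebra :: "'g::complex_lie_algebra set \<Rightarrow> bool" where
  "cartan_subalgebra t \<longleftrightarrow>
     cv.subspace t \<and>
     (\<forall>h\<in>t. \<forall>h'\<in>t. bracket h h' = 0) \<and>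
     (\<forall>x. (\<forall>h\<in>t. bracket h x = 0) \<longrightarrow> x \<in> t) \<and>
     (\<forall>h\<in>t. cv.span {x. \<exists>c. bracket h x = c *\<^sub>C x} = UNIV)"

text \<open>Functionals on \<open>t\<close> are extended by 0 outside \<open>t\<close>, so that they are equal iff they agree on \<open>t\<close>.\<close>

definition dual_space :: "'g::complex_vector set \<Rightarrow> ('g \<Rightarrow> complex) set" where
  "dual_space t = {\<phi>. (\<forall>x\<in>t. \<forall>y\<in>t. \<phi> (x + y) = \<phi> x + \<phi> y) \<and>
                      (\<forall>c. \<forall>x\<in>t. \<phi> (c *\<^sub>C x) = c * \<phi> x) \<and>
                      (\<forall>x. x \<notin> t \<longrightarrow> \<phi> x = 0)}"

definition root_space ::
    "'g::complex_lie_algebra set \<Rightarrow> ('g \<Rightarrow> complex) \<Rightarrow> 'g set" where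
  "root_space t \<alpha> = {x. \<forall>h\<in>t. bracket h x = \<alpha> h *\<^sub>C x}"

definition roots :: "'g::complex_lie_algebra set \<Rightarrow> ('g \<Rightarrow> complex) set" where
  "roots t = {\<alpha> \<in> dual_space t. \<alpha> \<noteq> (\<lambda>h. 0) \<and> root_space t \<alpha> \<noteq> {0}}"

definition opposite :: "('g \<Rightarrow> complex) \<Rightarrow> 'g \<Rightarrow> complex" where
  "opposite \<alpha> = (\<lambda>h. - \<alpha> h)"

definition root_base ::
    "'g::complex_lie_algebra set \<Rightarrow> nat \<Rightarrow> (nat \<Rightarrow> 'g \<Rightarrow> complex) \<Rightarrow> bool" where
  "root_base t n \<beta> \<longleftrightarrow>
     \<beta> ` {..<n} \<subseteq> roots t \<and>
     (\<forall>a::nat \<Rightarrow> complex. (\<forall>h\<in>t. (\<Sum>i<n. a i * \<beta> i h) = 0) \<longrightarrow> (\<forall>i<n. a i = 0)) \<and>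
     (\<forall>\<alpha>\<in>roots t. \<exists>c::nat \<Rightarrow> nat.
        \<alpha> = (\<lambda>h. \<Sum>i<n. of_nat (c i) * \<beta> i h) \<or>
        \<alpha> = opposite (\<lambda>h. \<Sum>i<n. of_nat (c i) * \<beta> i h))"

definition positive_roots ::
    "'g::complex_lie_algebra set \<Rightarrow> nat \<Rightarrow> (nat \<Rightarrow> 'g \<Rightarrow> complex) \<Rightarrow> ('g \<Rightarrow> complex) set" where
  "positive_roots t n \<beta> =
     {\<alpha> \<in> roots t. \<exists>c::nat \<Rightarrow> nat. \<alpha> = (\<lambda>h. \<Sum>i<n. of_nat (c i) * \<beta> i h)}"

definition is_coroot ::
    "'g::complex_lie_algebra set \<Rightarrow> ('g \<Rightarrow> complex) \<Rightarrow> 'g \<Rightarrow> bool" where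
  "is_coroot t \<alpha> h \<longleftrightarrow>
     h \<in> cv.span {bracket x y |x y. x \<in> root_space t \<alpha> \<and> y \<in> root_space t (opposite \<alpha>)} \<and>
     \<alpha> h = 2"

definition fundamental_weights ::
    "'g::complex_lie_algebra set \<Rightarrow> nat \<Rightarrow> (nat \<Rightarrow> 'g \<Rightarrow> complex) \<Rightarrow> (nat \<Rightarrow> 'g \<Rightarrow> complex) \<Rightarrow> bool"
  where
  "fundamental_weights t n \<beta> \<omega> \<longleftrightarrow>
     (\<forall>i<n. \<omega> i \<in> dual_space t \<and>
        (\<forall>j<n. \<forall>h. is_coroot t (\<beta> j) h \<longrightarrow> \<omega> i h = (if i = j then 1 else 0)))"

text \<open>
  All finite numerations start at 0.  A dominant weight \<open>\<Sum>i<n. k i * \<omega> i\<close> is encoded by its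
  coordinate tuple \<open>k\<close>, and a signature is a pair of a dominant weight and an exponent tuple.
  Tuples of length \<open>n\<close> are finitely supported functions with support in \<open>{..<n}\<close>.
\<close>

type_synonym weight = "nat \<Rightarrow>\<^sub>0 nat"
type_synonym exponent = "nat \<Rightarrow>\<^sub>0 nat"
type_synonym signature = "weight \<times> exponent"

text \<open>
  The modules \<open>V(\<lambda>)\<close> are subspaces of a common vector space, each with its own action;
  \<open>irrep\<close>, \<open>action\<close> and \<open>hw_vector\<close> are only used at dominant weights.
\<close>

record ('g, 'v) lie_setup =
  cartan :: "'g set"
  rank :: nat
  simple_root :: "nat \<Rightarrow> 'g \<Rightarrow> complex"
  fund_weight :: "nat \<Rightarrow> 'g \<Rightarrow> complex"
  num_pos :: nat
  pos_root :: "nat \<Rightarrow> 'g \<Rightarrow> complex"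
  root_vector :: "('g \<Rightarrow> complex) \<Rightarrow> 'g"
  mon_order :: "exponent rel"
  irrep :: "weight \<Rightarrow> 'v set"
  action :: "weight \<Rightarrow> 'g \<Rightarrow> 'v \<Rightarrow> 'v"
  hw_vector :: "weight \<Rightarrow> 'v"

definition tuples :: "nat \<Rightarrow> (nat \<Rightarrow>\<^sub>0 nat) set" where
  "tuples n = {k. Poly_Mapping.keys k \<subseteq> {..<n}}"

definition dominant_weights :: "('g, 'v) lie_setup \<Rightarrow> weight set" where
  "dominant_weights D = tuples (rank D)"

definition weight_fun :: "('g, 'v) lie_setup \<Rightarrow> weight \<Rightarrow> 'g \<Rightarrow> complex" where
  "weight_fun D k h = (\<Sum>i<rank D. of_nat (Poly_Mapping.lookup k i) * fund_weight D i h)"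

definition root_setup :: "('g::complex_lie_algebra, 'v) lie_setup \<Rightarrow> bool" where
  "root_setup D \<longleftrightarrow>
     cartan_subalgebra (cartan D) \<and>
     root_base (cartan D) (rank D) (simple_root D) \<and>
     fundamental_weights (cartan D) (rank D) (simple_root D) (fund_weight D) \<and>
     bij_betw (pos_root D) {..<num_pos D}
       (positive_roots (cartan D) (rank D) (simple_root D)) \<and>
     (\<forall>\<alpha>\<in>roots (cartan D). root_vector D \<alpha> \<in> root_space (cartan D) \<alpha> - {0})"

definition monomial_order :: "nat \<Rightarrow> exponent rel \<Rightarrow> bool" where
  "monomial_order N r \<longleftrightarrow>
     linear_order_on (tuples N) r \<and>
     (\<forall>p q s. (p, q) \<in> r \<longrightarrow> s \<in> tuples N \<longrightarrow> (p + s, q + s) \<in> r) \<and>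
     (\<forall>p\<in>tuples N. (0, p) \<in> r)"

definition lie_module ::
    "'v::complex_vector set \<Rightarrow> ('g::complex_lie_algebra \<Rightarrow> 'v \<Rightarrow> 'v) \<Rightarrow> bool" where
  "lie_module V \<rho> \<longleftrightarrow>
     cv.subspace V \<and>
     (\<forall>x. \<forall>u\<in>V. \<rho> x u \<in> V) \<and>
     (\<forall>x. \<forall>u\<in>V. \<forall>w\<in>V. \<rho> x (u + w) = \<rho> x u + \<rho> x w) \<and>
     (\<forall>x c. \<forall>u\<in>V. \<rho> x (c *\<^sub>C u) = c *\<^sub>C \<rho> x u) \<and>
     (\<forall>x y. \<forall>u\<in>V. \<rho> (x + y) u = \<rho> x u + \<rho> y u) \<and>
     (\<forall>x c. \<forall>u\<in>V. \<rho> (c *\<^sub>C x) u = c *\<^sub>C \<rho> x u) \<and>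
     (\<forall>x y. \<forall>u\<in>V. \<rho> (bracket x y) u = \<rho> x (\<rho> y u) - \<rho> y (\<rho> x u))"

definition irreducible_module ::
    "'v::complex_vector set \<Rightarrow> ('g::complex_lie_algebra \<Rightarrow> 'v \<Rightarrow> 'v) \<Rightarrow> bool" where
  "irreducible_module V \<rho> \<longleftrightarrow>
     lie_module V \<rho> \<and> V \<noteq> {0} \<and>
     (\<forall>W. cv.subspace W \<longrightarrow> W \<subseteq> V \<longrightarrow> (\<forall>x. \<forall>u\<in>W. \<rho> x u \<in> W) \<longrightarrow> W = {0} \<or> W = V)"

definition module_setup ::
    "('g::complex_lie_algebra, 'v::complex_vector) lie_setup \<Rightarrow> bool" where
  "module_setup D \<longleftrightarrow>
     (\<forall>k\<in>dominant_weights D.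
        irreducible_module (irrep D k) (action D k) \<and>
        (\<exists>B. finite B \<and> irrep D k = cv.span B) \<and>
        hw_vector D k \<in> irrep D k - {0} \<and>
        (\<forall>i<num_pos D. action D k (root_vector D (pos_root D i)) (hw_vector D k) = 0) \<and>
        (\<forall>h\<in>cartan D. action D k h (hw_vector D k) = weight_fun D k h *\<^sub>C hw_vector D k))"

definition signatures :: "('g, 'v) lie_setup \<Rightarrow> signature set" where
  "signatures D = dominant_weights D \<times> tuples (num_pos D)"

definition sig_vector ::
    "('g, 'v::complex_vector) lie_setup \<Rightarrow> signature \<Rightarrow> 'v" where
  "sig_vector D \<sigma> =
     foldr (\<lambda>i w. (1 / fact (Poly_Mapping.lookup (snd \<sigma>) i)) *\<^sub>C
              (action D (fst \<sigma>) (root_vector D (opposite (pos_root D i)))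
                 ^^ Poly_Mapping.lookup (snd \<sigma>) i) w)
       [0..<num_pos D] (hw_vector D (fst \<sigma>))"

text \<open>On \<open>nat \<Rightarrow>\<^sub>0 nat\<close>, the library's \<open><\<close> is the lexicographic order (index 0 first).\<close>

definition deglex_less :: "nat \<Rightarrow> weight \<Rightarrow> weight \<Rightarrow> bool" where
  "deglex_less n k k' \<longleftrightarrow>
     (\<Sum>i<n. Poly_Mapping.lookup k i) < (\<Sum>i<n. Poly_Mapping.lookup k' i) \<or>
     (\<Sum>i<n. Poly_Mapping.lookup k i) = (\<Sum>i<n. Poly_Mapping.lookup k' i) \<and> k < k'"

definition sig_less :: "('g, 'v) lie_setup \<Rightarrow> signature \<Rightarrow> signature \<Rightarrow> bool" where
  "sig_less D \<sigma> \<tau> \<longleftrightarrow>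
     deglex_less (rank D) (fst \<sigma>) (fst \<tau>) \<or>
     fst \<sigma> = fst \<tau> \<and> (snd \<sigma>, snd \<tau>) \<in> mon_order D \<and> snd \<sigma> \<noteq> snd \<tau>"

definition essential :: "('g, 'v::complex_vector) lie_setup \<Rightarrow> signature set" where
  "essential D =
     {\<sigma> \<in> signatures D.
        sig_vector D \<sigma> \<notin>
          cv.span (sig_vector D ` {\<tau> \<in> signatures D. fst \<tau> = fst \<sigma> \<and> sig_less D \<tau> \<sigma>})}"

text \<open>Semigroups of weights and of signatures contain 0.\<close>

definition generated :: "'a::monoid_add set \<Rightarrow> 'a set" where
  "generated A = {sum_list xs |xs. set xs \<subseteq> A}"

definition Sigma_over :: "('g, 'v::complex_vector) lie_setup \<Rightarrow> weight set \<Rightarrow> signature set" where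
  "Sigma_over D S = {\<sigma> \<in> essential D. fst \<sigma> \<in> S}"

definition Sigma_gen :: "('g, 'v::complex_vector) lie_setup \<Rightarrow> weight set \<Rightarrow> signature set" where
  "Sigma_gen D L = generated {\<sigma> \<in> essential D. fst \<sigma> \<in> L}"

type_synonym 'x mpoly = "('x \<Rightarrow>\<^sub>0 nat) \<Rightarrow>\<^sub>0 complex"

definition mpoly_eval :: "'x mpoly \<Rightarrow> ('x \<Rightarrow> complex) \<Rightarrow> complex" where
  "mpoly_eval f a =
     (\<Sum>m\<in>Poly_Mapping.keys f. Poly_Mapping.lookup f m *
        (\<Prod>x\<in>Poly_Mapping.keys m. a x ^ Poly_Mapping.lookup m x))"

definition ideal_in :: "'a::comm_ring_1 set \<Rightarrow> 'a set \<Rightarrow> bool" where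
  "ideal_in A I \<longleftrightarrow> I \<subseteq> A \<and> 0 \<in> I \<and> (\<forall>f\<in>I. \<forall>g\<in>I. f + g \<in> I) \<and> (\<forall>r\<in>A. \<forall>f\<in>I. r * f \<in> I)"

definition ideal_spanned :: "'a::comm_ring_1 set \<Rightarrow> 'a set \<Rightarrow> 'a set" where
  "ideal_spanned A F = ideal_in A hull F"

definition entries :: "complex^'n^'n \<Rightarrow> 'n \<times> 'n \<Rightarrow> complex" where
  "entries A = (\<lambda>(i, j). A $ i $ j)"

definition linear_algebraic_group :: "(complex^'n^'n) set \<Rightarrow> bool" where
  "linear_algebraic_group G \<longleftrightarrow>
     (\<exists>P :: ('n \<times> 'n) mpoly set.
        G = {A. invertible A \<and> (\<forall>p\<in>P. mpoly_eval p (entries A) = 0)}) \<and>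
     mat 1 \<in> G \<and> (\<forall>A\<in>G. \<forall>B\<in>G. A ** B \<in> G) \<and> (\<forall>A\<in>G. matrix_inv A \<in> G)"

definition matrix_scale :: "complex \<Rightarrow> complex^'n^'n \<Rightarrow> complex^'n^'n" where
  "matrix_scale c A = (\<chi> i j. c * A $ i $ j)"

text \<open>The Lie algebra of \<open>G\<close> is its Zariski tangent space at the identity.\<close>

definition lie_algebra_of :: "(complex^'n^'n) set \<Rightarrow> (complex^'n^'n) set" where
  "lie_algebra_of G =
     {A. \<forall>p :: ('n \<times> 'n) mpoly. (\<forall>B\<in>G. mpoly_eval p (entries B) = 0) \<longrightarrow>
        ((\<lambda>s. mpoly_eval p (entries (mat 1 + matrix_scale s A))) has_field_derivative 0) (at 0)}"

definition lie_algebra_iso ::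
    "(complex^'n^'n) set \<Rightarrow> ('g::complex_lie_algebra \<Rightarrow> complex^'n^'n) \<Rightarrow> bool" where
  "lie_algebra_iso G \<iota> \<longleftrightarrow>
     bij_betw \<iota> UNIV (lie_algebra_of G) \<and>
     (\<forall>x y. \<iota> (x + y) = \<iota> x + \<iota> y) \<and>
     (\<forall>c x. \<iota> (c *\<^sub>C x) = matrix_scale c (\<iota> x)) \<and>
     (\<forall>x y. \<iota> (bracket x y) = \<iota> x ** \<iota> y - \<iota> y ** \<iota> x)"

definition regular_on_GL :: "(complex^'n^'n \<Rightarrow> complex) \<Rightarrow> bool" where
  "regular_on_GL F \<longleftrightarrow>
     (\<exists>(p :: ('n \<times> 'n) mpoly) k. \<forall>A. invertible A \<longrightarrow> F A = mpoly_eval p (entries A) / det A ^ k)"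

text \<open>
  \<open>R\<close> is a rational representation of \<open>G\<close> on \<open>V\<close> with differential \<open>\<rho>\<close>: every matrix
  coefficient of \<open>R\<close> is the restriction to \<open>G\<close> of a regular function on the general linear group,
  and its derivative at 1 along \<open>\<iota> x\<close> is the matrix coefficient of \<open>\<rho> x\<close>.  The derivative does
  not depend on the choice of the regular function, since \<open>\<iota> x\<close> is tangent to \<open>G\<close>.
\<close>

definition rational_rep ::
    "(complex^'n^'n) set \<Rightarrow> ('g \<Rightarrow> complex^'n^'n) \<Rightarrow> 'v::complex_vector set \<Rightarrow>
     ('g \<Rightarrow> 'v \<Rightarrow> 'v) \<Rightarrow> (complex^'n^'n \<Rightarrow> 'v \<Rightarrow> 'v) \<Rightarrow> bool" where
  "rational_rep G \<iota> V \<rho> R \<longleftrightarrow>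
     (\<forall>A\<in>G. \<forall>u\<in>V. R A u \<in> V) \<and>
     (\<forall>A\<in>G. \<forall>u\<in>V. \<forall>w\<in>V. R A (u + w) = R A u + R A w) \<and>
     (\<forall>A\<in>G. \<forall>c. \<forall>u\<in>V. R A (c *\<^sub>C u) = c *\<^sub>C R A u) \<and>
     (\<forall>u\<in>V. R (mat 1) u = u) \<and>
     (\<forall>A\<in>G. \<forall>B\<in>G. \<forall>u\<in>V. R (A ** B) u = R A (R B u)) \<and>
     (\<forall>u\<in>V. \<forall>\<xi>. Vector_Spaces.linear (*\<^sub>C) (*) \<xi> \<longrightarrow>
        (\<exists>F. regular_on_GL F \<and> (\<forall>A\<in>G. \<xi> (R A u) = F A) \<and>
             (\<forall>x. ((\<lambda>s. F (mat 1 + matrix_scale s (\<iota> x))) has_field_derivative \<xi> (\<rho> x u)) (at 0))))"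

text \<open>
  \<open>V = V(\<lambda>_0) \<oplus> \<dots> \<oplus> V(\<lambda>_(m-1))\<close>.  The coordinate dual to the basis vector with signature
  \<open>(\<lambda>_j, p)\<close> in the \<open>j\<close>-th summand is indexed by \<open>(j, p)\<close>; so repetitions among the
  \<open>\<lambda>_j\<close> are allowed.
\<close>

definition direct_sum ::
    "('g, 'v::complex_vector) lie_setup \<Rightarrow> (nat \<Rightarrow> weight) \<Rightarrow> nat \<Rightarrow> (nat \<Rightarrow> 'v) set" where
  "direct_sum D lam m = {w. (\<forall>j<m. w j \<in> irrep D (lam j)) \<and> (\<forall>j\<ge>m. w j = 0)}"

definition coord_vars ::
    "('g, 'v::complex_vector) lie_setup \<Rightarrow> (nat \<Rightarrow> weight) \<Rightarrow> nat \<Rightarrow> (nat \<times> exponent) set" where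
  "coord_vars D lam m = {(j, p). j < m \<and> (lam j, p) \<in> essential D}"

definition coord_ring ::
    "('g, 'v::complex_vector) lie_setup \<Rightarrow> (nat \<Rightarrow> weight) \<Rightarrow> nat \<Rightarrow> (nat \<times> exponent) mpoly set" where
  "coord_ring D lam m =
     {f. \<forall>a\<in>Poly_Mapping.keys f. Poly_Mapping.keys a \<subseteq> coord_vars D lam m}"

definition coords ::
    "('g, 'v::complex_vector) lie_setup \<Rightarrow> (nat \<Rightarrow> weight) \<Rightarrow> (nat \<Rightarrow> 'v) \<Rightarrow> nat \<times> exponent \<Rightarrow> complex"
  where
  "coords D lam w = (\<lambda>(j, p).
     cv.representation (sig_vector D ` {\<sigma> \<in> essential D. fst \<sigma> = lam j}) (w j)
       (sig_vector D (lam j, p)))"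

definition orbit ::
    "('g, 'v::complex_vector) lie_setup \<Rightarrow> (complex^'n^'n) set \<Rightarrow>
     (weight \<Rightarrow> complex^'n^'n \<Rightarrow> 'v \<Rightarrow> 'v) \<Rightarrow> (nat \<Rightarrow> weight) \<Rightarrow> nat \<Rightarrow> (nat \<Rightarrow> 'v) set" where
  "orbit D G R lam m =
     (\<lambda>A j. if j < m then R (lam j) A (hw_vector D (lam j)) else 0) ` G"

definition vanishing_ideal ::
    "('g, 'v::complex_vector) lie_setup \<Rightarrow> (nat \<Rightarrow> weight) \<Rightarrow> nat \<Rightarrow> (nat \<Rightarrow> 'v) set \<Rightarrow>
     (nat \<times> exponent) mpoly set" where
  "vanishing_ideal D lam m Y =
     {f \<in> coord_ring D lam m. \<forall>w\<in>Y. mpoly_eval f (coords D lam w) = 0}"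

definition zariski_closure ::
    "('g, 'v::complex_vector) lie_setup \<Rightarrow> (nat \<Rightarrow> weight) \<Rightarrow> nat \<Rightarrow> (nat \<Rightarrow> 'v) set \<Rightarrow>
     (nat \<Rightarrow> 'v) set" where
  "zariski_closure D lam m Y =
     {w \<in> direct_sum D lam m. \<forall>f\<in>vanishing_ideal D lam m Y. mpoly_eval f (coords D lam w) = 0}"

definition monomial_sign :: "(nat \<Rightarrow> weight) \<Rightarrow> (nat \<times> exponent \<Rightarrow>\<^sub>0 nat) \<Rightarrow> signature" where
  "monomial_sign lam a =
     (\<Sum>(j, p)\<in>Poly_Mapping.keys a. \<Sum>_<Poly_Mapping.lookup a (j, p). (lam j, p))"

definition sign_component ::
    "(nat \<Rightarrow> weight) \<Rightarrow> signature \<Rightarrow> (nat \<times> exponent) mpoly \<Rightarrow> (nat \<times> exponent) mpoly" where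
  "sign_component lam \<sigma> f =
     (\<Sum>a\<in>{a \<in> Poly_Mapping.keys f. monomial_sign lam a = \<sigma>}.
        Poly_Mapping.single a (Poly_Mapping.lookup f a))"

definition least_sign ::
    "('g, 'v) lie_setup \<Rightarrow> (nat \<Rightarrow> weight) \<Rightarrow> (nat \<times> exponent) mpoly \<Rightarrow> signature" where
  "least_sign D lam f =
     (THE \<sigma>. \<sigma> \<in> monomial_sign lam ` Poly_Mapping.keys f \<and>
        (\<forall>\<tau> \<in> monomial_sign lam ` Poly_Mapping.keys f. \<tau> = \<sigma> \<or> sig_less D \<sigma> \<tau>))"

definition lt ::
    "('g, 'v) lie_setup \<Rightarrow> (nat \<Rightarrow> weight) \<Rightarrow> (nat \<times> exponent) mpoly \<Rightarrow> (nat \<times> exponent) mpoly" where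
  "lt D lam f = sign_component lam (least_sign D lam f) f"

definition lt_ideal ::
    "('g, 'v::complex_vector) lie_setup \<Rightarrow> (nat \<Rightarrow> weight) \<Rightarrow> nat \<Rightarrow>
     (nat \<times> exponent) mpoly set \<Rightarrow> (nat \<times> exponent) mpoly set" where
  "lt_ideal D lam m I = ideal_spanned (coord_ring D lam m) (lt D lam ` (I - {0}))"

definition binomial_ideal ::
    "('g, 'v::complex_vector) lie_setup \<Rightarrow> (nat \<Rightarrow> weight) \<Rightarrow> nat \<Rightarrow> (nat \<times> exponent) mpoly set" where
  "binomial_ideal D lam m =
     ideal_spanned (coord_ring D lam m)
       {Poly_Mapping.single a 1 - Poly_Mapping.single b 1 |a b.
          Poly_Mapping.keys a \<subseteq> coord_vars D lam m \<and>
          Poly_Mapping.keys b \<subseteq> coord_vars D lam m \<and>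
          monomial_sign lam a = monomial_sign lam b}"

end

theory Submission
  imports Defs "HOL-Library.Function_Algebras" "HOL-Complex_Analysis.Cauchy_Integral_Formula"
begin

text \<open>
  A polynomial \<open>f\<close> on the sum of the modules is expanded along the product of the one-parameter subgroups
  \<open>exp (t\<^sub>i e\<^bsub>-\<alpha>i\<^esub>)\<close>, applied to the sum of the highest weight vectors.  The coefficient \<open>cf p f\<close> of \<open>t\<^sup>p\<close> is
  multiplicative in the sense of power series, so a monomial of signature \<open>(k, s)\<close> has the lowest term \<open>t\<^sup>s\<close>, with
  coefficient 1.  On polynomials of weight \<open>k\<close> the functionals \<open>cf p\<close> satisfy exactly the linear relations of the
  vectors \<open>v(k, p)\<close>: both families come from a highest weight vector of weight \<open>k\<close>, the first one in a
  dual of the coordinate ring, and by complete reducibility (proved through vanishing of the first cohomology) such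
  vectors generate isomorphic irreducible modules.  Hence the lowest exponents of polynomials of weight \<open>k\<close> are
  exactly the essential ones.

  A polynomial lies in \<open>I\<close> iff its derivatives under all words in the Lie algebra vanish at the sum of the
  highest weight vectors, iff the coefficients \<open>cf p\<close> of all its weight components vanish.  The first equivalence
  needs that near 1 the group is swept out by exponentials of its Zariski tangent space; a nearest point
  argument replaces the theory of Lie subgroups here.

  What remains is a subalgebra basis criterion.  The coefficients of the least component of an element of \<open>I\<close> sum
  to zero, so \<open>lt(I) \<subseteq> J\<close>.  If every essential signature is the signature of a monomial, then a binomial in \<open>J\<close> can
  be corrected by monomials of larger signature to an element of \<open>I\<close>.  Conversely, an essential signature that is
  not the signature of a monomial is the lowest exponent of some \<open>f\<close> whose least component lies in \<open>J\<close>; if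
  \<open>J = lt(I)\<close>, elements of \<open>I\<close> can be subtracted from \<open>f\<close> to raise its least signature again and again, although only finitely many
  signatures are available.
\<close>


section \<open>Linear algebra on subspaces\<close>

text \<open>Three obstacles give the argument its form. Comparing highest weight vectors needs
  finite-dimensional modules, but the coordinate ring is infinite-dimensional; since the derivations
  preserve degree and weight, the comparison takes place in the dual of the polynomials of degree at
  most \<open>d\<close>, for varying \<open>d\<close>. Complete reducibility needs nondegenerate
  trace forms. They come from positivity: every module involved is spanned by eigenvectors of one
  \<open>h\<close> from an sl2-triple, the eigenvalues are real, so the trace of the square of
  \<open>h\<close> is a sum of squares and vanishes only if \<open>h\<close> acts as zero. For this
  reason diagonalizability of \<open>h\<close> travels as a hypothesis through the cohomological
  argument. Finally, the group is given by equations and its Lie algebra by tangent vectors; a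
  vector is turned into a curve in the group by showing that all derivatives of the equations along
  the matrix exponential vanish at 1. The corrections by which least signatures are raised stay
  within one weight, where only finitely many exponents are essential; this is what makes them
  terminate.\<close>

instantiation complex :: complex_vector
begin
definition scaleC_complex :: "complex \<Rightarrow> complex \<Rightarrow> complex" where "scaleC_complex = (*)"
instance by standard (simp_all add: scaleC_complex_def algebra_simps)
end

instantiation "fun" :: (type, complex_vector) complex_vector
begin
definition scaleC_fun :: "complex \<Rightarrow> ('a \<Rightarrow> 'b) \<Rightarrow> 'a \<Rightarrow> 'b" where "scaleC_fun c f = (\<lambda>x. c *\<^sub>C f x)"
instance by standard
  (simp_all add: scaleC_fun_def fun_eq_iff scaleC_add_right scaleC_add_left scaleC_scaleC scaleC_one)
end

instantiation prod :: (complex_vector, complex_vector) complex_vector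
begin
definition scaleC_prod :: "complex \<Rightarrow> 'a \<times> 'b \<Rightarrow> 'a \<times> 'b" where
  "scaleC_prod c x = (c *\<^sub>C fst x, c *\<^sub>C snd x)"
instance by standard
  (simp_all add: scaleC_prod_def prod_eq_iff scaleC_add_right scaleC_add_left scaleC_scaleC scaleC_one)
end

lemma scaleC_fun_apply [simp]: "(c *\<^sub>C f) x = c *\<^sub>C f x"
  by (simp add: scaleC_fun_def)

lemma fst_scaleC [simp]: "fst (c *\<^sub>C x) = c *\<^sub>C fst x"
  and snd_scaleC [simp]: "snd (c *\<^sub>C x) = c *\<^sub>C snd x"
  by (simp_all add: scaleC_prod_def)

lemma scaleC_complex_eq [simp]: "c *\<^sub>C x = c * (x::complex)"
  by (simp add: scaleC_complex_def)

lemma sum_fun_apply: "(\<Sum>i\<in>A. f i) x = (\<Sum>i\<in>A. f i x)" for f :: "'i \<Rightarrow> 'a \<Rightarrow> 'b::comm_monoid_add"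
  by (induction A rule: infinite_finite_induct) auto

text \<open>Modules are subspaces of an ambient type and their actions are meaningful only there, so
  linearity is relative to \<open>V\<close>.\<close>

definition lin_on :: "'a::complex_vector set \<Rightarrow> ('a \<Rightarrow> 'b::complex_vector) \<Rightarrow> bool" where
  "lin_on V T \<longleftrightarrow> (\<forall>u\<in>V. \<forall>w\<in>V. T (u + w) = T u + T w) \<and> (\<forall>c. \<forall>u\<in>V. T (c *\<^sub>C u) = c *\<^sub>C T u)"

text \<open>Inclusion in the span instead of equality, so that the property passes to arbitrary
  subsets.\<close>

definition fin_dim :: "'a::complex_vector set \<Rightarrow> bool" where
  "fin_dim V \<longleftrightarrow> (\<exists>B. finite B \<and> V \<subseteq> cv.span B)"

definition is_basis :: "'a::complex_vector set \<Rightarrow> 'a set \<Rightarrow> bool" where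
  "is_basis B V \<longleftrightarrow> finite B \<and> \<not> cv.dependent B \<and> cv.span B = V"

abbreviation coord :: "'a::complex_vector set \<Rightarrow> 'a \<Rightarrow> 'a \<Rightarrow> complex" where
  "coord \<equiv> cv.representation"

lemma lin_onD:
  assumes "lin_on V T"
  shows "u \<in> V \<Longrightarrow> w \<in> V \<Longrightarrow> T (u + w) = T u + T w"
    and "u \<in> V \<Longrightarrow> T (c *\<^sub>C u) = c *\<^sub>C T u"
  using assms by (auto simp: lin_on_def)

lemma lin_on_subset: "lin_on V T \<Longrightarrow> W \<subseteq> V \<Longrightarrow> lin_on W T"
  unfolding lin_on_def by blast

lemma lin_on_zero: "lin_on V T \<Longrightarrow> cv.subspace V \<Longrightarrow> T 0 = 0"
  using lin_onD(2)[of V T 0 0] cv.subspace_0[of V] by simp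

lemma lin_on_diff: "lin_on V T \<Longrightarrow> cv.subspace V \<Longrightarrow> u \<in> V \<Longrightarrow> w \<in> V \<Longrightarrow> T (u - w) = T u - T w"
  using lin_onD(1)[of V T "u - w" w] cv.subspace_diff[of V u w] by (simp add: algebra_simps)

lemma lin_on_sum:
  assumes "lin_on V T" "cv.subspace V" "\<And>i. i \<in> A \<Longrightarrow> g i \<in> V"
  shows "T (\<Sum>i\<in>A. g i) = (\<Sum>i\<in>A. T (g i))"
  using assms(3)
proof (induction A rule: infinite_finite_induct)
  case (insert x F)
  then have "(\<Sum>i\<in>F. g i) \<in> V" using assms(2) by (intro cv.subspace_sum) auto
  then show ?case using insert lin_onD(1)[OF assms(1)] by auto
qed (use lin_on_zero[OF assms(1,2)] in auto)

lemma lin_on_sum_scale: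
  assumes "lin_on V T" "cv.subspace V" "\<And>i. i \<in> A \<Longrightarrow> g i \<in> V"
  shows "T (\<Sum>i\<in>A. c i *\<^sub>C g i) = (\<Sum>i\<in>A. c i *\<^sub>C T (g i))"
  using lin_on_sum[OF assms(1,2), of A "\<lambda>i. c i *\<^sub>C g i"] assms(3)
    cv.subspace_scale[OF assms(2)] lin_onD(2)[OF assms(1)] by auto

lemma lin_on_compose:
  "lin_on V T \<Longrightarrow> lin_on W S \<Longrightarrow> T ` V \<subseteq> W \<Longrightarrow> lin_on V (\<lambda>u. S (T u))"
  by (auto simp: lin_on_def image_subset_iff)

lemma lin_on_image_subspace: "lin_on V T \<Longrightarrow> cv.subspace V \<Longrightarrow> cv.subspace (T ` V)"
proof (rule cv.subspaceI)
  assume T: "lin_on V T" "cv.subspace V"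
  show "0 \<in> T ` V" using lin_on_zero[OF T] cv.subspace_0[OF T(2)] by force
  show "x + y \<in> T ` V" if "x \<in> T ` V" "y \<in> T ` V" for x y
    using that lin_onD(1)[OF T(1), symmetric] cv.subspace_add[OF T(2)] by auto
  show "c *\<^sub>C x \<in> T ` V" if "x \<in> T ` V" for c x
    using that lin_onD(2)[OF T(1), symmetric] cv.subspace_scale[OF T(2)] by auto
qed

lemma lin_on_image_span:
  assumes "lin_on V T" "cv.subspace V" "X \<subseteq> V"
  shows "T ` cv.span X = cv.span (T ` X)"
proof
  have sp: "cv.span X \<subseteq> V" using assms cv.span_minimal by blast
  have "cv.subspace {u \<in> V. T u \<in> cv.span (T ` X)}"
    using assms(2) lin_on_zero[OF assms(1,2)] lin_onD[OF assms(1)]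
    by (auto simp: cv.subspace_def cv.span_zero cv.span_add cv.span_scale)
  then have "cv.span X \<subseteq> {u \<in> V. T u \<in> cv.span (T ` X)}"
    using assms(3) by (intro cv.span_minimal) (auto intro: cv.span_base)
  then show "T ` cv.span X \<subseteq> cv.span (T ` X)" by auto
  have "cv.subspace (T ` cv.span X)"
    using lin_on_image_subspace[OF lin_on_subset[OF assms(1) sp]] by simp
  then show "cv.span (T ` X) \<subseteq> T ` cv.span X"
    by (intro cv.span_minimal) (auto intro: cv.span_base)
qed

lemma lin_on_span_into:
  assumes "lin_on V T" "cv.subspace V" "X \<subseteq> V" "cv.subspace W" "T ` X \<subseteq> W" "u \<in> cv.span X"
  shows "T u \<in> W"
  using lin_on_image_span[OF assms(1-3)] cv.span_minimal[OF assms(5,4)] assms(6) by auto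

lemma fin_dim_subset: "fin_dim V \<Longrightarrow> W \<subseteq> V \<Longrightarrow> fin_dim W"
  unfolding fin_dim_def by (meson order_trans)

lemma basis_within:
  assumes "fin_dim V" "cv.subspace V" "J \<subseteq> V" "V \<subseteq> cv.span J"
  obtains B where "is_basis B V" "B \<subseteq> J"
proof -
  obtain B where B: "B \<subseteq> J" "cv.independent B" "J \<subseteq> cv.span B"
    using cv.maximal_independent_subset by blast
  have V: "cv.span B = V"
  proof
    show "cv.span B \<subseteq> V" using B(1) assms(2,3) by (intro cv.span_minimal) auto
    show "V \<subseteq> cv.span B" using assms(4) B(3) by (metis cv.span_minimal cv.subspace_span order_trans)
  qed
  obtain F where "finite F" "V \<subseteq> cv.span F" using assms(1) by (auto simp: fin_dim_def)
  moreover have "B \<subseteq> V" using B(1) assms(3) by blast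
  ultimately have "finite B" using cv.independent_span_bound[of F B] B(2) by auto
  then show ?thesis using that B V by (auto simp: is_basis_def)
qed

lemma basis_ex:
  assumes "fin_dim V" "cv.subspace V"
  obtains B where "is_basis B V"
  using basis_within[OF assms subset_refl cv.span_superset] by blast

lemma is_basisD:
  assumes "is_basis B V"
  shows "finite B" "cv.independent B" "cv.span B = V" "B \<subseteq> V" "cv.subspace V" "fin_dim V"
  using assms cv.span_superset[of B] cv.subspace_span[of B] by (auto simp: is_basis_def fin_dim_def)

lemma coord_sum: "is_basis B V \<Longrightarrow> u \<in> V \<Longrightarrow> (\<Sum>b\<in>B. coord B u b *\<^sub>C b) = u"
  using cv.sum_representation_eq[of B u B] by (simp add: is_basis_def)

lemma coord_lin:
  assumes "is_basis B V"
  shows "u \<in> V \<Longrightarrow> w \<in> V \<Longrightarrow> coord B (u + w) b = coord B u b + coord B w b"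
    and "u \<in> V \<Longrightarrow> coord B (c *\<^sub>C u) b = c * coord B u b"
  using assms by (auto simp: is_basis_def cv.representation_add cv.representation_scale)

lemma coord_lin_on: "is_basis B V \<Longrightarrow> lin_on V (\<lambda>u. coord B u b)"
  by (simp add: lin_on_def coord_lin)

lemma coord_basis: "is_basis B V \<Longrightarrow> b \<in> B \<Longrightarrow> coord B b b' = (if b' = b then 1 else 0)"
  by (simp add: is_basis_def cv.representation_basis)

lemma dim_basis: "is_basis B V \<Longrightarrow> cv.dim V = card B"
  using cv.dim_eq_card[of B V] by (auto simp: is_basis_def cv.span_span)

lemma proper_subspace_dim:
  assumes "cv.subspace W" "cv.subspace V" "fin_dim V" "W \<subset> V"
  shows "cv.dim W < cv.dim V"
proof -
  obtain B where B: "is_basis B V" using basis_ex assms by blast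
  obtain C where C: "is_basis C W" using basis_ex assms fin_dim_subset by (metis psubset_imp_subset)
  obtain v where v: "v \<in> V" "v \<notin> W" using assms(4) by blast
  have "cv.independent (insert v C)"
    using C v by (auto simp: is_basis_def cv.independent_insert)
  moreover have "insert v C \<subseteq> cv.span B" using v assms(4) is_basisD[OF B] is_basisD[OF C] by auto
  ultimately have "card (insert v C) \<le> card B"
    using cv.independent_span_bound is_basisD(1)[OF B] by blast
  moreover have "card (insert v C) = Suc (card C)"
    using is_basisD[OF C] v by (intro card_insert_disjoint) auto
  ultimately show ?thesis using dim_basis[OF B] dim_basis[OF C] by simp
qed

text \<open>The images decrease, so a power whose image has least dimension works. This is the part
  of Fitting's lemma that is applied to the Casimir operator.\<close>

lemma image_stabilizes:
  assumes "fin_dim V" "cv.subspace V" "lin_on V T" "T ` V \<subseteq> V"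
  obtains n where "(T ^^ Suc n) ` V = (T ^^ n) ` V"
proof -
  have sub: "(T ^^ n) ` V \<subseteq> V" for n
    by (induction n) (use assms(4) in auto)
  have lin: "lin_on V (T ^^ n)" for n
  proof (induction n)
    case (Suc n)
    then show ?case using lin_on_compose[OF Suc assms(3) sub] by (simp add: o_def)
  qed (simp add: lin_on_def)
  define n where "n = (ARG_MIN (\<lambda>n. cv.dim ((T ^^ n) ` V)) n. True)"
  have min: "cv.dim ((T ^^ n) ` V) \<le> cv.dim ((T ^^ k) ` V)" for k
    unfolding n_def using arg_min_nat_le[of "\<lambda>_. True" k] by auto
  have "(T ^^ Suc n) ` V = (T ^^ n) ` (T ` V)" by (simp add: funpow_swap1 image_image)
  also have "\<dots> \<subseteq> (T ^^ n) ` V" using assms(4) by auto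
  finally have "(T ^^ Suc n) ` V \<subseteq> (T ^^ n) ` V" .
  with min[of "Suc n"] have "(T ^^ Suc n) ` V = (T ^^ n) ` V"
    using proper_subspace_dim[OF lin_on_image_subspace[OF lin assms(2), of "Suc n"]
        lin_on_image_subspace[OF lin assms(2)] fin_dim_subset[OF assms(1) sub], of n]
    by (metis leD psubsetI)
  then show ?thesis by (rule that)
qed

text \<open>Simultaneous version of: a sum of eigenvectors for distinct eigenvalues that lies in a stable
  subspace has all its terms there.\<close>

lemma eigen_component:
  fixes T :: "'h \<Rightarrow> 'a::complex_vector \<Rightarrow> 'a"
  assumes "finite J" "cv.subspace V" "cv.subspace W" "W \<subseteq> V"
    and "\<And>h. h \<in> H \<Longrightarrow> lin_on V (T h)" "\<And>h w. h \<in> H \<Longrightarrow> w \<in> W \<Longrightarrow> T h w \<in> W"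
    and "\<And>j. j \<in> insert i J \<Longrightarrow> u j \<in> V" "\<And>h j. h \<in> H \<Longrightarrow> j \<in> insert i J \<Longrightarrow> T h (u j) = \<psi> j h *\<^sub>C u j"
    and "\<And>j. j \<in> J \<Longrightarrow> \<exists>h\<in>H. \<psi> j h \<noteq> \<psi> i h"
    and "u i + (\<Sum>j\<in>J. u j) \<in> W"
  shows "u i \<in> W"
  using assms(1,7-10)
proof (induction J arbitrary: u)
  case (insert k J)
  obtain h where h: "h \<in> H" "\<psi> k h \<noteq> \<psi> i h" using insert.prems(3) by blast
  \<comment> \<open>\<open>T h - \<psi> k h\<close> kills the term at \<open>k\<close> and
    multiplies the term at \<open>i\<close> by \<open>c i\<close>, which is nonzero by the choice of
    \<open>h\<close>.\<close>
  define c where "c j = \<psi> j h - \<psi> k h" for j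
  define s where "s = u i + (\<Sum>j\<in>insert k J. u j)"
  have sW: "s \<in> W" using insert.prems(4) by (simp add: s_def)
  have sumV: "(\<Sum>j\<in>insert k J. u j) \<in> V"
    using insert.prems(1) assms(2) by (intro cv.subspace_sum) auto
  have Ts: "T h s = \<psi> i h *\<^sub>C u i + (\<Sum>j\<in>insert k J. \<psi> j h *\<^sub>C u j)"
    unfolding s_def
    using lin_onD(1)[OF assms(5)[OF h(1)] _ sumV] insert.prems(1,2) h(1)
      lin_on_sum[OF assms(5)[OF h(1)] assms(2), of "insert k J" u] by auto
  have "c i *\<^sub>C u i + (\<Sum>j\<in>J. c j *\<^sub>C u j) = T h s - \<psi> k h *\<^sub>C s"
    using insert.hyps unfolding Ts unfolding s_def c_def
    by (simp add: cv.scale_left_diff_distrib cv.scale_right_distrib sum_subtractf cv.scale_sum_right)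
  also have "\<dots> \<in> W" using assms(3,6) h(1) sW
    by (intro cv.subspace_diff cv.subspace_scale) auto
  finally have cW: "c i *\<^sub>C u i + (\<Sum>j\<in>J. c j *\<^sub>C u j) \<in> W" .
  have "c i *\<^sub>C u i \<in> W"
  proof (rule insert.IH[where u="\<lambda>j. c j *\<^sub>C u j"])
    show "\<And>j. j \<in> insert i J \<Longrightarrow> c j *\<^sub>C u j \<in> V"
      using insert.prems(1) assms(2) by (auto intro: cv.subspace_scale)
    show "T h' (c j *\<^sub>C u j) = \<psi> j h' *\<^sub>C c j *\<^sub>C u j" if "h' \<in> H" "j \<in> insert i J" for h' j
      using that insert.prems(1,2) lin_onD(2)[OF assms(5)] by (auto simp: mult.commute)
  qed (use insert.prems(3) cW in auto)
  then have "(1 / c i) *\<^sub>C c i *\<^sub>C u i \<in> W" using assms(3) cv.subspace_scale by blast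
  then show ?case using h(2) by (simp add: c_def)
qed auto

text \<open>Diagonalizability passes to stable subspaces: in an expansion of \<open>w\<close> into
  eigenvectors, the partial sum belonging to one eigenvalue is again an eigenvector, and it lies in
  \<open>W\<close> by \<open>eigen_component\<close>.\<close>

lemma eigen_span_subspace:
  fixes T :: "'a::complex_vector \<Rightarrow> 'a"
  assumes "cv.subspace V" "lin_on V T" "cv.subspace W" "W \<subseteq> V" "T ` W \<subseteq> W"
    and "V \<subseteq> cv.span {v\<in>V. \<exists>c. T v = c *\<^sub>C v}"
  shows "W \<subseteq> cv.span {w\<in>W. \<exists>c. T w = c *\<^sub>C w}"
proof
  fix w assume w: "w \<in> W"
  then have "w \<in> cv.span {v\<in>V. \<exists>c. T v = c *\<^sub>C v}" using assms by blast
  then obtain S r where S: "finite S" "S \<subseteq> {v\<in>V. \<exists>c. T v = c *\<^sub>C v}" "(\<Sum>a\<in>S. r a *\<^sub>C a) = w"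
    by (auto simp: cv.span_explicit)
  obtain ev where ev: "\<And>v. v \<in> S \<Longrightarrow> T v = ev v *\<^sub>C v" using S(2) by (simp add: subset_iff) metis
  define u where "u c = (\<Sum>a\<in>{a\<in>S. ev a = c}. r a *\<^sub>C a)" for c
  have uV: "u c \<in> V" for c unfolding u_def
    using S(2) assms(1) by (intro cv.subspace_sum cv.subspace_scale) auto
  have Tu: "T (u c) = c *\<^sub>C u c" for c
  proof -
    have "T (u c) = (\<Sum>a\<in>{a\<in>S. ev a = c}. r a *\<^sub>C T a)" unfolding u_def
      using S(2) by (intro lin_on_sum_scale[OF assms(2,1)]) auto
    also have "\<dots> = c *\<^sub>C u c"
      by (auto simp: u_def cv.scale_sum_right ev mult.commute intro!: sum.cong)
    finally show ?thesis .
  qed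
  have w_eq: "w = (\<Sum>c\<in>ev ` S. u c)"
    unfolding u_def S(3)[symmetric] by (rule sum.image_gen[OF S(1)])
  have "u c \<in> W" if c: "c \<in> ev ` S" for c
  proof (rule eigen_component[where J="ev ` S - {c}" and V=V and W=W and H="{()}" and T="\<lambda>_. T"
        and u=u and \<psi>="\<lambda>c _. c" and i=c])
    show "u c + (\<Sum>j\<in>ev ` S - {c}. u j) \<in> W"
      using w w_eq c S(1) by (simp add: sum.remove[of "ev ` S" c u])
  qed (use S(1) assms uV Tu in auto)
  then have "\<And>c. c \<in> ev ` S \<Longrightarrow> u c \<in> cv.span {w\<in>W. \<exists>c. T w = c *\<^sub>C w}"
    using Tu by (intro cv.span_base) auto
  then show "w \<in> cv.span {w\<in>W. \<exists>c. T w = c *\<^sub>C w}"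
    unfolding w_eq by (intro cv.span_sum) auto
qed

text \<open>\<open>V\<close> may be infinite-dimensional, as can happen for \<open>wpoly k\<close>.
  Induction on the set of functionals: a vector on which the old functionals vanish and the new one
  does not is subtracted from the old dual vectors in suitable multiples.\<close>

lemma dual_vectors:
  fixes \<phi> :: "'i \<Rightarrow> 'a::complex_vector \<Rightarrow> complex"
  assumes "finite I" "cv.subspace V" "\<And>i. i \<in> I \<Longrightarrow> lin_on V (\<phi> i)"
    and "\<And>a i. (\<And>v. v \<in> V \<Longrightarrow> (\<Sum>i\<in>I. a i * \<phi> i v) = 0) \<Longrightarrow> i \<in> I \<Longrightarrow> a i = 0"
  shows "\<exists>v. \<forall>i\<in>I. v i \<in> V \<and> (\<forall>j\<in>I. \<phi> i (v j) = (if i = j then 1 else 0))"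
  using assms(1,3,4)
proof (induction I)
  case (insert k I)
  have "\<exists>v. \<forall>i\<in>I. v i \<in> V \<and> (\<forall>j\<in>I. \<phi> i (v j) = (if i = j then 1 else 0))"
  proof (rule insert.IH)
    fix a i assume a: "\<And>v. v \<in> V \<Longrightarrow> (\<Sum>i\<in>I. a i * \<phi> i v) = 0" and i: "i \<in> I"
    have "(\<Sum>i\<in>I. (if i = k then 0 else a i) * \<phi> i v) = (\<Sum>i\<in>I. a i * \<phi> i v)" for v
      using insert.hyps by (intro sum.cong) auto
    then have "(\<Sum>i\<in>insert k I. (if i = k then 0 else a i) * \<phi> i v) = 0" if "v \<in> V" for v
      using a[OF that] insert.hyps by simp
    then have "(if i = k then 0 else a i) = 0"
      using i by (intro insert.prems(2)[of "\<lambda>i. if i = k then 0 else a i"]) blast+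
    then show "a i = 0" using i insert.hyps by (auto split: if_splits)
  qed (use insert.prems in auto)
  then obtain v where v: "\<And>i. i \<in> I \<Longrightarrow> v i \<in> V"
    "\<And>i j. i \<in> I \<Longrightarrow> j \<in> I \<Longrightarrow> \<phi> i (v j) = (if i = j then 1 else 0)" by metis
  \<comment> \<open>By independence, the new functional differs somewhere from the combination of
    the old ones that agrees with it on all \<open>v i\<close>.\<close>
  obtain w where w: "w \<in> V" "\<phi> k w \<noteq> (\<Sum>i\<in>I. \<phi> k (v i) * \<phi> i w)"
  proof (rule ccontr)
    assume "\<not> thesis"
    then have *: "\<And>w. w \<in> V \<Longrightarrow> \<phi> k w = (\<Sum>i\<in>I. \<phi> k (v i) * \<phi> i w)" using that by blast
    define a where "a i = (if i = k then 1 else - \<phi> k (v i))" for i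
    have z: "(\<Sum>i\<in>insert k I. a i * \<phi> i w) = 0" if "w \<in> V" for w
    proof -
      have "(\<Sum>i\<in>I. a i * \<phi> i w) = - (\<Sum>i\<in>I. \<phi> k (v i) * \<phi> i w)"
        using insert.hyps by (subst sum_negf[symmetric], intro sum.cong) (auto simp: a_def)
      then show ?thesis using insert.hyps *[OF that] by (simp add: a_def)
    qed
    have "a k = 0" by (rule insert.prems(2)[OF z]) auto
    then show False by (simp add: a_def)
  qed
  define s where "s = (\<Sum>i\<in>I. \<phi> i w *\<^sub>C v i)"
  have sV: "s \<in> V" unfolding s_def using v(1) assms(2) by (intro cv.subspace_sum cv.subspace_scale)
  have phis: "\<phi> j s = (\<Sum>i\<in>I. \<phi> i w * \<phi> j (v i))" if "j \<in> insert k I" for j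
    unfolding s_def using lin_on_sum_scale[OF insert.prems(1)[OF that] assms(2) v(1)] by simp
  \<comment> \<open>\<open>w - s\<close> is annihilated by the old functionals; the scaling makes
    the new one take the value 1.\<close>
  define z where "z = (1 / \<phi> k (w - s)) *\<^sub>C (w - s)"
  have dif: "\<phi> j (w - s) = \<phi> j w - \<phi> j s" if "j \<in> insert k I" for j
    using lin_on_diff[OF insert.prems(1)[OF that] assms(2) w(1) sV] .
  have zV: "z \<in> V" unfolding z_def using assms(2) w(1) sV by (intro cv.subspace_scale cv.subspace_diff)
  have kne: "\<phi> k (w - s) \<noteq> 0" using w(2) dif phis by (auto simp: mult.commute)
  have phiz: "\<phi> j z = \<phi> j (w - s) / \<phi> k (w - s)" if "j \<in> insert k I" for j
    unfolding z_def using lin_onD(2)[OF insert.prems(1)[OF that]] assms(2) w(1) sV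
    by (simp add: cv.subspace_diff)
  have kz: "\<phi> k z = 1" using kne phiz by simp
  have iz: "\<phi> i z = 0" if "i \<in> I" for i
  proof -
    have "\<phi> i s = (\<Sum>j\<in>I. if i = j then \<phi> j w else 0)"
      using that phis[of i] v(2) by (auto intro!: sum.cong)
    then have "\<phi> i s = \<phi> i w" using that insert.hyps by simp
    then show ?thesis using that phiz[of i] dif[of i] by simp
  qed
  define v' where "v' i = (if i = k then z else v i - \<phi> k (v i) *\<^sub>C z)" for i
  have "v' i \<in> V" if "i \<in> insert k I" for i
    using that zV v(1) assms(2) by (auto simp: v'_def intro!: cv.subspace_diff cv.subspace_scale)
  moreover have "\<phi> i (v' j) = (if i = j then 1 else 0)" if "i \<in> insert k I" "j \<in> insert k I" for i j
  proof (cases "j = k")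
    case False
    then have j: "j \<in> I" using that by auto
    have "\<phi> i (v' j) = \<phi> i (v j) - \<phi> k (v j) * \<phi> i z"
      using False lin_on_diff[OF insert.prems(1)[OF that(1)] assms(2) v(1)[OF j]]
        lin_onD(2)[OF insert.prems(1)[OF that(1)] zV] cv.subspace_scale[OF assms(2) zV]
      by (simp add: v'_def)
    then show ?thesis using that j kz iz v(2) False insert.hyps by auto
  qed (use that kz iz in \<open>auto simp: v'_def\<close>)
  ultimately show ?case by (intro exI[of _ v']) blast
qed auto

subsection \<open>Trace\<close>

definition trace_basis :: "'a::complex_vector set \<Rightarrow> ('a \<Rightarrow> 'a) \<Rightarrow> complex" where
  "trace_basis B T = (\<Sum>b\<in>B. coord B (T b) b)"

text \<open>The basis is an arbitrary choice; \<open>trace_on_eq\<close> shows that the choice does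
  not matter.\<close>

definition trace_on :: "'a::complex_vector set \<Rightarrow> ('a \<Rightarrow> 'a) \<Rightarrow> complex" where
  "trace_on V T = trace_basis (SOME B. is_basis B V) T"

lemma trace_basis_compose:
  assumes "is_basis B V" "is_basis C W" "lin_on V S" "S ` V \<subseteq> W" "lin_on W T" "T ` W \<subseteq> V"
  shows "trace_basis B (\<lambda>u. T (S u)) = (\<Sum>b\<in>B. \<Sum>c\<in>C. coord C (S b) c * coord B (T c) b)"
  unfolding trace_basis_def
proof (intro sum.cong refl)
  fix b assume b: "b \<in> B"
  then have Sb: "S b \<in> W" using assms(4) is_basisD[OF assms(1)] by blast
  have TC: "\<And>c. c \<in> C \<Longrightarrow> T c \<in> V" using assms(6) is_basisD[OF assms(2)] by blast
  have "T (S b) = T (\<Sum>c\<in>C. coord C (S b) c *\<^sub>C c)" using coord_sum[OF assms(2) Sb] by simp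
  also have "\<dots> = (\<Sum>c\<in>C. coord C (S b) c *\<^sub>C T c)"
    using is_basisD[OF assms(2)] by (intro lin_on_sum_scale[OF assms(5)]) auto
  finally show "coord B (T (S b)) b = (\<Sum>c\<in>C. coord C (S b) c * coord B (T c) b)"
    using lin_on_sum_scale[OF coord_lin_on[OF assms(1)] is_basisD(5)[OF assms(1)] TC] by simp
qed

text \<open>Two different spaces are allowed on purpose: with one map the identity and two bases of
  the same space this is independence of the basis, and with the inclusion of a subspace that
  contains the image it is \<open>trace_on_restrict\<close>.\<close>

lemma trace_comm:
  assumes "is_basis B V" "is_basis C W" "lin_on V S" "S ` V \<subseteq> W" "lin_on W T" "T ` W \<subseteq> V"
  shows "trace_basis B (\<lambda>u. T (S u)) = trace_basis C (\<lambda>w. S (T w))"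
  unfolding trace_basis_compose[OF assms] trace_basis_compose[OF assms(2,1,5,6,3,4)]
  by (subst sum.swap, intro sum.cong refl mult.commute)

lemma trace_on_eq:
  assumes "is_basis B V" "lin_on V T" "T ` V \<subseteq> V"
  shows "trace_on V T = trace_basis B T"
proof -
  have "is_basis (SOME B. is_basis B V) V" using someI[of "\<lambda>B. is_basis B V"] assms(1) .
  moreover have "lin_on V (\<lambda>x. x)" by (simp add: lin_on_def)
  ultimately show ?thesis
    unfolding trace_on_def using trace_comm[OF _ assms(1), of _ V "\<lambda>x. x" T] assms(2,3) by blast
qed

lemma trace_on_restrict:
  assumes "fin_dim V" "cv.subspace V" "cv.subspace W" "W \<subseteq> V" "lin_on V T" "T ` V \<subseteq> W"
  shows "trace_on V T = trace_on W T"
proof -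
  obtain B where B: "is_basis B V" using basis_ex[OF assms(1,2)] .
  obtain C where C: "is_basis C W" using basis_ex[OF fin_dim_subset[OF assms(1,4)] assms(3)] .
  have "trace_basis B (\<lambda>u. T u) = trace_basis C (\<lambda>w. T w)"
    by (rule trace_comm[OF B C assms(5,6), of "\<lambda>x. x"]) (use assms(4) in \<open>auto simp: lin_on_def\<close>)
  moreover have "T ` V \<subseteq> V" "T ` W \<subseteq> W" using assms by auto
  ultimately show ?thesis
    using trace_on_eq[OF B assms(5)] trace_on_eq[OF C lin_on_subset[OF assms(5,4)]] by simp
qed

lemma trace_on_mult_commute:
  assumes "fin_dim V" "cv.subspace V" "lin_on V S" "S ` V \<subseteq> V" "lin_on V T" "T ` V \<subseteq> V"
  shows "trace_on V (\<lambda>u. S (T u)) = trace_on V (\<lambda>u. T (S u))"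
proof -
  obtain B where B: "is_basis B V" using basis_ex[OF assms(1,2)] .
  have im: "(\<lambda>u. S (T u)) ` V \<subseteq> V" "(\<lambda>u. T (S u)) ` V \<subseteq> V" using assms(4,6) by blast+
  show ?thesis
    using trace_on_eq[OF B lin_on_compose[OF assms(5,3,6)] im(1)] trace_comm[OF B B assms(5,6,3,4)]
      trace_on_eq[OF B lin_on_compose[OF assms(3,5,4)] im(2)] by simp
qed

lemma trace_on_add:
  assumes "fin_dim V" "cv.subspace V" "lin_on V S" "S ` V \<subseteq> V" "lin_on V T" "T ` V \<subseteq> V"
  shows "trace_on V (\<lambda>u. S u + T u) = trace_on V S + trace_on V T"
proof -
  obtain B where B: "is_basis B V" using basis_ex[OF assms(1,2)] .
  have "lin_on V (\<lambda>u. S u + T u)"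
    using lin_onD[OF assms(3)] lin_onD[OF assms(5)] by (simp add: lin_on_def cv.scale_right_distrib)
  moreover have "(\<lambda>u. S u + T u) ` V \<subseteq> V" using assms(4,6) cv.subspace_add[OF assms(2)] by blast
  ultimately have "trace_on V (\<lambda>u. S u + T u) = trace_basis B (\<lambda>u. S u + T u)"
    by (rule trace_on_eq[OF B])
  moreover have "b \<in> B \<Longrightarrow> S b \<in> V \<and> T b \<in> V" for b using assms is_basisD[OF B] by blast
  ultimately show ?thesis using trace_on_eq[OF B] assms coord_lin(1)[OF B]
    by (simp add: trace_basis_def sum.distrib)
qed

lemma trace_on_scale:
  assumes "fin_dim V" "cv.subspace V" "lin_on V S" "S ` V \<subseteq> V"
  shows "trace_on V (\<lambda>u. c *\<^sub>C S u) = c * trace_on V S"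
proof -
  obtain B where B: "is_basis B V" using basis_ex[OF assms(1,2)] .
  have "lin_on V (\<lambda>u. c *\<^sub>C S u)"
    using lin_onD[OF assms(3)] by (simp add: lin_on_def cv.scale_right_distrib mult.commute)
  moreover have "(\<lambda>u. c *\<^sub>C S u) ` V \<subseteq> V" using assms(4) cv.subspace_scale[OF assms(2)] by blast
  ultimately have "trace_on V (\<lambda>u. c *\<^sub>C S u) = trace_basis B (\<lambda>u. c *\<^sub>C S u)"
    by (rule trace_on_eq[OF B])
  moreover have "b \<in> B \<Longrightarrow> S b \<in> V" for b using assms is_basisD[OF B] by blast
  ultimately show ?thesis using trace_on_eq[OF B assms(3,4)] assms coord_lin(2)[OF B]
    by (simp add: trace_basis_def sum_distrib_left)
qed

lemma trace_on_zero:
  assumes "fin_dim V" "cv.subspace V" "\<And>u. u \<in> V \<Longrightarrow> T u = 0"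
  shows "trace_on V T = 0"
proof -
  obtain B where B: "is_basis B V" using basis_ex[OF assms(1,2)] .
  have "trace_on V T = trace_basis B T"
    using assms(3) cv.subspace_0[OF assms(2)] cv.subspace_add[OF assms(2)] cv.subspace_scale[OF assms(2)]
    by (intro trace_on_eq[OF B]) (auto simp: lin_on_def)
  then show ?thesis using is_basisD(4)[OF B] assms(3)
    by (auto simp: trace_basis_def cv.representation_zero subset_iff intro!: sum.neutral)
qed

lemma trace_on_sum:
  assumes "fin_dim V" "cv.subspace V" "finite I" "\<And>i. i \<in> I \<Longrightarrow> lin_on V (S i)"
    "\<And>i. i \<in> I \<Longrightarrow> S i ` V \<subseteq> V"
  shows "trace_on V (\<lambda>u. \<Sum>i\<in>I. S i u) = (\<Sum>i\<in>I. trace_on V (S i))"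
  using assms(3-5)
proof (induction I)
  case (insert i I)
  have "lin_on V (\<lambda>u. \<Sum>i\<in>I. S i u)"
    using insert.prems by (auto simp: lin_on_def sum.distrib cv.scale_sum_right)
  moreover have "(\<lambda>u. \<Sum>i\<in>I. S i u) ` V \<subseteq> V"
    using insert.prems(2) assms(2) by (auto intro!: cv.subspace_sum)
  ultimately show ?case using insert trace_on_add[OF assms(1,2), of "S i"] by simp
qed (simp add: trace_on_zero assms)

lemma trace_on_nilpotent:
  assumes "fin_dim V" "cv.subspace V" "lin_on V T" "T ` V \<subseteq> V" "\<And>u. u \<in> V \<Longrightarrow> (T ^^ n) u = 0"
  shows "trace_on V T = 0"
  using assms
proof (induction n arbitrary: V)
  case 0
  then show ?case using trace_on_zero[of V T] lin_on_zero[of V T] by auto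
next
  case (Suc n)
  have "trace_on V T = trace_on (T ` V) T"
    using trace_on_restrict[OF Suc.prems(1,2) lin_on_image_subspace[OF Suc.prems(3,2)]] Suc.prems by auto
  also have "\<dots> = 0"
  proof (rule Suc.IH)
    show "cv.subspace (T ` V)" using lin_on_image_subspace Suc.prems by blast
    show "\<And>u. u \<in> T ` V \<Longrightarrow> (T ^^ n) u = 0" using Suc.prems(5) by (auto simp: funpow_swap1)
  qed (use Suc.prems in \<open>auto intro: fin_dim_subset lin_on_subset\<close>)
  finally show ?case .
qed

lemma trace_on_diag:
  assumes "is_basis B V" "lin_on V T" "\<And>b. b \<in> B \<Longrightarrow> T b = \<psi> b *\<^sub>C b"
  shows "trace_on V T = (\<Sum>b\<in>B. \<psi> b)"
proof -
  have "T ` V \<subseteq> V"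
  proof clarify
    fix u assume "u \<in> V"
    then show "T u \<in> V"
      using lin_on_span_into[OF assms(2) is_basisD(5,4,5)[OF assms(1)], of u]
        is_basisD(3)[OF assms(1)] assms(3) is_basisD(4,5)[OF assms(1)] by (auto intro: cv.subspace_scale)
  qed
  then show ?thesis using trace_on_eq[OF assms(1,2)] assms(3) coord_lin(2)[OF assms(1)] is_basisD(4)[OF assms(1)]
    by (auto simp: trace_basis_def coord_basis[OF assms(1)] subset_iff intro!: sum.cong)
qed

section \<open>Modules over a simple Lie algebra\<close>

lemma lie_moduleD:
  assumes "lie_module V \<rho>"
  shows "cv.subspace V" "u \<in> V \<Longrightarrow> \<rho> x u \<in> V" "lin_on V (\<rho> x)"
    and "u \<in> V \<Longrightarrow> w \<in> V \<Longrightarrow> \<rho> x (u + w) = \<rho> x u + \<rho> x w"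
    and "u \<in> V \<Longrightarrow> \<rho> x (c *\<^sub>C u) = c *\<^sub>C \<rho> x u"
    and "u \<in> V \<Longrightarrow> \<rho> (x + y) u = \<rho> x u + \<rho> y u"
    and "u \<in> V \<Longrightarrow> \<rho> (c *\<^sub>C x) u = c *\<^sub>C \<rho> x u"
    and "u \<in> V \<Longrightarrow> \<rho> (bracket x y) u = \<rho> x (\<rho> y u) - \<rho> y (\<rho> x u)"
  using assms by (auto simp: lie_module_def lin_on_def)

lemma lie_module_lin_left: "lie_module V \<rho> \<Longrightarrow> u \<in> V \<Longrightarrow> lin_on UNIV (\<lambda>x. \<rho> x u)"
  by (simp add: lin_on_def lie_moduleD)

lemma lie_module_zero_left: "lie_module V \<rho> \<Longrightarrow> u \<in> V \<Longrightarrow> \<rho> 0 u = 0"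
  using lin_on_zero[OF lie_module_lin_left] by auto

lemma lie_module_zero_right: "lie_module V \<rho> \<Longrightarrow> \<rho> x 0 = 0"
  using lin_on_zero[OF lie_moduleD(3,1)] by auto

lemma lie_module_submodule:
  assumes "lie_module V \<rho>" "cv.subspace W" "W \<subseteq> V" "\<And>x u. u \<in> W \<Longrightarrow> \<rho> x u \<in> W"
  shows "lie_module W \<rho>"
  using assms unfolding lie_module_def by (auto simp: subset_iff)

lemma bracket_lin: "lin_on UNIV (bracket x)" "lin_on UNIV (\<lambda>x. bracket x y)"
  by (simp_all add: lin_on_def bracket_add_left bracket_add_right bracket_scaleC_left bracket_scaleC_right)

lemma bracket_zero [simp]: "bracket x 0 = 0" "bracket 0 x = 0"
  using lin_on_zero[OF bracket_lin(1)] lin_on_zero[OF bracket_lin(2)] by auto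

lemma bracket_anti: "bracket y x = - bracket x y"
proof -
  have "bracket x y + bracket y x = 0"
    using bracket_self[of "x + y"] bracket_self[of x] bracket_self[of y]
    by (simp add: bracket_add_left bracket_add_right add.commute)
  then show ?thesis by (simp add: add_eq_0_iff)
qed

lemma bracket_neg [simp]: "bracket x (- y) = - bracket x y" "bracket (- x) y = - bracket x y"
  using bracket_scaleC_right[of x "-1" y] bracket_scaleC_left[of "-1" x y] by simp_all

lemma adjoint_module: "lie_module UNIV bracket"
proof -
  have "bracket (bracket x y) u = bracket x (bracket y u) - bracket y (bracket x u)" for x y u :: 'a
    using jacobi[of x y u] bracket_anti[of u "bracket x y"] bracket_anti[of u x]
    by (simp add: algebra_simps)
  then show ?thesis
    by (simp add: lie_module_def bracket_add_left bracket_add_right bracket_scaleC_left bracket_scaleC_right)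
qed

lemma simple_fin_dim: "simple_lie_algebra TYPE('g::complex_lie_algebra) \<Longrightarrow> fin_dim (UNIV :: 'g set)"
  by (auto simp: simple_lie_algebra_def fin_dim_def)

lemma simple_ideal:
  "simple_lie_algebra TYPE('g::complex_lie_algebra) \<Longrightarrow> lie_ideal I \<Longrightarrow> x \<notin> I \<Longrightarrow> y \<in> I \<Longrightarrow> y = (0::'g)"
  by (auto simp: simple_lie_algebra_def)

lemma simple_perfect:
  assumes "simple_lie_algebra TYPE('g::complex_lie_algebra)"
  shows "cv.span {bracket x y |x y. True} = (UNIV :: 'g set)"
proof -
  have "lie_ideal (cv.span {bracket x y |x y::'g. True})"
    unfolding lie_ideal_def by (auto intro: cv.span_base)
  moreover obtain x y :: 'g where "bracket x y \<noteq> 0" using assms by (auto simp: simple_lie_algebra_def)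
  ultimately show ?thesis using assms cv.span_base[of "bracket x y" "{bracket x y |x y. True}"]
    unfolding simple_lie_algebra_def by blast
qed

text \<open>The device that ends every sl2-string: nonzero eigenvectors for distinct eigenvalues are
  independent, so finite dimension forbids infinitely many of them.\<close>

lemma eigenvectors_vanish:
  fixes w :: "nat \<Rightarrow> 'a::complex_vector"
  assumes "fin_dim V" "cv.subspace V" "lin_on V T" "\<And>k. w k \<in> V" "\<And>k. T (w k) = \<psi> k *\<^sub>C w k" "inj \<psi>"
  shows "\<exists>k. w k = 0"
proof (rule ccontr)
  assume nz: "\<nexists>k. w k = 0"
  obtain B where B: "is_basis B V" using basis_ex assms(1,2) by blast
  define A where "A = {..card B}"
  have inj: "inj w"
  proof (rule injI)
    fix j k assume "w j = w k"
    then have "\<psi> j *\<^sub>C w j = \<psi> k *\<^sub>C w j" using assms(5) by metis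
    then show "j = k" using nz assms(6) by (auto dest: injD)
  qed
  have "cv.independent (w ` A)"
  proof (rule cv.independent_if_scalars_zero)
    fix g x assume s: "(\<Sum>x\<in>w ` A. g x *\<^sub>C x) = 0" and "x \<in> w ` A"
    then obtain i where i: "i \<in> A" "x = w i" by auto
    have s': "(\<Sum>k\<in>A. g (w k) *\<^sub>C w k) = 0" using s inj by (simp add: sum.reindex inj_on_subset)
    have "g (w i) *\<^sub>C w i \<in> {0}"
    proof (rule eigen_component[where J="A - {i}" and V=V and H="{()}" and T="\<lambda>_. T" 
          and u="\<lambda>k. g (w k) *\<^sub>C w k" and \<psi>="\<lambda>k _. \<psi> k"])
      show "g (w i) *\<^sub>C w i + (\<Sum>k\<in>A - {i}. g (w k) *\<^sub>C w k) \<in> {0}"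
        using sum.remove[OF _ i(1), of "\<lambda>k. g (w k) *\<^sub>C w k"] s' by (simp add: A_def)
      show "\<And>h w. h \<in> {()} \<Longrightarrow> w \<in> {0} \<Longrightarrow> T w \<in> {0}" using lin_on_zero[OF assms(3,2)] by simp
      show "\<And>j. g (w j) *\<^sub>C w j \<in> V" using assms(2,4) by (intro cv.subspace_scale)
      show "\<And>j. T (g (w j) *\<^sub>C w j) = \<psi> j *\<^sub>C g (w j) *\<^sub>C w j"
        using lin_onD(2)[OF assms(3,4)] assms(5) by (simp add: mult.commute)
    qed (use assms(2,3,6) cv.subspace_0 in \<open>auto simp: A_def dest: injD\<close>)
    then show "g x = 0" using nz i by auto
  qed (simp add: A_def)
  moreover have "w ` A \<subseteq> cv.span B" using assms(4) is_basisD[OF B] by auto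
  ultimately have "card (w ` A) \<le> card B" using cv.independent_span_bound is_basisD(1)[OF B] by blast
  then show False using inj by (simp add: card_image inj_on_subset A_def)
qed

section \<open>Eigenvalues of sl2-triples in finite-dimensional modules\<close>

definition sl2_triple :: "'g::complex_lie_algebra \<Rightarrow> 'g \<Rightarrow> 'g \<Rightarrow> bool" where
  "sl2_triple e f h \<longleftrightarrow> bracket h e = 2 *\<^sub>C e \<and> bracket h f = (-2) *\<^sub>C f \<and> bracket e f = h \<and> h \<noteq> 0"

text \<open>Stated for any eigenvector \<open>e\<close> of \<open>h\<close>, because the same shift
  computes the weights of ordered monomials in \<open>fpow_weight\<close>.\<close>

lemma sl2_shift:
  assumes "lie_module V \<rho>" "u \<in> V" "bracket h e = a *\<^sub>C e" "\<rho> h u = c *\<^sub>C u"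
  shows "\<rho> h ((\<rho> e ^^ k) u) = (c + of_nat k * a) *\<^sub>C (\<rho> e ^^ k) u \<and> (\<rho> e ^^ k) u \<in> V"
proof (induction k)
  case (Suc k)
  let ?w = "(\<rho> e ^^ k) u"
  have "\<rho> h (\<rho> e ?w) = \<rho> e (\<rho> h ?w) + \<rho> (bracket h e) ?w"
    using lie_moduleD(8)[OF assms(1), of ?w h e] Suc by simp
  also have "\<dots> = (c + of_nat k * a) *\<^sub>C \<rho> e ?w + a *\<^sub>C \<rho> e ?w"
    using Suc assms(3) lie_moduleD(5,7)[OF assms(1)] by simp
  finally show ?case using Suc lie_moduleD(2)[OF assms(1)]
    by (simp add: algebra_simps scaleC_add_left)
qed (use assms in auto)

text \<open>The string satisfies \<open>e (f^(k+1) u) = (k+1) (c-k) f^k u\<close>. If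
  \<open>c\<close> is not a natural number, no factor vanishes and the string never ends.\<close>

lemma sl2_highest:
  assumes "lie_module V \<rho>" "fin_dim V" "sl2_triple e f h" "u \<in> V" "u \<noteq> 0" "\<rho> e u = 0" "\<rho> h u = c *\<^sub>C u"
  shows "\<exists>n. c = of_nat n"
proof (rule ccontr)
  assume c: "\<nexists>n. c = of_nat n"
  note M = lie_moduleD[OF assms(1)]
  define w where "w k = (\<rho> f ^^ k) u" for k
  have hw: "\<rho> h (w k) = (c + of_nat k * (-2)) *\<^sub>C w k" "w k \<in> V" for k
    using sl2_shift[OF assms(1,4) _ assms(7), of f "-2" k] assms(3) by (auto simp: w_def sl2_triple_def)
  have ew: "\<rho> e (w (Suc k)) = (of_nat (Suc k) * (c - of_nat k)) *\<^sub>C w k" for k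
  proof (induction k)
    case 0
    show ?case using M(8)[OF assms(4), of e f] assms M(3)
      by (simp add: w_def sl2_triple_def lie_module_zero_right[OF assms(1)])
  next
    case (Suc k)
    have "\<rho> e (\<rho> f (w (Suc k))) = \<rho> f (\<rho> e (w (Suc k))) + \<rho> h (w (Suc k))"
      using M(8)[OF hw(2), of e f "Suc k"] assms(3) by (simp add: sl2_triple_def)
    also have "\<dots> = (of_nat (Suc k) * (c - of_nat k) + (c + of_nat (Suc k) * (-2))) *\<^sub>C w (Suc k)"
      unfolding Suc hw using M(5)[OF hw(2)] by (simp add: w_def scaleC_add_left)
    finally show ?case by (simp add: w_def algebra_simps)
  qed
  have "w k \<noteq> 0" for k
  proof (induction k)
    case (Suc k)
    then have "\<rho> e (w (Suc k)) \<noteq> 0" unfolding ew using c by (simp del: of_nat_Suc)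
    then show ?case using lie_module_zero_right[OF assms(1)] by metis
  qed (simp add: w_def assms)
  moreover have "\<exists>k. w k = 0"
    by (rule eigenvectors_vanish[OF assms(2) M(1) M(3) hw(2,1)]) (auto intro!: injI)
  ultimately show False by blast
qed

text \<open>Raising \<open>u\<close> by \<open>e\<close> until it dies yields a highest vector,
  whose eigenvalue is a natural number and differs from \<open>c\<close> by an even integer. Reality
  is all that the positivity argument for the trace form requires.\<close>

lemma sl2_integral:
  assumes "lie_module V \<rho>" "fin_dim V" "sl2_triple e f h" "u \<in> V" "u \<noteq> 0" "\<rho> h u = c *\<^sub>C u"
  shows "c \<in> \<real>"
proof -
  define w where "w k = (\<rho> e ^^ k) u" for k
  have hw: "\<rho> h (w k) = (c + of_nat k * 2) *\<^sub>C w k" "w k \<in> V" for k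
    using sl2_shift[OF assms(1,4) _ assms(6), of e 2 k] assms(3) by (auto simp: w_def sl2_triple_def)
  have "\<exists>k. w k = 0"
    by (rule eigenvectors_vanish[OF assms(2) lie_moduleD(1,3)[OF assms(1)] hw(2,1)]) (auto intro!: injI)
  then obtain k where k: "w k = 0" "\<And>j. j < k \<Longrightarrow> w j \<noteq> 0"
    using exists_least_iff[of "\<lambda>k. w k = 0"] by auto
  then obtain j where j: "k = Suc j" using assms(5) by (cases k) (auto simp: w_def)
  have "\<rho> e (w j) = 0" using k(1) j by (simp add: w_def)
  then obtain n where "c + of_nat j * 2 = of_nat n"
    using sl2_highest[OF assms(1-3) hw(2) _ _ hw(1)] k(2) j by auto
  then have "c = of_real (of_nat n - of_nat j * 2)" by (simp add: algebra_simps)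
  then show ?thesis by (metis Reals_of_real)
qed

text \<open>Exchanging \<open>e\<close> and \<open>f\<close> and negating \<open>h\<close> gives
  again an sl2-triple.\<close>

lemma sl2_lowest:
  assumes "lie_module V \<rho>" "fin_dim V" "sl2_triple e f h" "u \<in> V" "u \<noteq> 0" "\<rho> f u = 0" "\<rho> h u = c *\<^sub>C u"
  shows "\<exists>n. - c = of_nat n"
proof -
  have "sl2_triple f e (- h)"
    using assms(3) bracket_anti[of f e] by (auto simp: sl2_triple_def)
  moreover have "\<rho> (- h) u = (- c) *\<^sub>C u" using lie_moduleD(7)[OF assms(1,4), of "-1" h] assms(7) by simp
  ultimately show ?thesis using sl2_highest[OF assms(1,2)] assms(4-6) by blast
qed

subsection \<open>The trace form\<close>

definition trace_form :: "'v::complex_vector set \<Rightarrow> ('g \<Rightarrow> 'v \<Rightarrow> 'v) \<Rightarrow> 'g \<Rightarrow> 'g \<Rightarrow> complex" where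
  "trace_form V \<rho> x y = trace_on V (\<lambda>u. \<rho> x (\<rho> y u))"

definition diag_on :: "'v::complex_vector set \<Rightarrow> ('v \<Rightarrow> 'v) \<Rightarrow> bool" where
  "diag_on V T \<longleftrightarrow> V \<subseteq> cv.span {v\<in>V. \<exists>c. T v = c *\<^sub>C v}"

lemma trace_on_cong:
  assumes "fin_dim V" "cv.subspace V" "lin_on V T" "T ` V \<subseteq> V" "\<And>u. u \<in> V \<Longrightarrow> S u = T u"
  shows "trace_on V S = trace_on V T"
proof -
  obtain B where B: "is_basis B V" using basis_ex[OF assms(1,2)] .
  have "lin_on V S"
    using assms(3,5) cv.subspace_add[OF assms(2)] cv.subspace_scale[OF assms(2)] by (simp add: lin_on_def)
  moreover have "S ` V \<subseteq> V" using assms(4,5) by auto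
  moreover have "b \<in> B \<Longrightarrow> S b = T b" for b using assms(5) is_basisD(4)[OF B] by auto
  ultimately show ?thesis using trace_on_eq[OF B] assms(3,4) by (simp add: trace_basis_def)
qed

context
  fixes V :: "'v::complex_vector set" and \<rho> :: "'g::complex_lie_algebra \<Rightarrow> 'v \<Rightarrow> 'v"
  assumes M: "lie_module V \<rho>" and fd: "fin_dim V"
begin

private lemma im: "\<rho> x ` V \<subseteq> V" using lie_moduleD(2)[OF M] by blast

private lemma lin2: "lin_on V (\<lambda>u. \<rho> x (\<rho> y u))"
  by (rule lin_on_compose[OF lie_moduleD(3)[OF M] lie_moduleD(3)[OF M] im])

private lemma im2: "(\<lambda>u. \<rho> x (\<rho> y u)) ` V \<subseteq> V" using lie_moduleD(2)[OF M] by blast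

lemma trace_form_lin_left: "lin_on UNIV (\<lambda>x. trace_form V \<rho> x y)"
proof -
  have "trace_form V \<rho> (x + z) y = trace_form V \<rho> x y + trace_form V \<rho> z y" for x z
    unfolding trace_form_def trace_on_add[OF fd lie_moduleD(1)[OF M] lin2 im2 lin2 im2, symmetric]
    using lie_moduleD[OF M] by (intro trace_on_cong[OF fd]) (auto simp: lin_on_def cv.scale_right_distrib cv.subspace_add)
  moreover have "trace_form V \<rho> (c *\<^sub>C x) y = c * trace_form V \<rho> x y" for c x
    unfolding trace_form_def trace_on_scale[OF fd lie_moduleD(1)[OF M] lin2 im2, symmetric]
    using lie_moduleD[OF M]
    by (intro trace_on_cong[OF fd]) (auto simp: lin_on_def cv.scale_right_distrib mult.commute cv.subspace_scale)
  ultimately show ?thesis by (simp add: lin_on_def)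
qed

lemma trace_form_commute: "trace_form V \<rho> x y = trace_form V \<rho> y x"
  unfolding trace_form_def
  by (rule trace_on_mult_commute[OF fd lie_moduleD(1)[OF M] lie_moduleD(3)[OF M] im lie_moduleD(3)[OF M] im])

lemma trace_form_lin_right: "lin_on UNIV (trace_form V \<rho> x)"
  using trace_form_lin_left[of x] by (simp add: trace_form_commute[of x] lin_on_def)

lemma trace_form_invariant: "trace_form V \<rho> (bracket x y) z = trace_form V \<rho> x (bracket y z)"
proof -
  note D = lie_moduleD[OF M]
  have lin3: "lin_on V (\<lambda>u. \<rho> x (\<rho> y (\<rho> z u)))" for x y z
    by (rule lin_on_compose[OF lin2 D(3) im2])
  have im3: "(\<lambda>u. \<rho> x (\<rho> y (\<rho> z u))) ` V \<subseteq> V" for x y z using D(2) by blast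
  \<comment> \<open>Differences are written as sums with a factor -1, so that additivity and
    homogeneity of the trace apply.\<close>
  have sub: "trace_on V (\<lambda>u. S u + (-1) *\<^sub>C T u) = trace_on V S - trace_on V T"
    if "lin_on V S" "S ` V \<subseteq> V" "lin_on V T" "T ` V \<subseteq> V" for S T
  proof -
    have "lin_on V (\<lambda>u. (-1) *\<^sub>C T u)" "(\<lambda>u. (-1) *\<^sub>C T u) ` V \<subseteq> V"
      using that(3,4) cv.subspace_neg[OF D(1)] by (auto simp: lin_on_def)
    then show ?thesis
      using trace_on_add[OF fd D(1) that(1,2)] trace_on_scale[OF fd D(1) that(3,4), of "-1"]
      by (simp del: cv.scale_minus_left)
  qed
  have A: "trace_form V \<rho> (bracket x y) z =
      trace_on V (\<lambda>u. \<rho> x (\<rho> y (\<rho> z u)) + (-1) *\<^sub>C \<rho> y (\<rho> x (\<rho> z u)))"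
    unfolding trace_form_def using D
    by (intro arg_cong[where f="trace_on V"] trace_on_cong[OF fd])
      (auto simp: lin_on_def cv.subspace_diff algebra_simps cv.scale_right_diff_distrib)
  have B: "trace_form V \<rho> x (bracket y z) =
      trace_on V (\<lambda>u. \<rho> x (\<rho> y (\<rho> z u)) + (-1) *\<^sub>C \<rho> x (\<rho> z (\<rho> y u)))"
    unfolding trace_form_def using D lin_on_diff[OF D(3) D(1)]
    by (intro trace_on_cong[OF fd]) 
      (simp_all add: lin_on_def cv.subspace_diff image_subset_iff cv.scale_right_diff_distrib)
  \<comment> \<open>Both sides contain the trace of \<open>x y z\<close>; the remaining traces agree
    because \<open>y\<close> commutes with the product \<open>x z\<close> under the trace.\<close>
  have "trace_on V (\<lambda>u. \<rho> y (\<rho> x (\<rho> z u))) = trace_on V (\<lambda>u. \<rho> x (\<rho> z (\<rho> y u)))"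
    by (rule trace_on_mult_commute[OF fd D(1) D(3) im lin2 im2])
  then show ?thesis unfolding A B by (simp only: sub lin3 im3)
qed

text \<open>The radical of the form is an ideal, so by simplicity it is enough that it misses
  \<open>h\<close>. The trace of the square of \<open>h\<close> is the sum of the squares of real
  eigenvalues. They are not all zero: the kernel of the representation is an ideal missing
  \<open>y\<close>, hence zero, so \<open>h\<close> does not act as zero.\<close>

lemma trace_form_nondegenerate:
  assumes simple: "simple_lie_algebra TYPE('g)" and sl2: "sl2_triple e f h" and diag: "diag_on V (\<rho> h)"
    and nt: "u \<in> V" "\<rho> y u \<noteq> 0" and deg: "\<And>z. trace_form V \<rho> x z = 0"
  shows "x = 0"
proof -
  note D = lie_moduleD[OF M]
  have "lie_ideal {x. \<forall>u\<in>V. \<rho> x u = 0}"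
    using D lie_module_zero_left[OF M] lie_module_zero_right[OF M]
    by (auto simp: lie_ideal_def cv.subspace_def)
  then have "h \<notin> {x. \<forall>u\<in>V. \<rho> x u = 0}"
    using simple_ideal[OF simple, of "{x. \<forall>u\<in>V. \<rho> x u = 0}" y h] nt sl2 by (auto simp: sl2_triple_def)
  then obtain u where u: "u \<in> V" "\<rho> h u \<noteq> 0" by blast
  obtain B where B: "is_basis B V" "B \<subseteq> {v\<in>V. \<exists>c. \<rho> h v = c *\<^sub>C v}"
    using basis_within[OF fd D(1), of "{v\<in>V. \<exists>c. \<rho> h v = c *\<^sub>C v}"] diag unfolding diag_on_def by blast
  then obtain ev where ev: "\<And>b. b \<in> B \<Longrightarrow> \<rho> h b = ev b *\<^sub>C b" by (simp add: subset_iff) metis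
  have BV: "b \<in> B \<Longrightarrow> b \<in> V \<and> b \<noteq> 0" for b
    using is_basisD[OF B(1)] cv.dependent_zero by blast
  have real: "b \<in> B \<Longrightarrow> ev b \<in> \<real>" for b
    using sl2_integral[OF M fd sl2] BV ev by blast
  have "trace_form V \<rho> h h = (\<Sum>b\<in>B. ev b * ev b)"
    unfolding trace_form_def using ev BV D(5)
    by (intro trace_on_diag[OF B(1) lin2]) auto
  also have "\<dots> = of_real (\<Sum>b\<in>B. (Re (ev b))\<^sup>2)"
    using real by (auto simp: power2_eq_square elim!: Reals_cases intro!: sum.cong)
  finally have hh: "trace_form V \<rho> h h = of_real (\<Sum>b\<in>B. (Re (ev b))\<^sup>2)" .
  have "trace_form V \<rho> h h \<noteq> 0"
  proof
    assume "trace_form V \<rho> h h = 0"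
    then have "\<And>b. b \<in> B \<Longrightarrow> Re (ev b) = 0"
      using hh is_basisD(1)[OF B(1)] by (simp add: sum_nonneg_eq_0_iff del: of_real_sum)
    then have "\<And>b. b \<in> B \<Longrightarrow> ev b = 0" using real by (metis Reals_cases Re_complex_of_real of_real_0)
    then have "\<And>b. b \<in> B \<Longrightarrow> \<rho> h b = 0" using ev by simp
    then have "\<rho> h u \<in> {0}"
      using lin_on_span_into[OF D(3) D(1) is_basisD(4)[OF B(1)] cv.subspace_single_0, of h] u is_basisD(3)[OF B(1)] by auto
    then show False using u by simp
  qed
  moreover have "lie_ideal {x. \<forall>z. trace_form V \<rho> x z = 0}"
  proof -
    have "trace_form V \<rho> (bracket w x) z = 0" if "\<forall>z. trace_form V \<rho> x z = 0" for w x z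
    proof -
      have "trace_form V \<rho> (bracket w x) z = - trace_form V \<rho> (bracket x w) z"
        using lin_onD(2)[OF trace_form_lin_left[of z], of "bracket x w" "-1"] bracket_anti[of w x] by simp
      then show ?thesis using that by (simp add: trace_form_invariant)
    qed
    then show ?thesis
      using lin_onD[OF trace_form_lin_left] lin_on_zero[OF trace_form_lin_left]
      by (auto simp: lie_ideal_def cv.subspace_def)
  qed
  ultimately show ?thesis
    using simple_ideal[OF simple, of "{x. \<forall>z. trace_form V \<rho> x z = 0}" h x] deg by blast
qed

end

subsection \<open>Vanishing of the first cohomology and splitting\<close>

lemma dual_basis:
  fixes \<beta> :: "'g::complex_vector \<Rightarrow> 'g \<Rightarrow> complex"
  assumes X: "is_basis X UNIV" and lin: "\<And>x. lin_on UNIV (\<beta> x)" and sym: "\<And>x y. \<beta> x y = \<beta> y x"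
    and nd: "\<And>x. (\<And>y. \<beta> x y = 0) \<Longrightarrow> x = 0"
  obtains x' where "\<And>z. z = (\<Sum>x\<in>X. \<beta> (x' x) z *\<^sub>C x)" "\<And>z. z = (\<Sum>x\<in>X. \<beta> x z *\<^sub>C x' x)"
    "\<And>x y. x \<in> X \<Longrightarrow> y \<in> X \<Longrightarrow> \<beta> x (x' y) = (if x = y then 1 else 0)"
proof -
  note fin = is_basisD(1)[OF X]
  have "\<exists>v. \<forall>x\<in>X. v x \<in> UNIV \<and> (\<forall>y\<in>X. \<beta> x (v y) = (if x = y then 1 else 0))"
  proof (rule dual_vectors[OF fin cv.subspace_UNIV lin])
    fix a x assume a: "\<And>v. v \<in> UNIV \<Longrightarrow> (\<Sum>x\<in>X. a x * \<beta> x v) = 0" and x: "x \<in> X"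
    have "\<beta> (\<Sum>x\<in>X. a x *\<^sub>C x) v = 0" for v
      using a[of v] lin_on_sum_scale[OF lin[of v] cv.subspace_UNIV, of X "\<lambda>x. x" a] by (simp add: sym[of _ v])
    then have "(\<Sum>x\<in>X. a x *\<^sub>C x) = 0" by (rule nd)
    then show "a x = 0" using cv.independentD[OF is_basisD(2)[OF X] fin subset_refl] x by blast
  qed
  then obtain x' where x': "\<And>x y. x \<in> X \<Longrightarrow> y \<in> X \<Longrightarrow> \<beta> x (x' y) = (if x = y then 1 else 0)" by metis
  have 1: "z = (\<Sum>x\<in>X. \<beta> (x' x) z *\<^sub>C x)" for z
  proof -
    have z: "(\<Sum>b\<in>X. coord X z b *\<^sub>C b) = z" by (rule coord_sum[OF X UNIV_I])
    have "\<beta> (x' x) z = coord X z x" if "x \<in> X" for x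
    proof -
      have "\<beta> (x' x) z = (\<Sum>b\<in>X. coord X z b * \<beta> (x' x) b)"
        using lin_on_sum_scale[OF lin[of "x' x"] cv.subspace_UNIV, of X "\<lambda>x. x" "coord X z"] z by simp
      also have "\<dots> = (\<Sum>b\<in>X. if b = x then coord X z b else 0)"
        using x' that by (intro sum.cong) (auto simp: sym[of "x' x"])
      finally show ?thesis using that fin by simp
    qed
    then show ?thesis using z by simp
  qed
  have 2: "z = (\<Sum>x\<in>X. \<beta> x z *\<^sub>C x' x)" for z
  proof -
    \<comment> \<open>The error of the second expansion pairs to zero with the basis, hence with
      everything, and nondegeneracy removes it.\<close>
    define d where "d = z - (\<Sum>x\<in>X. \<beta> x z *\<^sub>C x' x)"
    have dX: "\<beta> y d = 0" if "y \<in> X" for y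
    proof -
      have "\<beta> y d = \<beta> y z - (\<Sum>x\<in>X. \<beta> x z * \<beta> y (x' x))"
        unfolding d_def using lin_on_diff[OF lin cv.subspace_UNIV] lin_on_sum_scale[OF lin[of y] cv.subspace_UNIV, of X x'] by simp
      also have "(\<Sum>x\<in>X. \<beta> x z * \<beta> y (x' x)) = (\<Sum>x\<in>X. if x = y then \<beta> x z else 0)"
        using x' that by (intro sum.cong) auto
      finally show ?thesis using that fin by simp
    qed
    have "\<beta> d y = 0" for y
      using lin_on_span_into[OF lin[of d] cv.subspace_UNIV subset_UNIV cv.subspace_single_0, of X y] dX sym is_basisD(3)[OF X] by auto
    then have "d = 0" by (rule nd)
    then show ?thesis by (simp add: d_def)
  qed
  show ?thesis by (rule that[OF 1 2 x'])
qed

text \<open>Invariance of the Casimir tensor, the sum of \<open>x\<close> tensor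
  \<open>x' x\<close>. An arbitrary bilinear \<open>F\<close> is allowed because the tensor is used
  twice: for the Casimir operator and for a vector built from a cocycle.\<close>

lemma casimir_shift:
  fixes \<beta> :: "'g::complex_lie_algebra \<Rightarrow> 'g \<Rightarrow> complex" and F :: "'g \<Rightarrow> 'g \<Rightarrow> 'a::complex_vector"
  assumes "finite X" "\<And>x y z. \<beta> (bracket x y) z = \<beta> x (bracket y z)"
    "\<And>x. lin_on UNIV (\<beta> x)" "\<And>x y. \<beta> x y = \<beta> y x"
    "\<And>z. z = (\<Sum>x\<in>X. \<beta> (x' x) z *\<^sub>C x)" "\<And>z. z = (\<Sum>x\<in>X. \<beta> x z *\<^sub>C x' x)"
    "\<And>x. lin_on UNIV (F x)" "\<And>y. lin_on UNIV (\<lambda>x. F x y)"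
  shows "(\<Sum>x\<in>X. F (bracket y x) (x' x) + F x (bracket y (x' x))) = 0"
proof -
  have 1: "F (bracket y x) (x' x) = (\<Sum>z\<in>X. \<beta> (x' z) (bracket y x) *\<^sub>C F z (x' x))" for x
    by (rule trans[OF arg_cong[OF assms(5), of "\<lambda>z. F z (x' x)"]
          lin_on_sum_scale[OF assms(8) cv.subspace_UNIV, of X "\<lambda>x. x"]]) simp
  have 2: "F x (bracket y (x' x)) = (\<Sum>z\<in>X. \<beta> z (bracket y (x' x)) *\<^sub>C F x (x' z))" for x
    by (rule trans[OF arg_cong[OF assms(6), of "F x"] lin_on_sum_scale[OF assms(7) cv.subspace_UNIV]]) simp
  \<comment> \<open>The matrices of \<open>bracket y\<close> in the two dual bases are negative
    transposes of each other, by invariance of the form.\<close>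
  have 3: "\<beta> (x' z) (bracket y x) + \<beta> x (bracket y (x' z)) = 0" for x z
  proof -
    have "\<beta> x (bracket y (x' z)) = - \<beta> x (bracket (x' z) y)"
      using lin_onD(2)[OF assms(3), of "bracket (x' z) y" x "-1"] bracket_anti[of y "x' z"] by simp
    also have "\<beta> x (bracket (x' z) y) = \<beta> (x' z) (bracket y x)"
      using assms(2,4) by metis
    finally show ?thesis by simp
  qed
  have "(\<Sum>x\<in>X. F x (bracket y (x' x))) = (\<Sum>x\<in>X. \<Sum>z\<in>X. \<beta> x (bracket y (x' z)) *\<^sub>C F z (x' x))"
    unfolding 2 by (rule sum.swap)
  then have "(\<Sum>x\<in>X. F (bracket y x) (x' x) + F x (bracket y (x' x))) =
      (\<Sum>x\<in>X. \<Sum>z\<in>X. (\<beta> (x' z) (bracket y x) + \<beta> x (bracket y (x' z))) *\<^sub>C F z (x' x))"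
    by (simp only: sum.distrib 1 scaleC_add_left)
  then show ?thesis by (simp only: 3 cv.scale_zero_left sum.neutral_const)
qed

locale simple_sl2 =
  fixes e f h :: "'g::complex_lie_algebra"
  assumes simple: "simple_lie_algebra TYPE('g)" and sl2: "sl2_triple e f h"
begin

text \<open>Whitehead's first lemma. The Casimir operator \<Omega> of the trace form commutes with
  the action, and the vector \<open>e'\<close> satisfies \<open>y e' = \<Omega> (\<phi> y)\<close>.
  So a preimage of \<open>e'\<close> under \<Omega> would solve the problem; one exists up to the
  generalized kernel \<open>E0\<close> of \<Omega>. The remaining cocycle has values in
  \<open>E0\<close>, which is a proper submodule because the trace of \<Omega> is not zero, and
  induction on the dimension applies.\<close>

lemma cocycle_trivial:
  fixes E :: "'e::complex_vector set" and \<phi> :: "'g \<Rightarrow> 'e"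
  assumes "lie_module E \<rho>" "fin_dim E" "diag_on E (\<rho> h)" "\<And>x. \<phi> x \<in> E" "lin_on UNIV \<phi>"
    "\<And>x y. \<phi> (bracket x y) = \<rho> x (\<phi> y) - \<rho> y (\<phi> x)"
  shows "\<exists>u\<in>E. \<forall>x. \<phi> x = \<rho> x u"
  using assms
proof (induction "cv.dim E" arbitrary: E \<phi> rule: less_induct)
  case less
  note M = lie_moduleD[OF less.prems(1)]
  show ?case
  proof (cases "\<forall>u\<in>E. \<forall>y. \<rho> y u = 0")
    case True
    \<comment> \<open>If the action is trivial, the cocycle identity makes \<phi> vanish on
      brackets, and these span the algebra.\<close>
    have "cv.span {bracket x y |x y::'g. True} \<subseteq> {x. \<phi> x = 0}"
    proof (rule cv.span_minimal)
      show "{bracket x y |x y. True} \<subseteq> {x. \<phi> x = 0}" using less.prems(4,6) True by auto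
      show "cv.subspace {x. \<phi> x = 0}"
        using lin_onD[OF less.prems(5)] lin_on_zero[OF less.prems(5)] by (auto simp: cv.subspace_def)
    qed
    then have "\<And>x. \<phi> x = 0" unfolding simple_perfect[OF simple] by auto
    then show ?thesis using lie_module_zero_right[OF less.prems(1)] cv.subspace_0[OF M(1)] by auto
  next
    case False
    then obtain u0 y0 where nt: "u0 \<in> E" "\<rho> y0 u0 \<noteq> 0" by blast
    define \<beta> where "\<beta> = trace_form E \<rho>"
    have nd: "x = 0" if "\<And>z. \<beta> x z = 0" for x
      using trace_form_nondegenerate[OF less.prems(1,2) simple sl2 less.prems(3) nt] that by (simp add: \<beta>_def)
    have \<beta>lin: "lin_on UNIV (\<beta> x)" for x
      unfolding \<beta>_def by (rule trace_form_lin_right[OF less.prems(1,2)])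
    have \<beta>sym: "\<beta> x y = \<beta> y x" for x y
      unfolding \<beta>_def by (rule trace_form_commute[OF less.prems(1,2)])
    have \<beta>inv: "\<beta> (bracket x y) z = \<beta> x (bracket y z)" for x y z
      unfolding \<beta>_def by (rule trace_form_invariant[OF less.prems(1,2)])
    obtain X :: "'g set" where X: "is_basis X UNIV" using basis_ex[OF simple_fin_dim[OF simple] cv.subspace_UNIV] .
    obtain x' where x': "\<And>z. z = (\<Sum>x\<in>X. \<beta> (x' x) z *\<^sub>C x)" "\<And>z. z = (\<Sum>x\<in>X. \<beta> x z *\<^sub>C x' x)"
      "\<And>x y. x \<in> X \<Longrightarrow> y \<in> X \<Longrightarrow> \<beta> x (x' y) = (if x = y then 1 else 0)"
      using dual_basis[OF X \<beta>lin \<beta>sym nd] by blast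
    note fin = is_basisD(1)[OF X]
    note shift = casimir_shift[OF fin \<beta>inv \<beta>lin \<beta>sym x'(1,2)]
    define \<Omega> where "\<Omega> u = (\<Sum>x\<in>X. \<rho> x (\<rho> (x' x) u))" for u
    have lin2: "lin_on E (\<lambda>u. \<rho> x (\<rho> y u))" for x y
      using lin_on_compose[OF M(3) M(3)] M(2) by (auto simp: image_subset_iff)
    have \<Omega>E: "u \<in> E \<Longrightarrow> \<Omega> u \<in> E" for u
      unfolding \<Omega>_def using M by (intro cv.subspace_sum) auto
    have \<Omega>lin: "lin_on E \<Omega>" unfolding \<Omega>_def
      using lin_onD[OF lin2] by (simp add: lin_on_def sum.distrib cv.scale_sum_right)
    \<comment> \<open>Moving \<open>y\<close> through the Casimir sum. It is used for \<Omega>, with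
      \<zeta> the orbit map of \<open>u\<close>, and for \<open>e'\<close>, with \<zeta> the
      cocycle.\<close>
    have comm: "\<rho> y (\<Sum>x\<in>X. \<rho> x (\<zeta> (x' x))) = (\<Sum>x\<in>X. \<rho> x (\<rho> y (\<zeta> (x' x)) - \<zeta> (bracket y (x' x))))"
      if "lin_on UNIV \<zeta>" "\<And>x. \<zeta> x \<in> E" for \<zeta> y
    proof -
      have "(\<Sum>x\<in>X. \<rho> (bracket y x) (\<zeta> (x' x)) + \<rho> x (\<zeta> (bracket y (x' x)))) = 0"
      proof (rule shift)
        show "lin_on UNIV (\<lambda>z. \<rho> x (\<zeta> z))" for x
          using lin_on_compose[OF that(1) M(3)] that(2) by auto
        show "lin_on UNIV (\<lambda>x. \<rho> x (\<zeta> z))" for z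
          by (rule lie_module_lin_left[OF less.prems(1) that(2)])
      qed
      moreover have "\<rho> (bracket y x) (\<zeta> (x' x)) = \<rho> y (\<rho> x (\<zeta> (x' x))) - \<rho> x (\<rho> y (\<zeta> (x' x)))" for x
        by (rule M(8)[OF that(2)])
      moreover have "\<rho> x (\<rho> y (\<zeta> (x' x)) - \<zeta> (bracket y (x' x))) = \<rho> x (\<rho> y (\<zeta> (x' x))) - \<rho> x (\<zeta> (bracket y (x' x)))" for x
        using lin_on_diff[OF M(3) M(1)] that(2) M(2) by blast
      moreover have "\<rho> y (\<Sum>x\<in>X. \<rho> x (\<zeta> (x' x))) = (\<Sum>x\<in>X. \<rho> y (\<rho> x (\<zeta> (x' x))))"
        using M(2)[OF that(2)] by (intro lin_on_sum[OF M(3) M(1)])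
      ultimately show ?thesis
        by (simp only: sum.distrib sum_subtractf) (simp add: algebra_simps)
    qed
    have \<Omega>comm: "\<rho> y (\<Omega> u) = \<Omega> (\<rho> y u)" if "u \<in> E" for y u
    proof -
      have "\<rho> y (\<Omega> u) = (\<Sum>x\<in>X. \<rho> x (\<rho> y (\<rho> (x' x) u) - \<rho> (bracket y (x' x)) u))"
        unfolding \<Omega>_def using comm[of "\<lambda>x. \<rho> x u"] lie_module_lin_left[OF less.prems(1) that] M(2)[OF that] by blast
      then show ?thesis using M(8)[OF that] by (simp add: \<Omega>_def)
    qed
    define e' where "e' = (\<Sum>x\<in>X. \<rho> x (\<phi> (x' x)))"
    have e'E: "e' \<in> E" unfolding e'_def using M less.prems(4) by (intro cv.subspace_sum) auto
    have e': "\<rho> y e' = \<Omega> (\<phi> y)" for y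
    proof -
      have "\<rho> y e' = (\<Sum>x\<in>X. \<rho> x (\<rho> y (\<phi> (x' x)) - \<phi> (bracket y (x' x))))"
        unfolding e'_def by (rule comm[OF less.prems(5,4)])
      then show ?thesis by (simp add: \<Omega>_def less.prems(6))
    qed
    have \<Omega>nE: "u \<in> E \<Longrightarrow> (\<Omega> ^^ n) u \<in> E" for u n using \<Omega>E by (induction n) auto
    have \<Omega>ncomm: "u \<in> E \<Longrightarrow> \<rho> y ((\<Omega> ^^ n) u) = (\<Omega> ^^ n) (\<rho> y u)" for u n y
      using \<Omega>comm \<Omega>nE by (induction n) auto
    have \<Omega>nlin: "lin_on E (\<Omega> ^^ n)" for n
    proof (induction n)
      case (Suc n)
      then show ?case using lin_on_compose[OF Suc \<Omega>lin] \<Omega>nE by (auto simp: o_def)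
    qed (simp add: lin_on_def)
    obtain n where n: "(\<Omega> ^^ Suc n) ` E = (\<Omega> ^^ n) ` E"
      using image_stabilizes[OF less.prems(2) M(1) \<Omega>lin] \<Omega>E by blast
    \<comment> \<open>By stabilization of the images, \<open>e1\<close> is a preimage of
      \<open>e'\<close> under \<Omega> up to the kernel of a power of \<Omega>.\<close>
    then obtain e1 where e1: "e1 \<in> E" "(\<Omega> ^^ n) e' = (\<Omega> ^^ Suc n) e1" using e'E by blast
    define E0 where "E0 = {u\<in>E. (\<Omega> ^^ Suc n) u = 0}"
    have E0sub: "cv.subspace E0"
      unfolding E0_def cv.subspace_def
      using lin_onD[OF \<Omega>nlin] lin_on_zero[OF \<Omega>nlin M(1)] M(1)
      by (auto simp: cv.subspace_add cv.subspace_scale cv.subspace_0 simp del: funpow.simps)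
    have E0\<rho>: "\<rho> x u \<in> E0" if "u \<in> E0" for x u
      using that \<Omega>ncomm[of u x "Suc n"] M(2) lie_module_zero_right[OF less.prems(1)]
      by (auto simp: E0_def simp del: funpow.simps)
    \<comment> \<open>Each pair of dual basis vectors contributes 1, so the trace is the dimension
      of the algebra. A nilpotent \<Omega> would have trace 0.\<close>
    have "trace_on E \<Omega> = (\<Sum>x\<in>X. \<beta> x (x' x))"
      unfolding \<Omega>_def \<beta>_def trace_form_def
      using lin2 M(2) by (intro trace_on_sum[OF less.prems(2) M(1) fin]) auto
    also have "\<dots> = of_nat (card X)" using x'(3) by simp
    also have "\<dots> \<noteq> 0"
    proof -
      have "X \<noteq> {}" using is_basisD(3)[OF X] sl2 by (auto simp: sl2_triple_def)
      then show ?thesis using fin by simp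
    qed
    finally have "E0 \<noteq> E"
      using trace_on_nilpotent[OF less.prems(2) M(1) \<Omega>lin, of "Suc n"] \<Omega>E by (auto simp: E0_def simp del: funpow.simps)
    then have ps: "E0 \<subset> E" by (auto simp: E0_def)
    define \<phi>' where "\<phi>' x = \<phi> x - \<rho> x e1" for x
    have "\<exists>u\<in>E0. \<forall>x. \<phi>' x = \<rho> x u"
    proof (rule less.hyps)
      show "cv.dim E0 < cv.dim E" by (rule proper_subspace_dim[OF E0sub M(1) less.prems(2) ps])
      show "lie_module E0 \<rho>" using lie_module_submodule[OF less.prems(1) E0sub] ps E0\<rho> by auto
      show "fin_dim E0" using fin_dim_subset[OF less.prems(2)] ps by auto
      show "diag_on E0 (\<rho> h)" unfolding diag_on_def
        using less.prems(3) ps E0\<rho> by (intro eigen_span_subspace[OF M(1) M(3) E0sub]) (auto simp: diag_on_def)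
      show "lin_on UNIV \<phi>'"
        using lin_onD[OF less.prems(5)] lin_onD[OF lie_module_lin_left[OF less.prems(1) e1(1)]]
        by (simp add: \<phi>'_def lin_on_def algebra_simps cv.scale_right_diff_distrib)
      show "\<phi>' x \<in> E0" for x
      proof -
        \<comment> \<open>Applying a high power of \<Omega> to \<phi> or to the coboundary of
          \<open>e1\<close> gives the same result, so their difference lies in
          \<open>E0\<close>.\<close>
        have "(\<Omega> ^^ Suc n) (\<phi> x) = (\<Omega> ^^ n) (\<rho> x e')" by (simp add: e' funpow_swap1)
        also have "\<dots> = (\<Omega> ^^ Suc n) (\<rho> x e1)"
          using \<Omega>ncomm[OF e'E, of x n] \<Omega>ncomm[OF e1(1), of x "Suc n"] e1(2) by simp
        finally show ?thesis
          using lin_on_diff[OF \<Omega>nlin M(1), of "\<phi> x" "\<rho> x e1" "Suc n"] less.prems(4) M(1,2) e1(1)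
          by (auto simp: E0_def \<phi>'_def cv.subspace_diff simp del: funpow.simps)
      qed
      show "\<phi>' (bracket x y) = \<rho> x (\<phi>' y) - \<rho> y (\<phi>' x)" for x y
        using lin_on_diff[OF M(3) M(1)] less.prems(4) M(2)[OF e1(1)] M(8)[OF e1(1)]
        by (simp add: \<phi>'_def less.prems(6))
    qed
    then obtain u where u: "u \<in> E0" "\<And>x. \<phi> x - \<rho> x e1 = \<rho> x u" by (auto simp: \<phi>'_def)
    have "\<phi> x = \<rho> x (u + e1)" for x
      using u M(4)[of u e1 x] ps e1(1) by (auto simp: algebra_simps)
    then show ?thesis using u(1) e1(1) ps cv.subspace_add[OF M(1)] by blast
  qed
qed

text \<open>A linear projection onto the submodule \<open>K\<close> is corrected to an equivariant one: the obstruction is a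
  cocycle with values in the maps \<open>M \<rightarrow> K\<close> that vanish on \<open>K\<close>.\<close>

lemma equivariant_projection:
  fixes M :: "'w::complex_vector set"
  assumes "lie_module M \<rho>" "fin_dim M" "diag_on M (\<rho> h)"
    and "cv.subspace K" "K \<subseteq> M" "\<And>x u. u \<in> K \<Longrightarrow> \<rho> x u \<in> K"
  obtains \<pi> where "lin_on M \<pi>" "\<And>u. u \<in> M \<Longrightarrow> \<pi> u \<in> K" "\<And>u. u \<in> K \<Longrightarrow> \<pi> u = u"
    "\<And>x u. u \<in> M \<Longrightarrow> \<pi> (\<rho> x u) = \<rho> x (\<pi> u)"
proof -
  note D = lie_moduleD[OF assms(1)]
  let ?eig = "\<lambda>V. {v\<in>V. \<exists>c. \<rho> h v = c *\<^sub>C v}"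
  have "K \<subseteq> cv.span (?eig K)"
    using assms(3,6) by (intro eigen_span_subspace[OF D(1,3) assms(4,5)]) (auto simp: diag_on_def)
  then obtain C where C: "is_basis C K" "C \<subseteq> ?eig K"
    using basis_within[OF fin_dim_subset[OF assms(2,5)] assms(4), of "?eig K"] by auto
  \<comment> \<open>An eigenbasis of \<open>K\<close> is extended to one of \<open>M\<close>, so
    that the elementary maps between basis vectors diagonalize \<open>h\<close> on the space of
    maps.\<close>
  obtain B where B: "C \<subseteq> B" "B \<subseteq> ?eig M" "cv.independent B" "?eig M \<subseteq> cv.span B"
    using cv.maximal_independent_subset_extend[of C "?eig M"] C is_basisD(2)[OF C(1)] assms(5) by blast
  have spB: "cv.span B = M"
  proof
    show "cv.span B \<subseteq> M" using B(2) by (intro cv.span_minimal D(1)) auto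
    show "M \<subseteq> cv.span B"
      by (rule order_trans[OF assms(3)[unfolded diag_on_def] cv.span_minimal[OF B(4) cv.subspace_span]])
  qed
  obtain F where "finite F" "M \<subseteq> cv.span F" using assms(2) by (auto simp: fin_dim_def)
  then have "finite B" using cv.independent_span_bound[of F B] B(2,3) by blast
  then have Bb: "is_basis B M" using B(3) spB by (simp add: is_basis_def)
  obtain ev where ev: "\<And>b. b \<in> B \<Longrightarrow> \<rho> h b = ev b *\<^sub>C b" using B(2) by (simp add: subset_iff) metis
  note BD = is_basisD[OF Bb] and CD = is_basisD[OF C(1)]
  define p where "p u = (\<Sum>b\<in>C. coord B u b *\<^sub>C b)" for u
  have plin: "lin_on M p"
    using coord_lin[OF Bb] by (simp add: p_def lin_on_def scaleC_add_left sum.distrib cv.scale_sum_right)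
  have pK: "p u \<in> K" for u unfolding p_def using CD by (intro cv.subspace_sum cv.subspace_scale) auto
  have coordK: "coord B u = coord C u" if "u \<in> K" for u
    using cv.representation_extend[OF BD(2) _ B(1)] that CD(3) by auto
  have pid: "p u = u" if "u \<in> K" for u
    using coord_sum[OF C(1) that] by (simp add: p_def coordK[OF that])
  \<comment> \<open>Maps are set to 0 outside \<open>M\<close>; equality of functions then means
    equality on \<open>M\<close>, and \<open>E\<close> is a genuine subspace of the function
    type.\<close>
  define E where "E = {T. lin_on M T \<and> (\<forall>u\<in>M. T u \<in> K) \<and> (\<forall>u\<in>K. T u = 0) \<and> (\<forall>u. u \<notin> M \<longrightarrow> T u = 0)}"
  define \<theta> where "\<theta> x T = (\<lambda>u. if u \<in> M then \<rho> x (T u) - T (\<rho> x u) else 0)" for x and T :: "'w \<Rightarrow> 'w"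
  have ET: "lin_on M T" "u \<in> M \<Longrightarrow> T u \<in> K" "u \<in> K \<Longrightarrow> T u = 0" "u \<notin> M \<Longrightarrow> T u = 0" "u \<in> M \<Longrightarrow> T u \<in> M"
    if "T \<in> E" for T u using that assms(5) by (auto simp: E_def)
  note M0 = cv.subspace_add[OF D(1)] cv.subspace_scale[OF D(1)]
  note K0 = cv.subspace_0[OF assms(4)] cv.subspace_add[OF assms(4)] cv.subspace_scale[OF assms(4)] cv.subspace_diff[OF assms(4)]
  have \<rho>diff: "u \<in> M \<Longrightarrow> w \<in> M \<Longrightarrow> \<rho> x (u - w) = \<rho> x u - \<rho> x w" for x u w
    using lin_on_diff[OF D(3) D(1)] by blast
  have Tdiff: "T \<in> E \<Longrightarrow> u \<in> M \<Longrightarrow> w \<in> M \<Longrightarrow> T (u - w) = T u - T w" for T u w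
    using lin_on_diff[OF ET(1) D(1)] by blast
  have KM: "u \<in> K \<Longrightarrow> u \<in> M" for u using assms(5) by auto
  have EM: "lie_module E \<theta>"
    unfolding lie_module_def
  proof (intro conjI allI ballI)
    show "cv.subspace E"
      by (rule cv.subspaceI) (auto simp: E_def lin_on_def K0 cv.scale_right_distrib algebra_simps mult.commute)
    fix x y c T S assume T: "T \<in> E" and S: "S \<in> E"
    show "\<theta> x T \<in> E"
      using ET[OF T] D K0 assms(6) lin_onD[OF ET(1)[OF T]] \<rho>diff KM M0 lie_module_zero_right[OF assms(1)]
      by (auto simp: E_def \<theta>_def lin_on_def cv.scale_right_diff_distrib algebra_simps)
    show "\<theta> x (T + S) = \<theta> x T + \<theta> x S"
      using ET(5)[OF T] ET(5)[OF S] D by (auto simp: \<theta>_def fun_eq_iff)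
    show "\<theta> x (c *\<^sub>C T) = c *\<^sub>C \<theta> x T"
      using ET(5)[OF T] D by (auto simp: \<theta>_def fun_eq_iff cv.scale_right_diff_distrib)
    show "\<theta> (x + y) T = \<theta> x T + \<theta> y T"
      using ET(5)[OF T] D lin_onD[OF ET(1)[OF T]] by (auto simp: \<theta>_def fun_eq_iff)
    show "\<theta> (c *\<^sub>C x) T = c *\<^sub>C \<theta> x T"
      using ET(5)[OF T] D lin_onD[OF ET(1)[OF T]] by (auto simp: \<theta>_def fun_eq_iff cv.scale_right_diff_distrib)
    show "\<theta> (bracket x y) T = \<theta> x (\<theta> y T) - \<theta> y (\<theta> x T)"
      using ET(5)[OF T] D Tdiff[OF T] \<rho>diff by (auto simp: \<theta>_def fun_eq_iff)
  qed
  \<comment> \<open>The elementary map sending \<open>b\<close> to \<open>k\<close> and the other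
    basis vectors to 0. It is an eigenvector of \<open>h\<close> for the difference of the two
    eigenvalues.\<close>
  define e where "e b k = (\<lambda>u. if u \<in> M then coord B u b *\<^sub>C k else 0)" for b and k :: 'w
  have eE: "e b k \<in> E" if "b \<in> B - C" "k \<in> C" for b k
  proof -
    have "coord B u b = 0" if "u \<in> K" for u
      using coordK[OF that] \<open>b \<in> B - C\<close> cv.representation_ne_zero[of C u b] by auto
    then show ?thesis using that CD(4) K0 coord_lin[OF Bb]
      by (auto simp: e_def E_def lin_on_def scaleC_add_left D cv.subspace_add cv.subspace_scale)
  qed
  have e\<theta>: "\<theta> h (e b k) = (ev k - ev b) *\<^sub>C e b k" if "b \<in> B - C" "k \<in> C" for b k
  proof
    fix u
    have kM: "k \<in> M" "k \<in> B" using that CD(4) assms(5) B(1) by auto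
    have "coord B (\<rho> h u) b = ev b * coord B u b" if "u \<in> M"
    proof -
      have "\<rho> h u = \<rho> h (\<Sum>b\<in>B. coord B u b *\<^sub>C b)" by (simp add: coord_sum[OF Bb that])
      also have "\<dots> = (\<Sum>b\<in>B. coord B u b *\<^sub>C \<rho> h b)" using BD(4) by (intro lin_on_sum_scale[OF D(3,1)]) auto
      finally have hu: "\<rho> h u = (\<Sum>b\<in>B. coord B u b *\<^sub>C \<rho> h b)" .
      have "coord B (\<rho> h u) b = (\<Sum>b'\<in>B. coord B u b' *\<^sub>C coord B (\<rho> h b') b)"
        unfolding hu using BD(4) D(2) by (intro lin_on_sum_scale[OF coord_lin_on[OF Bb] D(1)]) auto
      then have "coord B (\<rho> h u) b = (\<Sum>b'\<in>B. coord B u b' * coord B (\<rho> h b') b)"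
        by simp
      also have "\<dots> = (\<Sum>b'\<in>B. if b' = b then ev b * coord B u b else 0)"
        using BD(4) ev by (intro sum.cong) (auto simp: subset_iff coord_lin[OF Bb] coord_basis[OF Bb])
      finally show ?thesis using \<open>b \<in> B - C\<close> BD(1) by simp
    qed
    then show "\<theta> h (e b k) u = ((ev k - ev b) *\<^sub>C e b k) u"
      using ev[OF kM(2)] D(2,5) kM(1) by (auto simp: \<theta>_def e_def cv.scale_left_diff_distrib mult.commute)
  qed
  have Espan: "T \<in> cv.span ((\<lambda>(b, k). e b k) ` ((B - C) \<times> C))" if "T \<in> E" for T
  proof -
    have "T = (\<Sum>b\<in>B - C. \<Sum>k\<in>C. coord C (T b) k *\<^sub>C e b k)"
    proof
      fix u
      show "T u = (\<Sum>b\<in>B - C. \<Sum>k\<in>C. coord C (T b) k *\<^sub>C e b k) u"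
      proof (cases "u \<in> M")
        case True
        have "T u = T (\<Sum>b\<in>B. coord B u b *\<^sub>C b)" by (simp add: coord_sum[OF Bb True])
        also have "\<dots> = (\<Sum>b\<in>B. coord B u b *\<^sub>C T b)"
          using BD(4) by (intro lin_on_sum_scale[OF ET(1)[OF that] D(1)]) auto
        also have "\<dots> = (\<Sum>b\<in>B - C. coord B u b *\<^sub>C T b)"
          using BD(1) CD(4) ET(3)[OF that] by (intro sum.mono_neutral_right) auto
        also have "\<dots> = (\<Sum>b\<in>B - C. \<Sum>k\<in>C. coord C (T b) k *\<^sub>C coord B u b *\<^sub>C k)"
        proof (intro sum.cong refl)
          fix b assume "b \<in> B - C"
          then have "T b \<in> K" using BD(4) ET(2)[OF that] by auto
          then have "coord B u b *\<^sub>C T b = coord B u b *\<^sub>C (\<Sum>k\<in>C. coord C (T b) k *\<^sub>C k)"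
            by (simp add: coord_sum[OF C(1)])
          then show "coord B u b *\<^sub>C T b = (\<Sum>k\<in>C. coord C (T b) k *\<^sub>C coord B u b *\<^sub>C k)"
            by (simp add: cv.scale_sum_right mult.commute)
        qed
        finally show ?thesis using True by (simp add: sum_fun_apply e_def)
      qed (simp add: sum_fun_apply e_def ET(4)[OF that])
    qed
    moreover have "(\<Sum>b\<in>B - C. \<Sum>k\<in>C. coord C (T b) k *\<^sub>C e b k) \<in> cv.span ((\<lambda>(b, k). e b k) ` ((B - C) \<times> C))"
      by (intro cv.span_sum cv.span_scale cv.span_base) auto
    ultimately show ?thesis by simp
  qed
  \<comment> \<open>Formally the coboundary of \<open>p\<close>. Although \<open>p\<close> itself is
    not in \<open>E\<close>, all values \<open>\<phi> x\<close> are: they vanish on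
    \<open>K\<close>, where \<open>p\<close> is the identity.\<close>
  define \<phi> where "\<phi> x = (\<lambda>u. if u \<in> M then \<rho> x (p u) - p (\<rho> x u) else 0)" for x
  have "\<exists>T\<in>E. \<forall>x. \<phi> x = \<theta> x T"
  proof (rule cocycle_trivial[OF EM])
    show "fin_dim E" unfolding fin_dim_def using Espan BD(1) CD(1)
      by (intro exI[of _ "(\<lambda>(b, k). e b k) ` ((B - C) \<times> C)"]) auto
    have sub: "(\<lambda>(b, k). e b k) ` ((B - C) \<times> C) \<subseteq> {T\<in>E. \<exists>c. \<theta> h T = c *\<^sub>C T}"
    proof (clarsimp, intro conjI exI)
      fix b k assume "b \<in> B" "b \<notin> C" "k \<in> C"
      then show "e b k \<in> E" "\<theta> h (e b k) = (ev k - ev b) *\<^sub>C e b k" using eE e\<theta> by auto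
    qed
    show "diag_on E (\<theta> h)" unfolding diag_on_def
      using Espan cv.span_mono[OF sub] by (intro subsetI) (rule subsetD)
    have pM: "p u \<in> M" for u using pK KM by blast
    show "\<phi> x \<in> E" for x
      using pK K0 assms(6) lin_onD[OF plin] D M0 \<rho>diff pM pid KM
      by (auto simp: \<phi>_def E_def lin_on_def cv.scale_right_diff_distrib algebra_simps)
    show "lin_on UNIV \<phi>"
      using lin_onD[OF plin] D pM
      by (auto simp: \<phi>_def lin_on_def fun_eq_iff cv.scale_right_diff_distrib)
    show "\<phi> (bracket x y) = \<theta> x (\<phi> y) - \<theta> y (\<phi> x)" for x y
      using D pM \<rho>diff lin_on_diff[OF plin D(1)] by (auto simp: \<phi>_def \<theta>_def fun_eq_iff)
  qed
  then obtain T where T: "T \<in> E" "\<And>x. \<phi> x = \<theta> x T" by blast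
  show ?thesis
  proof (rule that[of "\<lambda>u. p u - T u"])
    show "lin_on M (\<lambda>u. p u - T u)"
      using lin_onD[OF plin] lin_onD[OF ET(1)[OF T(1)]] by (simp add: lin_on_def cv.scale_right_diff_distrib)
    show "u \<in> M \<Longrightarrow> p u - T u \<in> K" for u using pK K0 ET(2)[OF T(1)] by auto
    show "u \<in> K \<Longrightarrow> p u - T u = u" for u using pid ET(3)[OF T(1)] by auto
    show "p (\<rho> x u) - T (\<rho> x u) = \<rho> x (p u - T u)" if "u \<in> M" for x u
    proof -
      have "\<rho> x (p u) - p (\<rho> x u) = \<rho> x (T u) - T (\<rho> x u)"
        using fun_cong[OF T(2)[of x], of u] that by (simp add: \<phi>_def \<theta>_def)
      moreover have "\<rho> x (p u - T u) = \<rho> x (p u) - \<rho> x (T u)"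
        using \<rho>diff pK KM ET(5)[OF T(1) that] by blast
      ultimately show ?thesis by (metis diff_diff_eq2 diff_add_cancel add_diff_cancel_left' diff_add_eq)
    qed
  qed
qed

end

section \<open>Root space decomposition\<close>

lemma trace_on_diff:
  assumes "fin_dim V" "cv.subspace V" "lin_on V S" "S ` V \<subseteq> V" "lin_on V T" "T ` V \<subseteq> V"
  shows "trace_on V (\<lambda>u. S u - T u) = trace_on V S - trace_on V T"
proof -
  have "lin_on V (\<lambda>u. (-1) *\<^sub>C T u)" "(\<lambda>u. (-1) *\<^sub>C T u) ` V \<subseteq> V"
    using lin_onD[OF assms(5)] assms(6) cv.subspace_neg[OF assms(2)] by (auto simp: lin_on_def)
  from trace_on_add[OF assms(1-4) this] trace_on_scale[OF assms(1,2,5,6), of "-1"]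
  show ?thesis by simp
qed

lemma bracket_derivation: "bracket h (bracket x y) = bracket (bracket h x) y + bracket x (bracket h y)"
  using lie_moduleD(8)[OF adjoint_module, of y h x] by simp

locale simple_cartan =
  fixes t :: "'g::complex_lie_algebra set"
  assumes simple: "simple_lie_algebra TYPE('g)" and cartan: "cartan_subalgebra t"
begin

abbreviation "rs \<equiv> root_space t"

lemma t_subspace: "cv.subspace t"
  and t_abelian: "h \<in> t \<Longrightarrow> k \<in> t \<Longrightarrow> bracket h k = 0"
  and t_centralizer: "(\<And>h. h \<in> t \<Longrightarrow> bracket h x = 0) \<Longrightarrow> x \<in> t"
  and t_diag: "h \<in> t \<Longrightarrow> diag_on UNIV (bracket h)"
  using cartan unfolding cartan_subalgebra_def diag_on_def by (simp, blast, blast, simp)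

lemma g_fin_dim: "fin_dim (UNIV :: 'g set)"
  by (rule simple_fin_dim[OF simple])

lemma center_trivial:
  assumes "\<And>x. bracket z x = 0"
  shows "z = (0::'g)"
proof -
  have "lie_ideal {z::'g. \<forall>x. bracket z x = 0}"
    unfolding lie_ideal_def
  proof (intro conjI allI ballI)
    show "cv.subspace {z::'g. \<forall>x. bracket z x = 0}"
      by (simp add: cv.subspace_def bracket_add_left bracket_scaleC_left)
    show "bracket w z \<in> {z::'g. \<forall>x. bracket z x = 0}" if "z \<in> {z::'g. \<forall>x. bracket z x = 0}" for w z
      using that bracket_anti[of w z] by simp
  qed
  moreover obtain x y :: 'g where "bracket x y \<noteq> 0" using simple by (auto simp: simple_lie_algebra_def)
  ultimately show ?thesis using simple_ideal[OF simple, of "{z. \<forall>x. bracket z x = 0}" x z] assms by blast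
qed

lemma rs_subspace: "cv.subspace (rs \<phi>)"
  by (auto simp: cv.subspace_def root_space_def bracket_add_right bracket_scaleC_right
      cv.scale_right_distrib mult.commute)

lemma rsD: "x \<in> rs \<phi> \<Longrightarrow> h \<in> t \<Longrightarrow> bracket h x = \<phi> h *\<^sub>C x"
  by (simp add: root_space_def)

lemma rs_bracket: "x \<in> rs \<phi> \<Longrightarrow> y \<in> rs \<psi> \<Longrightarrow> bracket x y \<in> rs (\<lambda>h. \<phi> h + \<psi> h)"
  by (auto simp: root_space_def bracket_derivation bracket_scaleC_left bracket_scaleC_right scaleC_add_left)

lemma rs_zero: "rs (\<lambda>h. 0) = t"
  using t_centralizer t_abelian by (auto simp: root_space_def)

lemma rs_bracket_opposite: "x \<in> rs \<phi> \<Longrightarrow> y \<in> rs (opposite \<phi>) \<Longrightarrow> bracket x y \<in> t"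
  using rs_bracket[of x \<phi> y "opposite \<phi>"] by (simp add: opposite_def rs_zero)

text \<open>Simultaneous diagonalization, one element at a time: a new element of \<open>t\<close>
  commutes with the old ones, hence stabilizes their joint eigenspaces and is diagonalizable
  there.\<close>

lemma joint_eigen_span:
  assumes "finite F" "F \<subseteq> t"
  shows "UNIV \<subseteq> cv.span {x. \<forall>h\<in>F. \<exists>c. bracket h x = c *\<^sub>C x}"
  using assms
proof (induction F)
  case (insert k F)
  let ?J = "\<lambda>F. {x. \<forall>h\<in>F. \<exists>c. bracket h x = c *\<^sub>C x}"
  have "?J F \<subseteq> cv.span (?J (insert k F))"
  proof
    fix x assume "x \<in> ?J F"
    then obtain c where c: "\<And>h. h \<in> F \<Longrightarrow> bracket h x = c h *\<^sub>C x" by simp metis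
    define W where "W = {y. \<forall>h\<in>F. bracket h y = c h *\<^sub>C y}"
    have W: "cv.subspace W"
      by (auto simp: W_def cv.subspace_def bracket_add_right bracket_scaleC_right cv.scale_right_distrib mult.commute)
    have "bracket k ` W \<subseteq> W"
      using insert.prems t_abelian by (auto simp: W_def bracket_derivation bracket_scaleC_right)
    then have "W \<subseteq> cv.span {w\<in>W. \<exists>c. bracket k w = c *\<^sub>C w}"
      using t_diag[of k] insert.prems
      by (intro eigen_span_subspace[OF cv.subspace_UNIV bracket_lin(1) W]) (auto simp: diag_on_def)
    moreover have "{w\<in>W. \<exists>c. bracket k w = c *\<^sub>C w} \<subseteq> ?J (insert k F)" by (auto simp: W_def)
    moreover have "x \<in> W" using c by (simp add: W_def)
    ultimately show "x \<in> cv.span (?J (insert k F))" using cv.span_mono[of "{w\<in>W. \<exists>c. bracket k w = c *\<^sub>C w}"] by blast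
  qed
  then have "cv.span (?J F) \<subseteq> cv.span (?J (insert k F))" by (intro cv.span_minimal cv.subspace_span)
  moreover have "UNIV \<subseteq> cv.span (?J F)" using insert by blast
  ultimately show ?case by (rule order_trans[rotated])
qed (simp add: cv.span_superset)

lemma dual_space_iff: "\<phi> \<in> dual_space t \<longleftrightarrow> lin_on t \<phi> \<and> (\<forall>x. x \<notin> t \<longrightarrow> \<phi> x = 0)"
  unfolding dual_space_def lin_on_def scaleC_complex_eq mem_Collect_eq by blast

lemma dual_space_lin: "\<phi> \<in> dual_space t \<Longrightarrow> lin_on t \<phi>"
  by (simp add: dual_space_iff)

lemma dual_space_ext:
  assumes "\<phi> \<in> dual_space t" "\<psi> \<in> dual_space t" "\<And>h. h \<in> t \<Longrightarrow> \<phi> h = \<psi> h"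
  shows "\<phi> = \<psi>"
proof
  fix h show "\<phi> h = \<psi> h" using assms by (cases "h \<in> t") (simp_all add: dual_space_iff)
qed

lemma dual_space_add: "\<phi> \<in> dual_space t \<Longrightarrow> \<psi> \<in> dual_space t \<Longrightarrow> (\<lambda>h. \<phi> h + \<psi> h) \<in> dual_space t"
  unfolding dual_space_iff lin_on_def by (simp add: algebra_simps)

lemma opposite_dual: "\<phi> \<in> dual_space t \<Longrightarrow> opposite \<phi> \<in> dual_space t"
  unfolding dual_space_iff lin_on_def opposite_def by simp

lemma dual_space_nonzero: "\<phi> \<in> dual_space t \<Longrightarrow> \<phi> \<noteq> (\<lambda>h. 0) \<Longrightarrow> \<exists>h\<in>t. \<phi> h \<noteq> 0"
  unfolding dual_space_iff by (metis (full_types))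

lemma opposite_opposite [simp]: "opposite (opposite \<phi>) = \<phi>"
  by (simp add: opposite_def)

lemma root_decomposition: "cv.span (\<Union>\<phi>\<in>dual_space t. rs \<phi>) = UNIV"
proof -
  obtain B where B: "is_basis B t" using basis_ex[OF fin_dim_subset[OF g_fin_dim subset_UNIV] t_subspace] .
  have sub: "{x. \<forall>h\<in>B. \<exists>c. bracket h x = c *\<^sub>C x} \<subseteq> (\<Union>\<phi>\<in>dual_space t. rs \<phi>)"
  proof
    fix x assume "x \<in> {x. \<forall>h\<in>B. \<exists>c. bracket h x = c *\<^sub>C x}"
    then obtain c where c: "\<And>h. h \<in> B \<Longrightarrow> bracket h x = c h *\<^sub>C x" by simp metis
    \<comment> \<open>The eigenvalues on a basis of \<open>t\<close> are extended linearly to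
      \<open>t\<close>, and by 0 elsewhere as \<open>dual_space\<close> prescribes.\<close>
    define \<phi> where "\<phi> h = (if h \<in> t then \<Sum>b\<in>B. coord B h b * c b else 0)" for h
    have "lin_on t \<phi>" unfolding lin_on_def \<phi>_def
      using coord_lin[OF B] cv.subspace_add[OF t_subspace] cv.subspace_scale[OF t_subspace]
      by (simp add: sum.distrib algebra_simps sum_distrib_left)
    then have "\<phi> \<in> dual_space t" by (simp add: dual_space_iff \<phi>_def)
    moreover have "x \<in> rs \<phi>" unfolding root_space_def
    proof clarify
      fix h assume h: "h \<in> t"
      have "bracket h x = bracket (\<Sum>b\<in>B. coord B h b *\<^sub>C b) x" by (simp only: coord_sum[OF B h])
      also have "\<dots> = (\<Sum>b\<in>B. coord B h b *\<^sub>C bracket b x)"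
        by (rule lin_on_sum_scale[OF bracket_lin(2) cv.subspace_UNIV UNIV_I])
      also have "\<dots> = \<phi> h *\<^sub>C x" using h c by (simp add: \<phi>_def cv.scale_sum_left)
      finally show "bracket h x = \<phi> h *\<^sub>C x" .
    qed
    ultimately show "x \<in> (\<Union>\<phi>\<in>dual_space t. rs \<phi>)" by blast
  qed
  show ?thesis
    using order_trans[OF joint_eigen_span[OF is_basisD(1)[OF B] is_basisD(4)[OF B]] cv.span_mono[OF sub]] by blast
qed

text \<open>The form in which the decomposition is used: properties that define a subspace may be
  checked on the root spaces, weight 0 included.\<close>

lemma root_spaces_into:
  assumes "lin_on UNIV T" "cv.subspace P" "\<And>\<phi> y. \<phi> \<in> dual_space t \<Longrightarrow> y \<in> rs \<phi> \<Longrightarrow> T y \<in> P"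
  shows "T z \<in> P"
  by (rule lin_on_span_into[OF assms(1) cv.subspace_UNIV subset_UNIV assms(2), of "\<Union>\<phi>\<in>dual_space t. rs \<phi>"])
    (use assms(3) root_decomposition in auto)

text \<open>On an eigenspace of \<open>z = [x, y]\<close> commuting with \<open>x, y\<close> the trace of \<open>z\<close> vanishes.\<close>

lemma heisenberg_trivial:
  assumes x: "x \<in> rs \<alpha>" and y: "y \<in> rs (opposite \<alpha>)" and "\<alpha> (bracket x y) = 0"
  shows "bracket x y = 0"
proof -
  define z where "z = bracket x y"
  have zt: "z \<in> t" unfolding z_def by (rule rs_bracket_opposite[OF x y])
  have zx: "bracket z x = 0" "bracket z y = 0"
    using rsD[OF x zt] rsD[OF y zt] assms(3) by (simp_all add: opposite_def z_def)
  have ev: "c = 0 \<or> u = 0" if u: "bracket z u = c *\<^sub>C u" for c u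
  proof (rule ccontr)
    assume nz: "\<not> ?thesis"
    define W where "W = {u. bracket z u = c *\<^sub>C u}"
    have W: "cv.subspace W"
      by (auto simp: W_def cv.subspace_def bracket_add_right bracket_scaleC_right cv.scale_right_distrib mult.commute)
    have st: "bracket x ` W \<subseteq> W" "bracket y ` W \<subseteq> W"
      using zx by (auto simp: W_def bracket_derivation bracket_scaleC_right)
    have fd: "fin_dim W" by (rule fin_dim_subset[OF g_fin_dim subset_UNIV])
    have lin: "lin_on W (bracket w)" for w by (rule lin_on_subset[OF bracket_lin(1) subset_UNIV])
    obtain B where B: "is_basis B W" using basis_ex[OF fd W] .
    have "trace_on W (bracket z) = trace_on W (\<lambda>u. bracket x (bracket y u) - bracket y (bracket x u))"
      by (rule arg_cong[where f="trace_on W"], rule ext) (simp add: z_def lie_moduleD(8)[OF adjoint_module])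
    also have "\<dots> = trace_on W (\<lambda>u. bracket x (bracket y u)) - trace_on W (\<lambda>u. bracket y (bracket x u))"
    proof (rule trace_on_diff[OF fd W])
      show "lin_on W (\<lambda>u. bracket x (bracket y u))" "lin_on W (\<lambda>u. bracket y (bracket x u))"
        by (rule lin_on_compose[OF lin lin st(2)], rule lin_on_compose[OF lin lin st(1)])
    qed (use st in blast)+
    also have "\<dots> = 0"
      using trace_on_mult_commute[OF fd W lin st(1) lin st(2)] by simp
    finally have "trace_on W (bracket z) = 0" .
    moreover have "trace_on W (bracket z) = (\<Sum>b\<in>B. c)"
      using is_basisD(4)[OF B] by (intro trace_on_diag[OF B lin]) (auto simp: W_def)
    ultimately have "card B = 0" using nz by simp
    then have "W = {0}" using is_basisD[OF B] by (auto simp: card_eq_0_iff)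
    then show False using nz u by (auto simp: W_def)
  qed
  \<comment> \<open>All eigenvalues of the diagonalizable operator \<open>bracket z\<close> are 0,
    so \<open>z\<close> is central and vanishes.\<close>
  have "{v. \<exists>c. bracket z v = c *\<^sub>C v} \<subseteq> {v. bracket z v = 0}" using ev by force
  moreover have "cv.subspace {v. bracket z v = 0}"
    by (auto simp: cv.subspace_def bracket_add_right bracket_scaleC_right)
  ultimately have "cv.span {v. \<exists>c. bracket z v = c *\<^sub>C v} \<subseteq> {v. bracket z v = 0}"
    by (rule cv.span_minimal)
  then have "UNIV \<subseteq> {v. bracket z v = 0}"
    using t_diag[OF zt] unfolding diag_on_def by simp
  then show ?thesis using center_trivial[of z] by (auto simp: z_def)
qed

text \<open>\<open>t\<close> meets the span of the root spaces of nonzero weight only in 0. In the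
  proof the negative of the sum enters as a term of weight 0, with index \<open>None\<close>, and
  \<open>eigen_component\<close> is applied to the zero subspace.\<close>

lemma sum_nonzero_weights:
  assumes "finite S" "\<And>a. a \<in> S \<Longrightarrow> \<exists>\<phi>\<in>dual_space t. \<phi> \<noteq> (\<lambda>h. 0) \<and> a \<in> rs \<phi>" "(\<Sum>a\<in>S. r a *\<^sub>C a) \<in> t"
  shows "(\<Sum>a\<in>S. r a *\<^sub>C a) = 0"
proof -
  obtain wt where wt: "\<And>a. a \<in> S \<Longrightarrow> wt a \<in> dual_space t \<and> wt a \<noteq> (\<lambda>h. 0) \<and> a \<in> rs (wt a)"
    using assms(2) by metis
  define u where "u j = (case j of None \<Rightarrow> - (\<Sum>a\<in>S. r a *\<^sub>C a) | Some a \<Rightarrow> r a *\<^sub>C a)" for j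
  define \<psi> where "\<psi> j = (case j of None \<Rightarrow> (\<lambda>h. 0) | Some a \<Rightarrow> wt a)" for j
  have "u None \<in> {0}"
  proof (rule eigen_component[where J="Some ` S" and V=UNIV and H=t and T=bracket and \<psi>=\<psi>])
    show "bracket h (u j) = \<psi> j h *\<^sub>C u j" if "h \<in> t" "j \<in> insert None (Some ` S)" for h j
    proof -
      have "bracket h a = wt a h *\<^sub>C a" if "a \<in> S" for a using rsD[of a "wt a"] wt that \<open>h \<in> t\<close> by blast
      then show ?thesis using that t_abelian[OF that(1) assms(3)]
        by (auto simp: u_def \<psi>_def bracket_scaleC_right mult.commute)
    qed
    show "\<exists>h\<in>t. \<psi> j h \<noteq> \<psi> None h" if "j \<in> Some ` S" for j
      using that wt dual_space_nonzero by (auto simp: \<psi>_def)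
    show "u None + (\<Sum>j\<in>Some ` S. u j) \<in> {0}"
      by (simp add: u_def sum.reindex)
  qed (use assms(1) bracket_lin in auto)
  then show ?thesis by (simp add: u_def)
qed

lemma sl2_from_pair:
  assumes "x \<in> rs \<alpha>" "y \<in> rs (opposite \<alpha>)" "\<alpha> \<in> dual_space t" "bracket x y \<noteq> 0"
  obtains c where "c \<noteq> 0" "sl2_triple x (c *\<^sub>C y) (bracket x (c *\<^sub>C y))" "\<alpha> (bracket x (c *\<^sub>C y)) = 2"
    "bracket x (c *\<^sub>C y) \<in> t"
proof -
  have z: "\<alpha> (bracket x y) \<noteq> 0" using heisenberg_trivial[OF assms(1,2)] assms(4) by blast
  have zt: "bracket x y \<in> t" by (rule rs_bracket_opposite[OF assms(1,2)])
  define c where "c = 2 / \<alpha> (bracket x y)"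
  have c: "c \<noteq> 0" using z by (simp add: c_def)
  have ht: "bracket x (c *\<^sub>C y) \<in> t"
    using zt cv.subspace_scale[OF t_subspace] by (simp add: bracket_scaleC_right)
  have ah: "\<alpha> (bracket x (c *\<^sub>C y)) = 2"
    using lin_onD(2)[OF dual_space_lin[OF assms(3)] zt, of c] z by (simp add: bracket_scaleC_right c_def)
  have "sl2_triple x (c *\<^sub>C y) (bracket x (c *\<^sub>C y))"
    using rsD[OF assms(1) ht] rsD[OF assms(2) ht] ah c assms(4)
    by (simp add: sl2_triple_def opposite_def bracket_scaleC_right mult.commute)
  then show ?thesis using that c ah ht by blast
qed

text \<open>If opposite root spaces always commuted, all brackets would lie in the span
  \<open>P\<close> of the root spaces of nonzero weight. As brackets span the algebra, this would
  force \<open>t = 0\<close>; then every element centralizes \<open>t\<close>, so the algebra would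
  be 0.\<close>

lemma exists_sl2: "\<exists>e f h. sl2_triple e f h \<and> h \<in> t"
proof -
  have "\<exists>\<alpha>\<in>dual_space t. \<exists>x\<in>rs \<alpha>. \<exists>y\<in>rs (opposite \<alpha>). bracket x y \<noteq> 0"
  proof (rule ccontr)
    assume no: "\<not> ?thesis"
    define P where "P = cv.span (\<Union>\<phi>\<in>dual_space t - {\<lambda>h. 0}. rs \<phi>)"
    have sP: "cv.subspace P" by (simp add: P_def)
    have *: "bracket x y \<in> P" if x: "x \<in> (\<Union>\<phi>\<in>dual_space t. rs \<phi>)" and y: "y \<in> (\<Union>\<phi>\<in>dual_space t. rs \<phi>)" for x y
    proof -
      obtain \<phi> \<psi> where p: "\<phi> \<in> dual_space t" "\<psi> \<in> dual_space t" "x \<in> rs \<phi>" "y \<in> rs \<psi>"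
        using x y by blast
      have s: "(\<lambda>h. \<phi> h + \<psi> h) \<in> dual_space t" using p(1,2) by (rule dual_space_add)
      show ?thesis
      proof (cases "(\<lambda>h. \<phi> h + \<psi> h) = (\<lambda>h. 0)")
        case True
        then have "\<psi> = opposite \<phi>" by (auto simp: opposite_def fun_eq_iff add_eq_0_iff)
        then have "bracket x y = 0" using no p by blast
        then show ?thesis using cv.subspace_0[OF sP] by simp
      next
        case False
        then show ?thesis unfolding P_def using s rs_bracket[OF p(3,4)] by (intro cv.span_base) blast
      qed
    qed
    have "bracket x y \<in> P" for x y
    proof -
      have "bracket x y \<in> P" if "x \<in> (\<Union>\<phi>\<in>dual_space t. rs \<phi>)" for x y
        by (rule root_spaces_into[OF bracket_lin(1) sP]) (use *[OF that] in blast)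
      then show ?thesis
        using root_spaces_into[of "\<lambda>x. bracket x y" P x, OF bracket_lin(2) sP] by blast
    qed
    then have "UNIV \<subseteq> P" using simple_perfect[OF simple] cv.span_minimal[OF _ sP, of "{bracket x y |x y. True}"] by blast
    have t0: "z = 0" if "z \<in> t" for z
    proof -
      have "z \<in> P" using \<open>UNIV \<subseteq> P\<close> by auto
      then obtain S r where S: "finite S" "S \<subseteq> (\<Union>\<phi>\<in>dual_space t - {\<lambda>h. 0}. rs \<phi>)" "(\<Sum>a\<in>S. r a *\<^sub>C a) = z"
        unfolding P_def by (auto simp: cv.span_explicit)
      then show ?thesis using sum_nonzero_weights[OF S(1), of r] that by blast
    qed
    have "x \<in> t" for x by (rule t_centralizer) (metis t0 bracket_zero(2))
    then have "(x::'g) = 0" for x using t0 by blast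
    then show False using simple unfolding simple_lie_algebra_def by metis
  qed
  then show ?thesis using sl2_from_pair by metis
qed

section \<open>The Killing form and one-dimensionality of root spaces\<close>

definition killing :: "'g \<Rightarrow> 'g \<Rightarrow> complex" where
  "killing = trace_form UNIV bracket"

lemma killing_lin: "lin_on UNIV (killing x)" "lin_on UNIV (\<lambda>x. killing x y)"
  unfolding killing_def
  by (rule trace_form_lin_right[OF adjoint_module g_fin_dim] trace_form_lin_left[OF adjoint_module g_fin_dim])+

lemma killing_invariant: "killing (bracket x y) z = killing x (bracket y z)"
  unfolding killing_def by (rule trace_form_invariant[OF adjoint_module g_fin_dim])

lemma killing_nondegenerate:
  assumes "\<And>z. killing x z = 0"
  shows "x = 0"
proof -
  obtain e f h where s: "sl2_triple e f h" "h \<in> t" using exists_sl2 by blast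
  obtain y u :: 'g where "bracket y u \<noteq> 0" using simple by (auto simp: simple_lie_algebra_def)
  then show ?thesis
    using trace_form_nondegenerate[OF adjoint_module g_fin_dim simple s(1) t_diag[OF s(2)] UNIV_I] assms
    by (simp add: killing_def)
qed

lemma killing_orthogonal:
  assumes "x \<in> rs \<phi>" "y \<in> rs \<psi>" "h \<in> t" "\<phi> h + \<psi> h \<noteq> 0"
  shows "killing x y = 0"
proof -
  have "\<psi> h * killing x y = killing x (bracket h y)"
    using rsD[OF assms(2,3)] lin_onD(2)[OF killing_lin(1)] by simp
  also have "\<dots> = killing (bracket x h) y" by (simp add: killing_invariant)
  also have "bracket x h = (- \<phi> h) *\<^sub>C x" using rsD[OF assms(1,3)] bracket_anti[of x h] by simp
  also have "killing \<dots> y = - \<phi> h * killing x y"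
    using lin_onD(2)[OF killing_lin(2)[of y], of x "- \<phi> h"] by (simp del: cv.scale_minus_left)
  finally have "(\<phi> h + \<psi> h) * killing x y = 0" by (simp add: algebra_simps)
  then show ?thesis using assms(4) by simp
qed

lemma span_vanish:
  assumes "lin_on UNIV T" "\<And>\<phi> y. \<phi> \<in> dual_space t \<Longrightarrow> y \<in> rs \<phi> \<Longrightarrow> T y = (0::'b::complex_vector)"
  shows "T z = 0"
  using root_spaces_into[OF assms(1) cv.subspace_single_0] assms(2) by blast

text \<open>Nondegeneracy gives a root vector not orthogonal to \<open>x\<close>, and orthogonality
  of weight spaces forces its weight to be opposite. The bracket is nonzero because its pairing with
  \<open>h\<close> is \<open>\<alpha> h * killing x y\<close> by invariance.\<close>

lemma root_pairing:
  assumes "\<alpha> \<in> roots t" "x \<in> rs \<alpha>" "x \<noteq> 0"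
  obtains y where "y \<in> rs (opposite \<alpha>)" "killing x y \<noteq> 0" "bracket x y \<noteq> 0"
proof -
  have a: "\<alpha> \<in> dual_space t" "\<alpha> \<noteq> (\<lambda>h. 0)" using assms(1) by (auto simp: roots_def)
  then obtain h where h: "h \<in> t" "\<alpha> h \<noteq> 0" using dual_space_nonzero by blast
  obtain \<psi> y where y: "\<psi> \<in> dual_space t" "y \<in> rs \<psi>" "killing x y \<noteq> 0"
    using killing_nondegenerate[of x] span_vanish[OF killing_lin(1)[of x]] assms(3) by blast
  have "\<psi> k = opposite \<alpha> k" if "k \<in> t" for k
    using killing_orthogonal[OF assms(2) y(2) that] y(3)
    by (auto simp: opposite_def add_eq_0_iff)
  then have "\<psi> = opposite \<alpha>" using dual_space_ext[OF y(1) opposite_dual[OF a(1)]] by blast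
  then have yo: "y \<in> rs (opposite \<alpha>)" using y(2) by simp
  have "killing (bracket x y) h = killing x (bracket y h)" by (rule killing_invariant)
  also have "bracket y h = \<alpha> h *\<^sub>C y" using rsD[OF yo h(1)] bracket_anti[of y h] by (simp add: opposite_def)
  also have "killing x \<dots> \<noteq> 0" using lin_onD(2)[OF killing_lin(1)] y(3) h(2) by simp
  finally have "bracket x y \<noteq> 0" using lin_on_zero[OF killing_lin(2)] by auto
  then show ?thesis using that yo y(3) by blast
qed

lemma roots_opposite: "\<alpha> \<in> roots t \<Longrightarrow> opposite \<alpha> \<in> roots t"
proof -
  assume a: "\<alpha> \<in> roots t"
  then obtain x where x: "x \<in> rs \<alpha>" "x \<noteq> 0"
    using cv.subspace_0[OF rs_subspace[of \<alpha>]] by (auto simp: roots_def)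
  from root_pairing[OF a x] obtain y where "y \<in> rs (opposite \<alpha>)" "bracket x y \<noteq> 0" by blast
  then show ?thesis using a opposite_dual by (auto simp: roots_def opposite_def fun_eq_iff)
qed

text \<open>After subtracting a multiple of \<open>x\<close>, the vector \<open>x'\<close> becomes
  orthogonal to \<open>f\<close> and then commutes with \<open>f\<close>. If nonzero it would be a
  lowest vector for the triple with \<open>h\<close>-eigenvalue 2, but lowest vectors have
  eigenvalues at most 0.\<close>

lemma root_space_line:
  assumes "\<alpha> \<in> roots t" "x \<in> rs \<alpha>" "x \<noteq> 0" "x' \<in> rs \<alpha>"
  shows "\<exists>c. x' = c *\<^sub>C x"
proof -
  have a: "\<alpha> \<in> dual_space t" using assms(1) by (auto simp: roots_def)
  obtain y where y: "y \<in> rs (opposite \<alpha>)" "killing x y \<noteq> 0" "bracket x y \<noteq> 0"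
    using root_pairing[OF assms(1-3)] .
  obtain c where c: "c \<noteq> 0" "sl2_triple x (c *\<^sub>C y) (bracket x (c *\<^sub>C y))" "\<alpha> (bracket x (c *\<^sub>C y)) = 2"
    "bracket x (c *\<^sub>C y) \<in> t" using sl2_from_pair[OF assms(2) y(1) a y(3)] .
  define f where "f = c *\<^sub>C y"
  have f: "f \<in> rs (opposite \<alpha>)" using y(1) cv.subspace_scale[OF rs_subspace] by (simp add: f_def)
  have kf: "killing x f \<noteq> 0" using y(2) c(1) lin_onD(2)[OF killing_lin(1)] by (simp add: f_def)
  define d where "d = killing x' f / killing x f"
  define w where "w = x' - d *\<^sub>C x"
  have w: "w \<in> rs \<alpha>" using assms(2,4) rs_subspace by (auto simp: w_def intro!: cv.subspace_diff cv.subspace_scale)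
  have kw: "killing w f = 0"
    unfolding w_def using lin_on_diff[OF killing_lin(2) cv.subspace_UNIV] lin_onD(2)[OF killing_lin(2)] kf by (simp add: d_def)
  \<comment> \<open>The bracket lies in \<open>t\<close>, hence is orthogonal to all nonzero
    weights; its pairing with \<open>t\<close> is a multiple of \<open>killing w f\<close>.\<close>
  have "bracket w f = 0"
  proof (rule killing_nondegenerate)
    fix z
    show "killing (bracket w f) z = 0"
    proof (rule span_vanish[OF killing_lin(1)])
      fix \<phi> z assume z: "\<phi> \<in> dual_space t" "z \<in> rs \<phi>"
      show "killing (bracket w f) z = 0"
      proof (cases "\<phi> = (\<lambda>h. 0)")
        case True
        then have zt: "z \<in> t" using z rs_zero by simp
        have "killing (bracket w f) z = killing w (bracket f z)" by (rule killing_invariant)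
        also have "bracket f z = \<alpha> z *\<^sub>C f" using rsD[OF f zt] bracket_anti[of f z] by (simp add: opposite_def)
        finally show ?thesis using kw lin_onD(2)[OF killing_lin(1)] by simp
      next
        case False
        then obtain h where h: "h \<in> t" "\<phi> h \<noteq> 0" using z(1) dual_space_nonzero by blast
        have "bracket w f \<in> rs (\<lambda>h. 0)" using rs_bracket_opposite[OF w f] rs_zero by simp
        then show ?thesis using killing_orthogonal[OF _ z(2) h(1)] h(2) by auto
      qed
    qed
  qed
  then have fw: "bracket f w = 0" using bracket_anti[of f w] by simp
  have "w = 0"
  proof (rule ccontr)
    assume "w \<noteq> 0"
    moreover have "bracket (bracket x f) w = 2 *\<^sub>C w" using rsD[OF w c(4)] c(3) by (simp add: f_def)
    ultimately obtain n where "- (2::complex) = of_nat n"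
      using sl2_lowest[OF adjoint_module g_fin_dim c(2) UNIV_I, of w 2] fw by (auto simp: f_def)
    then have "Re (- (2::complex)) = Re (of_nat n)" by metis
    then show False by simp
  qed
  then show ?thesis by (auto simp: w_def)
qed

text \<open>It gives content to the condition on fundamental weights, which quantifies over coroots;
  evaluation at coroots recovers the coordinates of a weight in
  \<open>weight_fun_inj\<close>.\<close>

lemma coroot_exists:
  assumes "\<alpha> \<in> roots t"
  shows "\<exists>h\<in>t. is_coroot t \<alpha> h"
proof -
  have a: "\<alpha> \<in> dual_space t" using assms(1) by (auto simp: roots_def)
  obtain x where x: "x \<in> rs \<alpha>" "x \<noteq> 0"
    using assms cv.subspace_0[OF rs_subspace[of \<alpha>]] by (auto simp: roots_def)
  obtain y where y: "y \<in> rs (opposite \<alpha>)" "bracket x y \<noteq> 0" using root_pairing[OF assms x] by metis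
  obtain c where c: "\<alpha> (bracket x (c *\<^sub>C y)) = 2" "bracket x (c *\<^sub>C y) \<in> t"
    using sl2_from_pair[OF x(1) y(1) a y(2)] by metis
  have "c *\<^sub>C y \<in> rs (opposite \<alpha>)" using y(1) cv.subspace_scale[OF rs_subspace] by simp
  then have "is_coroot t \<alpha> (bracket x (c *\<^sub>C y))"
    unfolding is_coroot_def using x(1) c(1) by (auto intro!: cv.span_base)
  then show ?thesis using c(2) by blast
qed

end

section \<open>Positive roots and the triangular decomposition\<close>

locale root_data =
  fixes D :: "('g::complex_lie_algebra, 'v) lie_setup"
  assumes simple: "simple_lie_algebra TYPE('g)" and root_setup: "root_setup D"
begin

lemma root_setup_parts:
  "cartan_subalgebra (cartan D)" "root_base (cartan D) (rank D) (simple_root D)"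
  "fundamental_weights (cartan D) (rank D) (simple_root D) (fund_weight D)"
  "bij_betw (pos_root D) {..<num_pos D} (positive_roots (cartan D) (rank D) (simple_root D))"
  "\<And>\<alpha>. \<alpha> \<in> roots (cartan D) \<Longrightarrow> root_vector D \<alpha> \<in> root_space (cartan D) \<alpha> \<and> root_vector D \<alpha> \<noteq> 0"
  using root_setup unfolding root_setup_def by blast+

sublocale simple_cartan "cartan D"
  by unfold_locales (rule simple root_setup_parts)+

abbreviation "ee i \<equiv> root_vector D (pos_root D i)"
abbreviation "ff i \<equiv> root_vector D (opposite (pos_root D i))"

lemma simple_roots_independent:
  "(\<And>h. h \<in> cartan D \<Longrightarrow> (\<Sum>i<rank D. a i * simple_root D i h) = 0) \<Longrightarrow> i < rank D \<Longrightarrow> a i = 0"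
  using root_setup_parts(2) unfolding root_base_def by blast

lemma pos_root_positive: "i < num_pos D \<Longrightarrow> pos_root D i \<in> positive_roots (cartan D) (rank D) (simple_root D)"
  using root_setup_parts(4) by (auto simp: bij_betw_def)

lemma positive_root_index:
  "\<alpha> \<in> positive_roots (cartan D) (rank D) (simple_root D) \<Longrightarrow> \<exists>i<num_pos D. \<alpha> = pos_root D i"
  using root_setup_parts(4) unfolding bij_betw_def by blast

lemma pos_root_root: "i < num_pos D \<Longrightarrow> pos_root D i \<in> roots (cartan D)"
  using pos_root_positive by (simp add: positive_roots_def)

lemma root_dual: "\<alpha> \<in> roots (cartan D) \<Longrightarrow> \<alpha> \<in> dual_space (cartan D)"
  and root_nonzero: "\<alpha> \<in> roots (cartan D) \<Longrightarrow> \<exists>h\<in>cartan D. \<alpha> h \<noteq> 0"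
  using dual_space_nonzero unfolding roots_def by blast+

lemma ee_mem: "i < num_pos D \<Longrightarrow> ee i \<in> rs (pos_root D i)"
  and ff_mem: "i < num_pos D \<Longrightarrow> ff i \<in> rs (opposite (pos_root D i))"
  using root_setup_parts(5)[OF pos_root_root] root_setup_parts(5)[OF roots_opposite[OF pos_root_root]] by blast+

lemma positive_root_space:
  assumes "\<alpha> \<in> positive_roots (cartan D) (rank D) (simple_root D)"
  shows "rs \<alpha> \<subseteq> cv.span (ee ` {..<num_pos D})" "rs (opposite \<alpha>) \<subseteq> cv.span (ff ` {..<num_pos D})"
proof -
  obtain i where i: "i < num_pos D" "\<alpha> = pos_root D i" using positive_root_index[OF assms] by blast
  have r: "\<alpha> \<in> roots (cartan D)" using pos_root_root i by blast
  have "\<exists>c. x = c *\<^sub>C ee i" if "x \<in> rs \<alpha>" for x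
    using root_space_line[OF r _ _ that, of "ee i"] root_setup_parts(5)[OF r] i(2) by blast
  then show "rs \<alpha> \<subseteq> cv.span (ee ` {..<num_pos D})"
    using i(1) by (metis cv.span_base cv.span_scale imageI lessThan_iff subsetI)
  have "\<exists>c. x = c *\<^sub>C ff i" if "x \<in> rs (opposite \<alpha>)" for x
    using root_space_line[OF roots_opposite[OF r] _ _ that, of "ff i"] root_setup_parts(5)[OF roots_opposite[OF r]] i(2)
    by blast
  then show "rs (opposite \<alpha>) \<subseteq> cv.span (ff ` {..<num_pos D})"
    using i(1) by (metis cv.span_base cv.span_scale imageI lessThan_iff subsetI)
qed

lemma triangular_decomposition:
  "cv.span (cartan D \<union> ee ` {..<num_pos D} \<union> ff ` {..<num_pos D}) = UNIV"
proof -
  let ?P = "cv.span (cartan D \<union> ee ` {..<num_pos D} \<union> ff ` {..<num_pos D})"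
  have "z \<in> ?P" for z
  proof (rule root_spaces_into[of "\<lambda>x. x"])
    fix \<phi> y assume \<phi>: "\<phi> \<in> dual_space (cartan D)" and y: "y \<in> rs \<phi>"
    show "y \<in> ?P"
    proof (cases "\<phi> = (\<lambda>h. 0) \<or> y = 0")
      case True
      then show ?thesis using y rs_zero cv.span_zero by (auto intro: cv.span_base)
    next
      case False
      then have r: "\<phi> \<in> roots (cartan D)" using \<phi> y by (auto simp: roots_def)
      then obtain c :: "nat \<Rightarrow> nat" where "\<phi> = (\<lambda>h. \<Sum>i<rank D. of_nat (c i) * simple_root D i h) \<or>
          \<phi> = opposite (\<lambda>h. \<Sum>i<rank D. of_nat (c i) * simple_root D i h)"
        using root_setup_parts(2) unfolding root_base_def by blast
      then show ?thesis
      proof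
        assume "\<phi> = (\<lambda>h. \<Sum>i<rank D. of_nat (c i) * simple_root D i h)"
        then have "\<phi> \<in> positive_roots (cartan D) (rank D) (simple_root D)"
          unfolding positive_roots_def using r by blast
        then have "y \<in> cv.span (ee ` {..<num_pos D})" using positive_root_space(1) y by blast
        then show ?thesis by (rule subsetD[OF cv.span_mono, rotated]) blast
      next
        assume o: "\<phi> = opposite (\<lambda>h. \<Sum>i<rank D. of_nat (c i) * simple_root D i h)"
        then have "opposite \<phi> \<in> positive_roots (cartan D) (rank D) (simple_root D)"
          unfolding positive_roots_def using roots_opposite[OF r] by auto
        then have "y \<in> cv.span (ff ` {..<num_pos D})" using positive_root_space(2)[of "opposite \<phi>"] y by auto
        then show ?thesis by (rule subsetD[OF cv.span_mono, rotated]) blast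
      qed
    qed
  qed (auto simp: lin_on_def)
  then show ?thesis by blast
qed

lemma pos_root_coeffs:
  obtains c :: "nat \<Rightarrow> nat \<Rightarrow> nat"
  where "\<And>i. i < num_pos D \<Longrightarrow> pos_root D i = (\<lambda>h. \<Sum>j<rank D. of_nat (c i j) * simple_root D j h)"
proof -
  have "\<forall>i. \<exists>c::nat \<Rightarrow> nat. i < num_pos D \<longrightarrow> pos_root D i = (\<lambda>h. \<Sum>j<rank D. of_nat (c j) * simple_root D j h)"
    using pos_root_positive unfolding positive_roots_def by blast
  then obtain c :: "nat \<Rightarrow> nat \<Rightarrow> nat" where "\<forall>i. i < num_pos D \<longrightarrow> pos_root D i = (\<lambda>h. \<Sum>j<rank D. of_nat (c i j) * simple_root D j h)"
    by (rule choice[THEN exE])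
  then show ?thesis using that by blast
qed

text \<open>Positive roots have nonnegative coordinates, not all zero, in the independent simple
  roots, so nothing can cancel. Later this separates the highest weight from the weights of all
  nontrivial monomials.\<close>

lemma pos_root_sum_zero:
  fixes p :: "nat \<Rightarrow> nat"
  assumes "\<And>h. h \<in> cartan D \<Longrightarrow> (\<Sum>i<num_pos D. of_nat (p i) * pos_root D i h) = 0" and k: "k < num_pos D"
  shows "p k = 0"
proof -
  obtain c :: "nat \<Rightarrow> nat \<Rightarrow> nat"
    where c: "\<And>i. i < num_pos D \<Longrightarrow> pos_root D i = (\<lambda>h. \<Sum>j<rank D. of_nat (c i j) * simple_root D j h)"
    using pos_root_coeffs by blast
  have z: "(\<Sum>i<num_pos D. p i * c i j) = 0" if j: "j < rank D" for j
  proof -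
    have "(\<Sum>j<rank D. of_nat (\<Sum>i<num_pos D. p i * c i j) * simple_root D j h) = 0" if h: "h \<in> cartan D" for h
    proof -
      have "(\<Sum>i<num_pos D. of_nat (p i) * pos_root D i h) =
          (\<Sum>i<num_pos D. \<Sum>j<rank D. of_nat (p i * c i j) * simple_root D j h)"
        using c by (intro sum.cong) (auto simp: sum_distrib_left mult.assoc)
      also have "\<dots> = (\<Sum>j<rank D. of_nat (\<Sum>i<num_pos D. p i * c i j) * simple_root D j h)"
        by (subst sum.swap) (simp add: sum_distrib_right)
      finally show ?thesis using assms(1)[OF h] by simp
    qed
    then have "of_nat (\<Sum>i<num_pos D. p i * c i j) = (0::complex)"
      using simple_roots_independent[of "\<lambda>j. of_nat (\<Sum>i<num_pos D. p i * c i j)"] j by blast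
    then show ?thesis by (simp only: of_nat_eq_0_iff)
  qed
  show ?thesis
  proof (rule ccontr)
    assume pk: "p k \<noteq> 0"
    have "c k j = 0" if "j < rank D" for j
    proof -
      have "\<forall>a\<in>{..<num_pos D}. p a * c a j = 0" using z[OF that] by (simp add: sum_eq_0_iff)
      then have "p k * c k j = 0" using k by (intro bspec[of "{..<num_pos D}" "\<lambda>a. p a * c a j = 0" k]) simp_all
      then show ?thesis using pk by simp
    qed
    then have "pos_root D k h = 0" for h using c[OF k] by simp
    then show False using root_nonzero[OF pos_root_root[OF k]] by blast
  qed
qed

text \<open>A sum of two positive roots is not zero; so if the bracket is nonzero, minus that sum is
  a root, and nonnegative coordinates make the sum a positive root.\<close>

lemma ff_bracket:
  assumes "i < num_pos D" "j < num_pos D"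
  shows "bracket (ff i) (ff j) \<in> cv.span (ff ` {..<num_pos D})"
proof (cases "bracket (ff i) (ff j) = 0")
  case False
  obtain c :: "nat \<Rightarrow> nat \<Rightarrow> nat"
    where c: "\<And>i. i < num_pos D \<Longrightarrow> pos_root D i = (\<lambda>h. \<Sum>j<rank D. of_nat (c i j) * simple_root D j h)"
    using pos_root_coeffs by blast
  define \<gamma> where "\<gamma> = (\<lambda>h. pos_root D i h + pos_root D j h)"
  have \<gamma>d: "\<gamma> \<in> dual_space (cartan D)"
    unfolding \<gamma>_def using assms by (intro dual_space_add root_dual pos_root_root)
  have mem: "bracket (ff i) (ff j) \<in> rs (opposite \<gamma>)"
    using rs_bracket[OF ff_mem[OF assms(1)] ff_mem[OF assms(2)]] by (simp add: \<gamma>_def opposite_def)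
  have nz: "opposite \<gamma> \<noteq> (\<lambda>h. 0)"
  proof
    assume "opposite \<gamma> = (\<lambda>h. 0)"
    then have "\<gamma> h = 0" for h by (simp add: opposite_def fun_eq_iff)
    moreover have "(\<Sum>k<num_pos D. of_nat ((if k = i then 1 else 0) + (if k = j then 1 else 0)) * pos_root D k h) = \<gamma> h" for h
    proof -
      have "of_nat ((if k = i then 1 else 0) + (if k = j then 1 else 0)) * pos_root D k h =
          (if k = i then pos_root D k h else 0) + (if k = j then pos_root D k h else 0)" for k by auto
      then show ?thesis using assms by (simp add: \<gamma>_def sum.distrib)
    qed
    ultimately have "(if i = i then 1 else 0) + (if i = j then 1 else 0) = (0::nat)"
      by (intro pos_root_sum_zero[OF _ assms(1)]) simp
    then show False by simp
  qed
  have "opposite \<gamma> \<in> roots (cartan D)"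
    using opposite_dual[OF \<gamma>d] nz mem False by (auto simp: roots_def)
  then have "\<gamma> \<in> roots (cartan D)" using roots_opposite by force
  moreover have "\<gamma> = (\<lambda>h. \<Sum>l<rank D. of_nat (c i l + c j l) * simple_root D l h)"
    using c assms by (simp add: \<gamma>_def sum.distrib algebra_simps)
  ultimately have "\<gamma> \<in> positive_roots (cartan D) (rank D) (simple_root D)"
    unfolding positive_roots_def by (intro CollectI conjI exI[of _ "\<lambda>l. c i l + c j l"])
  then show ?thesis using positive_root_space(2) mem by blast
qed (simp add: cv.span_zero)

lemma weight_fun_inj:
  assumes "k \<in> dominant_weights D" "k' \<in> dominant_weights D"
    "\<And>h. h \<in> cartan D \<Longrightarrow> weight_fun D k h = weight_fun D k' h"
  shows "k = k'"
proof (rule poly_mapping_eqI)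
  fix i
  show "Poly_Mapping.lookup k i = Poly_Mapping.lookup k' i"
  proof (cases "i < rank D")
    case True
    then have "simple_root D i \<in> roots (cartan D)" using root_setup_parts(2) by (auto simp: root_base_def)
    then obtain h where h: "h \<in> cartan D" "is_coroot (cartan D) (simple_root D i) h" using coroot_exists by blast
    have "weight_fun D l h = of_nat (Poly_Mapping.lookup l i)" for l
    proof -
      have "weight_fun D l h = (\<Sum>j<rank D. if j = i then of_nat (Poly_Mapping.lookup l j) else 0)"
        unfolding weight_fun_def using root_setup_parts(3) True h(2)
        by (intro sum.cong) (auto simp: fundamental_weights_def)
      then show ?thesis using True by simp
    qed
    then show ?thesis using assms(3)[OF h(1)] by simp
  next
    case False
    then have "i \<notin> Poly_Mapping.keys k" "i \<notin> Poly_Mapping.keys k'"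
      using assms(1,2) by (auto simp: dominant_weights_def tuples_def)
    then show ?thesis by (simp add: in_keys_iff)
  qed
qed

lemma ff_weight: "i < num_pos D \<Longrightarrow> h \<in> cartan D \<Longrightarrow> bracket h (ff i) = (- pos_root D i h) *\<^sub>C ff i"
  using rsD[OF ff_mem] by (simp add: opposite_def)

end

section \<open>Highest weight modules\<close>

context root_data
begin

text \<open>Neither generation by \<open>w\<close> nor irreducibility is required, so that the
  notion also covers the dual of a space of polynomials.\<close>

definition hw_module :: "'w::complex_vector set \<Rightarrow> ('g \<Rightarrow> 'w \<Rightarrow> 'w) \<Rightarrow> 'w \<Rightarrow> ('g \<Rightarrow> complex) \<Rightarrow> bool" where
  "hw_module V \<rho> w \<mu> \<longleftrightarrow> lie_module V \<rho> \<and> fin_dim V \<and> w \<in> V \<and> w \<noteq> 0 \<and>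
     (\<forall>i<num_pos D. \<rho> (ee i) w = 0) \<and> (\<forall>h\<in>cartan D. \<rho> h w = \<mu> h *\<^sub>C w)"

definition fpow :: "('g \<Rightarrow> 'w \<Rightarrow> 'w) \<Rightarrow> exponent \<Rightarrow> 'w \<Rightarrow> 'w::complex_vector" where
  "fpow \<rho> p w = foldr (\<lambda>i w. (1 / fact (Poly_Mapping.lookup p i)) *\<^sub>C (\<rho> (ff i) ^^ Poly_Mapping.lookup p i) w)
     [0..<num_pos D] w"

text \<open>Only ordered monomials are taken; that they span a submodule is
  \<open>hwspan_stable\<close>.\<close>

definition hwspan :: "('g \<Rightarrow> 'w \<Rightarrow> 'w) \<Rightarrow> 'w \<Rightarrow> 'w::complex_vector set" where
  "hwspan \<rho> w = cv.span ((\<lambda>p. fpow \<rho> p w) ` tuples (num_pos D))"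

lemma fpow_zero [simp]: "fpow \<rho> 0 w = w"
proof -
  have "foldr (\<lambda>i w. (1 / fact (Poly_Mapping.lookup 0 i)) *\<^sub>C (\<rho> (ff i) ^^ Poly_Mapping.lookup 0 i) w) xs w = w" for xs
    by (induction xs) auto
  then show ?thesis unfolding fpow_def by blast
qed

lemma fpow_mem:
  assumes "cv.subspace W" "\<And>x u. u \<in> W \<Longrightarrow> \<rho> x u \<in> W" "w \<in> W"
  shows "fpow \<rho> p w \<in> W"
proof -
  have pw: "u \<in> W \<Longrightarrow> (\<rho> x ^^ k) u \<in> W" for x k u by (induction k) (use assms in auto)
  have "foldr (\<lambda>i w. (1 / fact (Poly_Mapping.lookup p i)) *\<^sub>C (\<rho> (ff i) ^^ Poly_Mapping.lookup p i) w) xs w \<in> W" for xs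
    by (induction xs) (use assms(3) pw cv.subspace_scale[OF assms(1)] in auto)
  then show ?thesis unfolding fpow_def by blast
qed

lemma hwspan_least:
  assumes "cv.subspace W" "\<And>x u. u \<in> W \<Longrightarrow> \<rho> x u \<in> W" "w \<in> W"
  shows "hwspan \<rho> w \<subseteq> W"
  unfolding hwspan_def using fpow_mem[of W \<rho> w] assms by (intro cv.span_minimal) auto

lemma hwspan_base: "w \<in> hwspan \<rho> w"
proof -
  have "(0::exponent) \<in> tuples (num_pos D)" by (simp add: tuples_def)
  then have "fpow \<rho> 0 w \<in> hwspan \<rho> w" unfolding hwspan_def by (intro cv.span_base) (rule imageI)
  then show ?thesis by simp
qed

text \<open>Since no index below \<open>i\<close> occurs, the new factor already stands in its
  ordered place; the multiple compensates the factorials of the divided powers.\<close>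

lemma fpow_step:
  assumes "lie_module V \<rho>" "w \<in> V" "i < num_pos D" "\<And>l. l < i \<Longrightarrow> Poly_Mapping.lookup p l = 0"
  shows "\<rho> (ff i) (fpow \<rho> p w) = of_nat (Suc (Poly_Mapping.lookup p i)) *\<^sub>C fpow \<rho> (p + Poly_Mapping.single i 1) w"
proof -
  let ?g = "\<lambda>p i w. (1 / fact (Poly_Mapping.lookup p i)) *\<^sub>C (\<rho> (ff i) ^^ Poly_Mapping.lookup p i) w"
  define r where "r = p + Poly_Mapping.single i (1::nat)"
  have q: "Poly_Mapping.lookup r l = (if l = i then Suc (Poly_Mapping.lookup p l) else Poly_Mapping.lookup p l)" for l
    by (simp add: r_def lookup_add lookup_single when_def)
  have split: "[0..<num_pos D] = [0..<i] @ i # [Suc i..<num_pos D]"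
    using assms(3) upt_add_eq_append[of 0 i "num_pos D - i"] upt_conv_Cons[of i "num_pos D"] by simp
  define u where "u = foldr (?g p) [Suc i..<num_pos D] w"
  have pw: "u \<in> V \<Longrightarrow> (\<rho> x ^^ k) u \<in> V" for x k u
    using lie_moduleD(2)[OF assms(1)] by (induction k) auto
  have uV: "foldr (?g p) xs w \<in> V" for xs
    by (induction xs) (use assms(2) pw cv.subspace_scale[OF lie_moduleD(1)[OF assms(1)]] in auto)
  have u': "foldr (?g r) [Suc i..<num_pos D] w = u"
    unfolding u_def by (rule foldr_cong) (auto simp: q)
  have tr: "foldr (?g s) xs z = z" if "\<And>l. l \<in> set xs \<Longrightarrow> Poly_Mapping.lookup s l = 0" for s xs z
    using that by (induction xs) auto
  have tp: "foldr (?g p) [0..<i] z = z" and tq: "foldr (?g r) [0..<i] z = z" for z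
    by (rule tr, use assms(4) q in simp)+
  have "fpow \<rho> p w = ?g p i u" unfolding fpow_def split
    by (simp add: tp u_def)
  moreover have "fpow \<rho> r w = ?g r i u" unfolding fpow_def split
    by (simp add: tq u')
  moreover have "of_nat (Suc k) * (1 / fact (Suc k)) = (1 / fact k :: complex)" for k
    by (simp add: fact_Suc del: of_nat_Suc)
  moreover have "u \<in> V" unfolding u_def by (rule uV)
  ultimately show ?thesis unfolding r_def[symmetric]
    using lie_moduleD(5)[OF assms(1) pw] by (simp add: q del: of_nat_Suc fact_Suc)
qed

section \<open>Ordering of words in the negative root vectors\<close>

definition sorted_words :: "('g \<Rightarrow> 'w \<Rightarrow> 'w) \<Rightarrow> 'w \<Rightarrow> nat \<Rightarrow> 'w::complex_vector set" where
  "sorted_words \<rho> w k = {foldr (\<lambda>i. \<rho> (ff i)) xs w |xs. sorted xs \<and> set xs \<subseteq> {..<num_pos D} \<and> length xs \<le> k}"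

lemma sorted_words_mono: "k \<le> l \<Longrightarrow> cv.span (sorted_words \<rho> w k) \<subseteq> cv.span (sorted_words \<rho> w l)"
  by (intro cv.span_mono) (auto simp: sorted_words_def)

lemma sorted_words_sub:
  assumes "lie_module V \<rho>" "w \<in> V"
  shows "sorted_words \<rho> w k \<subseteq> V" "cv.span (sorted_words \<rho> w k) \<subseteq> V"
proof -
  have "foldr (\<lambda>i. \<rho> (ff i)) xs w \<in> V" for xs
    by (induction xs) (use assms lie_moduleD(2) in auto)
  then show *: "sorted_words \<rho> w k \<subseteq> V" by (auto simp: sorted_words_def)
  then show "cv.span (sorted_words \<rho> w k) \<subseteq> V" by (rule cv.span_minimal[OF _ lie_moduleD(1)[OF assms(1)]])
qed

text \<open>Straightening, by induction on the length and inside it on the index \<open>i\<close>.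
  If the word starts with a smaller index \<open>j\<close>, the two letters are exchanged:
  \<open>ff j\<close> is now applied, with a smaller index, and the bracket is a combination of
  negative root vectors acting on a shorter word.\<close>

lemma ff_sorted_words:
  assumes M: "lie_module V \<rho>" and w: "w \<in> V" and "i < num_pos D" "u \<in> cv.span (sorted_words \<rho> w k)"
  shows "\<rho> (ff i) u \<in> cv.span (sorted_words \<rho> w (Suc k))"
  using assms(3,4)
proof (induction k arbitrary: i u)
  case 0
  have "sorted_words \<rho> w 0 = {w}" by (auto simp: sorted_words_def)
  moreover have "foldr (\<lambda>i. \<rho> (ff i)) [i] w \<in> sorted_words \<rho> w (Suc 0)"
    unfolding sorted_words_def using 0 by (intro CollectI exI[of _ "[i]"]) auto
  moreover obtain c where "u = c *\<^sub>C w" using 0(2) \<open>sorted_words \<rho> w 0 = {w}\<close> by (auto simp: cv.span_singleton)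
  ultimately show ?case using cv.span_scale[OF cv.span_base] lie_moduleD(5)[OF M w] by simp
next
  case (Suc k)
  note sub = sorted_words_sub[OF M w]
  show ?case using Suc.prems
  proof (induction i arbitrary: u rule: less_induct)
    case (less i)
    show ?case
    proof (rule lin_on_span_into[OF lie_moduleD(3,1)[OF M] sub(1) cv.subspace_span _ less.prems(2)])
      show "\<rho> (ff i) ` sorted_words \<rho> w (Suc k) \<subseteq> cv.span (sorted_words \<rho> w (Suc (Suc k)))"
      proof clarify
        fix v assume "v \<in> sorted_words \<rho> w (Suc k)"
        then obtain xs where xs: "v = foldr (\<lambda>i. \<rho> (ff i)) xs w" "sorted xs" "set xs \<subseteq> {..<num_pos D}" "length xs \<le> Suc k"
          unfolding sorted_words_def by blast
        show "\<rho> (ff i) v \<in> cv.span (sorted_words \<rho> w (Suc (Suc k)))"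
        proof (cases "sorted (i # xs)")
          case True
          then have "foldr (\<lambda>i. \<rho> (ff i)) (i # xs) w \<in> sorted_words \<rho> w (Suc (Suc k))"
            using xs less.prems(1) unfolding sorted_words_def by (intro CollectI exI[of _ "i # xs"]) auto
          then show ?thesis using xs(1) by (auto intro: cv.span_base)
        next
          case False
          then obtain j js where j: "xs = j # js" "j < i" using xs(2) by (cases xs) (auto simp: not_le)
          define v' where "v' = foldr (\<lambda>i. \<rho> (ff i)) js w"
          have v': "v' \<in> cv.span (sorted_words \<rho> w k)"
            unfolding v'_def using xs j by (intro cv.span_base) (auto simp: sorted_words_def)
          have jN: "j < num_pos D" using xs(3) j by auto
          have v'V: "v' \<in> V" using v' sub(2) by blast
          have "\<rho> (ff i) v' \<in> cv.span (sorted_words \<rho> w (Suc k))" by (rule Suc.IH[OF less.prems(1) v'])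
          \<comment> \<open>The induction on the length bounds the inner application, and the
            induction on the index the outer one, at the same length as in the claim.\<close>
          then have 1: "\<rho> (ff j) (\<rho> (ff i) v') \<in> cv.span (sorted_words \<rho> w (Suc (Suc k)))"
            using less.IH[OF j(2) jN] by blast
          have "\<rho> (bracket (ff i) (ff j)) v' \<in> cv.span (sorted_words \<rho> w (Suc k))"
            by (rule lin_on_span_into[OF lie_module_lin_left[OF M v'V] cv.subspace_UNIV subset_UNIV cv.subspace_span _
                  ff_bracket[OF less.prems(1) jN]]) (use Suc.IH v' in auto)
          then have 2: "\<rho> (bracket (ff i) (ff j)) v' \<in> cv.span (sorted_words \<rho> w (Suc (Suc k)))"
            using sorted_words_mono[of "Suc k" "Suc (Suc k)"] by auto
          have "\<rho> (ff i) v = \<rho> (ff j) (\<rho> (ff i) v') + \<rho> (bracket (ff i) (ff j)) v'"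
            using lie_moduleD(8)[OF M v'V, of "ff i" "ff j"] by (simp add: xs(1) j v'_def)
          then show ?thesis using 1 2 by (simp add: cv.span_add)
        qed
      qed
    qed
  qed
qed

text \<open>Elements of the Borel part do not lengthen words: they are moved past the first letter.
  The bracket created there can be any element of the algebra, which may lengthen the shorter
  remaining word by one.\<close>

lemma sorted_words_step:
  assumes M: "lie_module V \<rho>" and w: "w \<in> V"
    and hw: "\<And>x. x \<in> cartan D \<union> ee ` {..<num_pos D} \<Longrightarrow> \<rho> x w \<in> cv.span {w}"
  shows "x \<in> cartan D \<union> ee ` {..<num_pos D} \<Longrightarrow> u \<in> cv.span (sorted_words \<rho> w k) \<Longrightarrow> \<rho> x u \<in> cv.span (sorted_words \<rho> w k)"
    and "u \<in> cv.span (sorted_words \<rho> w k) \<Longrightarrow> \<rho> y u \<in> cv.span (sorted_words \<rho> w (Suc k))"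
proof -
  note sub = sorted_words_sub[OF M w]
  \<comment> \<open>An arbitrary element is split by the triangular decomposition; only its negative
    part costs a letter. The Borel claim is assumed for the same \<open>u\<close>, so that this can
    serve inside its induction.\<close>
  have all: "\<rho> y u \<in> cv.span (sorted_words \<rho> w (Suc k))"
    if B: "\<And>x. x \<in> cartan D \<union> ee ` {..<num_pos D} \<Longrightarrow> \<rho> x u \<in> cv.span (sorted_words \<rho> w k)"
      and u: "u \<in> cv.span (sorted_words \<rho> w k)" for y u k
  proof (rule lin_on_span_into[OF lie_module_lin_left[OF M] cv.subspace_UNIV subset_UNIV cv.subspace_span])
    show "u \<in> V" using u sub by blast
    show "y \<in> cv.span (cartan D \<union> ee ` {..<num_pos D} \<union> ff ` {..<num_pos D})"
      unfolding triangular_decomposition by simp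
    show "(\<lambda>x. \<rho> x u) ` (cartan D \<union> ee ` {..<num_pos D} \<union> ff ` {..<num_pos D}) \<subseteq> cv.span (sorted_words \<rho> w (Suc k))"
      using B ff_sorted_words[OF M w _ u] sorted_words_mono[of k "Suc k" \<rho> w] by auto
  qed
  have borel: "\<rho> x u \<in> cv.span (sorted_words \<rho> w k)"
    if "x \<in> cartan D \<union> ee ` {..<num_pos D}" "u \<in> cv.span (sorted_words \<rho> w k)" for x u k
    using that
  proof (induction k arbitrary: x u)
    case 0
    have "sorted_words \<rho> w 0 = {w}" by (auto simp: sorted_words_def)
    moreover have "\<rho> x u \<in> cv.span {w}"
      by (rule lin_on_span_into[OF lie_moduleD(3,1)[OF M] _ cv.subspace_span, of "{w}"])
        (use w hw[OF 0(1)] 0(2) \<open>sorted_words \<rho> w 0 = {w}\<close> in auto)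
    ultimately show ?case by simp
  next
    case (Suc k)
    show ?case
    proof (rule lin_on_span_into[OF lie_moduleD(3,1)[OF M] sub(1) cv.subspace_span _ Suc.prems(2)])
      show "\<rho> x ` sorted_words \<rho> w (Suc k) \<subseteq> cv.span (sorted_words \<rho> w (Suc k))"
      proof clarify
        fix v assume "v \<in> sorted_words \<rho> w (Suc k)"
        then obtain xs where xs: "v = foldr (\<lambda>i. \<rho> (ff i)) xs w" "sorted xs" "set xs \<subseteq> {..<num_pos D}" "length xs \<le> Suc k"
          unfolding sorted_words_def by blast
        show "\<rho> x v \<in> cv.span (sorted_words \<rho> w (Suc k))"
        proof (cases xs)
          case Nil
          then have "\<rho> x v \<in> cv.span {w}" using hw[OF Suc.prems(1)] xs(1) by simp
          moreover have "foldr (\<lambda>i. \<rho> (ff i)) [] w \<in> sorted_words \<rho> w (Suc k)"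
            unfolding sorted_words_def by (intro CollectI exI[of _ "[]"]) auto
          ultimately show ?thesis using cv.span_mono[of "{w}" "sorted_words \<rho> w (Suc k)"] by auto
        next
          case (Cons j js)
          define v' where "v' = foldr (\<lambda>i. \<rho> (ff i)) js w"
          have v': "v' \<in> cv.span (sorted_words \<rho> w k)"
            unfolding v'_def using xs Cons by (intro cv.span_base) (auto simp: sorted_words_def)
          have jN: "j < num_pos D" using xs(3) Cons by auto
          have "\<rho> (ff j) (\<rho> x v') \<in> cv.span (sorted_words \<rho> w (Suc k))"
            by (rule ff_sorted_words[OF M w jN Suc.IH[OF Suc.prems(1) v']])
          moreover have "\<rho> (bracket x (ff j)) v' \<in> cv.span (sorted_words \<rho> w (Suc k))"
            by (rule all[OF Suc.IH[OF _ v'] v'])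
          moreover have "\<rho> x v = \<rho> (ff j) (\<rho> x v') + \<rho> (bracket x (ff j)) v'"
            using lie_moduleD(8)[OF M subsetD[OF sub(2) v'], of x "ff j"] by (simp add: xs(1) Cons v'_def)
          ultimately show ?thesis by (simp add: cv.span_add)
        qed
      qed
    qed
  qed
  show "x \<in> cartan D \<union> ee ` {..<num_pos D} \<Longrightarrow> u \<in> cv.span (sorted_words \<rho> w k) \<Longrightarrow> \<rho> x u \<in> cv.span (sorted_words \<rho> w k)"
    by (rule borel)
  show "u \<in> cv.span (sorted_words \<rho> w k) \<Longrightarrow> \<rho> y u \<in> cv.span (sorted_words \<rho> w (Suc k))"
    by (rule all[OF borel])
qed

lemma sorted_word_fpow:
  assumes M: "lie_module V \<rho>" and w: "w \<in> V" and "sorted xs" "set xs \<subseteq> {..<num_pos D}"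
  shows "\<exists>c p. p \<in> tuples (num_pos D) \<and> foldr (\<lambda>i. \<rho> (ff i)) xs w = c *\<^sub>C fpow \<rho> p w \<and> Poly_Mapping.keys p \<subseteq> set xs"
  using assms(3,4)
proof (induction xs)
  case Nil
  show ?case by (intro exI[of _ 1] exI[of _ 0]) (simp add: tuples_def)
next
  case (Cons i xs)
  then obtain c p where p: "p \<in> tuples (num_pos D)" "foldr (\<lambda>i. \<rho> (ff i)) xs w = c *\<^sub>C fpow \<rho> p w" "Poly_Mapping.keys p \<subseteq> set xs"
    by auto
  have i: "i < num_pos D" using Cons.prems by auto
  have low: "Poly_Mapping.lookup p l = 0" if "l < i" for l
    using that p(3) Cons.prems(1) by (force simp: in_keys_iff)
  have "fpow \<rho> p w \<in> V" by (rule fpow_mem) (use lie_moduleD[OF M] w in auto)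
  then have "foldr (\<lambda>i. \<rho> (ff i)) (i # xs) w =
      (c * of_nat (Suc (Poly_Mapping.lookup p i))) *\<^sub>C fpow \<rho> (p + Poly_Mapping.single i 1) w"
    using p(2) lie_moduleD(5)[OF M] fpow_step[OF M w i low] by simp
  moreover have "Poly_Mapping.keys (p + Poly_Mapping.single i 1) \<subseteq> insert i (Poly_Mapping.keys p)"
    using keys_add[of p "Poly_Mapping.single i 1"] by auto
  ultimately show ?case using p(1,3) i unfolding tuples_def
    by (intro exI[of _ "c * of_nat (Suc (Poly_Mapping.lookup p i))"] exI[of _ "p + Poly_Mapping.single i 1"]) auto
qed

text \<open>The span of the ordered monomials is the union of the spans of sorted words of bounded
  length, and an element of the algebra raises the bound by at most one.\<close>

lemma hwspan_stable:
  assumes hw: "hw_module V \<rho> w \<mu>" and u: "u \<in> hwspan \<rho> w"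
  shows "\<rho> x u \<in> hwspan \<rho> w"
proof -
  have M: "lie_module V \<rho>" and w: "w \<in> V" using hw by (auto simp: hw_module_def)
  have b: "\<rho> x w \<in> cv.span {w}" if "x \<in> cartan D \<union> ee ` {..<num_pos D}" for x
    using that hw by (auto simp: hw_module_def cv.span_zero cv.span_singleton)
  define P where "P = (\<Union>k. cv.span (sorted_words \<rho> w k))"
  have eq: "hwspan \<rho> w = P"
  proof
    show "P \<subseteq> hwspan \<rho> w" unfolding P_def
    proof (intro UN_least)
      fix k
      show "cv.span (sorted_words \<rho> w k) \<subseteq> hwspan \<rho> w"
        unfolding hwspan_def
      proof (intro cv.span_minimal cv.subspace_span subsetI)
        fix v assume "v \<in> sorted_words \<rho> w k"
        then obtain c p where "p \<in> tuples (num_pos D)" "v = c *\<^sub>C fpow \<rho> p w"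
          unfolding sorted_words_def using sorted_word_fpow[OF M w] by blast
        then show "v \<in> cv.span ((\<lambda>p. fpow \<rho> p w) ` tuples (num_pos D))"
          by (simp add: cv.span_scale[OF cv.span_base])
      qed
    qed
    show "hwspan \<rho> w \<subseteq> P"
    proof (rule hwspan_least)
      show "cv.subspace P"
      proof (rule cv.subspaceI)
        show "0 \<in> P" by (auto simp: P_def cv.span_zero)
        show "a + b \<in> P" if ab: "a \<in> P" "b \<in> P" for a b
        proof -
          obtain k l where "a \<in> cv.span (sorted_words \<rho> w k)" "b \<in> cv.span (sorted_words \<rho> w l)"
            using ab by (auto simp: P_def)
          then have "a \<in> cv.span (sorted_words \<rho> w (max k l))" "b \<in> cv.span (sorted_words \<rho> w (max k l))"
            using sorted_words_mono[of k "max k l" \<rho> w] sorted_words_mono[of l "max k l" \<rho> w] by auto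
          then show ?thesis by (auto simp: P_def intro: cv.span_add)
        qed
        show "c *\<^sub>C a \<in> P" if "a \<in> P" for c a using that by (auto simp: P_def intro: cv.span_scale)
      qed
      show "\<rho> x u \<in> P" if "u \<in> P" for x u
        using that sorted_words_step(2)[OF M w b] by (auto simp: P_def)
      have "foldr (\<lambda>i. \<rho> (ff i)) [] w \<in> sorted_words \<rho> w 0"
        unfolding sorted_words_def by (intro CollectI exI[of _ "[]"]) auto
      then have "w \<in> cv.span (sorted_words \<rho> w 0)" by (auto intro: cv.span_base)
      then show "w \<in> P" by (auto simp: P_def)
    qed
  qed
  show ?thesis using u sorted_words_step(2)[OF M w b] unfolding eq by (auto simp: P_def)
qed

lemma fpow_weight:
  assumes hw: "hw_module V \<rho> w \<mu>" and h: "h \<in> cartan D"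
  shows "\<rho> h (fpow \<rho> p w) =
    (\<mu> h - (\<Sum>i<num_pos D. of_nat (Poly_Mapping.lookup p i) * pos_root D i h)) *\<^sub>C fpow \<rho> p w"
proof -
  have M: "lie_module V \<rho>" and w: "w \<in> V" "\<rho> h w = \<mu> h *\<^sub>C w" using hw h by (auto simp: hw_module_def)
  let ?g = "\<lambda>i w. (1 / fact (Poly_Mapping.lookup p i)) *\<^sub>C (\<rho> (ff i) ^^ Poly_Mapping.lookup p i) w"
  have "\<rho> h (foldr ?g xs w) = (\<mu> h - (\<Sum>i\<leftarrow>xs. of_nat (Poly_Mapping.lookup p i) * pos_root D i h)) *\<^sub>C foldr ?g xs w
      \<and> foldr ?g xs w \<in> V" if "set xs \<subseteq> {..<num_pos D}" for xs
    using that
  proof (induction xs)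
    case (Cons i xs)
    define u where "u = foldr ?g xs w"
    define c where "c = \<mu> h - (\<Sum>i\<leftarrow>xs. of_nat (Poly_Mapping.lookup p i) * pos_root D i h)"
    have u: "u \<in> V" "\<rho> h u = c *\<^sub>C u" using Cons by (auto simp: u_def c_def)
    have i: "i < num_pos D" using Cons.prems by auto
    define k where "k = Poly_Mapping.lookup p i"
    have "\<rho> h ((\<rho> (ff i) ^^ k) u) = (c + of_nat k * (- pos_root D i h)) *\<^sub>C (\<rho> (ff i) ^^ k) u"
      "(\<rho> (ff i) ^^ k) u \<in> V"
      using sl2_shift[OF M u(1) ff_weight[OF i h] u(2)] by blast+
    then show ?case using lie_moduleD[OF M]
      by (simp add: u_def[symmetric] k_def[symmetric] cv.subspace_scale c_def mult.commute diff_diff_eq)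
  qed (simp add: w)
  from this[of "[0..<num_pos D]"] show ?thesis
    unfolding fpow_def by (simp add: interv_sum_list_conv_sum_set_nat atLeast0LessThan lessThan_Suc_atMost)
qed

lemma hwspan_sub: "hw_module V \<rho> w \<mu> \<Longrightarrow> hwspan \<rho> w \<subseteq> V"
  by (rule hwspan_least) (auto simp: hw_module_def lie_moduleD)

lemma hwspan_subspace: "cv.subspace (hwspan \<rho> w)"
  by (simp add: hwspan_def)

lemma hwspan_explicit:
  assumes "u \<in> hwspan \<rho> w"
  obtains P \<gamma> where "finite P" "P \<subseteq> tuples (num_pos D)" "u = (\<Sum>p\<in>P. \<gamma> p *\<^sub>C fpow \<rho> p w)"
proof -
  from assms have "\<exists>P \<gamma>. finite P \<and> P \<subseteq> tuples (num_pos D) \<and> u = (\<Sum>p\<in>P. \<gamma> p *\<^sub>C fpow \<rho> p w)"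
    unfolding hwspan_def
  proof (induction rule: cv.span_induct_alt)
    case base
    show ?case by (intro exI[of _ "{}"]) auto
  next
    case (step c x y)
    then obtain q P \<gamma> where q: "q \<in> tuples (num_pos D)" "x = fpow \<rho> q w"
      and P: "finite P" "P \<subseteq> tuples (num_pos D)" "y = (\<Sum>p\<in>P. \<gamma> p *\<^sub>C fpow \<rho> p w)" by auto
    define \<gamma>' where "\<gamma>' p = (if p \<in> P then \<gamma> p else 0) + (if p = q then c else 0)" for p
    have "(\<Sum>p\<in>insert q P. \<gamma>' p *\<^sub>C fpow \<rho> p w) =
        (\<Sum>p\<in>insert q P. (if p \<in> P then \<gamma> p else 0) *\<^sub>C fpow \<rho> p w) + (\<Sum>p\<in>insert q P. (if p = q then c else 0) *\<^sub>C fpow \<rho> p w)"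
      by (simp only: \<gamma>'_def scaleC_add_left sum.distrib)
    also have "(\<Sum>p\<in>insert q P. (if p \<in> P then \<gamma> p else 0) *\<^sub>C fpow \<rho> p w) = y"
      unfolding P(3) using P(1) by (intro sum.mono_neutral_cong_right) auto
    also have "(\<Sum>p\<in>insert q P. (if p = q then c else 0) *\<^sub>C fpow \<rho> p w) = (\<Sum>p\<in>{q}. c *\<^sub>C fpow \<rho> p w)"
      using P(1) by (intro sum.mono_neutral_cong_right) auto
    finally have "c *\<^sub>C x + y = (\<Sum>p\<in>insert q P. \<gamma>' p *\<^sub>C fpow \<rho> p w)" by (simp add: q(2) add.commute)
    then show ?case using P(1,2) q(1) by (intro exI[of _ "insert q P"] exI[of _ \<gamma>']) auto
  qed
  then show ?thesis using that by blast
qed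

text \<open>The weight space of the highest weight is the line through the highest weight vector.\<close>

lemma hw_component:
  assumes hw: "hw_module V \<rho> w \<mu>" and K: "cv.subspace K" "K \<subseteq> V" "\<And>h u. h \<in> cartan D \<Longrightarrow> u \<in> K \<Longrightarrow> \<rho> h u \<in> K"
    and P: "finite P" "P \<subseteq> tuples (num_pos D)" and v: "v \<in> V" "\<And>h. h \<in> cartan D \<Longrightarrow> \<rho> h v = \<mu> h *\<^sub>C v"
    and u: "v + (\<Sum>p\<in>P - {0}. \<gamma> p *\<^sub>C fpow \<rho> p w) \<in> K"
  shows "v \<in> K"
proof -
  have M: "lie_module V \<rho>" and w: "w \<in> V" using hw by (auto simp: hw_module_def)
  define \<psi> where "\<psi> p h = \<mu> h - (\<Sum>i<num_pos D. of_nat (Poly_Mapping.lookup p i) * pos_root D i h)" for p :: exponent and h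
  \<comment> \<open>The index 0 is free for \<open>v\<close>, because the weight \<mu> of
    \<open>v\<close> is the weight attached to the exponent 0.\<close>
  define z where "z p = (if p = 0 then v else \<gamma> p *\<^sub>C fpow \<rho> p w)" for p
  have fV: "fpow \<rho> p w \<in> V" for p by (rule fpow_mem) (use lie_moduleD[OF M] w in auto)
  have "z 0 \<in> K"
  proof (rule eigen_component[where J="P - {0}" and V=V and H="cartan D" and T=\<rho> and u=z and \<psi>=\<psi>])
    show "z p \<in> V" for p using fV v(1) cv.subspace_scale[OF lie_moduleD(1)[OF M]] by (simp add: z_def)
    show "\<rho> h (z p) = \<psi> p h *\<^sub>C z p" if "h \<in> cartan D" for h p
      using v(2)[OF that] fpow_weight[OF hw that, of p] lie_moduleD(5)[OF M fV]
      by (simp add: z_def \<psi>_def mult.commute)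
    show "\<exists>h\<in>cartan D. \<psi> p h \<noteq> \<psi> 0 h" if p: "p \<in> P - {0}" for p
    proof (rule ccontr)
      assume "\<not> ?thesis"
      then have z: "\<And>h. h \<in> cartan D \<Longrightarrow> (\<Sum>i<num_pos D. of_nat (Poly_Mapping.lookup p i) * pos_root D i h) = 0"
        by (simp add: \<psi>_def)
      have "Poly_Mapping.lookup p i = 0" for i
      proof (cases "i < num_pos D")
        case False
        then have "i \<notin> Poly_Mapping.keys p" using p P(2) by (auto simp: tuples_def)
        then show ?thesis by (simp add: in_keys_iff)
      qed (use pos_root_sum_zero[OF z] in blast)
      then have "p = 0" by (intro poly_mapping_eqI) simp
      then show False using p by simp
    qed
    have "(\<Sum>p\<in>P - {0}. z p) = (\<Sum>p\<in>P - {0}. \<gamma> p *\<^sub>C fpow \<rho> p w)" by (intro sum.cong) (auto simp: z_def)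
    then show "z 0 + (\<Sum>p\<in>P - {0}. z p) \<in> K" using u by (simp add: z_def)
  qed (use P lie_moduleD[OF M] K in auto)
  then show ?thesis by (simp add: z_def)
qed

lemma hw_weight_space:
  assumes hw: "hw_module V \<rho> w \<mu>" and u: "u \<in> hwspan \<rho> w" "\<And>h. h \<in> cartan D \<Longrightarrow> \<rho> h u = \<mu> h *\<^sub>C u"
  shows "\<exists>c. u = c *\<^sub>C w"
proof -
  have M: "lie_module V \<rho>" and w: "w \<in> V" "\<And>h. h \<in> cartan D \<Longrightarrow> \<rho> h w = \<mu> h *\<^sub>C w"
    using hw by (auto simp: hw_module_def)
  note D = lie_moduleD[OF M]
  have uV: "u \<in> V" using hwspan_sub[OF hw] u(1) by blast
  obtain P \<gamma> where P: "finite P" "P \<subseteq> tuples (num_pos D)" "u = (\<Sum>p\<in>P. \<gamma> p *\<^sub>C fpow \<rho> p w)"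
    using hwspan_explicit[OF u(1)] .
  define c where "c = (if 0 \<in> P then \<gamma> 0 else 0)"
  have eq: "u = c *\<^sub>C w + (\<Sum>p\<in>P - {0}. \<gamma> p *\<^sub>C fpow \<rho> p w)"
    unfolding P(3) c_def using sum.remove[OF P(1), of 0 "\<lambda>p. \<gamma> p *\<^sub>C fpow \<rho> p w"] by auto
  have "u - c *\<^sub>C w \<in> {0}"
  proof (rule hw_component[OF hw _ _ _ P(1,2)])
    show "u - c *\<^sub>C w \<in> V" using uV w(1) D(1) by (intro cv.subspace_diff cv.subspace_scale)
    show "\<rho> h (u - c *\<^sub>C w) = \<mu> h *\<^sub>C (u - c *\<^sub>C w)" if "h \<in> cartan D" for h
      using lin_on_diff[OF D(3) D(1) uV cv.subspace_scale[OF D(1) w(1)]] D(5)[OF w(1)] u(2)[OF that] w(2)[OF that]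
      by (simp add: cv.scale_right_diff_distrib mult.commute)
    show "(u - c *\<^sub>C w) + (\<Sum>p\<in>P - {0}. (- \<gamma> p) *\<^sub>C fpow \<rho> p w) \<in> {0}"
      using eq by (simp add: sum_negf)
  qed (use cv.subspace_0[OF D(1)] lie_module_zero_right[OF M] in auto)
  then show ?thesis by auto
qed

text \<open>An equivariant projection onto \<open>K\<close> sends \<open>w\<close> to a vector of
  the same weight, hence to a multiple of \<open>w\<close>. The multiple is 0 since \<open>w\<close>
  is not in \<open>K\<close>; so the projection kills everything generated by \<open>w\<close>, in
  particular \<open>K\<close>, on which it is the identity.\<close>

lemma hw_irreducible:
  assumes hw: "hw_module V \<rho> w \<mu>" and K: "cv.subspace K" "K \<subseteq> hwspan \<rho> w" "\<And>x u. u \<in> K \<Longrightarrow> \<rho> x u \<in> K" "w \<notin> K"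
  shows "K = {0}"
proof -
  have M: "lie_module V \<rho>" and w: "w \<in> V" "\<And>h. h \<in> cartan D \<Longrightarrow> \<rho> h w = \<mu> h *\<^sub>C w"
    using hw by (auto simp: hw_module_def)
  obtain e f h where efh: "sl2_triple e f h" "h \<in> cartan D" using exists_sl2 by blast
  interpret simple_sl2 e f h by unfold_locales (rule simple efh)+
  have MM: "lie_module (hwspan \<rho> w) \<rho>"
    by (rule lie_module_submodule[OF M hwspan_subspace hwspan_sub[OF hw] hwspan_stable[OF hw]])
  have fd: "fin_dim (hwspan \<rho> w)" using fin_dim_subset[OF _ hwspan_sub[OF hw]] hw by (auto simp: hw_module_def)
  have "(\<lambda>p. fpow \<rho> p w) ` tuples (num_pos D) \<subseteq> {v\<in>hwspan \<rho> w. \<exists>c. \<rho> h v = c *\<^sub>C v}"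
    using fpow_weight[OF hw efh(2)] by (auto simp: hwspan_def intro: cv.span_base)
  \<comment> \<open>Diagonalizability is visible here because the ordered monomials are weight
    vectors.\<close>
  from cv.span_mono[OF this] have diag: "diag_on (hwspan \<rho> w) (\<rho> h)" by (simp add: diag_on_def hwspan_def)
  obtain \<pi> where \<pi>: "lin_on (hwspan \<rho> w) \<pi>" "\<And>u. u \<in> hwspan \<rho> w \<Longrightarrow> \<pi> u \<in> K" "\<And>u. u \<in> K \<Longrightarrow> \<pi> u = u"
    "\<And>x u. u \<in> hwspan \<rho> w \<Longrightarrow> \<pi> (\<rho> x u) = \<rho> x (\<pi> u)"
    using equivariant_projection[OF MM fd diag K(1-3)] by blast
  have \<pi>w: "\<pi> w \<in> K" by (rule \<pi>(2)[OF hwspan_base])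
  have "\<rho> k (\<pi> w) = \<mu> k *\<^sub>C \<pi> w" if "k \<in> cartan D" for k
    using \<pi>(4)[OF hwspan_base, of k] w(2)[OF that] lin_onD(2)[OF \<pi>(1) hwspan_base] by simp
  then obtain c where c: "\<pi> w = c *\<^sub>C w" using hw_weight_space[OF hw, of "\<pi> w"] \<pi>w K(2) by blast
  have "c = 0"
  proof (rule ccontr)
    assume "c \<noteq> 0"
    moreover have "(1 / c) *\<^sub>C \<pi> w \<in> K" using \<pi>w cv.subspace_scale[OF K(1)] by blast
    ultimately show False using K(4) by (simp add: c)
  qed
  then have "w \<in> {u\<in>hwspan \<rho> w. \<pi> u = 0}" using c hwspan_base by simp
  moreover have "cv.subspace {u\<in>hwspan \<rho> w. \<pi> u = 0}"
    using lin_onD[OF \<pi>(1)] lin_on_zero[OF \<pi>(1) hwspan_subspace] hwspan_subspace[of \<rho> w]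
    by (auto simp: cv.subspace_def)
  moreover have "\<rho> x u \<in> {u\<in>hwspan \<rho> w. \<pi> u = 0}" if "u \<in> {u\<in>hwspan \<rho> w. \<pi> u = 0}" for x u
    using that \<pi>(4) hwspan_stable[OF hw] lie_module_zero_right[OF M] by auto
  ultimately have "hwspan \<rho> w \<subseteq> {u\<in>hwspan \<rho> w. \<pi> u = 0}" by (intro hwspan_least)
  then show ?thesis using K(2) \<pi>(3) cv.subspace_0[OF K(1)] by force
qed

lemma fpow_prod:
  "fpow (\<lambda>x u. (\<rho> x (fst u), \<rho>' x (snd u))) p (w, w') = (fpow \<rho> p w, fpow \<rho>' p w')"
proof -
  have pw: "((\<lambda>u. (\<rho> x (fst u), \<rho>' x (snd u))) ^^ k) (a, b) = ((\<rho> x ^^ k) a, (\<rho>' x ^^ k) b)" for x k a b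
    by (induction k) auto
  have "foldr (\<lambda>i w. (1 / fact (Poly_Mapping.lookup p i)) *\<^sub>C ((\<lambda>u. (\<rho> (ff i) (fst u), \<rho>' (ff i) (snd u))) ^^ Poly_Mapping.lookup p i) w) xs (w, w')
     = (foldr (\<lambda>i w. (1 / fact (Poly_Mapping.lookup p i)) *\<^sub>C (\<rho> (ff i) ^^ Poly_Mapping.lookup p i) w) xs w,
        foldr (\<lambda>i w. (1 / fact (Poly_Mapping.lookup p i)) *\<^sub>C (\<rho>' (ff i) ^^ Poly_Mapping.lookup p i) w) xs w')" for xs
    by (induction xs) (auto simp: pw scaleC_prod_def)
  then show ?thesis unfolding fpow_def by blast
qed

lemma fin_dim_Times:
  assumes "fin_dim V" "fin_dim W"
  shows "fin_dim (V \<times> W)"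
proof -
  obtain B C where B: "finite B" "V \<subseteq> cv.span B" and C: "finite C" "W \<subseteq> cv.span C"
    using assms by (auto simp: fin_dim_def)
  let ?F = "(\<lambda>b. (b, 0)) ` B \<union> (\<lambda>c. (0, c)) ` C"
  have "V \<times> W \<subseteq> cv.span ?F"
  proof clarify
    fix a b assume ab: "a \<in> V" "b \<in> W"
    have "(a, 0) \<in> cv.span ?F"
      by (rule lin_on_span_into[OF _ cv.subspace_UNIV subset_UNIV cv.subspace_span, where T="\<lambda>a. (a, 0)" and X=B])
        (use ab B in \<open>auto simp: lin_on_def scaleC_prod_def intro: cv.span_base\<close>)
    moreover have "(0, b) \<in> cv.span ?F"
      by (rule lin_on_span_into[OF _ cv.subspace_UNIV subset_UNIV cv.subspace_span, where T="\<lambda>a. (0, a)" and X=C])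
        (use ab C in \<open>auto simp: lin_on_def scaleC_prod_def intro: cv.span_base\<close>)
    ultimately have "(a, 0) + (0, b) \<in> cv.span ?F" by (rule cv.span_add)
    then show "(a, b) \<in> cv.span ?F" by simp
  qed
  then show ?thesis unfolding fin_dim_def using B(1) C(1) by (intro exI[of _ ?F]) auto
qed

text \<open>Both modules are quotients of the module generated by the pair of highest weight vectors,
  which is irreducible.\<close>

lemma hw_relations_transfer:
  assumes hw: "hw_module V \<rho> w \<mu>" and hw': "hw_module V' \<rho>' w' \<mu>"
    and P: "finite P" "P \<subseteq> tuples (num_pos D)" and rel: "(\<Sum>p\<in>P. \<gamma> p *\<^sub>C fpow \<rho> p w) = 0"
  shows "(\<Sum>p\<in>P. \<gamma> p *\<^sub>C fpow \<rho>' p w') = 0"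
proof -
  define \<theta> where "\<theta> x u = (\<rho> x (fst u), \<rho>' x (snd u))" for x u
  have M: "lie_module V \<rho>" "lie_module V' \<rho>'" and w: "w \<noteq> 0" using hw hw' by (auto simp: hw_module_def)
  have "lie_module (V \<times> V') \<theta>"
    using M unfolding lie_module_def \<theta>_def cv.subspace_def
    by (auto simp: scaleC_prod_def zero_prod_def)
  then have hwp: "hw_module (V \<times> V') \<theta> (w, w') \<mu>"
    using hw hw' fin_dim_Times[of V V'] unfolding hw_module_def
    by (auto simp: \<theta>_def scaleC_prod_def zero_prod_def)
  have f\<theta>: "fpow \<theta> p (w, w') = (fpow \<rho> p w, fpow \<rho>' p w')" for p
    unfolding \<theta>_def by (rule fpow_prod)
  \<comment> \<open>The kernel of the first projection. A relation for \<open>w\<close> produces an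
    element of it, and triviality of the kernel carries the relation over to
    \<open>w'\<close>.\<close>
  define K where "K = {u \<in> hwspan \<theta> (w, w'). fst u = 0}"
  have "K = {0}"
  proof (rule hw_irreducible[OF hwp])
    show "cv.subspace K" using hwspan_subspace[of \<theta> "(w, w')"] by (auto simp: K_def cv.subspace_def)
    show "K \<subseteq> hwspan \<theta> (w, w')" by (auto simp: K_def)
    show "\<theta> x u \<in> K" if "u \<in> K" for x u
      using that hwspan_stable[OF hwp] lie_module_zero_right[OF M(1)] by (auto simp: K_def) (simp add: \<theta>_def)
    show "(w, w') \<notin> K" using w by (simp add: K_def)
  qed
  define u where "u = (\<Sum>p\<in>P. \<gamma> p *\<^sub>C fpow \<theta> p (w, w'))"
  have "u \<in> hwspan \<theta> (w, w')" unfolding u_def hwspan_def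
    using P(2) by (intro cv.span_sum cv.span_scale cv.span_base) auto
  moreover have "fst u = 0" using rel by (simp add: u_def fst_sum snd_sum f\<theta>)
  ultimately have "u = 0" using \<open>K = {0}\<close> by (auto simp: K_def)
  then have "snd u = 0" by simp
  then show ?thesis by (simp add: u_def fst_sum snd_sum f\<theta>)
qed

end

section \<open>Essential signatures\<close>

lemma nondecreasing_subsequence:
  fixes s :: "nat \<Rightarrow> nat"
  shows "\<exists>\<phi>::nat \<Rightarrow> nat. strict_mono \<phi> \<and> mono (s \<circ> \<phi>)"
proof -
  obtain g where g: "strict_mono g" "monoseq (\<lambda>n. s (g n))" using seq_monosub[of s] by (auto simp: o_def)
  show ?thesis
  proof (cases "incseq (\<lambda>n. s (g n))")
    case True
    then show ?thesis using g(1) by (intro exI[of _ g]) (simp add: o_def)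
  next
    case False
    then have dec: "\<And>m n. m \<le> n \<Longrightarrow> s (g n) \<le> s (g m)"
      using g(2) by (auto simp: monoseq_def incseq_def)
    \<comment> \<open>From the index of the least value on, a nonincreasing sequence is
      constant.\<close>
    define k where "k = (ARG_MIN (\<lambda>n. s (g n)) n. True)"
    have k: "s (g k) \<le> s (g n)" for n
      unfolding k_def using arg_min_nat_le[of "\<lambda>_. True" n "\<lambda>n. s (g n)"] by simp
    have "s (g (k + n)) = s (g k)" for n using k[of "k + n"] dec[of k "k + n"] by simp
    then show ?thesis using g(1)
      by (intro exI[of _ "\<lambda>n. g (k + n)"]) (auto simp: strict_mono_def mono_def)
  qed
qed

lemma nondecreasing_subsequence_tuples:
  fixes s :: "nat \<Rightarrow> nat \<Rightarrow> nat"
  shows "\<exists>\<phi>::nat \<Rightarrow> nat. strict_mono \<phi> \<and> (\<forall>i<N. mono (\<lambda>n. s (\<phi> n) i))"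
proof (induction N)
  case 0
  show ?case by (intro exI[of _ id]) (auto simp: strict_mono_def)
next
  case (Suc N)
  then obtain \<phi> :: "nat \<Rightarrow> nat" where \<phi>: "strict_mono \<phi>" "\<And>i. i < N \<Longrightarrow> mono (\<lambda>n. s (\<phi> n) i)" by blast
  obtain \<psi> :: "nat \<Rightarrow> nat" where \<psi>: "strict_mono \<psi>" "mono ((\<lambda>n. s (\<phi> n) N) \<circ> \<psi>)"
    using nondecreasing_subsequence by blast
  have "mono (\<lambda>n. s (\<phi> (\<psi> n)) i)" if "i < Suc N" for i
  proof (cases "i = N")
    case False
    then show ?thesis using \<phi>(2)[of i] that strict_mono_mono[OF \<psi>(1)] by (auto simp: mono_def)
  qed (use \<psi>(2) in \<open>simp add: o_def\<close>)
  then show ?case using \<phi>(1) \<psi>(1) by (intro exI[of _ "\<phi> \<circ> \<psi>"]) (auto simp: strict_mono_def)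
qed

text \<open>By Dickson's lemma, a strictly descending sequence would have a componentwise nondecreasing subsequence.\<close>

lemma monomial_order_wf:
  assumes "monomial_order N r"
  shows "wf {(p, q). (p, q) \<in> r \<and> p \<noteq> q}"
  unfolding wf_iff_no_infinite_down_chain
proof (rule notI, elim exE)
  fix s assume "\<forall>i. (s (Suc i), s i) \<in> {(p, q). (p, q) \<in> r \<and> p \<noteq> q}"
  then have s: "(s (Suc i), s i) \<in> r" "s (Suc i) \<noteq> s i" for i by auto
  have lin: "linear_order_on (tuples N) r" using assms by (simp add: monomial_order_def)
  then have tr: "trans r" and anti: "antisym r" and sub: "r \<subseteq> tuples N \<times> tuples N"
    by (auto simp: order_on_defs)
  have st: "s i \<in> tuples N" for i using s(1)[of i] sub by auto
  have dec: "(s (i + Suc k), s i) \<in> r" for i k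
  proof (induction k)
    case (Suc k)
    then show ?case using s(1)[of "i + Suc k"] tr by (auto dest: transD)
  qed (use s(1) in simp)
  obtain \<phi> :: "nat \<Rightarrow> nat" where \<phi>: "strict_mono \<phi>" "\<And>i. i < N \<Longrightarrow> mono (\<lambda>n. Poly_Mapping.lookup (s (\<phi> n)) i)"
    using nondecreasing_subsequence_tuples[of N "\<lambda>n. Poly_Mapping.lookup (s n)"] by blast
  define a b d where "a = s (\<phi> 0)" and "b = s (\<phi> 1)" and "d = b - a"
  have le: "Poly_Mapping.lookup a i \<le> Poly_Mapping.lookup b i" for i
  proof (cases "i < N")
    case True
    then show ?thesis using \<phi>(2)[OF True] by (auto simp: a_def b_def mono_def)
  next
    case False
    then have "i \<notin> Poly_Mapping.keys a" using st by (auto simp: tuples_def a_def)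
    then show ?thesis by (simp add: in_keys_iff)
  qed
  have bd: "b = d + a" by (rule poly_mapping_eqI) (simp add: d_def lookup_add lookup_minus le)
  have "Poly_Mapping.keys d \<subseteq> Poly_Mapping.keys b" by (auto simp: d_def in_keys_iff lookup_minus)
  then have "d \<in> tuples N" using st[of "\<phi> 1"] by (auto simp: tuples_def b_def)
  \<comment> \<open>The exponent 0 is least, and adding \<open>a\<close> preserves the
    order.\<close>
  then have "(0 + a, d + a) \<in> r" using assms st by (simp only: monomial_order_def a_def)
  then have ab: "(a, b) \<in> r" by (simp add: bd)
  have lt: "\<phi> 0 < \<phi> 1" using \<phi>(1) by (simp add: strict_mono_def)
  \<comment> \<open>In a descending sequence \<open>b\<close> is at most the immediate successor of
    \<open>a\<close>. Together with \<open>a\<close> being at most \<open>b\<close> this contradicts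
    the strict descent at \<open>a\<close>.\<close>
  then have "(b, s (Suc (\<phi> 0))) \<in> r"
  proof (cases "\<phi> 1 = Suc (\<phi> 0)")
    case True
    then show ?thesis using lin st by (auto simp: b_def order_on_defs refl_on_def)
  next
    case False
    then obtain k where "\<phi> 1 = Suc (\<phi> 0) + Suc k" using lt by (metis add_Suc_right less_iff_Suc_add Suc_lessI add_Suc)
    then show ?thesis using dec[of "Suc (\<phi> 0)" k] by (simp add: b_def)
  qed
  then have "(a, s (Suc (\<phi> 0))) \<in> r" using ab tr by (auto dest: transD)
  then show False using s[of "\<phi> 0"] anti by (auto simp: a_def dest: antisymD)
qed

section \<open>Essential exponents as bases of the irreducible modules\<close>

locale rep_data = root_data D for D :: "('g::complex_lie_algebra, 'v::complex_vector) lie_setup" +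
  assumes mon: "monomial_order (num_pos D) (mon_order D)" and modules: "module_setup D"
begin

abbreviation "Tup \<equiv> tuples (num_pos D)"

definition mless :: "exponent \<Rightarrow> exponent \<Rightarrow> bool" where
  "mless p q \<longleftrightarrow> (p, q) \<in> mon_order D \<and> p \<noteq> q"

lemma mon_linear: "linear_order_on Tup (mon_order D)"
  using mon by (simp add: monomial_order_def)

lemma mless_tuples: "mless p q \<Longrightarrow> p \<in> Tup \<and> q \<in> Tup"
  using mon_linear by (auto simp: order_on_defs mless_def)

lemma mless_irrefl [simp]: "\<not> mless p p" by (simp add: mless_def)

lemma mless_trans: "mless p q \<Longrightarrow> mless q r \<Longrightarrow> mless p r"
  using mon_linear by (auto simp: order_on_defs mless_def dest: transD antisymD)

lemma mless_asym: "mless p q \<Longrightarrow> \<not> mless q p"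
  using mless_trans mless_irrefl by blast

lemma mless_total: "p \<in> Tup \<Longrightarrow> q \<in> Tup \<Longrightarrow> p \<noteq> q \<Longrightarrow> mless p q \<or> mless q p"
  using mon_linear by (auto simp: order_on_defs mless_def total_on_def)

lemma mless_wf: "wfP mless"
  using monomial_order_wf[OF mon] by (simp add: wfp_def mless_def)

lemma mless_add: "mless p q \<Longrightarrow> s \<in> Tup \<Longrightarrow> mless (p + s) (q + s)"
  using mon by (auto simp: monomial_order_def mless_def)

lemma tuples_add: "p \<in> Tup \<Longrightarrow> q \<in> Tup \<Longrightarrow> p + q \<in> Tup"
  using keys_add[of p q] by (auto simp: tuples_def)

abbreviation "Dom \<equiv> dominant_weights D"
abbreviation "vv k p \<equiv> sig_vector D (k, p)"

definition Ess :: "weight \<Rightarrow> exponent set" where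
  "Ess k = {p. (k, p) \<in> essential D}"

lemma hw_module_irrep:
  assumes "k \<in> Dom"
  shows "hw_module (irrep D k) (action D k) (hw_vector D k) (weight_fun D k)"
  using modules assms unfolding module_setup_def hw_module_def irreducible_module_def fin_dim_def by fast

lemma vv_fpow: "vv k p = fpow (action D k) p (hw_vector D k)"
  by (simp add: sig_vector_def fpow_def)

lemma irrep_module: "k \<in> Dom \<Longrightarrow> lie_module (irrep D k) (action D k)"
  and irrep_fin_dim: "k \<in> Dom \<Longrightarrow> fin_dim (irrep D k)"
  and hw_in_irrep: "k \<in> Dom \<Longrightarrow> hw_vector D k \<in> irrep D k"
  using hw_module_irrep by (auto simp: hw_module_def)

lemma irrep_eq_hwspan:
  assumes "k \<in> Dom"
  shows "irrep D k = hwspan (action D k) (hw_vector D k)"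
proof -
  note hw = hw_module_irrep[OF assms]
  have "\<And>W. cv.subspace W \<Longrightarrow> W \<subseteq> irrep D k \<Longrightarrow> (\<forall>x. \<forall>u\<in>W. action D k x u \<in> W) \<Longrightarrow> W = {0} \<or> W = irrep D k"
    using modules assms unfolding module_setup_def irreducible_module_def by blast
  from this[OF hwspan_subspace hwspan_sub[OF hw]] hwspan_stable[OF hw]
  have "hwspan (action D k) (hw_vector D k) = {0} \<or> hwspan (action D k) (hw_vector D k) = irrep D k" by blast
  then show ?thesis using hwspan_base[of "hw_vector D k" "action D k"] hw by (auto simp: hw_module_def)
qed

lemma vv_in_irrep: "k \<in> Dom \<Longrightarrow> vv k p \<in> irrep D k"
  unfolding vv_fpow by (intro fpow_mem) (auto simp: lie_moduleD[OF irrep_module] hw_in_irrep)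

lemma irrep_span: "k \<in> Dom \<Longrightarrow> irrep D k = cv.span (vv k ` Tup)"
  unfolding irrep_eq_hwspan hwspan_def by (simp add: vv_fpow)

lemma deglex_irrefl [simp]: "\<not> deglex_less n k k"
  by (simp add: deglex_less_def)

lemma Ess_iff:
  "p \<in> Ess k \<longleftrightarrow> k \<in> Dom \<and> p \<in> Tup \<and> vv k p \<notin> cv.span (vv k ` {q. mless q p})"
proof -
  have "sig_vector D ` {\<tau> \<in> signatures D. fst \<tau> = k \<and> sig_less D \<tau> (k, p)} = vv k ` {q. mless q p}"
    if "k \<in> Dom"
    using that mless_tuples
    by (auto simp: signatures_def sig_less_def mless_def[symmetric] image_iff)
  then show ?thesis by (auto simp: Ess_def essential_def signatures_def)
qed

lemma Ess_tuples: "p \<in> Ess k \<Longrightarrow> p \<in> Tup" by (simp add: Ess_iff)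

text \<open>A vector of a nonessential exponent is rewritten by smaller ones; the rewriting ends
  because the monomial order is well-founded.\<close>

lemma vv_in_span_Ess:
  assumes "k \<in> Dom" "p \<in> Tup"
  shows "vv k p \<in> cv.span (vv k ` {q \<in> Ess k. q = p \<or> mless q p})"
  using assms(2)
proof (induction p rule: wfp_induct[OF mless_wf])
  case (1 p)
  show ?case
  proof (cases "p \<in> Ess k")
    case True
    then show ?thesis by (intro cv.span_base) auto
  next
    case False
    then have "vv k p \<in> cv.span (vv k ` {q. mless q p})" using 1 assms(1) by (simp add: Ess_iff)
    moreover have "cv.span (vv k ` {q. mless q p}) \<subseteq> cv.span (vv k ` {q \<in> Ess k. q = p \<or> mless q p})"
    proof (intro cv.span_minimal cv.subspace_span subsetI)
      fix v assume "v \<in> vv k ` {q. mless q p}"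
      then obtain q where q: "mless q p" "v = vv k q" by blast
      then have "v \<in> cv.span (vv k ` {q' \<in> Ess k. q' = q \<or> mless q' q})" using 1 mless_tuples by blast
      moreover have "vv k ` {q' \<in> Ess k. q' = q \<or> mless q' q} \<subseteq> vv k ` {q \<in> Ess k. q = p \<or> mless q p}"
        using q(1) mless_trans by blast
      ultimately show "v \<in> cv.span (vv k ` {q \<in> Ess k. q = p \<or> mless q p})" using cv.span_mono by blast
    qed
    ultimately show ?thesis by blast
  qed
qed

lemma mless_max:
  assumes "finite F" "F \<noteq> {}" "F \<subseteq> Tup"
  shows "\<exists>m\<in>F. \<forall>q\<in>F. q = m \<or> mless q m"
  using assms
proof (induction F rule: finite_ne_induct)
  case (insert x F)
  then obtain m where m: "m \<in> F" "\<forall>q\<in>F. q = m \<or> mless q m" by blast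
  have "x = m \<or> mless x m \<or> mless m x" using mless_total insert.prems m(1) by blast
  then show ?case
  proof (elim disjE)
    assume "mless m x"
    then show ?thesis using m mless_trans by (intro bexI[of _ x]) auto
  qed (use m in blast)+
qed auto

lemma finite_Ess_independent:
  assumes "finite F" "F \<subseteq> Ess k"
  shows "cv.independent (vv k ` F) \<and> inj_on (vv k) F"
  using assms
proof (induction "card F" arbitrary: F)
  case (Suc n)
  then have "F \<noteq> {}" "F \<subseteq> Tup" using Ess_tuples by auto
  \<comment> \<open>The vector of the largest exponent is outside the span of all smaller ones, in
    particular of the rest of \<open>F\<close>.\<close>
  then obtain m where m: "m \<in> F" "\<forall>q\<in>F. q = m \<or> mless q m" using mless_max Suc.prems(1) by blast
  define F' where "F' = F - {m}"
  have IH: "cv.independent (vv k ` F') \<and> inj_on (vv k) F'"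
    using Suc.hyps(2) Suc.prems m(1) unfolding F'_def by (intro Suc.hyps(1)) auto
  have F: "F = insert m F'" using m(1) by (auto simp: F'_def)
  have "vv k ` F' \<subseteq> vv k ` {q. mless q m}" using m(2) by (auto simp: F'_def)
  from cv.span_mono[OF this] have ns: "vv k m \<notin> cv.span (vv k ` F')"
    using subsetD[OF Suc.prems(2) m(1)] by (auto simp: Ess_iff)
  then have "vv k m \<notin> vv k ` F'" using cv.span_base[of "vv k m" "vv k ` F'"] by blast
  then show ?case using IH ns unfolding F by (auto simp: cv.independent_insert)
qed (auto simp: cv.independent_empty)

lemma Ess_finite: "finite (Ess k)"
proof (cases "k \<in> Dom")
  case True
  obtain B where B: "is_basis B (irrep D k)"
    using basis_ex[OF irrep_fin_dim[OF True] lie_moduleD(1)[OF irrep_module[OF True]]] .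
  show ?thesis
  proof (rule ccontr)
    assume "infinite (Ess k)"
    then obtain F where F: "finite F" "card F = Suc (card B)" "F \<subseteq> Ess k"
      using infinite_arbitrarily_large by blast
    have i: "cv.independent (vv k ` F)" "inj_on (vv k) F" using finite_Ess_independent[OF F(1,3)] by auto
    have "vv k ` F \<subseteq> cv.span B" using vv_in_irrep[OF True] is_basisD(3)[OF B] by auto
    then have "card (vv k ` F) \<le> card B" using cv.independent_span_bound[OF is_basisD(1)[OF B] i(1)] by blast
    then show False using F(2) card_image[OF i(2)] by simp
  qed
next
  case False
  then have "Ess k = {}" by (auto simp: Ess_iff)
  then show ?thesis by simp
qed

lemma Ess_inj: "inj_on (vv k) (Ess k)"
  using finite_Ess_independent[OF Ess_finite subset_refl] by blast

lemma Ess_basis: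
  assumes "k \<in> Dom"
  shows "is_basis (vv k ` Ess k) (irrep D k)"
proof -
  have "cv.span (vv k ` Tup) \<subseteq> cv.span (vv k ` Ess k)"
  proof (intro cv.span_minimal cv.subspace_span subsetI)
    fix v assume "v \<in> vv k ` Tup"
    then obtain p where p: "p \<in> Tup" "v = vv k p" by blast
    have "vv k ` {q \<in> Ess k. q = p \<or> mless q p} \<subseteq> vv k ` Ess k" by blast
    from cv.span_mono[OF this] show "v \<in> cv.span (vv k ` Ess k)"
      using vv_in_span_Ess[OF assms p(1)] p(2) by blast
  qed
  moreover have "cv.span (vv k ` Ess k) \<subseteq> cv.span (vv k ` Tup)"
    using Ess_tuples by (intro cv.span_mono) auto
  ultimately show ?thesis
    using finite_Ess_independent[OF Ess_finite subset_refl, of k] Ess_finite irrep_span[OF assms]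
    by (auto simp: is_basis_def)
qed

lemma Ess_image: "sig_vector D ` {\<sigma> \<in> essential D. fst \<sigma> = k} = vv k ` Ess k"
  by (auto simp: Ess_def image_iff)

definition vcoord :: "weight \<Rightarrow> exponent \<Rightarrow> 'v \<Rightarrow> complex" where
  "vcoord k p u = coord (vv k ` Ess k) u (vv k p)"

lemma vcoord_lin: "k \<in> Dom \<Longrightarrow> lin_on (irrep D k) (vcoord k p)"
  unfolding vcoord_def by (rule coord_lin_on[OF Ess_basis])

lemma vcoord_sum:
  assumes "k \<in> Dom" "u \<in> irrep D k"
  shows "(\<Sum>p\<in>Ess k. vcoord k p u *\<^sub>C vv k p) = u"
  using coord_sum[OF Ess_basis[OF assms(1)] assms(2)] by (simp add: vcoord_def sum.reindex[OF Ess_inj])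

lemma vcoord_vv:
  assumes "p \<in> Ess k" "q \<in> Ess k"
  shows "vcoord k p (vv k q) = (if p = q then 1 else 0)"
proof -
  have k: "k \<in> Dom" using assms by (simp add: Ess_iff)
  have "vcoord k p (vv k q) = (if vv k p = vv k q then 1 else 0)"
    unfolding vcoord_def using coord_basis[OF Ess_basis[OF k]] assms(2) by simp
  then show ?thesis using Ess_inj[of k] assms by (auto dest: inj_onD)
qed

text \<open>Triangularity of the coordinates. It is the reason why a coordinate function has no
  terms below its own exponent in its expansion along the orbit.\<close>

lemma vcoord_low:
  assumes "p \<in> Ess k" "mless q p"
  shows "vcoord k p (vv k q) = 0"
proof -
  have k: "k \<in> Dom" and q: "q \<in> Tup" using assms mless_tuples by (auto simp: Ess_iff)
  have "vcoord k p (vv k q) \<in> {0}"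
  proof (rule lin_on_span_into[OF vcoord_lin[OF k] _ _ cv.subspace_single_0 _ vv_in_span_Ess[OF k q]])
    show "vcoord k p ` vv k ` {r \<in> Ess k. r = q \<or> mless r q} \<subseteq> {0}"
      using assms vcoord_vv mless_asym by auto
  qed (use vv_in_irrep[OF k] lie_moduleD(1)[OF irrep_module[OF k]] in auto)
  then show ?thesis by simp
qed

end

section \<open>Polynomials and derivations\<close>

instantiation poly_mapping :: (type, complex_vector) complex_vector
begin
definition scaleC_poly_mapping :: "complex \<Rightarrow> ('a \<Rightarrow>\<^sub>0 'b) \<Rightarrow> 'a \<Rightarrow>\<^sub>0 'b" where
  "scaleC_poly_mapping c f = Poly_Mapping.map (scaleC c) f"
instance
proof
  have l: "Poly_Mapping.lookup (c *\<^sub>C f) k = c *\<^sub>C Poly_Mapping.lookup f k" for c k and f :: "'a \<Rightarrow>\<^sub>0 'b"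
    unfolding scaleC_poly_mapping_def by (simp add: map.rep_eq when_def)
  fix c d and x y :: "'a \<Rightarrow>\<^sub>0 'b"
  show "c *\<^sub>C (x + y) = c *\<^sub>C x + c *\<^sub>C y" "(c + d) *\<^sub>C x = c *\<^sub>C x + d *\<^sub>C x"
    "c *\<^sub>C d *\<^sub>C x = (c * d) *\<^sub>C x" "1 *\<^sub>C x = x"
    by (rule poly_mapping_eqI, simp add: l lookup_add scaleC_add_right scaleC_add_left scaleC_scaleC scaleC_one)+
qed
end

lemma lookup_scaleC [simp]: "Poly_Mapping.lookup (c *\<^sub>C f) k = c *\<^sub>C Poly_Mapping.lookup f k"
  unfolding scaleC_poly_mapping_def by (simp add: map.rep_eq when_def)

lemma scaleC_mpoly: "c *\<^sub>C f = Poly_Mapping.single 0 c * (f :: 'x mpoly)"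
proof -
  have "c *\<^sub>C f = Poly_Mapping.map ((*) c) f" by (rule poly_mapping_eqI) (simp add: map.rep_eq when_def)
  then show ?thesis by (simp add: mult_map_scale_conv_mult)
qed

lemma scaleC_mult: "(c *\<^sub>C f) * g = c *\<^sub>C (f * (g :: 'x mpoly))" "f * (c *\<^sub>C g) = c *\<^sub>C (f * g)"
  by (simp_all add: scaleC_mpoly algebra_simps)

lemma single_scaleC: "Poly_Mapping.single a c = c *\<^sub>C Poly_Mapping.single a (1::complex)"
  by (rule poly_mapping_eqI) (simp add: lookup_single when_def)

lemma keys_scaleC_subset: "Poly_Mapping.keys (c *\<^sub>C f) \<subseteq> Poly_Mapping.keys (f :: 'm \<Rightarrow>\<^sub>0 complex)"
  by (auto simp: in_keys_iff)

text \<open>A linear map on polynomials is stored by its values on monomials. Evaluation,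
  derivations, extraction of components and pairing with functionals are all of this form.\<close>

definition lin_ext :: "('m \<Rightarrow> 'b::complex_vector) \<Rightarrow> ('m \<Rightarrow>\<^sub>0 complex) \<Rightarrow> 'b" where
  "lin_ext F f = (\<Sum>a\<in>Poly_Mapping.keys f. Poly_Mapping.lookup f a *\<^sub>C F a)"

lemma lin_ext_superset:
  "finite S \<Longrightarrow> Poly_Mapping.keys f \<subseteq> S \<Longrightarrow> lin_ext F f = (\<Sum>a\<in>S. Poly_Mapping.lookup f a *\<^sub>C F a)"
  unfolding lin_ext_def by (rule sum.mono_neutral_left) (auto simp: in_keys_iff)

lemma lin_ext_add [simp]: "lin_ext F (f + g) = lin_ext F f + lin_ext F g"
proof -
  let ?S = "Poly_Mapping.keys f \<union> Poly_Mapping.keys g"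
  have "lin_ext F (f + g) = (\<Sum>a\<in>?S. Poly_Mapping.lookup (f + g) a *\<^sub>C F a)"
    using keys_add[of f g] by (intro lin_ext_superset) auto
  also have "\<dots> = lin_ext F f + lin_ext F g"
    by (simp add: lin_ext_superset[of ?S] lookup_add scaleC_add_left sum.distrib)
  finally show ?thesis .
qed

lemma lin_ext_scale [simp]: "lin_ext F (c *\<^sub>C f) = c *\<^sub>C lin_ext F f"
  using lin_ext_superset[of "Poly_Mapping.keys f" "c *\<^sub>C f" F] keys_scaleC_subset[of c f]
  by (simp add: lin_ext_def cv.scale_sum_right)

lemma lin_ext_zero [simp]: "lin_ext F 0 = 0"
  by (simp add: lin_ext_def)

lemma lin_ext_lin: "lin_on UNIV (lin_ext F)"
  by (simp add: lin_on_def)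

lemma lin_ext_diff [simp]: "lin_ext F (f - g) = lin_ext F f - lin_ext F g"
  by (rule lin_on_diff[OF lin_ext_lin cv.subspace_UNIV]) auto

lemma lin_ext_sum: "lin_ext F (\<Sum>i\<in>A. g i) = (\<Sum>i\<in>A. lin_ext F (g i))"
  by (rule lin_on_sum[OF lin_ext_lin cv.subspace_UNIV]) auto

lemma lin_ext_single [simp]: "lin_ext F (Poly_Mapping.single a c) = c *\<^sub>C F a"
  by (simp add: lin_ext_def)

lemma mpoly_expand: "(\<Sum>a\<in>Poly_Mapping.keys f. Poly_Mapping.lookup f a *\<^sub>C Poly_Mapping.single a (1::complex)) = f"
proof (rule poly_mapping_eqI)
  fix b
  have "Poly_Mapping.lookup (\<Sum>a\<in>Poly_Mapping.keys f. Poly_Mapping.lookup f a *\<^sub>C Poly_Mapping.single a (1::complex)) b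
    = (\<Sum>a\<in>Poly_Mapping.keys f. if a = b then Poly_Mapping.lookup f a else 0)"
    unfolding lookup_sum by (intro sum.cong refl) (simp add: lookup_single when_def)
  then show "Poly_Mapping.lookup (\<Sum>a\<in>Poly_Mapping.keys f. Poly_Mapping.lookup f a *\<^sub>C Poly_Mapping.single a (1::complex)) b
    = Poly_Mapping.lookup f b" by (simp add: in_keys_iff)
qed

lemma mpoly_linear_induct [consumes 1, case_names zero add scale single]:
  assumes "Poly_Mapping.keys f \<subseteq> S" and "P 0" and "\<And>f g. P f \<Longrightarrow> P g \<Longrightarrow> P (f + g)"
    and "\<And>c f. P f \<Longrightarrow> P (c *\<^sub>C f)" and "\<And>a. a \<in> S \<Longrightarrow> P (Poly_Mapping.single a (1::complex))"
  shows "P f"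
proof -
  have "P (\<Sum>a\<in>A. Poly_Mapping.lookup f a *\<^sub>C Poly_Mapping.single a 1)" if "finite A" "A \<subseteq> S" for A
    using that by (induction A) (auto intro: assms)
  then show ?thesis using mpoly_expand[of f] assms(1) finite_keys[of f] by metis
qed

definition mono_eval :: "('x \<Rightarrow>\<^sub>0 nat) \<Rightarrow> ('x \<Rightarrow> complex) \<Rightarrow> complex" where
  "mono_eval a v = (\<Prod>x\<in>Poly_Mapping.keys a. v x ^ Poly_Mapping.lookup a x)"

lemma mpoly_eval_lin_ext: "mpoly_eval f v = lin_ext (\<lambda>a. mono_eval a v) f"
  by (simp add: mpoly_eval_def lin_ext_def mono_eval_def)

lemma mono_eval_superset:
  "finite S \<Longrightarrow> Poly_Mapping.keys a \<subseteq> S \<Longrightarrow> mono_eval a v = (\<Prod>x\<in>S. v x ^ Poly_Mapping.lookup a x)"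
  unfolding mono_eval_def by (rule prod.mono_neutral_left) (auto simp: in_keys_iff)

lemma mono_eval_add: "mono_eval (a + b) v = mono_eval a v * mono_eval b v"
proof -
  let ?S = "Poly_Mapping.keys a \<union> Poly_Mapping.keys b"
  have "mono_eval (a + b) v = (\<Prod>x\<in>?S. v x ^ Poly_Mapping.lookup (a + b) x)"
    using keys_add[of a b] by (intro mono_eval_superset) auto
  then show ?thesis
    by (simp add: mono_eval_superset[of ?S] lookup_add power_add prod.distrib)
qed

lemma mono_eval_zero [simp]: "mono_eval 0 v = 1"
  by (simp add: mono_eval_def)

lemma mono_eval_single [simp]: "mono_eval (Poly_Mapping.single x n) v = v x ^ n"
  by (cases "n = 0") (simp_all add: mono_eval_def)

lemma mpoly_eval_simps [simp]:
  "mpoly_eval 0 v = 0" "mpoly_eval (f + g) v = mpoly_eval f v + mpoly_eval g v"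
  "mpoly_eval (c *\<^sub>C f) v = c * mpoly_eval f v" "mpoly_eval (f - g) v = mpoly_eval f v - mpoly_eval g v"
  "mpoly_eval (Poly_Mapping.single a c) v = c * mono_eval a v"
  by (simp_all add: mpoly_eval_lin_ext)

lemma mpoly_eval_sum: "mpoly_eval (\<Sum>i\<in>A. g i) v = (\<Sum>i\<in>A. mpoly_eval (g i) v)"
  by (simp add: mpoly_eval_lin_ext lin_ext_sum)

lemma mpoly_eval_mult [simp]: "mpoly_eval (f * g) v = mpoly_eval f v * mpoly_eval g v"
proof (rule mpoly_linear_induct[of f UNIV])
  show "mpoly_eval (Poly_Mapping.single a 1 * g) v = mpoly_eval (Poly_Mapping.single a 1) v * mpoly_eval g v" for a
    by (rule mpoly_linear_induct[of g UNIV])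
      (simp_all add: mult_single mono_eval_add algebra_simps scaleC_mult del: scaleC_complex_eq)
qed (simp_all add: algebra_simps scaleC_mult)

abbreviation var :: "'x \<Rightarrow> 'x mpoly" where
  "var x \<equiv> Poly_Mapping.single (Poly_Mapping.single x 1) 1"

definition polys :: "'x set \<Rightarrow> 'x mpoly set" where
  "polys X = {f. \<forall>a\<in>Poly_Mapping.keys f. Poly_Mapping.keys a \<subseteq> X}"

lemma polys_keys: "f \<in> polys X \<longleftrightarrow> Poly_Mapping.keys f \<subseteq> {a. Poly_Mapping.keys a \<subseteq> X}"
  by (auto simp: polys_def)

lemma polys_zero [simp]: "0 \<in> polys X"
  and polys_add: "f \<in> polys X \<Longrightarrow> g \<in> polys X \<Longrightarrow> f + g \<in> polys X"
  and polys_scale: "f \<in> polys X \<Longrightarrow> c *\<^sub>C f \<in> polys X"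
  and polys_single: "Poly_Mapping.keys a \<subseteq> X \<Longrightarrow> Poly_Mapping.single a c \<in> polys X"
  using keys_add[of f g] keys_scaleC_subset[of c f] by (auto simp: polys_def split: if_splits)

lemma polys_mult: 
  assumes "f \<in> polys X" "g \<in> polys X"
  shows "f * g \<in> polys X"
  unfolding polys_def
proof clarify
  fix c x assume c: "c \<in> Poly_Mapping.keys (f * g)" and x: "x \<in> Poly_Mapping.keys c"
  obtain a b where "a \<in> Poly_Mapping.keys f" "b \<in> Poly_Mapping.keys g" "c = a + b"
    using subsetD[OF keys_mult c] by blast
  then show "x \<in> X" using x keys_add[of a b] assms by (auto simp: polys_def)
qed

lemma polys_subspace: "cv.subspace (polys X)"
  by (auto simp: cv.subspace_def polys_add polys_scale)

definition tdeg :: "('x \<Rightarrow>\<^sub>0 nat) \<Rightarrow> nat" where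
  "tdeg a = (\<Sum>x\<in>Poly_Mapping.keys a. Poly_Mapping.lookup a x)"

lemma tdeg_superset:
  "finite S \<Longrightarrow> Poly_Mapping.keys a \<subseteq> S \<Longrightarrow> tdeg a = (\<Sum>x\<in>S. Poly_Mapping.lookup a x)"
  unfolding tdeg_def by (rule sum.mono_neutral_left) (auto simp: in_keys_iff)

lemma tdeg_add: "tdeg (a + b) = tdeg a + tdeg b"
proof -
  let ?S = "Poly_Mapping.keys a \<union> Poly_Mapping.keys b"
  have "tdeg (a + b) = (\<Sum>x\<in>?S. Poly_Mapping.lookup (a + b) x)"
    using keys_add[of a b] by (intro tdeg_superset) auto
  then show ?thesis by (simp add: tdeg_superset[of ?S] lookup_add sum.distrib)
qed

lemma tdeg_single [simp]: "tdeg (Poly_Mapping.single x n) = n"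
  by (cases "n = 0") (simp_all add: tdeg_def)

lemma remove_var:
  assumes "x \<in> Poly_Mapping.keys (a :: 'x \<Rightarrow>\<^sub>0 nat)"
  shows "a = (a - Poly_Mapping.single x 1) + Poly_Mapping.single x 1"
  using assms by (intro poly_mapping_eqI) (auto simp: lookup_add lookup_minus lookup_single when_def in_keys_iff)

lemma keys_remove_var: "Poly_Mapping.keys (a - Poly_Mapping.single x 1) \<subseteq> Poly_Mapping.keys (a :: 'x \<Rightarrow>\<^sub>0 nat)"
  by (auto simp: in_keys_iff lookup_minus)

lemma monomial_induct [consumes 1, case_names zero var]:
  assumes "Poly_Mapping.keys (a :: 'x \<Rightarrow>\<^sub>0 nat) \<subseteq> X" and "P 0"
    and "\<And>a x. Poly_Mapping.keys a \<subseteq> X \<Longrightarrow> x \<in> X \<Longrightarrow> P a \<Longrightarrow> P (a + Poly_Mapping.single x 1)"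
  shows "P a"
  using assms(1)
proof (induction "tdeg a" arbitrary: a rule: less_induct)
  case less
  show ?case
  proof (cases "a = 0")
    case False
    then obtain x where x: "x \<in> Poly_Mapping.keys a" by (metis poly_mapping_eqI lookup_zero in_keys_iff)
    define b where "b = a - Poly_Mapping.single x 1"
    have ab: "a = b + Poly_Mapping.single x 1" unfolding b_def by (rule remove_var[OF x])
    have b: "Poly_Mapping.keys b \<subseteq> X" using keys_remove_var[of a x] less.prems by (auto simp: b_def)
    have "tdeg b < tdeg a" by (simp add: ab tdeg_add)
    then have "P b" using less.hyps b by blast
    then show ?thesis unfolding ab using assms(3)[OF b] x less.prems by blast
  qed (use assms(2) in simp)
qed

lemma mpoly_ring_induct [consumes 1, case_names const var add mult]:
  assumes "f \<in> polys X" and "\<And>c. P (Poly_Mapping.single 0 c)" and "\<And>x. x \<in> X \<Longrightarrow> P (var x)"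
    and "\<And>f g. f \<in> polys X \<Longrightarrow> g \<in> polys X \<Longrightarrow> P f \<Longrightarrow> P g \<Longrightarrow> P (f + g)"
    and "\<And>f g. f \<in> polys X \<Longrightarrow> g \<in> polys X \<Longrightarrow> P f \<Longrightarrow> P g \<Longrightarrow> P (f * g)"
  shows "P f"
proof -
  have mon: "P (Poly_Mapping.single a 1)" if "Poly_Mapping.keys a \<subseteq> X" for a
    using that
  proof (induction a rule: monomial_induct)
    case zero
    show ?case by (rule assms(2))
  next
    case (var a x)
    then have "P (Poly_Mapping.single a 1 * Poly_Mapping.single (Poly_Mapping.single x 1) 1)"
      by (intro assms(5) assms(3) polys_single) auto
    then show ?case by (simp add: mult_single)
  qed
  have "f \<in> polys X \<and> P f"
    using assms(1) unfolding polys_keys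
  proof (induction f rule: mpoly_linear_induct)
    case zero
    show ?case using assms(2)[of 0] by simp
  next
    case (add f g)
    then show ?case using assms(4) polys_add[of f X g] unfolding polys_keys by blast
  next
    case (scale c f)
    then have f: "f \<in> polys X" "P f" by (auto simp: polys_keys)
    have "P (c *\<^sub>C f)" unfolding scaleC_mpoly by (rule assms(5)) (auto simp: f assms(2) polys_single)
    then show ?case using polys_scale[OF f(1)] by (simp add: polys_keys)
  next
    case (single a)
    then show ?case using mon by auto
  qed
  then show ?thesis ..
qed

text \<open>The Leibniz rule. Truncated subtraction does no harm: the sum runs over variables that
  occur in \<open>a\<close>.\<close>

definition mono_deriv :: "('x \<Rightarrow> 'x mpoly) \<Rightarrow> ('x \<Rightarrow>\<^sub>0 nat) \<Rightarrow> 'x mpoly" where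
  "mono_deriv \<delta> a = (\<Sum>x\<in>Poly_Mapping.keys a.
     of_nat (Poly_Mapping.lookup a x) *\<^sub>C (Poly_Mapping.single (a - Poly_Mapping.single x 1) 1 * \<delta> x))"

definition deriv_of :: "('x \<Rightarrow> 'x mpoly) \<Rightarrow> 'x mpoly \<Rightarrow> 'x mpoly" where
  "deriv_of \<delta> = lin_ext (mono_deriv \<delta>)"

lemma mono_deriv_superset:
  "finite S \<Longrightarrow> Poly_Mapping.keys a \<subseteq> S \<Longrightarrow> mono_deriv \<delta> a = (\<Sum>x\<in>S.
     of_nat (Poly_Mapping.lookup a x) *\<^sub>C (Poly_Mapping.single (a - Poly_Mapping.single x 1) 1 * \<delta> x))"
  unfolding mono_deriv_def by (rule sum.mono_neutral_left) (auto simp: in_keys_iff)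

lemma mono_deriv_add:
  "mono_deriv \<delta> (a + b) = Poly_Mapping.single a 1 * mono_deriv \<delta> b + Poly_Mapping.single b 1 * mono_deriv \<delta> a"
proof -
  let ?S = "Poly_Mapping.keys a \<union> Poly_Mapping.keys b"
  have *: "Poly_Mapping.single b 1 * (of_nat (Poly_Mapping.lookup a x) *\<^sub>C (Poly_Mapping.single (a - Poly_Mapping.single x 1) 1 * \<delta> x))
      = of_nat (Poly_Mapping.lookup a x) *\<^sub>C (Poly_Mapping.single (a + b - Poly_Mapping.single x 1) 1 * \<delta> x)" for a b x
  proof (cases "x \<in> Poly_Mapping.keys a")
    case True
    then have "b + (a - Poly_Mapping.single x 1) = a + b - Poly_Mapping.single x 1"
      by (intro poly_mapping_eqI) (auto simp: lookup_add lookup_minus lookup_single when_def in_keys_iff)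
    then have "Poly_Mapping.single b 1 * Poly_Mapping.single (a - Poly_Mapping.single x 1) 1
        = Poly_Mapping.single (a + b - Poly_Mapping.single x 1) (1::complex)" by (simp add: mult_single)
    then show ?thesis by (simp add: scaleC_mult mult.assoc[symmetric])
  qed (simp add: in_keys_iff)
  have "mono_deriv \<delta> (a + b) = (\<Sum>x\<in>?S.
     of_nat (Poly_Mapping.lookup (a + b) x) *\<^sub>C (Poly_Mapping.single (a + b - Poly_Mapping.single x 1) 1 * \<delta> x))"
    using keys_add[of a b] by (intro mono_deriv_superset) auto
  also have "\<dots> = Poly_Mapping.single b 1 * mono_deriv \<delta> a + Poly_Mapping.single a 1 * mono_deriv \<delta> b"
    using *[of b a] *[of a b]
    by (simp add: mono_deriv_superset[of ?S] lookup_add scaleC_add_left sum.distrib sum_distrib_left add.commute[of b a])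
  finally show ?thesis by simp
qed

lemma deriv_of_simps [simp]:
  "deriv_of \<delta> 0 = 0" "deriv_of \<delta> (f + g) = deriv_of \<delta> f + deriv_of \<delta> g"
  "deriv_of \<delta> (c *\<^sub>C f) = c *\<^sub>C deriv_of \<delta> f" "deriv_of \<delta> (f - g) = deriv_of \<delta> f - deriv_of \<delta> g"
  by (simp_all add: deriv_of_def)

lemma deriv_of_sum: "deriv_of \<delta> (\<Sum>i\<in>A. g i) = (\<Sum>i\<in>A. deriv_of \<delta> (g i))"
  by (simp add: deriv_of_def lin_ext_sum)

lemma deriv_of_single: "deriv_of \<delta> (Poly_Mapping.single a c) = c *\<^sub>C mono_deriv \<delta> a"
  by (simp add: deriv_of_def)

lemma deriv_of_var: "deriv_of \<delta> (var x) = \<delta> x"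
  by (simp add: deriv_of_single mono_deriv_def)

lemmas [simp] = deriv_of_var deriv_of_var[unfolded One_nat_def]

lemma deriv_of_const [simp]: "deriv_of \<delta> (Poly_Mapping.single 0 c) = 0"
  by (simp add: deriv_of_single mono_deriv_def)

lemma deriv_of_mult: "deriv_of \<delta> (f * g) = f * deriv_of \<delta> g + deriv_of \<delta> f * g"
proof (rule mpoly_linear_induct[of f UNIV])
  show "deriv_of \<delta> (Poly_Mapping.single a 1 * g) = Poly_Mapping.single a 1 * deriv_of \<delta> g + deriv_of \<delta> (Poly_Mapping.single a 1) * g" for a
    by (rule mpoly_linear_induct[of g UNIV])
      (simp_all add: mult_single mono_deriv_add deriv_of_single algebra_simps scaleC_mult cv.scale_right_distrib)
qed (simp_all add: algebra_simps scaleC_mult cv.scale_right_distrib)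

lemma deriv_of_polys:
  assumes "\<And>x. x \<in> X \<Longrightarrow> \<delta> x \<in> polys X" "f \<in> polys X"
  shows "deriv_of \<delta> f \<in> polys X"
  using assms(2) by (induction f rule: mpoly_ring_induct) (auto simp: deriv_of_mult polys_add polys_mult assms(1))

text \<open>The divided powers of a derivation multiply like the coefficients of the exponential
  series, which is an automorphism in a formal parameter.\<close>

lemma deriv_power_sum:
  fixes Dv :: "'x mpoly \<Rightarrow> 'x mpoly"
  assumes add: "\<And>f g. Dv (f + g) = Dv f + Dv g" and scale: "\<And>c f. Dv (c *\<^sub>C f) = c *\<^sub>C Dv f"
    and mult: "\<And>f g. Dv (f * g) = f * Dv g + Dv f * g"
  shows "(1 / fact n) *\<^sub>C (Dv ^^ n) (f * g) =
    (\<Sum>k\<le>n. ((1 / fact k) *\<^sub>C (Dv ^^ k) f) * ((1 / fact (n - k)) *\<^sub>C (Dv ^^ (n - k)) g))"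
proof -
  have sum: "Dv (\<Sum>i\<in>A. h i) = (\<Sum>i\<in>A. Dv (h i))" for A :: "nat set" and h
    using lin_on_sum[of UNIV Dv A h] add scale by (simp add: lin_on_def)
  have "(Dv ^^ n) (f * g) = (\<Sum>k\<le>n. of_nat (n choose k) *\<^sub>C ((Dv ^^ k) f * (Dv ^^ (n - k)) g))"
  proof (induction n)
    case (Suc n)
    let ?t = "\<lambda>k l. (Dv ^^ k) f * (Dv ^^ l) g"
    have "(Dv ^^ Suc n) (f * g) = (\<Sum>k\<le>n. of_nat (n choose k) *\<^sub>C (?t k (Suc n - k) + ?t (Suc k) (n - k)))"
      by (simp add: Suc sum scale mult Suc_diff_le)
    also have "\<dots> = (\<Sum>k\<le>n. of_nat (n choose k) *\<^sub>C ?t k (Suc n - k)) + (\<Sum>k\<le>n. of_nat (n choose k) *\<^sub>C ?t (Suc k) (n - k))"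
      by (simp add: cv.scale_right_distrib sum.distrib)
    also have "(\<Sum>k\<le>n. of_nat (n choose k) *\<^sub>C ?t k (Suc n - k)) = (\<Sum>k\<le>Suc n. of_nat (n choose k) *\<^sub>C ?t k (Suc n - k))"
      by simp
    also have "\<dots> = ?t 0 (Suc n) + (\<Sum>k\<le>n. of_nat (n choose Suc k) *\<^sub>C ?t (Suc k) (n - k))"
      by (subst sum.atMost_Suc_shift) simp
    finally have "(Dv ^^ Suc n) (f * g) = ?t 0 (Suc n) + (\<Sum>k\<le>n. of_nat (Suc n choose Suc k) *\<^sub>C ?t (Suc k) (n - k))"
      by (simp add: scaleC_add_left sum.distrib algebra_simps)
    also have "\<dots> = (\<Sum>k\<le>Suc n. of_nat (Suc n choose k) *\<^sub>C ?t k (Suc n - k))"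
      by (simp only: sum.atMost_Suc_shift) simp
    finally show ?case .
  qed simp
  moreover have "(1 / fact n) * of_nat (n choose k) = (1 / fact k) * (1 / fact (n - k) :: complex)" if "k \<le> n" for k
    using binomial_fact[OF that, where 'a=complex] by simp
  ultimately show ?thesis
    by (simp add: cv.scale_sum_right scaleC_mult mult.commute)
qed

section \<open>The Lie algebra action on the coordinate ring\<close>

declare One_nat_def [simp del]

lemma deriv_of_one [simp]: "deriv_of \<delta> 1 = 0"
  using deriv_of_const[of \<delta> 1] by simp

lemma mpoly_eval_one [simp]: "mpoly_eval 1 v = 1"
  using mpoly_eval_simps(5)[of 0 1 v] by (simp del: mpoly_eval_simps(5))

lemma lie_module_foldr:
  assumes "lie_module V \<rho>"
  shows "u \<in> V \<Longrightarrow> foldr \<rho> xs u \<in> V"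
    and "u \<in> V \<Longrightarrow> w \<in> V \<Longrightarrow> foldr \<rho> xs (u + w) = foldr \<rho> xs u + foldr \<rho> xs w"
    and "u \<in> V \<Longrightarrow> foldr \<rho> xs (c *\<^sub>C u) = c *\<^sub>C foldr \<rho> xs u"
    and "foldr \<rho> xs 0 = 0"
proof -
  show V: "u \<in> V \<Longrightarrow> foldr \<rho> xs u \<in> V" for u xs by (induction xs) (auto simp: lie_moduleD[OF assms])
  show "u \<in> V \<Longrightarrow> w \<in> V \<Longrightarrow> foldr \<rho> xs (u + w) = foldr \<rho> xs u + foldr \<rho> xs w"
    by (induction xs) (auto simp: lie_moduleD[OF assms] V)
  show "u \<in> V \<Longrightarrow> foldr \<rho> xs (c *\<^sub>C u) = c *\<^sub>C foldr \<rho> xs u"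
    by (induction xs) (auto simp: lie_moduleD[OF assms] V)
  show "foldr \<rho> xs 0 = 0" by (induction xs) (auto simp: lie_module_zero_right[OF assms])
qed

locale embedding = rep_data D for D :: "('g::complex_lie_algebra, 'v::complex_vector) lie_setup" +
  fixes lam :: "nat \<Rightarrow> weight" and m :: nat
  assumes lam: "\<And>j. j < m \<Longrightarrow> lam j \<in> dominant_weights D"
begin

abbreviation "X \<equiv> coord_vars D lam m"

lemma X_iff: "(j, p) \<in> X \<longleftrightarrow> j < m \<and> p \<in> Ess (lam j)"
  by (simp add: coord_vars_def Ess_def)

lemma X_finite: "finite X"
proof -
  have "X = (SIGMA j:{..<m}. Ess (lam j))" by (auto simp: X_iff)
  then show ?thesis using Ess_finite by auto
qed

lemma coord_ring_polys: "coord_ring D lam m = polys X"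
  by (simp add: coord_ring_def polys_def)

lemma sum_const_add: "(\<Sum>_<x + (y::nat). c) = (\<Sum>_<x. c) + (\<Sum>_<y. (c::'c::comm_monoid_add))"
  by (induction y) (auto simp: algebra_simps)

lemma monomial_sign_superset:
  "finite S \<Longrightarrow> Poly_Mapping.keys a \<subseteq> S \<Longrightarrow>
   monomial_sign lam a = (\<Sum>z\<in>S. \<Sum>_<Poly_Mapping.lookup a z. (lam (fst z), snd z))"
  unfolding monomial_sign_def by (rule sum.mono_neutral_cong_left) (auto simp: in_keys_iff)

lemma monomial_sign_add: "monomial_sign lam (a + b) = monomial_sign lam a + monomial_sign lam b"
proof -
  let ?S = "Poly_Mapping.keys a \<union> Poly_Mapping.keys b"
  have "monomial_sign lam (a + b) = (\<Sum>z\<in>?S. \<Sum>_<Poly_Mapping.lookup (a + b) z. (lam (fst z), snd z))"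
    using keys_add[of a b] by (intro monomial_sign_superset) auto
  then show ?thesis
    by (simp only: monomial_sign_superset[of ?S a] monomial_sign_superset[of ?S b] finite_Un finite_keys
        Un_upper1 Un_upper2 lookup_add sum_const_add sum.distrib simp_thms)
qed

lemma monomial_sign_zero [simp]: "monomial_sign lam 0 = 0"
  by (simp add: monomial_sign_def)

lemma monomial_sign_single [simp]: "monomial_sign lam (Poly_Mapping.single (j, p) 1) = (lam j, p)"
  by (simp add: monomial_sign_def One_nat_def)

definition wt :: "(nat \<times> exponent \<Rightarrow>\<^sub>0 nat) \<Rightarrow> weight" where
  "wt a = fst (monomial_sign lam a)"

lemma wt_simps [simp]: "wt 0 = 0" "wt (a + b) = wt a + wt b" "wt (Poly_Mapping.single (j, p) 1) = lam j"
  by (simp_all add: wt_def monomial_sign_add)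

lemma zero_Dom: "0 \<in> Dom"
  by (simp add: dominant_weights_def tuples_def)

lemma add_Dom: "k \<in> Dom \<Longrightarrow> l \<in> Dom \<Longrightarrow> k + l \<in> Dom"
  using keys_add[of k l] by (auto simp: dominant_weights_def tuples_def)

lemma sign_signature:
  assumes "Poly_Mapping.keys a \<subseteq> X"
  shows "wt a \<in> Dom" "snd (monomial_sign lam a) \<in> Tup"
proof -
  have "wt a \<in> Dom \<and> snd (monomial_sign lam a) \<in> Tup"
    using assms
  proof (induction a rule: monomial_induct)
    case zero
    show ?case by (simp add: zero_Dom) (simp add: tuples_def)
  next
    case (var a x)
    then obtain j p where x: "x = (j, p)" "j < m" "p \<in> Ess (lam j)" by (cases x) (simp add: X_iff)
    have "wt (a + Poly_Mapping.single x 1) = wt a + lam j" unfolding x(1) by (simp only: wt_simps)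
    moreover have "snd (monomial_sign lam (a + Poly_Mapping.single x 1)) = snd (monomial_sign lam a) + p"
      unfolding x(1) monomial_sign_add monomial_sign_single by simp
    ultimately show ?case using var.IH add_Dom[OF _ lam[OF x(2)]] tuples_add[OF _ Ess_tuples[OF x(3)]] by simp
  qed
  then show "wt a \<in> Dom" "snd (monomial_sign lam a) \<in> Tup" by auto
qed

lemma weight_fun_add: "weight_fun D (k + l) h = weight_fun D k h + weight_fun D l h"
  by (simp add: weight_fun_def lookup_add algebra_simps sum.distrib)

text \<open>The linear form that sends \<open>w\<close> to the coordinate \<open>q\<close> of
  \<open>T (w j)\<close>, written in the coordinate functions.\<close>

definition linf :: "nat \<Rightarrow> exponent \<Rightarrow> ('v \<Rightarrow> 'v) \<Rightarrow> (nat \<times> exponent) mpoly" where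
  "linf j q T = (\<Sum>r\<in>Ess (lam j). vcoord (lam j) q (T (vv (lam j) r)) *\<^sub>C var (j, r))"

text \<open>The derivative of a coordinate function along the linear vector field given by the
  action of \<open>x\<close> on the direct sum.\<close>

definition \<delta> :: "'g \<Rightarrow> nat \<times> exponent \<Rightarrow> (nat \<times> exponent) mpoly" where
  "\<delta> x = (\<lambda>(j, q). linf j q (action D (lam j) x))"

abbreviation "Dx x \<equiv> deriv_of (\<delta> x)"

definition endo :: "weight \<Rightarrow> ('v \<Rightarrow> 'v) \<Rightarrow> bool" where
  "endo k T \<longleftrightarrow> lin_on (irrep D k) T \<and> T ` irrep D k \<subseteq> irrep D k"

lemma endo_action: "k \<in> Dom \<Longrightarrow> endo k (action D k x)"
  using lie_moduleD(2,3)[OF irrep_module] by (auto simp: endo_def)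

lemma endo_compose: "endo k S \<Longrightarrow> endo k T \<Longrightarrow> endo k (\<lambda>u. S (T u))"
  unfolding endo_def using lin_on_compose[of "irrep D k" T "irrep D k" S] by blast

lemma endo_id: "endo k (\<lambda>u. u)"
  by (simp add: endo_def lin_on_def)

lemma endo_power: "endo k T \<Longrightarrow> endo k (T ^^ n)"
proof (induction n)
  case 0
  show ?case by (simp add: endo_def lin_on_def)
next
  case (Suc n)
  then show ?case using endo_compose[of k T "T ^^ n"] by (simp add: o_def)
qed

lemma irrep_subspace: "k \<in> Dom \<Longrightarrow> cv.subspace (irrep D k)"
  by (rule lie_moduleD(1)[OF irrep_module])

lemma endo_scale: "k \<in> Dom \<Longrightarrow> endo k T \<Longrightarrow> endo k (\<lambda>u. c *\<^sub>C T u)"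
  using cv.subspace_scale[OF irrep_subspace] by (auto simp: endo_def lin_on_def cv.scale_right_distrib mult.commute)

lemma vcoord_endo:
  assumes "k \<in> Dom" "endo k T" "u \<in> irrep D k"
  shows "vcoord k q (T u) = (\<Sum>r\<in>Ess k. vcoord k r u * vcoord k q (T (vv k r)))"
proof -
  have vi: "\<And>r. vv k r \<in> irrep D k" by (rule vv_in_irrep[OF assms(1)])
  have "lin_on (irrep D k) (\<lambda>u. vcoord k q (T u))"
    using assms(2) by (intro lin_on_compose[OF _ vcoord_lin[OF assms(1)]]) (auto simp: endo_def)
  from lin_on_sum_scale[where A="Ess k" and g="vv k" and c="\<lambda>r. vcoord k r u", OF this irrep_subspace[OF assms(1)] vi]
  show ?thesis by (simp add: vcoord_sum[OF assms(1,3)])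
qed

lemma linf_polys: "j < m \<Longrightarrow> linf j q T \<in> polys X"
  unfolding linf_def by (intro cv.subspace_sum[OF polys_subspace] polys_scale polys_single) (simp add: X_iff)

lemma linf_eval:
  assumes "j < m" "endo (lam j) T" "w j \<in> irrep D (lam j)"
  shows "mpoly_eval (linf j q T) (coords D lam w) = vcoord (lam j) q (T (w j))"
  unfolding vcoord_endo[OF lam[OF assms(1)] assms(2,3)]
  by (simp add: linf_def mpoly_eval_sum coords_def Ess_image vcoord_def mult.commute)

lemma coords_eq: "coords D lam w (j, q) = vcoord (lam j) q (w j)"
  by (simp add: coords_def Ess_image vcoord_def)

lemma linf_id:
  assumes "(j, q) \<in> X"
  shows "linf j q (\<lambda>u. u) = var (j, q)"
proof -
  have q: "q \<in> Ess (lam j)" using assms by (simp add: X_iff)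
  have "linf j q (\<lambda>u. u) = (\<Sum>r\<in>Ess (lam j). if r = q then var (j, r) else 0)"
    unfolding linf_def using vcoord_vv[OF q] by (intro sum.cong) auto
  then show ?thesis using q Ess_finite by simp
qed

lemma Dx_linf:
  assumes "j < m" "endo (lam j) T"
  shows "Dx x (linf j q T) = linf j q (\<lambda>u. T (action D (lam j) x u))"
proof -
  note k = lam[OF assms(1)]
  let ?c = "\<lambda>r. vcoord (lam j) q (T (vv (lam j) r))"
  let ?d = "\<lambda>r s. vcoord (lam j) r (action D (lam j) x (vv (lam j) s))"
  have "Dx x (linf j q T) = (\<Sum>r\<in>Ess (lam j). \<Sum>s\<in>Ess (lam j). (?c r * ?d r s) *\<^sub>C var (j, s))"
    by (simp add: linf_def deriv_of_sum \<delta>_def cv.scale_sum_right)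
  also have "\<dots> = (\<Sum>s\<in>Ess (lam j). (\<Sum>r\<in>Ess (lam j). ?d r s * ?c r) *\<^sub>C var (j, s))"
    by (subst sum.swap) (simp add: cv.scale_sum_left mult.commute)
  also have "\<dots> = linf j q (\<lambda>u. T (action D (lam j) x u))"
    unfolding linf_def
    using vcoord_endo[OF k assms(2) lie_moduleD(2)[OF irrep_module[OF k] vv_in_irrep[OF k]]] by simp
  finally show ?thesis .
qed

lemma \<delta>_polys: "x \<in> X \<Longrightarrow> \<delta> y x \<in> polys X"
  by (cases x) (simp add: \<delta>_def X_iff linf_polys)

lemma Dx_polys: "f \<in> polys X \<Longrightarrow> Dx x f \<in> polys X"
  by (rule deriv_of_polys[OF \<delta>_polys])

lemma Dx_var: "(j, q) \<in> X \<Longrightarrow> Dx x (var (j, q)) = linf j q (action D (lam j) x)"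
  unfolding deriv_of_var by (simp add: \<delta>_def)

lemma linf_cong: "(\<And>r. r \<in> Ess (lam j) \<Longrightarrow> T (vv (lam j) r) = S (vv (lam j) r)) \<Longrightarrow> linf j q T = linf j q S"
  unfolding linf_def by (intro sum.cong) auto

lemma linf_combine:
  assumes "j < m" "endo (lam j) S" "endo (lam j) T"
  shows "linf j q (\<lambda>u. S u + T u) = linf j q S + linf j q T" "linf j q (\<lambda>u. S u - T u) = linf j q S - linf j q T"
    "linf j q (\<lambda>u. c *\<^sub>C T u) = c *\<^sub>C linf j q T"
proof -
  note k = lam[OF assms(1)]
  have i: "S (vv (lam j) r) \<in> irrep D (lam j)" "T (vv (lam j) r) \<in> irrep D (lam j)" for r
    using vv_in_irrep[OF k] assms(2,3) by (auto simp: endo_def)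
  note L = vcoord_lin[OF k, of q]
  show "linf j q (\<lambda>u. S u + T u) = linf j q S + linf j q T"
    unfolding linf_def by (simp add: lin_onD(1)[OF L i] scaleC_add_left sum.distrib)
  show "linf j q (\<lambda>u. S u - T u) = linf j q S - linf j q T"
    unfolding linf_def by (simp add: lin_on_diff[OF L irrep_subspace[OF k] i] cv.scale_left_diff_distrib sum_subtractf)
  show "linf j q (\<lambda>u. c *\<^sub>C T u) = c *\<^sub>C linf j q T"
    unfolding linf_def by (simp add: lin_onD(2)[OF L i(2)] cv.scale_sum_right)
qed

lemma Dx_add:
  assumes "f \<in> polys X"
  shows "Dx (x + y) f = Dx x f + Dx y f"
  using assms
proof (induction f rule: mpoly_ring_induct)
  case (var z)
  then obtain j q where z: "z = (j, q)" "j < m" "(j, q) \<in> X" by (cases z) (auto simp: X_iff)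
  note k = lam[OF z(2)]
  have "linf j q (action D (lam j) (x + y)) = linf j q (\<lambda>u. action D (lam j) x u + action D (lam j) y u)"
    using lie_moduleD(6)[OF irrep_module[OF k] vv_in_irrep[OF k]] by (intro linf_cong) simp
  then show ?case unfolding z(1) Dx_var[OF z(3)] using linf_combine(1)[OF z(2) endo_action[OF k] endo_action[OF k]] by simp
qed (simp_all add: deriv_of_mult algebra_simps)

lemma Dx_scale:
  assumes "f \<in> polys X"
  shows "Dx (c *\<^sub>C x) f = c *\<^sub>C Dx x f"
  using assms
proof (induction f rule: mpoly_ring_induct)
  case (var z)
  then obtain j q where z: "z = (j, q)" "j < m" "(j, q) \<in> X" by (cases z) (auto simp: X_iff)
  note k = lam[OF z(2)]
  have "linf j q (action D (lam j) (c *\<^sub>C x)) = linf j q (\<lambda>u. c *\<^sub>C action D (lam j) x u)"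
    using lie_moduleD(7)[OF irrep_module[OF k] vv_in_irrep[OF k]] by (intro linf_cong) simp
  then show ?case unfolding z(1) Dx_var[OF z(3)] using linf_combine(3)[OF z(2) endo_action[OF k] endo_action[OF k]] by simp
qed (simp_all add: deriv_of_mult scaleC_mult cv.scale_right_distrib)

text \<open>The order is reversed because differentiation composes a linear form with the action on
  the right, as in \<open>Dx_linf\<close>. Both sides are derivations, so the variables
  decide.\<close>

lemma Dx_bracket:
  assumes "f \<in> polys X"
  shows "Dx (bracket x y) f = Dx y (Dx x f) - Dx x (Dx y f)"
  using assms
proof (induction f rule: mpoly_ring_induct)
  case (var z)
  then obtain j q where z: "z = (j, q)" "j < m" "(j, q) \<in> X" by (cases z) (auto simp: X_iff)
  note k = lam[OF z(2)]
  let ?\<rho> = "action D (lam j)"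
  have "linf j q (?\<rho> (bracket x y)) = linf j q (\<lambda>u. ?\<rho> x (?\<rho> y u) - ?\<rho> y (?\<rho> x u))"
    using lie_moduleD(8)[OF irrep_module[OF k] vv_in_irrep[OF k]] by (intro linf_cong) simp
  also have "\<dots> = linf j q (\<lambda>u. ?\<rho> x (?\<rho> y u)) - linf j q (\<lambda>u. ?\<rho> y (?\<rho> x u))"
    by (rule linf_combine(2)[OF z(2) endo_compose[OF endo_action[OF k] endo_action[OF k]]
          endo_compose[OF endo_action[OF k] endo_action[OF k]]])
  finally show ?case unfolding z(1) Dx_var[OF z(3)] Dx_linf[OF z(2) endo_action[OF k]] .
next
  case (mult f g)
  show ?case unfolding deriv_of_mult deriv_of_simps mult.IH by (simp add: algebra_simps)
qed (simp_all add: algebra_simps)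

subsection \<open>The dual module\<close>

definition homog :: "nat \<Rightarrow> weight \<Rightarrow> (nat \<times> exponent) mpoly set" where
  "homog t k = {f. Poly_Mapping.keys f \<subseteq> {b. Poly_Mapping.keys b \<subseteq> X \<and> tdeg b = t \<and> wt b = k}}"

lemma homog_subspace: "cv.subspace (homog t k)"
proof (rule cv.subspaceI)
  show "f + g \<in> homog t k" if "f \<in> homog t k" "g \<in> homog t k" for f g
    using that keys_add[of f g] unfolding homog_def by blast
  show "c *\<^sub>C f \<in> homog t k" if "f \<in> homog t k" for c f
    using that keys_scaleC_subset[of c f] unfolding homog_def by blast
qed (simp add: homog_def)

lemma homog_mult:
  assumes "f \<in> homog t k" "g \<in> homog t' k'"
  shows "f * g \<in> homog (t + t') (k + k')"
  unfolding homog_def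
proof (intro CollectI subsetI)
  fix c assume "c \<in> Poly_Mapping.keys (f * g)"
  then obtain a b where ab: "a \<in> Poly_Mapping.keys f" "b \<in> Poly_Mapping.keys g" "c = a + b"
    using keys_mult[of f g] by blast
  then have "Poly_Mapping.keys a \<subseteq> X \<and> tdeg a = t \<and> wt a = k" "Poly_Mapping.keys b \<subseteq> X \<and> tdeg b = t' \<and> wt b = k'"
    using assms unfolding homog_def by blast+
  then show "Poly_Mapping.keys c \<subseteq> X \<and> tdeg c = t + t' \<and> wt c = k + k'"
    unfolding ab(3) tdeg_add wt_simps using keys_add[of a b] by blast
qed

lemma homog_single: "Poly_Mapping.keys a \<subseteq> X \<Longrightarrow> Poly_Mapping.single a c \<in> homog (tdeg a) (wt a)"
  by (simp add: homog_def)

lemma linf_homog: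
  assumes "j < m"
  shows "linf j q T \<in> homog 1 (lam j)"
  unfolding linf_def
proof (intro cv.subspace_sum[OF homog_subspace] cv.subspace_scale[OF homog_subspace])
  fix r assume "r \<in> Ess (lam j)"
  then have "Poly_Mapping.keys (Poly_Mapping.single (j, r) (1::nat)) \<subseteq> X" using assms by (simp add: X_iff)
  from homog_single[OF this, of 1] show "var (j, r) \<in> homog 1 (lam j)" by (simp only: tdeg_single wt_simps)
qed

text \<open>A derivation replaces one variable by a linear combination of variables of the same
  summand, which changes neither degree nor weight. This makes finite-dimensional stable pieces
  available.\<close>

lemma Dx_homog_single:
  assumes "Poly_Mapping.keys a \<subseteq> X"
  shows "Dx x (Poly_Mapping.single a 1) \<in> homog (tdeg a) (wt a)"
  using assms
proof (induction a rule: monomial_induct)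
  case zero
  show ?case by (simp add: cv.subspace_0[OF homog_subspace])
next
  case (var a z)
  then obtain j q where z: "z = (j, q)" "j < m" "(j, q) \<in> X" by (cases z) (auto simp: X_iff)
  have eq: "Dx x (Poly_Mapping.single (a + Poly_Mapping.single z 1) 1) =
      Poly_Mapping.single a 1 * linf j q (action D (lam j) x) + Dx x (Poly_Mapping.single a 1) * var z"
    using deriv_of_mult[of "\<delta> x" "Poly_Mapping.single a 1" "var z"] Dx_var[OF z(3), of x] by (simp add: mult_single z(1))
  have vh: "var z \<in> homog 1 (lam j)"
    using homog_single[of "Poly_Mapping.single z 1" 1] var.hyps(2) unfolding z(1) by (simp only: tdeg_single wt_simps) simp
  have "tdeg (a + Poly_Mapping.single z 1) = tdeg a + 1" by (simp add: tdeg_add)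
  moreover have "wt (a + Poly_Mapping.single z 1) = wt a + lam j" unfolding z(1) by (simp only: wt_simps)
  ultimately show ?case unfolding eq
    using homog_mult[OF homog_single[OF var.hyps(1), of 1] linf_homog[OF z(2), of q "action D (lam j) x"]]
      homog_mult[OF var.IH vh] by (simp add: cv.subspace_add[OF homog_subspace])
qed

text \<open>Bounding the degree makes the dual finite-dimensional. A bound is used instead of a
  fixed degree because one weight can occur in several degrees.\<close>

definition S :: "nat \<Rightarrow> (nat \<times> exponent \<Rightarrow>\<^sub>0 nat) set" where
  "S d = {a. Poly_Mapping.keys a \<subseteq> X \<and> tdeg a \<le> d}"

lemma lookup_le_tdeg: "Poly_Mapping.lookup a x \<le> tdeg a"
proof (cases "x \<in> Poly_Mapping.keys a")
  case True
  then show ?thesis unfolding tdeg_def by (intro member_le_sum) auto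
qed (simp add: in_keys_iff)

lemma S_finite: "finite (S d)"
proof (rule inj_on_finite[where f="\<lambda>a. restrict (Poly_Mapping.lookup a) X" and B="X \<rightarrow>\<^sub>E {..d}"])
  show "inj_on (\<lambda>a. restrict (Poly_Mapping.lookup a) X) (S d)"
  proof (rule inj_onI)
    fix a b assume ab: "a \<in> S d" "b \<in> S d" "restrict (Poly_Mapping.lookup a) X = restrict (Poly_Mapping.lookup b) X"
    show "a = b"
    proof (rule poly_mapping_eqI)
      fix x
      show "Poly_Mapping.lookup a x = Poly_Mapping.lookup b x"
      proof (cases "x \<in> X")
        case True
        then show ?thesis using fun_cong[OF ab(3), of x] by simp
      next
        case False
        then have "x \<notin> Poly_Mapping.keys a" "x \<notin> Poly_Mapping.keys b" using ab(1,2) by (auto simp: S_def)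
        then show ?thesis by (simp add: in_keys_iff)
      qed
    qed
  qed
  show "(\<lambda>a. restrict (Poly_Mapping.lookup a) X) ` S d \<subseteq> X \<rightarrow>\<^sub>E {..d}"
    by (auto simp: S_def intro: order_trans[OF lookup_le_tdeg])
qed (intro finite_PiE X_finite finite_atMost)

lemma polys_bounded: "f \<in> polys X \<Longrightarrow> \<exists>d. Poly_Mapping.keys f \<subseteq> S d"
proof -
  assume f: "f \<in> polys X"
  have "tdeg a \<le> Max (tdeg ` Poly_Mapping.keys f)" if "a \<in> Poly_Mapping.keys f" for a
    using that by (intro Max_ge) auto
  then show ?thesis using f by (intro exI[of _ "Max (tdeg ` Poly_Mapping.keys f)"]) (auto simp: S_def polys_def)
qed

definition keyed :: "(nat \<times> exponent \<Rightarrow>\<^sub>0 nat) set \<Rightarrow> (nat \<times> exponent) mpoly set" where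
  "keyed A = {f. Poly_Mapping.keys f \<subseteq> A}"

lemma keyed_subspace: "cv.subspace (keyed A)"
proof (rule cv.subspaceI)
  show "f + g \<in> keyed A" if "f \<in> keyed A" "g \<in> keyed A" for f g
    using that keys_add[of f g] unfolding keyed_def by blast
  show "c *\<^sub>C f \<in> keyed A" if "f \<in> keyed A" for c f
    using that keys_scaleC_subset[of c f] unfolding keyed_def by blast
qed (simp add: keyed_def)

lemma Dx_keyed:
  assumes "f \<in> keyed {a \<in> S d. P (wt a)}"
  shows "Dx x f \<in> keyed {a \<in> S d. P (wt a)}"
  using assms unfolding keyed_def mem_Collect_eq
proof (induction f rule: mpoly_linear_induct)
  case (add f g)
  then show ?case using keys_add[of "Dx x f" "Dx x g"] by auto
next
  case (scale c f)
  then show ?case using keys_scaleC_subset[of c "Dx x f"] by auto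
next
  case (single a)
  then have "Poly_Mapping.keys a \<subseteq> X" by (simp add: S_def)
  from Dx_homog_single[OF this, of x] show ?case using single unfolding homog_def S_def by auto
qed simp

lemma Dx_S: "Poly_Mapping.keys f \<subseteq> S d \<Longrightarrow> Poly_Mapping.keys (Dx x f) \<subseteq> S d"
  using Dx_keyed[of f d "\<lambda>_. True" x] by (simp add: keyed_def)

definition W :: "nat \<Rightarrow> ((nat \<times> exponent \<Rightarrow>\<^sub>0 nat) \<Rightarrow> complex) set" where
  "W d = {\<phi>. \<forall>a. a \<notin> S d \<longrightarrow> \<phi> a = 0}"

text \<open>The transpose of the derivation. As the derivations reverse brackets, the transpose is a
  representation without any sign.\<close>

definition act :: "nat \<Rightarrow> 'g \<Rightarrow> ((nat \<times> exponent \<Rightarrow>\<^sub>0 nat) \<Rightarrow> complex) \<Rightarrow> (nat \<times> exponent \<Rightarrow>\<^sub>0 nat) \<Rightarrow> complex" where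
  "act d x \<phi> = (\<lambda>a. if a \<in> S d then lin_ext \<phi> (Dx x (Poly_Mapping.single a 1)) else 0)"

lemma lin_ext_fun_lin:
  "lin_ext (\<phi> + \<psi>) f = lin_ext \<phi> f + lin_ext \<psi> f" "lin_ext (c *\<^sub>C \<phi>) f = c *\<^sub>C lin_ext \<phi> f" "lin_ext 0 f = 0"
  for \<phi> :: "'m \<Rightarrow> complex"
  by (simp_all add: lin_ext_def algebra_simps sum.distrib sum_distrib_left)

lemma act_pair:
  assumes "Poly_Mapping.keys f \<subseteq> S d"
  shows "lin_ext (act d x \<phi>) f = lin_ext \<phi> (Dx x f)"
  using assms
  by (induction f rule: mpoly_linear_induct) (simp_all add: act_def)

lemma W_subspace: "cv.subspace (W d)"
  by (auto simp: cv.subspace_def W_def)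

lemma W_module: "lie_module (W d) (act d)"
  unfolding lie_module_def
proof (intro conjI allI ballI)
  fix x y c \<phi> \<psi> assume "\<phi> \<in> W d" "\<psi> \<in> W d"
  have ps: "Poly_Mapping.single a 1 \<in> polys X" if "a \<in> S d" for a
    using that by (intro polys_single) (simp add: S_def)
  show "act d x \<phi> \<in> W d" by (simp add: act_def W_def)
  show "act d x (\<phi> + \<psi>) = act d x \<phi> + act d x \<psi>"
    by (auto simp: act_def fun_eq_iff lin_ext_fun_lin)
  show "act d x (c *\<^sub>C \<phi>) = c *\<^sub>C act d x \<phi>"
    by (auto simp: act_def fun_eq_iff lin_ext_fun_lin)
  show "act d (x + y) \<phi> = act d x \<phi> + act d y \<phi>"
    by (auto simp: act_def fun_eq_iff Dx_add[OF ps])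
  show "act d (c *\<^sub>C x) \<phi> = c *\<^sub>C act d x \<phi>"
    by (auto simp: act_def fun_eq_iff Dx_scale[OF ps])
  show "act d (bracket x y) \<phi> = act d x (act d y \<phi>) - act d y (act d x \<phi>)"
  proof
    fix a
    show "act d (bracket x y) \<phi> a = (act d x (act d y \<phi>) - act d y (act d x \<phi>)) a"
    proof (cases "a \<in> S d")
      case True
      then have k: "Poly_Mapping.keys (Dx z (Poly_Mapping.single a 1)) \<subseteq> S d" for z by (intro Dx_S) simp
      show ?thesis using True act_pair[OF k]
        by (simp add: act_def[of d x "act d y \<phi>"] act_def[of d y "act d x \<phi>"] act_def[of d "bracket x y"] Dx_bracket[OF ps])
    qed (simp add: act_def)
  qed
qed (rule W_subspace)

lemma W_fin_dim: "fin_dim (W d)"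
  unfolding fin_dim_def
proof (intro exI conjI subsetI)
  let ?e = "\<lambda>a b. if b = a then 1 else (0::complex)"
  show "finite (?e ` S d)" using S_finite by simp
  fix \<phi> assume \<phi>: "\<phi> \<in> W d"
  have "\<phi> = (\<Sum>a\<in>S d. \<phi> a *\<^sub>C ?e a)"
  proof
    fix b
    have "(\<Sum>a\<in>S d. \<phi> a *\<^sub>C ?e a) b = (\<Sum>a\<in>S d. if a = b then \<phi> a else 0)"
      unfolding sum_fun_apply by (intro sum.cong) auto
    then show "\<phi> b = (\<Sum>a\<in>S d. \<phi> a *\<^sub>C ?e a) b" using \<phi> S_finite by (simp add: W_def)
  qed
  also have "\<dots> \<in> cv.span (?e ` S d)" by (intro cv.span_sum cv.span_scale cv.span_base) auto
  finally show "\<phi> \<in> cv.span (?e ` S d)" .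
qed

definition vh :: "nat \<times> exponent \<Rightarrow> complex" where
  "vh = coords D lam (\<lambda>j. hw_vector D (lam j))"

text \<open>Evaluation at the sum of the highest weight vectors, cut down to weight
  \<open>k\<close>. Without the cut it would in general be a sum of weight vectors for different
  weights.\<close>

definition ev0 :: "weight \<Rightarrow> nat \<Rightarrow> (nat \<times> exponent \<Rightarrow>\<^sub>0 nat) \<Rightarrow> complex" where
  "ev0 k d = (\<lambda>a. if a \<in> S d \<and> wt a = k then mono_eval a vh else 0)"

lemma ev0_W: "ev0 k d \<in> W d"
  by (simp add: ev0_def W_def)

lemma ev0_pair:
  assumes "f \<in> keyed {a \<in> S d. wt a = k'}"
  shows "lin_ext (ev0 k d) f = (if k' = k then mpoly_eval f vh else 0)"
  using assms unfolding keyed_def mem_Collect_eq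
  by (induction f rule: mpoly_linear_induct) (auto simp: ev0_def)

lemma single_keyed: "a \<in> S d \<Longrightarrow> Poly_Mapping.single a 1 \<in> keyed {b \<in> S d. wt b = wt a}"
  by (simp add: keyed_def)

lemma act_ev0:
  "act d x (ev0 k d) a = (if a \<in> S d \<and> wt a = k then mpoly_eval (Dx x (Poly_Mapping.single a 1)) vh else 0)"
  using ev0_pair[OF Dx_keyed[OF single_keyed]] by (simp add: act_def)

text \<open>Covers the raising operators, with eigenvalue 0, and the Cartan elements at once: at the
  base point the eigenvalues of the factors of a monomial add up, and \<open>C\<close> is their
  additive extension to weights.\<close>

lemma Dx_vh_monomial:
  assumes "\<And>j. j < m \<Longrightarrow> action D (lam j) x (hw_vector D (lam j)) = c j *\<^sub>C hw_vector D (lam j)"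
    and "C 0 = 0" "\<And>a j. C (a + lam j) = C a + c j" and "Poly_Mapping.keys a \<subseteq> X"
  shows "mpoly_eval (Dx x (Poly_Mapping.single a 1)) vh = C (wt a) * mono_eval a vh"
  using assms(4)
proof (induction a rule: monomial_induct)
  case zero
  show ?case by (simp add: assms(2))
next
  case (var a z)
  then obtain j q where z: "z = (j, q)" "j < m" "(j, q) \<in> X" by (cases z) (auto simp: X_iff)
  note k = lam[OF z(2)]
  have eq: "Dx x (Poly_Mapping.single (a + Poly_Mapping.single z 1) 1) =
      Poly_Mapping.single a 1 * linf j q (action D (lam j) x) + Dx x (Poly_Mapping.single a 1) * var z"
    using deriv_of_mult[of "\<delta> x" "Poly_Mapping.single a 1" "var z"] Dx_var[OF z(3), of x] by (simp add: mult_single z(1))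
  have "mpoly_eval (linf j q (action D (lam j) x)) vh = c j * vh z"
    unfolding vh_def linf_eval[where w="\<lambda>j. hw_vector D (lam j)", OF z(2) endo_action[OF k] hw_in_irrep[OF k]] z(1) coords_eq assms(1)[OF z(2)]
    using lin_onD(2)[OF vcoord_lin[OF k] hw_in_irrep[OF k]] by simp
  moreover have Cw: "C (wt (a + Poly_Mapping.single z 1)) = C (wt a) + c j" unfolding z(1) by (simp only: wt_simps assms(3))
  ultimately show ?case
    unfolding eq Cw by (simp add: var.IH mono_eval_add algebra_simps)
qed

text \<open>The base point is annihilated by the positive root vectors and each of its summands is
  an eigenvector of the Cartan subalgebra; transposition turns this into the same property of the
  evaluation functional.\<close>

lemma ev0_hw:
  assumes "ev0 k d \<noteq> 0"
  shows "hw_module (W d) (act d) (ev0 k d) (weight_fun D k)"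
  unfolding hw_module_def
proof (intro conjI allI impI ballI W_module W_fin_dim ev0_W assms)
  fix i assume i: "i < num_pos D"
  have "action D (lam j) (ee i) (hw_vector D (lam j)) = 0 *\<^sub>C hw_vector D (lam j)" if "j < m" for j
    using hw_module_irrep[OF lam[OF that]] i by (simp add: hw_module_def)
  from Dx_vh_monomial[of "ee i" "\<lambda>_. 0" "\<lambda>_. 0", OF this]
  show "act d (ee i) (ev0 k d) = 0" by (auto simp: fun_eq_iff act_ev0 S_def)
next
  fix h assume h: "h \<in> cartan D"
  have "action D (lam j) h (hw_vector D (lam j)) = weight_fun D (lam j) h *\<^sub>C hw_vector D (lam j)" if "j < m" for j
    using hw_module_irrep[OF lam[OF that]] h by (simp add: hw_module_def)
  from Dx_vh_monomial[of h "\<lambda>j. weight_fun D (lam j) h" "\<lambda>k. weight_fun D k h", OF this]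
  have "mpoly_eval (Dx h (Poly_Mapping.single a 1)) vh = weight_fun D (wt a) h * mono_eval a vh"
    if "Poly_Mapping.keys a \<subseteq> X" for a
    using that weight_fun_add by (simp add: weight_fun_def[of _ 0])
  then show "act d h (ev0 k d) = weight_fun D k h *\<^sub>C ev0 k d"
    unfolding fun_eq_iff act_ev0 by (simp add: ev0_def S_def)
qed

subsection \<open>Divided powers\<close>

definition gd :: "nat \<Rightarrow> nat \<Rightarrow> (nat \<times> exponent) mpoly \<Rightarrow> (nat \<times> exponent) mpoly" where
  "gd i k f = (1 / fact k) *\<^sub>C (Dx (ff i) ^^ k) f"

text \<open>\<open>fold\<close> lets index 0 act first. As derivations compose on the right, this
  matches \<open>fpow\<close>, where index 0 acts last.\<close>

definition dps :: "nat list \<Rightarrow> exponent \<Rightarrow> (nat \<times> exponent) mpoly \<Rightarrow> (nat \<times> exponent) mpoly" where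
  "dps is p = fold (\<lambda>i. gd i (Poly_Mapping.lookup p i)) is"

text \<open>The coefficient of \<open>t\<^sup>p\<close> in the restriction of \<open>f\<close> to the orbit of the product of the
  one-parameter subgroups \<open>exp (t\<^sub>i ff i)\<close>.\<close>

definition cf :: "exponent \<Rightarrow> (nat \<times> exponent) mpoly \<Rightarrow> complex" where
  "cf p f = mpoly_eval (dps [0..<num_pos D] p f) vh"

lemma gd_lin: "lin_on UNIV (gd i k)"
proof -
  have "lin_on UNIV (Dx (ff i) ^^ k)" by (induction k) (simp_all add: lin_on_def)
  then show ?thesis unfolding gd_def by (auto simp: lin_on_def cv.scale_right_distrib mult.commute)
qed

lemma dps_lin: "lin_on UNIV (dps is p)"
proof (induction "is")
  case Nil
  show ?case by (simp add: dps_def lin_on_def)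
next
  case (Cons i "is")
  have "dps (i # is) p = (\<lambda>f. dps is p (gd i (Poly_Mapping.lookup p i) f))" by (simp add: dps_def fun_eq_iff)
  then show ?case using lin_on_compose[OF gd_lin Cons] by auto
qed

lemma cf_lin: "lin_on UNIV (cf p)"
proof -
  have "lin_on UNIV (\<lambda>f. mpoly_eval f vh)" by (simp add: lin_on_def)
  from lin_on_compose[OF dps_lin this] show ?thesis by (simp add: cf_def[abs_def])
qed

lemma gd_mult: "gd i k (f * g) = (\<Sum>l\<le>k. gd i l f * gd i (k - l) g)"
  unfolding gd_def by (rule deriv_power_sum) (simp_all add: deriv_of_mult)

lemma dps_cong: "(\<And>i. i \<in> set is \<Longrightarrow> Poly_Mapping.lookup p i = Poly_Mapping.lookup q i) \<Longrightarrow> dps is p = dps is q"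
  unfolding dps_def by (intro ext fold_cong) auto

text \<open>The first parts of the splittings of \<open>p\<close> at the indices in
  \<open>A\<close>. Entries of \<open>p\<close> outside \<open>A\<close> remain in the difference
  \<open>p - q\<close>, where \<open>dps\<close> over a list of indices from \<open>A\<close> does
  not look at them.\<close>

definition Q :: "nat set \<Rightarrow> exponent \<Rightarrow> exponent set" where
  "Q A p = {q. Poly_Mapping.keys q \<subseteq> A \<and> (\<forall>l. Poly_Mapping.lookup q l \<le> Poly_Mapping.lookup p l)}"

lemma Q_finite: "finite (Q A p)"
proof (rule inj_on_finite[where f="\<lambda>a. restrict (Poly_Mapping.lookup a) (Poly_Mapping.keys p)"
      and B="\<Pi>\<^sub>E x\<in>Poly_Mapping.keys p. {..Poly_Mapping.lookup p x}"])
  show "inj_on (\<lambda>a. restrict (Poly_Mapping.lookup a) (Poly_Mapping.keys p)) (Q A p)"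
  proof (rule inj_onI, rule poly_mapping_eqI)
    fix a b x
    assume ab: "a \<in> Q A p" "b \<in> Q A p"
      "restrict (Poly_Mapping.lookup a) (Poly_Mapping.keys p) = restrict (Poly_Mapping.lookup b) (Poly_Mapping.keys p)"
    show "Poly_Mapping.lookup a x = Poly_Mapping.lookup b x"
    proof (cases "x \<in> Poly_Mapping.keys p")
      case True
      then show ?thesis using fun_cong[OF ab(3), of x] by simp
    next
      case False
      then show ?thesis using ab(1,2) by (simp add: Q_def in_keys_iff) (metis le_zero_eq)
    qed
  qed
  show "(\<lambda>a. restrict (Poly_Mapping.lookup a) (Poly_Mapping.keys p)) ` Q A p \<subseteq> (\<Pi>\<^sub>E x\<in>Poly_Mapping.keys p. {..Poly_Mapping.lookup p x})"
    by (auto simp: Q_def)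
qed (intro finite_PiE finite_keys finite_atMost)

text \<open>The Cauchy product of power series in several variables, built up one variable at a
  time.\<close>

lemma dps_mult:
  assumes "distinct is"
  shows "dps is p (f * g) = (\<Sum>q\<in>Q (set is) p. dps is q f * dps is (p - q) g)"
  using assms
proof (induction "is" arbitrary: f g)
  case Nil
  have "Q {} p = {0}" by (auto simp: Q_def intro: poly_mapping_eqI)
  then show ?case by (simp add: dps_def)
next
  case (Cons i "is")
  let ?pi = "Poly_Mapping.lookup p i"
  let ?s = "\<lambda>k. Poly_Mapping.single i k"
  have i: "i \<notin> set is" using Cons.prems by auto
  have step: "dps (i # is) r h = dps is r (gd i (Poly_Mapping.lookup r i) h)" for r h by (simp add: dps_def)
  have qi: "Poly_Mapping.lookup q i = 0" if "q \<in> Q (set is) p" for q using that i by (auto simp: Q_def in_keys_iff)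
  have "dps (i # is) p (f * g) = (\<Sum>k\<le>?pi. dps is p (gd i k f * gd i (?pi - k) g))"
    unfolding step gd_mult by (rule lin_on_sum[OF dps_lin cv.subspace_UNIV]) simp
  also have "\<dots> = (\<Sum>k\<le>?pi. \<Sum>q\<in>Q (set is) p. dps is q (gd i k f) * dps is (p - q) (gd i (?pi - k) g))"
    using Cons by simp
  also have "\<dots> = (\<Sum>(k, q)\<in>{..?pi} \<times> Q (set is) p. dps is q (gd i k f) * dps is (p - q) (gd i (?pi - k) g))"
    by (rule sum.cartesian_product)
  also have "\<dots> = (\<Sum>q\<in>Q (set (i # is)) p. dps (i # is) q f * dps (i # is) (p - q) g)"
  \<comment> \<open>The exponent of the new index \<open>i\<close> is joined to the old exponent,
    and read off again; this is possible because \<open>i\<close> does not occur among the other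
    indices.\<close>
  proof (rule sum.reindex_bij_witness[where j="\<lambda>(k, q). q + ?s k" and i="\<lambda>q. (Poly_Mapping.lookup q i, q - ?s (Poly_Mapping.lookup q i))"])
    fix z assume z: "z \<in> {..?pi} \<times> Q (set is) p"
    obtain k q where kq: "z = (k, q)" "k \<le> ?pi" "q \<in> Q (set is) p" using z by auto
    have l: "Poly_Mapping.lookup (q + ?s k) x = (if x = i then k else Poly_Mapping.lookup q x)" for x
      using qi[OF kq(3)] by (simp add: lookup_add lookup_single when_def)
    have "q + ?s k - ?s k = q" by (rule poly_mapping_eqI) (simp add: lookup_minus lookup_add)
    then show "(\<lambda>q. (Poly_Mapping.lookup q i, q - ?s (Poly_Mapping.lookup q i))) (case z of (k, q) \<Rightarrow> q + ?s k) = z"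
      by (simp add: kq(1) l)
    have "Poly_Mapping.keys (q + ?s k) \<subseteq> set (i # is)"
      using kq(3) keys_add[of q "?s k"] by (auto simp: Q_def split: if_splits)
    then show "(case z of (k, q) \<Rightarrow> q + ?s k) \<in> Q (set (i # is)) p"
      using kq by (simp add: Q_def l)
    have "dps is (q + ?s k) = dps is q" using i by (intro dps_cong) (auto simp: l)
    moreover have "dps is (p - (q + ?s k)) = dps is (p - q)" using i by (intro dps_cong) (auto simp: l lookup_minus)
    ultimately show "dps (i # is) (case z of (k, q) \<Rightarrow> q + ?s k) f * dps (i # is) (p - (case z of (k, q) \<Rightarrow> q + ?s k)) g =
        (case z of (k, q) \<Rightarrow> dps is q (gd i k f) * dps is (p - q) (gd i (?pi - k) g))"
      by (simp add: kq(1) step l lookup_minus)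
  next
    fix q assume q: "q \<in> Q (set (i # is)) p"
    let ?k = "Poly_Mapping.lookup q i"
    have l: "Poly_Mapping.lookup (q - ?s ?k) x = (if x = i then 0 else Poly_Mapping.lookup q x)" for x
      by (simp add: lookup_minus lookup_single when_def)
    show "(case (?k, q - ?s ?k) of (k, q) \<Rightarrow> q + ?s k) = q"
      by (simp, rule poly_mapping_eqI) (simp add: lookup_add l lookup_single when_def)
    have "Poly_Mapping.keys (q - ?s ?k) \<subseteq> set is"
    proof
      fix x assume "x \<in> Poly_Mapping.keys (q - ?s ?k)"
      then have "x \<noteq> i" "x \<in> Poly_Mapping.keys q" by (auto simp: in_keys_iff l split: if_splits)
      then show "x \<in> set is" using q by (auto simp: Q_def)
    qed
    then show "(?k, q - ?s ?k) \<in> {..?pi} \<times> Q (set is) p" using q by (simp add: Q_def l)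
  qed
  finally show ?case .
qed

lemma cf_mult:
  "cf p (f * g) = (\<Sum>q\<in>Q {..<num_pos D} p. cf q f * cf (p - q) g)"
  unfolding cf_def using dps_mult[of "[0..<num_pos D]" p f g]
  by (simp add: mpoly_eval_sum atLeast0LessThan)

lemma zero_tuple: "0 \<in> Tup" by (simp add: tuples_def)

lemma mless_zero: "\<not> mless p 0"
proof
  assume p: "mless p 0"
  then have "(0, p) \<in> mon_order D" using mon mless_tuples[OF p] by (auto simp: monomial_order_def)
  then show False using p mon_linear by (auto simp: mless_def order_on_defs dest: antisymD)
qed

definition lead :: "(nat \<times> exponent) mpoly \<Rightarrow> exponent \<Rightarrow> bool" where
  "lead f s \<longleftrightarrow> s \<in> Tup \<and> cf s f = 1 \<and> (\<forall>p. mless p s \<longrightarrow> cf p f = 0)"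

text \<open>Lowest terms multiply as for power series: compatibility of the order with addition
  leaves only the pair \<open>(s, s')\<close> among all contributions at or below
  \<open>s + s'\<close>.\<close>

lemma lead_mult:
  assumes f: "lead f s" and g: "lead g s'"
  shows "lead (f * g) (s + s')"
proof -
  have T: "s \<in> Tup" "s' \<in> Tup" using f g by (auto simp: lead_def)
  have Qd: "q \<in> Tup \<and> p - q \<in> Tup \<and> p = q + (p - q)" if "q \<in> Q {..<num_pos D} p" "p \<in> Tup" for p q
  proof -
    have "q + (p - q) = p" using that(1) by (intro poly_mapping_eqI) (simp add: lookup_add lookup_minus Q_def)
    moreover have "Poly_Mapping.keys (p - q) \<subseteq> Poly_Mapping.keys p" by (auto simp: in_keys_iff lookup_minus)
    ultimately show ?thesis using that by (auto simp: Q_def tuples_def)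
  qed
  \<comment> \<open>A nonzero product requires \<open>q\<close> and \<open>r\<close> to be at least
    \<open>s\<close> and \<open>s'\<close>; if one of them were strictly larger, the sum would be
    too.\<close>
  have key: "q = s \<and> r = s'" if "q \<in> Tup" "r \<in> Tup" "mless (q + r) (s + s') \<or> q + r = s + s'" "cf q f * cf r g \<noteq> 0" for q r
  proof -
    have "q = s \<or> mless s q" "r = s' \<or> mless s' r"
      using that f g mless_total T by (auto simp: lead_def)
    moreover have "mless (s + s') (q + s')" if "mless s q" using mless_add[OF that T(2)] .
    moreover have "mless (q + s') (q + r)" if "mless s' r" using mless_add[OF that \<open>q \<in> Tup\<close>] by (simp add: add.commute)
    ultimately show ?thesis using that(3) mless_trans mless_irrefl by metis
  qed
  have "cf p (f * g) = 0" if p: "mless p (s + s')" for p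
    unfolding cf_mult
  proof (rule sum.neutral, rule ballI)
    fix q assume q: "q \<in> Q {..<num_pos D} p"
    have "q \<in> Tup \<and> p - q \<in> Tup \<and> p = q + (p - q)" using Qd[OF q] mless_tuples[OF p] by blast
    then show "cf q f * cf (p - q) g = 0" using key[of q "p - q"] p mless_irrefl by metis
  qed
  moreover have "cf (s + s') (f * g) = 1"
  proof -
    let ?p = "s + s'"
    have pT: "?p \<in> Tup" by (rule tuples_add[OF T])
    have sQ: "s \<in> Q {..<num_pos D} ?p" using T(1) by (auto simp: Q_def tuples_def lookup_add)
    have ps: "?p - s = s'" by (rule poly_mapping_eqI) (simp add: lookup_minus lookup_add)
    have "cf q f * cf (?p - q) g = 0" if q: "q \<in> Q {..<num_pos D} ?p - {s}" for q
    proof -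
      have "q \<in> Tup \<and> ?p - q \<in> Tup \<and> ?p = q + (?p - q)" using Qd[OF _ pT] q by blast
      then show ?thesis using key[of q "?p - q"] q by (metis DiffD2 singletonI)
    qed
    then have "(\<Sum>q\<in>Q {..<num_pos D} ?p - {s}. cf q f * cf (?p - q) g) = 0" by (rule sum.neutral[OF ballI])
    then have "cf ?p (f * g) = cf s f * cf (?p - s) g"
      unfolding cf_mult using sum.remove[OF Q_finite sQ, of "\<lambda>q. cf q f * cf (?p - q) g"] by simp
    then show ?thesis using f g by (simp add: ps lead_def)
  qed
  ultimately show ?thesis using tuples_add[OF T] by (simp add: lead_def)
qed

lemma dps_linf:
  assumes "j < m" "endo (lam j) T"
  shows "dps is p (linf j q T) = linf j q (\<lambda>u. T (foldr (\<lambda>i w. (1 / fact (Poly_Mapping.lookup p i)) *\<^sub>C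
      (action D (lam j) (ff i) ^^ Poly_Mapping.lookup p i) w) is u))"
  using assms(2)
proof (induction "is" arbitrary: T)
  case Nil
  show ?case by (simp add: dps_def)
next
  case (Cons i "is")
  note k = lam[OF assms(1)]
  let ?\<rho> = "action D (lam j)"
  define n where "n = Poly_Mapping.lookup p i"
  have pw: "(Dx (ff i) ^^ l) (linf j q T) = linf j q (\<lambda>u. T ((?\<rho> (ff i) ^^ l) u))" for l
  proof (induction l)
    case (Suc l)
    have "endo (lam j) (\<lambda>u. T ((?\<rho> (ff i) ^^ l) u))"
      by (rule endo_compose[OF Cons.prems endo_power[OF endo_action[OF k]]])
    then show ?case using Dx_linf[OF assms(1)] by (simp add: Suc funpow_swap1)
  qed simp
  have e: "endo (lam j) (\<lambda>u. T ((1 / fact n) *\<^sub>C (?\<rho> (ff i) ^^ n) u))"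
    by (rule endo_compose[OF Cons.prems endo_scale[OF k endo_power[OF endo_action[OF k]]]])
  have "gd i n (linf j q T) = linf j q (\<lambda>u. (1 / fact n) *\<^sub>C T ((?\<rho> (ff i) ^^ n) u))"
    unfolding gd_def pw
    by (rule linf_combine(3)[OF assms(1) endo_id endo_compose[OF Cons.prems endo_power[OF endo_action[OF k]]], symmetric])
  also have "\<dots> = linf j q (\<lambda>u. T ((1 / fact n) *\<^sub>C (?\<rho> (ff i) ^^ n) u))"
  proof (rule linf_cong)
    fix r
    have "(?\<rho> (ff i) ^^ n) (vv (lam j) r) \<in> irrep D (lam j)"
      using endo_power[OF endo_action[OF k], of n "ff i"] vv_in_irrep[OF k] by (auto simp: endo_def)
    then show "(1 / fact n) *\<^sub>C T ((?\<rho> (ff i) ^^ n) (vv (lam j) r)) = T ((1 / fact n) *\<^sub>C (?\<rho> (ff i) ^^ n) (vv (lam j) r))"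
      using lin_onD(2)[of "irrep D (lam j)" T] Cons.prems by (simp add: endo_def)
  qed
  finally have "dps (i # is) p (linf j q T) = dps is p (linf j q (\<lambda>u. T ((1 / fact n) *\<^sub>C (?\<rho> (ff i) ^^ n) u)))"
    by (simp add: dps_def n_def)
  then show ?case using Cons.IH[OF e] by (simp add: n_def)
qed

text \<open>The divided powers applied to the coordinate function move over to the highest weight
  vector, where they produce the vector of exponent \<open>p\<close>.\<close>

lemma cf_var:
  assumes "(j, q) \<in> X"
  shows "cf p (var (j, q)) = vcoord (lam j) q (vv (lam j) p)"
proof -
  have j: "j < m" using assms by (simp add: X_iff)
  note k = lam[OF j]
  let ?F = "fpow (action D (lam j)) p"
  have "dps [0..<num_pos D] p (var (j, q)) = linf j q ?F"
    using dps_linf[OF j endo_id, of "[0..<num_pos D]" p q] by (simp add: linf_id[OF assms] fpow_def[abs_def])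
  moreover have "endo (lam j) ?F"
  proof -
    have "endo (lam j) (foldr (\<lambda>i w. (1 / fact (Poly_Mapping.lookup p i)) *\<^sub>C
      (action D (lam j) (ff i) ^^ Poly_Mapping.lookup p i) w) is)" for "is"
    proof (induction "is")
      case Nil
      show ?case using endo_id by (simp add: id_def)
    next
      case (Cons i "is")
      from endo_compose[OF endo_scale[OF k endo_power[OF endo_action[OF k]]] Cons] show ?case by (simp add: o_def)
    qed
    then show ?thesis by (simp add: fpow_def[abs_def])
  qed
  ultimately show ?thesis
    unfolding cf_def vh_def using linf_eval[OF j, of ?F "\<lambda>j. hw_vector D (lam j)" q] hw_in_irrep[OF k]
    by (simp add: vv_fpow)
qed

lemma lead_monomial:
  assumes "Poly_Mapping.keys a \<subseteq> X"
  shows "lead (Poly_Mapping.single a 1) (snd (monomial_sign lam a))"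
  using assms
proof (induction a rule: monomial_induct)
  case zero
  have "dps is 0 1 = 1" for "is" by (induction "is") (simp_all add: dps_def gd_def)
  then show ?case using mless_zero by (simp add: lead_def zero_tuple cf_def)
next
  case (var a z)
  then obtain j q where z: "z = (j, q)" "j < m" "(j, q) \<in> X" "q \<in> Ess (lam j)" by (cases z) (auto simp: X_iff)
  have "lead (var z) q"
    unfolding lead_def z(1) cf_var[OF z(3)] using vcoord_vv[OF z(4,4)] vcoord_low[OF z(4)] Ess_tuples[OF z(4)] by simp
  from lead_mult[OF var.IH this] have "lead (Poly_Mapping.single (a + Poly_Mapping.single z 1) 1) (snd (monomial_sign lam a) + q)"
    by (simp add: mult_single)
  moreover have "snd (monomial_sign lam (a + Poly_Mapping.single z 1)) = snd (monomial_sign lam a) + q"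
    unfolding z(1) monomial_sign_add monomial_sign_single by simp
  ultimately show ?case by simp
qed

subsection \<open>Comparison with the irreducible modules\<close>

lemma dps_keyed: "f \<in> keyed {a \<in> S d. P (wt a)} \<Longrightarrow> dps is p f \<in> keyed {a \<in> S d. P (wt a)}"
proof (induction "is" arbitrary: f)
  case (Cons i "is")
  have "(Dx (ff i) ^^ k) f \<in> keyed {a \<in> S d. P (wt a)}" for k
    using Cons.prems Dx_keyed by (induction k) auto
  then have "gd i k f \<in> keyed {a \<in> S d. P (wt a)}" for k
    unfolding gd_def by (rule cv.subspace_scale[OF keyed_subspace])
  then show ?case using Cons.IH by (simp add: dps_def)
qed (simp add: dps_def)

lemma fpow_pair:
  assumes "Poly_Mapping.keys f \<subseteq> S d"
  shows "lin_ext (fpow (act d) p \<phi>) f = lin_ext \<phi> (dps [0..<num_pos D] p f)"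
proof -
  have kS: "g \<in> keyed {a \<in> S d. True} \<longleftrightarrow> Poly_Mapping.keys g \<subseteq> S d" for g by (simp add: keyed_def)
  have "lin_ext (foldr (\<lambda>i w. (1 / fact (Poly_Mapping.lookup p i)) *\<^sub>C (act d (ff i) ^^ Poly_Mapping.lookup p i) w) is \<phi>) f
      = lin_ext \<phi> (dps is p f)" if "Poly_Mapping.keys f \<subseteq> S d" for "is" f
    using that
  proof (induction "is" arbitrary: f)
    case (Cons i "is")
    define n where "n = Poly_Mapping.lookup p i"
    have pw: "Poly_Mapping.keys g \<subseteq> S d \<Longrightarrow> lin_ext ((act d (ff i) ^^ l) \<psi>) g = lin_ext \<psi> ((Dx (ff i) ^^ l) g)" for l \<psi> g
    proof (induction l arbitrary: g)
      case (Suc l)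
      have "lin_ext ((act d (ff i) ^^ Suc l) \<psi>) g = lin_ext ((act d (ff i) ^^ l) \<psi>) (Dx (ff i) g)"
        using act_pair[OF Suc.prems] by simp
      also have "\<dots> = lin_ext \<psi> ((Dx (ff i) ^^ Suc l) g)"
        unfolding funpow_Suc_right o_apply by (rule Suc.IH[OF Dx_S[OF Suc.prems]])
      finally show ?case .
    qed simp
    have "Poly_Mapping.keys (gd i n f) \<subseteq> S d"
    proof -
      have "(Dx (ff i) ^^ l) f \<in> keyed {a \<in> S d. True}" for l
        using Cons.prems Dx_keyed[of _ d "\<lambda>_. True"] unfolding kS[symmetric] by (induction l) auto
      then show ?thesis unfolding kS[symmetric] gd_def by (rule cv.subspace_scale[OF keyed_subspace])
    qed
    note IH = Cons.IH[OF this]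
    let ?\<psi> = "foldr (\<lambda>i w. (1 / fact (Poly_Mapping.lookup p i)) *\<^sub>C (act d (ff i) ^^ Poly_Mapping.lookup p i) w) is \<phi>"
    have "lin_ext ((1 / fact n) *\<^sub>C (act d (ff i) ^^ n) ?\<psi>) f = lin_ext ?\<psi> (gd i n f)"
      unfolding gd_def by (simp only: lin_ext_fun_lin lin_ext_scale pw[OF Cons.prems])
    also have "\<dots> = lin_ext \<phi> (dps (i # is) p f)" unfolding IH by (simp add: dps_def n_def)
    finally show ?case by (simp only: foldr.simps o_apply n_def)
  qed (simp add: dps_def)
  from this[OF assms, of "[0..<num_pos D]"] show ?thesis by (simp add: fpow_def)
qed

definition wpoly :: "weight \<Rightarrow> (nat \<times> exponent) mpoly set" where
  "wpoly k = keyed {a. Poly_Mapping.keys a \<subseteq> X \<and> wt a = k}"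

lemma wpoly_subspace: "cv.subspace (wpoly k)"
  unfolding wpoly_def by (rule keyed_subspace)

lemma wpoly_bounded:
  assumes "f \<in> wpoly k"
  obtains d where "f \<in> keyed {a \<in> S d. wt a = k}" "Poly_Mapping.keys f \<subseteq> S d"
proof -
  have "f \<in> polys X" using assms by (auto simp: wpoly_def keyed_def polys_def)
  then obtain d where "Poly_Mapping.keys f \<subseteq> S d" using polys_bounded by blast
  then show ?thesis using that[of d] assms by (auto simp: wpoly_def keyed_def)
qed

text \<open>The bridge between polynomials and modules: on weight \<open>k\<close> the coefficient
  functionals are the ordered monomials applied to the highest weight vector \<open>ev0 k d\<close>
  of the dual, so \<open>hw_relations_transfer\<close> applies to them.\<close>

lemma cf_pair:
  assumes "f \<in> keyed {a \<in> S d. wt a = k'}"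
  shows "lin_ext (fpow (act d) p (ev0 k d)) f = (if k' = k then cf p f else 0)"
proof -
  have f: "Poly_Mapping.keys f \<subseteq> S d" using assms by (auto simp: keyed_def)
  show ?thesis unfolding fpow_pair[OF f] cf_def
    using ev0_pair[OF dps_keyed[of f d "\<lambda>w. w = k'", OF assms], of k] by simp
qed

lemma lin_ext_fun_sum:
  fixes \<phi> :: "'i \<Rightarrow> 'm \<Rightarrow> complex"
  shows "lin_ext (\<Sum>i\<in>A. \<gamma> i *\<^sub>C \<phi> i) f = (\<Sum>i\<in>A. \<gamma> i * lin_ext (\<phi> i) f)"
proof (induction A rule: infinite_finite_induct)
  case (insert i A)
  show ?case unfolding sum.insert[OF insert.hyps] lin_ext_fun_lin insert.IH by simp
next
  case (infinite A)
  show ?case unfolding sum.infinite[OF infinite] lin_ext_fun_lin ..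
qed (simp only: sum.empty lin_ext_fun_lin)

lemma relation_to_cf:
  assumes "k \<in> Dom" "f \<in> wpoly k" "finite P" "P \<subseteq> Tup" "(\<Sum>p\<in>P. \<gamma> p *\<^sub>C vv k p) = 0"
  shows "(\<Sum>p\<in>P. \<gamma> p * cf p f) = 0"
proof -
  obtain d where d: "f \<in> keyed {a \<in> S d. wt a = k}" using wpoly_bounded[OF assms(2)] .
  have c: "cf p f = lin_ext (fpow (act d) p (ev0 k d)) f" for p using cf_pair[OF d, of p k] by simp
  show ?thesis
  proof (cases "ev0 k d = 0")
    \<comment> \<open>A zero evaluation functional is not a highest weight vector; in that case all
      coefficients are zero and the relation is trivial.\<close>
    case True
    have "fpow (act d) p (ev0 k d) \<in> {0}" for p
      by (rule fpow_mem) (use lie_module_zero_right[OF W_module] True in auto)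
    then have z: "fpow (act d) p (ev0 k d) = 0" for p by blast
    show ?thesis unfolding c z lin_ext_fun_lin by simp
  next
    case False
    have "(\<Sum>p\<in>P. \<gamma> p *\<^sub>C fpow (act d) p (ev0 k d)) = 0"
      using hw_relations_transfer[OF hw_module_irrep[OF assms(1)] ev0_hw[OF False] assms(3,4)] assms(5) by (simp add: vv_fpow)
    then show ?thesis
      using lin_ext_fun_sum[of \<gamma> "\<lambda>p. fpow (act d) p (ev0 k d)" P f] by (simp only: c lin_ext_fun_lin)
  qed
qed

text \<open>A product of the coordinates dual to the highest weight vectors. It shows that for
  weights in the semigroup the evaluation functional is not zero.\<close>

lemma generated_weight_monomial:
  assumes "k \<in> generated (lam ` {..<m})"
  obtains a where "Poly_Mapping.keys a \<subseteq> X" "wt a = k" "mono_eval a vh = 1"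
proof -
  obtain xs where xs: "k = sum_list xs" "set xs \<subseteq> lam ` {..<m}" using assms by (auto simp: generated_def)
  have "\<exists>a. Poly_Mapping.keys a \<subseteq> X \<and> wt a = sum_list xs \<and> mono_eval a vh = 1"
    using xs(2)
  proof (induction xs)
    case Nil
    show ?case by (intro exI[of _ 0]) simp
  next
    case (Cons l xs)
    then obtain a where a: "Poly_Mapping.keys a \<subseteq> X" "wt a = sum_list xs" "mono_eval a vh = 1" by auto
    obtain j where j: "j < m" "l = lam j" using Cons.prems by auto
    note k = lam[OF j(1)]
    have e: "(0::exponent) \<in> Ess (lam j)"
    proof -
      have "{q. mless q 0} = {}" using mless_zero by simp
      moreover have "vv (lam j) 0 \<noteq> 0" using hw_module_irrep[OF k] by (simp add: vv_fpow hw_module_def)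
      ultimately show ?thesis using k zero_tuple by (simp add: Ess_iff)
    qed
    have "vh (j, 0) = 1" unfolding vh_def coords_eq using vcoord_vv[OF e e] by (simp add: vv_fpow)
    moreover have "Poly_Mapping.keys (a + Poly_Mapping.single (j, 0) 1) \<subseteq> X"
      using keys_add[of a "Poly_Mapping.single (j, 0) 1"] a(1) e j(1) X_iff by auto
    ultimately show ?case using a j
      by (intro exI[of _ "a + Poly_Mapping.single (j, 0) 1"]) (simp add: mono_eval_add add.commute)
  qed
  then show ?thesis using that xs(1) by blast
qed

text \<open>The relation is tested in the dual on each monomial: on weight \<open>k\<close> it holds
  by assumption, on other weights every term vanishes. The degree bound only has to admit one
  monomial on which the evaluation does not vanish.\<close>

lemma cf_to_relation:
  assumes "k \<in> Dom" "k \<in> generated (lam ` {..<m})" "finite P" "P \<subseteq> Tup"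
    and "\<And>f. f \<in> wpoly k \<Longrightarrow> (\<Sum>p\<in>P. \<gamma> p * cf p f) = 0"
  shows "(\<Sum>p\<in>P. \<gamma> p *\<^sub>C vv k p) = 0"
proof -
  obtain a where a: "Poly_Mapping.keys a \<subseteq> X" "wt a = k" "mono_eval a vh = 1"
    using generated_weight_monomial[OF assms(2)] .
  define d where "d = tdeg a"
  have "ev0 k d a = 1" using a by (simp add: ev0_def S_def d_def)
  then have nz: "ev0 k d \<noteq> 0" by auto
  have "(\<Sum>p\<in>P. \<gamma> p *\<^sub>C fpow (act d) p (ev0 k d)) = 0"
  proof
    fix b
    have W: "fpow (act d) p (ev0 k d) \<in> W d" for p
      by (rule fpow_mem[OF W_subspace lie_moduleD(2)[OF W_module] ev0_W])
    show "(\<Sum>p\<in>P. \<gamma> p *\<^sub>C fpow (act d) p (ev0 k d)) b = 0 b"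
    proof (cases "b \<in> S d")
      case True
      let ?f = "Poly_Mapping.single b (1::complex)"
      have k: "?f \<in> keyed {a \<in> S d. wt a = wt b}" using True by (rule single_keyed)
      have "(\<Sum>p\<in>P. \<gamma> p *\<^sub>C fpow (act d) p (ev0 k d)) b = (\<Sum>p\<in>P. \<gamma> p * lin_ext (fpow (act d) p (ev0 k d)) ?f)"
        by (simp add: sum_fun_apply)
      also have "\<dots> = 0"
      proof (cases "wt b = k")
        case True
        then have "?f \<in> wpoly k" using k by (auto simp: wpoly_def keyed_def S_def)
        then show ?thesis unfolding cf_pair[OF k] using assms(5) True by simp
      next
        case False
        then show ?thesis unfolding cf_pair[OF k] by simp
      qed
      finally show ?thesis by simp
    next
      case False
      then show ?thesis using W by (simp add: sum_fun_apply W_def)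
    qed
  qed
  then show ?thesis
    using hw_relations_transfer[OF ev0_hw[OF nz] hw_module_irrep[OF assms(1)] assms(3,4)] by (simp add: vv_fpow)
qed

section \<open>Weight components and iterated derivatives at the base point\<close>

definition wcomp :: "weight \<Rightarrow> (nat \<times> exponent) mpoly \<Rightarrow> (nat \<times> exponent) mpoly" where
  "wcomp k = lin_ext (\<lambda>a. if wt a = k then Poly_Mapping.single a 1 else 0)"

lemma lookup_wcomp: "Poly_Mapping.lookup (wcomp k f) a = (if wt a = k then Poly_Mapping.lookup f a else 0)"
proof -
  have "Poly_Mapping.lookup (wcomp k f) a = (\<Sum>b\<in>Poly_Mapping.keys f. if b = a then (if wt a = k then Poly_Mapping.lookup f a else 0) else 0)"
    unfolding wcomp_def lin_ext_def lookup_sum by (intro sum.cong refl) (simp add: lookup_single when_def)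
  then show ?thesis by (simp add: in_keys_iff)
qed

lemma wcomp_wpoly: "f \<in> polys X \<Longrightarrow> wcomp k f \<in> wpoly k"
  unfolding wpoly_def keyed_def polys_def by (auto simp: in_keys_iff lookup_wcomp split: if_splits)

lemma wcomp_keyed: "Poly_Mapping.keys f \<subseteq> S d \<Longrightarrow> wcomp k f \<in> keyed {a \<in> S d. wt a = k}"
  unfolding keyed_def by (auto simp: in_keys_iff lookup_wcomp split: if_splits)

lemma wcomp_sum: "(\<Sum>k\<in>wt ` Poly_Mapping.keys f. wcomp k f) = f"
proof (rule poly_mapping_eqI)
  fix a
  have "Poly_Mapping.lookup f a = 0" if "wt a \<notin> wt ` Poly_Mapping.keys f" using that by (auto simp: in_keys_iff)
  then show "Poly_Mapping.lookup (\<Sum>k\<in>wt ` Poly_Mapping.keys f. wcomp k f) a = Poly_Mapping.lookup f a"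
    by (auto simp: lookup_sum lookup_wcomp)
qed

lemma wcomp_zero: "k \<notin> wt ` Poly_Mapping.keys f \<Longrightarrow> wcomp k f = 0"
  by (rule poly_mapping_eqI) (metis imageI lookup_wcomp lookup_zero not_in_keys_iff_lookup_eq_zero)

text \<open>Vanishing of all Taylor coefficients along the group at the base point;
  \<open>orbit_vanish_iff\<close> identifies it with vanishing on the orbit.\<close>

definition words_vanish :: "(nat \<times> exponent) mpoly \<Rightarrow> bool" where
  "words_vanish f \<longleftrightarrow> (\<forall>xs. mpoly_eval (fold Dx xs f) vh = 0)"

lemma fold_Dx_keyed: "f \<in> keyed {a \<in> S d. P (wt a)} \<Longrightarrow> fold Dx xs f \<in> keyed {a \<in> S d. P (wt a)}"
  by (induction xs arbitrary: f) (auto simp: Dx_keyed)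

lemma word_pair:
  assumes "Poly_Mapping.keys f \<subseteq> S d"
  shows "lin_ext (foldr (act d) xs \<phi>) f = lin_ext \<phi> (fold Dx xs f)"
  using assms by (induction xs arbitrary: f) (auto simp: act_pair Dx_S)

lemma fold_Dx_sum: "fold Dx xs (\<Sum>i\<in>A. g i) = (\<Sum>i\<in>A. fold Dx xs (g i))"
  by (induction xs arbitrary: g) (simp_all add: deriv_of_sum)

text \<open>Forward: the functionals annihilating \<open>f\<close> together with all their
  translates by words form a submodule; it contains the evaluation at the base point, hence its
  weight components and all ordered monomials applied to them. Backward: a word applied to a highest
  weight vector is a combination of ordered monomials.\<close>

lemma words_vanish_iff:
  assumes f: "f \<in> polys X"
  shows "words_vanish f \<longleftrightarrow> (\<forall>k. \<forall>p\<in>Tup. cf p (wcomp k f) = 0)"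
proof -
  obtain d where d: "Poly_Mapping.keys f \<subseteq> S d" using polys_bounded[OF f] by blast
  define L where "L = wt ` Poly_Mapping.keys f"
  have L: "finite L" "L \<subseteq> Dom" using f sign_signature(1) by (auto simp: L_def polys_def)
  have fL: "f = (\<Sum>k\<in>L. wcomp k f)" by (simp add: L_def wcomp_sum)
  have fx: "fold Dx xs f = (\<Sum>k\<in>L. fold Dx xs (wcomp k f))" for xs
    using fold_Dx_sum[of xs "\<lambda>k. wcomp k f" L] unfolding fL[symmetric] .
  have kc: "wcomp k f \<in> keyed {a \<in> S d. wt a = k}" for k by (rule wcomp_keyed[OF d])
  have kS: "Poly_Mapping.keys (wcomp k f) \<subseteq> S d" for k using kc[of k] by (auto simp: keyed_def)
  show ?thesis
  proof
    assume wv: "words_vanish f"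
    define K where "K = {\<phi> \<in> W d. \<forall>xs. lin_ext (foldr (act d) xs \<phi>) f = 0}"
    note fo = lie_module_foldr[OF W_module]
    have Ksub: "cv.subspace K"
    proof (rule cv.subspaceI)
      show "0 \<in> K" unfolding K_def mem_Collect_eq fo lin_ext_fun_lin using cv.subspace_0[OF W_subspace] by blast
      show "\<phi> + \<psi> \<in> K" if a: "\<phi> \<in> K" "\<psi> \<in> K" for \<phi> \<psi>
      proof -
        have W: "\<phi> \<in> W d" "\<psi> \<in> W d" using a by (auto simp only: K_def mem_Collect_eq)
        have "lin_ext (foldr (act d) xs \<phi>) f = 0" "lin_ext (foldr (act d) xs \<psi>) f = 0" for xs 
          using a by (auto simp only: K_def mem_Collect_eq)
        then show ?thesis
          unfolding K_def mem_Collect_eq fo(2)[OF W] lin_ext_fun_lin using cv.subspace_add[OF W_subspace W] by simp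
      qed
      show "c *\<^sub>C \<phi> \<in> K" if a: "\<phi> \<in> K" for c \<phi>
      proof -
        have W: "\<phi> \<in> W d" using a by (auto simp only: K_def mem_Collect_eq)
        have "lin_ext (foldr (act d) xs \<phi>) f = 0" for xs using a by (auto simp only: K_def mem_Collect_eq)
        then show ?thesis
          unfolding K_def mem_Collect_eq fo(3)[OF W] lin_ext_fun_lin using cv.subspace_scale[OF W_subspace W] by simp
      qed
    qed
    have Kact: "act d x \<phi> \<in> K" if "\<phi> \<in> K" for x \<phi>
    proof -
      have "foldr (act d) xs (act d x \<phi>) = foldr (act d) (xs @ [x]) \<phi>" for xs by simp
      then show ?thesis using that lie_moduleD(2)[OF W_module] unfolding K_def by (auto simp del: foldr_append)
    qed
    have sumK: "(\<Sum>k\<in>L. ev0 k d) \<in> K" unfolding K_def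
    proof (intro CollectI conjI allI)
      show "(\<Sum>k\<in>L. ev0 k d) \<in> W d" using ev0_W by (intro cv.subspace_sum[OF W_subspace])
      fix xs
      have "lin_ext (\<Sum>k\<in>L. ev0 k d) (fold Dx xs f) = (\<Sum>k\<in>L. \<Sum>l\<in>L. lin_ext (ev0 k d) (fold Dx xs (wcomp l f)))"
        unfolding fx[symmetric] lin_ext_sum[symmetric] using lin_ext_fun_sum[of "\<lambda>_. 1" "\<lambda>k. ev0 k d" L] by simp
      also have "\<dots> = (\<Sum>k\<in>L. \<Sum>l\<in>L. if l = k then mpoly_eval (fold Dx xs (wcomp l f)) vh else 0)"
        using ev0_pair[OF fold_Dx_keyed[of _ d "\<lambda>w. w = k" for k, OF kc]] by simp
      also have "\<dots> = (\<Sum>k\<in>L. mpoly_eval (fold Dx xs (wcomp k f)) vh)" using L(1) by simp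
      also have "\<dots> = mpoly_eval (fold Dx xs f) vh" by (simp add: fx mpoly_eval_sum)
      finally show "lin_ext (foldr (act d) xs (\<Sum>k\<in>L. ev0 k d)) f = 0"
        unfolding word_pair[OF d] using wv by (simp add: words_vanish_def)
    qed
    \<comment> \<open>Distinct dominant weights differ somewhere on the Cartan subalgebra, so the
      weight components of the evaluation can be separated inside \<open>K\<close>.\<close>
    have evK: "ev0 k d \<in> K" if k: "k \<in> L" for k
    proof (rule eigen_component[where J="L - {k}" and V="W d" and H="cartan D" and T="act d"
          and u="\<lambda>k. ev0 k d" and \<psi>="weight_fun D"])
      show "act d h (ev0 j d) = weight_fun D j h *\<^sub>C ev0 j d" if "h \<in> cartan D" for h j
      proof (cases "ev0 j d = 0")
        case False
        then show ?thesis using ev0_hw[OF False] that by (simp add: hw_module_def)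
      qed (simp add: lie_module_zero_right[OF W_module])
      show "\<exists>h\<in>cartan D. weight_fun D j h \<noteq> weight_fun D k h" if "j \<in> L - {k}" for j
        using that k L(2) weight_fun_inj[of j k] by blast
      show "ev0 k d + (\<Sum>j\<in>L - {k}. ev0 j d) \<in> K"
        using sumK sum.remove[OF L(1) k, of "\<lambda>k. ev0 k d"] by simp
    qed (use L(1) W_subspace Ksub Kact ev0_W lie_moduleD(3)[OF W_module] in \<open>auto simp: K_def\<close>)
    show "\<forall>k. \<forall>p\<in>Tup. cf p (wcomp k f) = 0"
    proof (intro allI ballI)
      fix k p
      show "cf p (wcomp k f) = 0"
      proof (cases "k \<in> L")
        case True
        have "fpow (act d) p (ev0 k d) \<in> K" by (rule fpow_mem[OF Ksub Kact evK[OF True]])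
        then have "lin_ext (foldr (act d) [] (fpow (act d) p (ev0 k d))) f = 0" unfolding K_def by blast
        then have "lin_ext (fpow (act d) p (ev0 k d)) f = 0" by simp
        moreover have "lin_ext (fpow (act d) p (ev0 k d)) f = (\<Sum>l\<in>L. if l = k then cf p (wcomp l f) else 0)"
          using lin_ext_sum[of "fpow (act d) p (ev0 k d)" "\<lambda>l. wcomp l f" L] unfolding fL[symmetric] cf_pair[OF kc] .
        ultimately show ?thesis using L(1) True by simp
      next
        case False
        then have "wcomp k f = 0" using wcomp_zero by (simp add: L_def)
        then show ?thesis using lin_on_zero[OF cf_lin] by simp
      qed
    qed
  next
    assume c: "\<forall>k. \<forall>p\<in>Tup. cf p (wcomp k f) = 0"
    have "mpoly_eval (fold Dx xs (wcomp k f)) vh = 0" for k xs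
    proof -
      have e: "lin_ext (foldr (act d) xs (ev0 k d)) (wcomp k f) = mpoly_eval (fold Dx xs (wcomp k f)) vh"
        unfolding word_pair[OF kS] using ev0_pair[OF fold_Dx_keyed[of _ d "\<lambda>w. w = k", OF kc]] by simp
      show ?thesis
      proof (cases "ev0 k d = 0")
        case True
        show ?thesis unfolding e[symmetric] True lie_module_foldr(4)[OF W_module] by (rule lin_ext_fun_lin)
      next
        case False
        have "foldr (act d) xs (ev0 k d) \<in> hwspan (act d) (ev0 k d)"
          by (induction xs) (auto simp: hwspan_base hwspan_stable[OF ev0_hw[OF False]])
        then obtain P \<gamma> where P: "finite P" "P \<subseteq> Tup" "foldr (act d) xs (ev0 k d) = (\<Sum>p\<in>P. \<gamma> p *\<^sub>C fpow (act d) p (ev0 k d))"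
          by (rule hwspan_explicit)
        have "lin_ext (foldr (act d) xs (ev0 k d)) (wcomp k f) = (\<Sum>p\<in>P. \<gamma> p * cf p (wcomp k f))"
          unfolding P(3) lin_ext_fun_sum using cf_pair[OF kc, of _ k] by simp
        also have "\<dots> = 0" using c P(2) by (intro sum.neutral) auto
        finally show ?thesis using e by simp
      qed
    qed
    then show "words_vanish f"
      unfolding words_vanish_def by (simp add: fx mpoly_eval_sum)
  qed
qed

end

section \<open>Polynomials along curves in an algebraic group\<close>

lemma polys_UNIV [simp]: "f \<in> polys UNIV"
  by (simp add: polys_def)

lemma curve_chain:
  assumes "f \<in> polys Y" 
    and "\<And>y. y \<in> Y \<Longrightarrow> ((\<lambda>s. \<gamma> s y) has_field_derivative mpoly_eval (\<delta> y) (\<gamma> s)) (at s)"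
  shows "((\<lambda>s. mpoly_eval f (\<gamma> s)) has_field_derivative mpoly_eval (deriv_of \<delta> f) (\<gamma> s)) (at s)"
  using assms(1)
proof (induction f rule: mpoly_ring_induct)
  case (mult f g)
  then show ?case using DERIV_mult[OF mult.IH] by (simp add: deriv_of_mult algebra_simps)
qed (auto simp: assms(2) intro!: derivative_intros)

text \<open>Along an integral curve of a polynomial vector field, differentiating in the parameter
  is applying the derivation. The composite is holomorphic and all its derivatives at 0
  vanish.\<close>

lemma curve_vanish:
  assumes f: "f \<in> polys Y" and \<delta>: "\<And>y. y \<in> Y \<Longrightarrow> \<delta> y \<in> polys Y" 
    and \<gamma>: "\<And>s y. s \<in> ball 0 r \<Longrightarrow> y \<in> Y \<Longrightarrow> ((\<lambda>s. \<gamma> s y) has_field_derivative mpoly_eval (\<delta> y) (\<gamma> s)) (at s)"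
    and z: "\<And>k. mpoly_eval ((deriv_of \<delta> ^^ k) f) (\<gamma> 0) = 0" and s: "s \<in> ball 0 r"
  shows "mpoly_eval f (\<gamma> s) = 0"
proof -
  let ?\<phi> = "\<lambda>k s. mpoly_eval ((deriv_of \<delta> ^^ k) f) (\<gamma> s)"
  have p: "(deriv_of \<delta> ^^ k) f \<in> polys Y" for k
    by (induction k) (auto simp: f intro: deriv_of_polys \<delta>)
  have d: "(?\<phi> k has_field_derivative ?\<phi> (Suc k) s) (at s)" if "s \<in> ball 0 r" for k s
    using curve_chain[OF p[of k], of \<gamma> \<delta> s] \<gamma>[OF that] by simp
  have hd: "(deriv ^^ k) (?\<phi> 0) s = ?\<phi> k s" if "s \<in> ball 0 r" for k s
    using that
  proof (induction k arbitrary: s)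
    case (Suc k)
    have "((deriv ^^ k) (?\<phi> 0) has_field_derivative ?\<phi> (Suc k) s) (at s)"
      by (rule has_field_derivative_transform_within_open[OF d[OF Suc.prems] open_ball Suc.prems]) (rule Suc.IH[symmetric])
    then show ?case using DERIV_imp_deriv by (simp del: funpow.simps add: funpow.simps(2)[where f=deriv])
  qed simp
  have r: "(0::complex) \<in> ball 0 r" using s by (simp, meson norm_ge_zero le_less_trans)
  have "?\<phi> 0 s = 0"
  proof (rule holomorphic_fun_eq_0_on_ball[OF _ s])
    show "?\<phi> 0 holomorphic_on ball 0 r"
      using d unfolding holomorphic_on_open[OF open_ball] by blast
    show "(deriv ^^ n) (?\<phi> 0) 0 = 0" for n using hd[OF r, of n] z[of n] by simp
  qed
  then show ?thesis by simp
qed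

lemma mpoly_eval_continuous:
  assumes "f \<in> polys Y" "\<And>y. y \<in> Y \<Longrightarrow> continuous_on T (\<lambda>a. \<gamma> a y)"
  shows "continuous_on T (\<lambda>a. mpoly_eval f (\<gamma> a))"
  using assms(1) by (induction f rule: mpoly_ring_induct) (auto intro!: continuous_intros simp: assms(2))

lemma poly_right_mult:
  fixes p :: "('n::finite \<times> 'n) mpoly" and B :: "complex^'n^'n"
  shows "\<exists>q. \<forall>A. mpoly_eval q (entries A) = mpoly_eval p (entries (A ** B))"
  using polys_UNIV[of p]
proof (induction p rule: mpoly_ring_induct)
  case (const c)
  show ?case by (intro exI[of _ "Poly_Mapping.single 0 c"]) simp
next
  case (var x)
  obtain i j where x: "x = (i, j)" by (cases x)
  show ?case
    by (intro exI[of _ "\<Sum>k\<in>UNIV. Poly_Mapping.single 0 (B $ k $ j) * var (i, k)"])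
      (simp add: x entries_def mpoly_eval_sum matrix_matrix_mult_def mult.commute)
next
  case (add f g)
  then show ?case by (metis mpoly_eval_simps(2))
next
  case (mult f g)
  then show ?case by (metis mpoly_eval_mult)
qed

lemma det_poly: "\<exists>p :: ('n::finite \<times> 'n) mpoly. \<forall>A :: complex^'n^'n. mpoly_eval p (entries A) = det A"
proof -
  have pr: "mpoly_eval (\<Prod>i\<in>I. f i) v = (\<Prod>i\<in>I. mpoly_eval (f i) v)" for I and f :: "'n \<Rightarrow> ('n \<times> 'n) mpoly" and v
    by (induction I rule: infinite_finite_induct) simp_all
  have sg: "mpoly_eval (of_int k) v = of_int k" for k and v :: "'n \<times> 'n \<Rightarrow> complex"
    using mpoly_eval_simps(5)[of 0 "of_int k" v] by (simp del: mpoly_eval_simps(5))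
  show ?thesis
    by (intro exI[of _ "\<Sum>\<pi>\<in>{\<pi>. \<pi> permutes UNIV}. Poly_Mapping.single 0 (of_int (sign \<pi>)) * (\<Prod>i\<in>UNIV. var (i, \<pi> i))"])
      (simp add: det_def mpoly_eval_sum pr sg entries_def)
qed

lemma det_continuous: "continuous_on T (\<lambda>A :: complex^'n^'n. det A)"
proof -
  obtain p :: "('n \<times> 'n) mpoly" where p: "\<And>A :: complex^'n^'n. mpoly_eval p (entries A) = det A" using det_poly by blast
  have "continuous_on T (\<lambda>A :: complex^'n^'n. mpoly_eval p (entries A))"
    by (rule mpoly_eval_continuous[OF polys_UNIV]) (auto simp: entries_def split: prod.splits intro!: continuous_intros)
  then show ?thesis by (simp add: p)
qed

lemma matrix_inv_mult:
  assumes "invertible A"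
  shows "A ** matrix_inv A = mat 1" "matrix_inv A ** A = mat 1"
  using someI_ex[OF assms[unfolded invertible_def]] unfolding matrix_inv_def by blast+

lemma matrix_line_mult:
  fixes X B :: "complex^'n^'n"
  shows "((mat 1 + matrix_scale s X) ** B) $ i $ j = B $ i $ j + s * (X ** B) $ i $ j"
proof -
  have "((mat 1 + matrix_scale s X) ** B) $ i $ j = (mat 1 ** B) $ i $ j + (matrix_scale s X ** B) $ i $ j"
    unfolding matrix_matrix_mult_def by (simp add: algebra_simps sum.distrib)
  moreover have "(matrix_scale s X ** B) $ i $ j = s * (X ** B) $ i $ j"
    by (simp add: matrix_scale_def matrix_matrix_mult_def sum_distrib_left mult.assoc)
  ultimately show ?thesis by simp
qed

lemma matrix_exp:
  fixes X :: "complex^'n^'n"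
  obtains E where "E 0 = mat 1" "\<And>s i j. ((\<lambda>s. E s $ i $ j) has_field_derivative (X ** E s) $ i $ j) (at s)"
proof -
  define M where "M n = (((**) X) ^^ n) (mat 1)" for n
  \<comment> \<open>The sum of the moduli of all entries dominates every row sum, so the entries of
    the powers of \<open>X\<close> grow at most like powers of \<open>K\<close>.\<close>
  define K where "K = (\<Sum>i\<in>UNIV. \<Sum>j\<in>UNIV. cmod (X $ i $ j))"
  have row: "(\<Sum>k\<in>UNIV. cmod (X $ i $ k)) \<le> K" for i
    unfolding K_def by (rule member_le_sum) (auto intro: sum_nonneg)
  have bound: "cmod (M n $ i $ j) \<le> K ^ n" for n i j
  proof (induction n arbitrary: i j)
    case 0
    show ?case by (simp add: M_def mat_def)
  next
    case (Suc n)
    have "cmod (M (Suc n) $ i $ j) \<le> (\<Sum>k\<in>UNIV. cmod (X $ i $ k * M n $ k $ j))"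
      unfolding M_def by (simp add: matrix_matrix_mult_def) (rule norm_sum)
    also have "\<dots> \<le> (\<Sum>k\<in>UNIV. cmod (X $ i $ k) * K ^ n)"
      by (intro sum_mono) (simp add: norm_mult Suc.IH mult_left_mono)
    also have "\<dots> \<le> K * K ^ n"
      unfolding sum_distrib_right[symmetric] using row[of i] by (intro mult_right_mono) (auto simp: K_def sum_nonneg)
    finally show ?case by simp
  qed
  define c where "c i j n = M n $ i $ j / fact n" for i j n
  have sm: "summable (\<lambda>n. c i j n * s ^ n)" for i j s
  proof (rule summable_comparison_test)
    show "summable (\<lambda>n. inverse (fact n) * (K * cmod s) ^ n)" by (rule summable_exp)
    have "norm (c i j n * s ^ n) \<le> inverse (fact n) * (K * cmod s) ^ n" for n
      unfolding c_def using mult_right_mono[OF bound[of n i j], of "cmod s ^ n"]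
      by (simp add: norm_mult norm_divide norm_power power_mult_distrib divide_simps)
    then show "\<exists>N. \<forall>n\<ge>N. norm (c i j n * s ^ n) \<le> inverse (fact n) * (K * cmod s) ^ n" by blast
  qed
  define E where "E s = (\<chi> i j. suminf (\<lambda>n. c i j n * s ^ n))" for s
  show thesis
  proof
    show "E 0 = mat 1"
      by (simp add: E_def vec_eq_iff powser_zero) (simp add: c_def M_def)
    fix s i j
    have "diffs (c i j) n = (\<Sum>k\<in>UNIV. X $ i $ k * c k j n)" for n
      by (simp add: diffs_def c_def M_def matrix_matrix_mult_def sum_divide_distrib[symmetric] del: of_nat_Suc)
    then have "suminf (\<lambda>n. diffs (c i j) n * s ^ n) = suminf (\<lambda>n. \<Sum>k\<in>UNIV. X $ i $ k * (c k j n * s ^ n))"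
      by (simp add: sum_distrib_right mult.assoc)
    also have "\<dots> = (\<Sum>k\<in>UNIV. X $ i $ k * suminf (\<lambda>n. c k j n * s ^ n))"
      by (subst suminf_sum) (auto simp: suminf_mult[OF sm] intro: summable_mult sm)
    finally have "suminf (\<lambda>n. diffs (c i j) n * s ^ n) = (X ** E s) $ i $ j"
      by (simp add: matrix_matrix_mult_def E_def)
    then show "((\<lambda>s. E s $ i $ j) has_field_derivative (X ** E s) $ i $ j) (at s)"
      using termdiffs_strong_converges_everywhere[OF sm, of i j s] by (simp add: E_def)
  qed
qed

text \<open>The derivation along the vector field \<open>B \<mapsto> X ** B\<close> preserves the
  polynomials vanishing on \<open>G\<close>: at \<open>B\<close> in \<open>G\<close>, right
  translation reduces this to tangency at 1. So all derivatives of the equations vanish at the start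
  of the exponential curve. The radius comes from continuity of the determinant.\<close>

lemma exp_curve:
  fixes G :: "(complex^'n^'n) set"
  assumes G: "linear_algebraic_group G" and X: "X \<in> lie_algebra_of G"
  obtains E r where "0 < r" "E 0 = mat 1" "\<And>s. s \<in> ball 0 r \<Longrightarrow> E s \<in> G"
    "\<And>s i j. ((\<lambda>s. E s $ i $ j) has_field_derivative (X ** E s) $ i $ j) (at s)"
proof -
  obtain P :: "('n \<times> 'n) mpoly set" where P: "G = {A. invertible A \<and> (\<forall>p\<in>P. mpoly_eval p (entries A) = 0)}"
    and G1: "mat 1 \<in> G" and Gm: "\<And>A B. A \<in> G \<Longrightarrow> B \<in> G \<Longrightarrow> A ** B \<in> G"
    using G unfolding linear_algebraic_group_def by blast
  obtain E where E: "E 0 = mat 1" "\<And>s i j. ((\<lambda>s. E s $ i $ j) has_field_derivative (X ** E s) $ i $ j) (at s)"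
    by (rule matrix_exp[of X]) blast
  define van :: "('n \<times> 'n) mpoly \<Rightarrow> bool" where "van p \<longleftrightarrow> (\<forall>B\<in>G. mpoly_eval p (entries B) = 0)" for p
  define \<delta> :: "'n \<times> 'n \<Rightarrow> ('n \<times> 'n) mpoly" where
    "\<delta> x = (\<Sum>k\<in>UNIV. Poly_Mapping.single 0 (X $ fst x $ k) * var (k, snd x))" for x
  have \<delta>: "mpoly_eval (\<delta> (i, j)) (entries B) = (X ** B) $ i $ j" for i j B
    by (simp add: \<delta>_def mpoly_eval_sum entries_def matrix_matrix_mult_def)
  \<comment> \<open>The translated polynomial \<open>q\<close> also vanishes on \<open>G\<close>, so
    its derivative at 1 along \<open>X\<close> is 0; computed by the chain rule, this is the
    derivative of \<open>p\<close> at \<open>B\<close>.\<close>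
  have D: "van (deriv_of \<delta> p)" if p: "van p" for p
    unfolding van_def
  proof
    fix B assume B: "B \<in> G"
    obtain q :: "('n \<times> 'n) mpoly" where q: "\<And>A :: complex^'n^'n. mpoly_eval q (entries A) = mpoly_eval p (entries (A ** B))"
      using poly_right_mult by blast
    have B0: "(mat 1 + matrix_scale 0 X) ** B = B" by (simp add: vec_eq_iff matrix_line_mult)
    have "\<forall>A\<in>G. mpoly_eval q (entries A) = 0" using p Gm B by (simp add: q van_def)
    then have "((\<lambda>s. mpoly_eval q (entries (mat 1 + matrix_scale s X))) has_field_derivative 0) (at 0)"
      using X by (simp add: lie_algebra_of_def)
    moreover have "((\<lambda>s. mpoly_eval p (entries ((mat 1 + matrix_scale s X) ** B))) has_field_derivative
      mpoly_eval (deriv_of \<delta> p) (entries ((mat 1 + matrix_scale 0 X) ** B))) (at 0)"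
    proof (rule curve_chain[OF polys_UNIV])
      fix y :: "'n \<times> 'n"
      obtain i j where y: "y = (i, j)" by (cases y)
      show "((\<lambda>s. entries ((mat 1 + matrix_scale s X) ** B) y) has_field_derivative
          mpoly_eval (\<delta> y) (entries ((mat 1 + matrix_scale 0 X) ** B))) (at 0)"
        unfolding y \<delta> B0 by (simp add: entries_def matrix_line_mult) (auto intro!: derivative_eq_intros)
    qed
    ultimately show "mpoly_eval (deriv_of \<delta> p) (entries B) = 0" 
      unfolding q B0 using DERIV_unique by blast
  qed
  have ent: "((\<lambda>s. entries (E s) y) has_field_derivative mpoly_eval (\<delta> y) (entries (E s))) (at s)" for s y
    using E(2) by (cases y) (simp only: \<delta>, simp add: entries_def)
  have vE: "mpoly_eval p (entries (E s)) = 0" if "van p" for p s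
  proof (rule curve_vanish[OF polys_UNIV polys_UNIV ent])
    have "van ((deriv_of \<delta> ^^ k) p)" for k using that D by (induction k) auto
    then show "mpoly_eval ((deriv_of \<delta> ^^ k) p) (entries (E 0)) = 0" for k using G1 by (simp add: van_def E(1))
    show "s \<in> ball 0 (cmod s + 1)" by simp
  qed
  obtain d :: "('n \<times> 'n) mpoly" where d: "\<And>A :: complex^'n^'n. mpoly_eval d (entries A) = det A" using det_poly by blast
  have "isCont (\<lambda>s. mpoly_eval d (entries (E s))) 0"
    using curve_chain[OF polys_UNIV ent] by (rule DERIV_isCont)
  then have "((\<lambda>s. det (E s)) \<longlongrightarrow> 1) (at 0)" by (simp add: isCont_def d E(1))
  then have "\<forall>\<^sub>F s in at 0. det (E s) \<noteq> 0" by (rule tendsto_imp_eventually_ne) simp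
  then obtain r where r: "0 < r" "\<And>s. s \<noteq> 0 \<Longrightarrow> dist s 0 < r \<Longrightarrow> det (E s) \<noteq> 0" by (auto simp: eventually_at)
  have "E s \<in> G" if "s \<in> ball 0 r" for s
  proof (cases "s = 0")
    case False
    then have "invertible (E s)" using r(2)[of s] that by (simp add: invertible_det_nz)
    moreover have "van p" if "p \<in> P" for p using that unfolding van_def P by blast
    ultimately show ?thesis using vE by (subst P) blast
  qed (simp add: E(1) G1)
  with r(1) E show thesis using that by blast
qed


lemma mpoly_eval_tendsto:
  assumes "\<And>x. (\<lambda>n. a n x) \<longlonglongrightarrow> u x"
  shows "(\<lambda>n. mpoly_eval p (a n)) \<longlonglongrightarrow> mpoly_eval p u"
  using polys_UNIV[of p] by (induction p rule: mpoly_ring_induct) (auto intro!: tendsto_intros simp: assms)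

text \<open>Both ends of the difference quotient move. This is needed because the nearest points
  vary along with the points outside \<open>H\<close>.\<close>

lemma mpoly_strict_derivative:
  assumes a: "\<And>x. (\<lambda>n. a n x) \<longlonglongrightarrow> u x" and c: "\<And>x. (\<lambda>n. c n x) \<longlonglongrightarrow> u x"
    and q: "\<And>x. (\<lambda>n. (a n x - c n x) / t n) \<longlonglongrightarrow> y x"
  shows "(\<lambda>n. (mpoly_eval p (a n) - mpoly_eval p (c n)) / t n) \<longlonglongrightarrow>
    mpoly_eval (deriv_of (\<lambda>x. Poly_Mapping.single 0 (y x)) p) u"
  using polys_UNIV[of p]
proof (induction p rule: mpoly_ring_induct)
  case (add f g)
  then show ?case using tendsto_add[OF add.IH] by (simp add: algebra_simps add_divide_distrib diff_divide_distrib)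
next
  case (mult f g)
  have "(\<lambda>n. mpoly_eval f (a n) * ((mpoly_eval g (a n) - mpoly_eval g (c n)) / t n) + (mpoly_eval f (a n) - mpoly_eval f (c n)) / t n * mpoly_eval g (c n)) 
    \<longlonglongrightarrow> mpoly_eval f u * mpoly_eval (deriv_of (\<lambda>x. Poly_Mapping.single 0 (y x)) g) u
      + mpoly_eval (deriv_of (\<lambda>x. Poly_Mapping.single 0 (y x)) f) u * mpoly_eval g u"
    by (intro tendsto_intros mult.IH mpoly_eval_tendsto a c)
  then show ?case by (simp add: deriv_of_mult algebra_simps add_divide_distrib diff_divide_distrib)
qed (auto simp: q)

text \<open>Equations cut out \<open>G\<close> only among invertible matrices, so closedness is
  obtained inside a ball that avoids the zeros of the determinant.\<close>

lemma algebraic_group_locally_closed: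
  fixes G :: "(complex^'n^'n) set"
  assumes G: "linear_algebraic_group G" and A: "A \<in> G"
  obtains e where "0 < e" "\<And>B. B \<in> cball A e \<Longrightarrow> invertible B" "closed (G \<inter> cball A e)"
proof -
  obtain P :: "('n \<times> 'n) mpoly set" where P: "G = {A. invertible A \<and> (\<forall>p\<in>P. mpoly_eval p (entries A) = 0)}"
    using G unfolding linear_algebraic_group_def by blast
  have "open {B :: complex^'n^'n. det B \<noteq> 0}"
    by (intro open_Collect_neq det_continuous continuous_intros)
  moreover have "det A \<noteq> 0" using A unfolding P invertible_det_nz by blast
  ultimately obtain e where e: "0 < e" "cball A e \<subseteq> {B. det B \<noteq> 0}" by (auto simp: open_contains_cball)
  have c: "continuous_on UNIV (\<lambda>B :: complex^'n^'n. mpoly_eval p (entries B))" for p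
    by (rule mpoly_eval_continuous[OF polys_UNIV]) (auto simp: entries_def split: prod.splits intro!: continuous_intros)
  have "G \<inter> cball A e = (\<Inter>p\<in>P. {B. mpoly_eval p (entries B) = 0}) \<inter> cball A e"
    using e(2) unfolding P invertible_det_nz by blast
  moreover have "closed (\<Inter>p\<in>P. {B :: complex^'n^'n. mpoly_eval p (entries B) = 0})"
    by (intro closed_INT ballI closed_Collect_eq c continuous_intros)
  ultimately have "closed (G \<inter> cball A e)" by (simp add: closed_Int)
  then show thesis using e(2) by (intro that[OF e(1)]) (auto simp: invertible_det_nz)
qed

text \<open>For real parameters the squared distance to \<open>A\<close> has a local minimum at 0,
  where its derivative is \<open>- 2 * inner (A - E 0) W\<close>. The inner product is the real
  one.\<close>

lemma curve_nearest_orthogonal: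
  fixes E :: "complex \<Rightarrow> complex^'n^'n"
  assumes "\<And>i j. ((\<lambda>s. E s $ i $ j) has_field_derivative W $ i $ j) (at 0)"
    and "0 < r" "\<And>s. s \<in> ball 0 r \<Longrightarrow> dist A (E 0) \<le> dist A (E s)"
  shows "inner (A - E 0) W = 0"
proof -
  let ?e = "\<lambda>i j s. A $ i $ j - E (of_real s) $ i $ j"
  let ?f = "\<lambda>s::real. \<Sum>i\<in>UNIV. \<Sum>j\<in>UNIV. inner (?e i j s) (?e i j s)"
  have f: "?f s = (dist A (E (of_real s)))\<^sup>2" for s
    by (simp add: dist_norm power2_norm_eq_inner inner_vec_def)
  have d: "(?e i j has_vector_derivative - W $ i $ j) (at 0)" for i j
  proof -
    have "((\<lambda>s. E (of_real s) $ i $ j) has_vector_derivative W $ i $ j) (at 0)"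
      by (rule has_vector_derivative_real_field) (simp add: assms(1))
    then show ?thesis by (auto intro!: derivative_eq_intros)
  qed
  have "(?f has_vector_derivative (\<Sum>i\<in>UNIV. \<Sum>j\<in>UNIV. inner (?e i j 0) (- W $ i $ j) + inner (- W $ i $ j) (?e i j 0))) (at 0)"
    by (intro has_vector_derivative_sum bounded_bilinear.has_vector_derivative[OF bounded_bilinear_inner] d)
  then have "(?f has_real_derivative (\<Sum>i\<in>UNIV. \<Sum>j\<in>UNIV. inner (?e i j 0) (- W $ i $ j) + inner (- W $ i $ j) (?e i j 0))) (at 0)"
    by (simp only: has_real_derivative_iff_has_vector_derivative)
  moreover have "\<forall>s. \<bar>0 - s\<bar> < r \<longrightarrow> ?f 0 \<le> ?f s"
  proof (intro allI impI)
    fix s :: real assume "\<bar>0 - s\<bar> < r"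
    then have "dist A (E 0) \<le> dist A (E (of_real s))" by (intro assms(3)) simp
    then show "?f 0 \<le> ?f s" unfolding f by (simp add: power_mono)
  qed
  ultimately have "(\<Sum>i\<in>UNIV. \<Sum>j\<in>UNIV. inner (?e i j 0) (- W $ i $ j) + inner (- W $ i $ j) (?e i j 0)) = 0"
    using DERIV_local_min assms(2) by blast
  moreover have "inner (?e i j 0) (- W $ i $ j) + inner (- W $ i $ j) (?e i j 0) = - 2 * inner (?e i j 0) (W $ i $ j)" for i j
    using inner_commute[of "?e i j 0" "W $ i $ j"] by simp
  ultimately have "(\<Sum>i\<in>UNIV. \<Sum>j\<in>UNIV. - 2 * inner (?e i j 0) (W $ i $ j)) = 0" by simp
  then show ?thesis unfolding sum_distrib_left[symmetric] by (simp add: inner_vec_def)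
qed

text \<open>For \<open>A\<close> in \<open>G\<close> close to \<open>A0\<close> in \<open>H\<close>, let \<open>C\<close> be a point of \<open>H\<close> nearest to \<open>A\<close>.  A limit \<open>Y\<close> of the
  directions of \<open>A - C\<close> is tangent to \<open>G\<close> at \<open>A0\<close>, and by minimality it is orthogonal to all tangent
  vectors there.\<close>

lemma exp_invariant_open:
  fixes G H :: "(complex^'n^'n) set"
  assumes G: "linear_algebraic_group G" and cl: "closedin (top_of_set G) H"
    and inv: "\<And>A X. A \<in> H \<Longrightarrow> X \<in> lie_algebra_of G \<Longrightarrow> \<exists>E r. 0 < r \<and> E 0 = mat 1 \<and>
      (\<forall>i j. ((\<lambda>s. E s $ i $ j) has_field_derivative X $ i $ j) (at 0)) \<and> (\<forall>s\<in>ball 0 r. E s ** A \<in> H)"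
  shows "openin (top_of_set G) H"
proof (rule ccontr)
  assume "\<not> openin (top_of_set G) H"
  moreover have HG: "H \<subseteq> G" using cl by (auto simp: closedin_closed)
  ultimately obtain A0 where A0: "A0 \<in> H" and no: "\<And>e. 0 < e \<Longrightarrow> \<exists>A. A \<in> G \<and> A \<notin> H \<and> dist A0 A < e"
    unfolding openin_contains_ball by (force simp: subset_iff)
  obtain e where e: "0 < e" "\<And>B. B \<in> cball A0 e \<Longrightarrow> invertible B" "closed (G \<inter> cball A0 e)"
    using algebraic_group_locally_closed[OF G] A0 HG by blast
  define K where "K = H \<inter> cball A0 e"
  have "closed K"
  proof -
    obtain T where "closed T" "H = G \<inter> T" using cl by (auto simp: closedin_closed)
    then have "K = (G \<inter> cball A0 e) \<inter> T" by (auto simp: K_def)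
    then show ?thesis using e(3) \<open>closed T\<close> by (simp add: closed_Int)
  qed
  \<comment> \<open>With the bound \<open>e / 3\<close> on the distance from \<open>A0\<close>, the
    nearest point stays within \<open>2 * e / 3\<close>, strictly inside the ball; the restriction
    to the ball is then not felt near it.\<close>
  have "\<exists>A C. A \<in> G \<and> A \<notin> H \<and> dist A0 A < e / 3 / real (Suc n) \<and> C \<in> K \<and> (\<forall>B\<in>K. dist A C \<le> dist A B)" for n
  proof -
    obtain A where A: "A \<in> G" "A \<notin> H" "dist A0 A < e / 3 / real (Suc n)" using no[of "e / 3 / real (Suc n)"] e(1) by auto
    have "A0 \<in> K" using A0 e(1) by (simp add: K_def)
    then obtain C where "C \<in> K" "\<And>B. B \<in> K \<Longrightarrow> dist A C \<le> dist A B"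
      using distance_attains_inf[OF \<open>closed K\<close>, of A] by blast
    then show ?thesis using A by blast
  qed
  then obtain A C where A: "\<And>n. A n \<in> G" "\<And>n. A n \<notin> H" "\<And>n. dist A0 (A n) < e / 3 / real (Suc n)"
    and C: "\<And>n. C n \<in> K" "\<And>n B. B \<in> K \<Longrightarrow> dist (A n) (C n) \<le> dist (A n) B" by metis
  have K0: "A0 \<in> K" using A0 e(1) by (simp add: K_def)
  have lim: "(\<lambda>n. e / 3 / real (Suc n)) \<longlonglongrightarrow> 0" by (rule LIMSEQ_Suc[OF lim_const_over_n])
  have dA: "(\<lambda>n. dist (A n) A0) \<longlonglongrightarrow> 0"
    by (rule tendsto_sandwich[OF _ _ tendsto_const lim]) (use A(3) in \<open>auto simp: dist_commute less_imp_le\<close>)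
  \<comment> \<open>\<open>A0\<close> itself competes for being nearest.\<close>
  have C2: "dist (C n) A0 \<le> 2 * dist (A n) A0" for n
    using C(2)[OF K0, of n] dist_triangle[of "C n" A0 "A n"] by (simp add: dist_commute)
  have dC: "(\<lambda>n. dist (C n) A0) \<longlonglongrightarrow> 0"
    by (rule tendsto_sandwich[OF _ _ tendsto_const tendsto_mult_right_zero[OF dA, of 2]]) (use C2 in auto)
  have orth: "inner (A n - C n) (W ** C n) = 0" if W: "W \<in> lie_algebra_of G" for n W
  proof -
    obtain E r where E: "0 < r" "E 0 = mat 1" "\<And>i j. ((\<lambda>s. E s $ i $ j) has_field_derivative W $ i $ j) (at 0)"
      "\<And>s. s \<in> ball 0 r \<Longrightarrow> E s ** C n \<in> H" using inv[OF _ W, of "C n"] C(1)[of n] by (auto simp: K_def)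
    let ?E = "\<lambda>s. E s ** C n"
    have d: "((\<lambda>s. ?E s $ i $ j) has_field_derivative (W ** C n) $ i $ j) (at 0)" for i j
      unfolding matrix_matrix_mult_def by (auto intro!: derivative_eq_intros E(3))
    have "e / 3 / real (Suc n) \<le> e / 3" using e(1) by (simp add: divide_simps)
    then have "dist (C n) A0 < e" using C2[of n] A(3)[of n] e(1) by (simp add: dist_commute)
    moreover have "((\<lambda>s. ?E s) \<longlongrightarrow> C n) (at 0)"
      using d[THEN DERIV_isCont] by (intro vec_tendstoI) (simp add: isCont_def E(2))
    then have "((\<lambda>s. dist (?E s) A0) \<longlongrightarrow> dist (C n) A0) (at 0)" by (intro tendsto_intros)
    ultimately have "\<forall>\<^sub>F s in at 0. dist (?E s) A0 < e" by (rule order_tendstoD(2)[rotated])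
    then obtain r' where r': "0 < r'" "\<And>s. s \<noteq> 0 \<Longrightarrow> dist s 0 < r' \<Longrightarrow> dist (?E s) A0 < e" by (auto simp: eventually_at)
    have "inner (A n - ?E 0) (W ** C n) = 0"
    proof (rule curve_nearest_orthogonal[OF d])
      show "0 < min r r'" using E(1) r'(1) by simp
      fix s :: complex assume s: "s \<in> ball 0 (min r r')"
      \<comment> \<open>A short piece of the curve through \<open>C n\<close> remains in
        \<open>H\<close> and in the ball, so minimality may be used along it.\<close>
      have "?E s \<in> K"
      proof (cases "s = 0")
        case True
        then show ?thesis using C(1) by (simp add: E(2))
      next
        case False
        then show ?thesis using E(4)[of s] r'(2)[of s] s by (auto simp: K_def dist_commute less_imp_le)
      qed
      then show "dist (A n) (?E 0) \<le> dist (A n) (?E s)" using C(2) by (simp add: E(2))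
    qed
    then show ?thesis by (simp add: E(2))
  qed
  define t where "t n = norm (A n - C n)" for n
  have t: "0 < t n" for n
  proof -
    have "A n \<noteq> C n" using A(2)[of n] C(1)[of n] by (auto simp: K_def)
    then show ?thesis by (simp add: t_def)
  qed
  define Y where "Y n = (1 / t n) *\<^sub>R (A n - C n)" for n
  have "norm (Y n) = 1" for n using t[of n] unfolding Y_def norm_scaleR t_def[symmetric] by simp
  then have "\<forall>n. Y n \<in> sphere 0 1" by simp
  then obtain y \<phi> where y: "y \<in> sphere 0 1" "strict_mono \<phi>" "(Y \<circ> \<phi>) \<longlonglongrightarrow> y"
    using seq_compactE[OF compact_imp_seq_compact[OF compact_sphere[of "0 :: complex^'n^'n" 1]]] by metis
  have "(\<lambda>n. A (\<phi> n)) \<longlonglongrightarrow> A0" "(\<lambda>n. C (\<phi> n)) \<longlonglongrightarrow> A0"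
    using LIMSEQ_subseq_LIMSEQ[OF tendsto_dist_iff[THEN iffD2, OF dA] y(2)]
      LIMSEQ_subseq_LIMSEQ[OF tendsto_dist_iff[THEN iffD2, OF dC] y(2)] by (simp_all only: o_def)
  note lims = this
  have ent: "(\<lambda>n. entries (B n) x) \<longlonglongrightarrow> entries B0 x" if "B \<longlonglongrightarrow> B0" for B and B0 :: "complex^'n^'n" and x
    using that by (cases x) (auto simp: entries_def intro!: tendsto_intros)
  \<comment> \<open>An equation of \<open>G\<close> vanishes at both \<open>A (\<phi> n)\<close> and
    \<open>C (\<phi> n)\<close>, so its difference quotients are 0 and so is their limit.\<close>
  have tang: "mpoly_eval (deriv_of (\<lambda>x. Poly_Mapping.single 0 (entries y x)) p) (entries A0) = 0"
    if p: "\<forall>B\<in>G. mpoly_eval p (entries B) = 0" for p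
  proof -
    have "(\<lambda>n. (entries (A (\<phi> n)) x - entries (C (\<phi> n)) x) / of_real (t (\<phi> n))) \<longlonglongrightarrow> entries y x" for x
      using ent[OF y(3), of x] by (cases x) (simp add: entries_def Y_def scaleR_conv_of_real[where 'a=complex])
    from mpoly_strict_derivative[where a="\<lambda>n. entries (A (\<phi> n))" and c="\<lambda>n. entries (C (\<phi> n))" and u="entries A0" and p=p,
        OF ent[OF lims(1)] ent[OF lims(2)] this]
    have "(\<lambda>n. 0) \<longlonglongrightarrow> mpoly_eval (deriv_of (\<lambda>x. Poly_Mapping.single 0 (entries y x)) p) (entries A0)"
      using p A(1) C(1) HG by (simp add: K_def subset_iff)
    then show ?thesis by (simp add: LIMSEQ_const_iff)
  qed
  have A0G: "A0 \<in> G" using A0 HG by blast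
  have Gm: "\<And>A B. A \<in> G \<Longrightarrow> B \<in> G \<Longrightarrow> A ** B \<in> G" "\<And>A. A \<in> G \<Longrightarrow> matrix_inv A \<in> G"
    using G unfolding linear_algebraic_group_def by blast+
  define B where "B = matrix_inv A0"
  have B: "B \<in> G" "A0 ** B = mat 1" "B ** A0 = mat 1"
    using Gm(2)[OF A0G] matrix_inv_mult[of A0] e(1) e(2)[of A0] by (auto simp: B_def)
  \<comment> \<open>Right translation by the inverse of \<open>A0\<close> carries the tangent vector
    at \<open>A0\<close> to one at 1.\<close>
  have "y ** B \<in> lie_algebra_of G"
    unfolding lie_algebra_of_def
  proof (intro CollectI allI impI)
    fix p :: "('n \<times> 'n) mpoly" assume p: "\<forall>B\<in>G. mpoly_eval p (entries B) = 0"
    obtain q :: "('n \<times> 'n) mpoly" where q: "\<And>A :: complex^'n^'n. mpoly_eval q (entries A) = mpoly_eval p (entries (A ** B))"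
      using poly_right_mult by blast
    have q0: "\<forall>A\<in>G. mpoly_eval q (entries A) = 0" using p Gm B(1) by (simp add: q)
    have "((\<lambda>s. mpoly_eval q (entries (A0 + matrix_scale s y))) has_field_derivative
      mpoly_eval (deriv_of (\<lambda>x. Poly_Mapping.single 0 (entries y x)) q) (entries (A0 + matrix_scale 0 y))) (at 0)"
    proof (rule curve_chain[OF polys_UNIV])
      show "((\<lambda>s. entries (A0 + matrix_scale s y) x) has_field_derivative
        mpoly_eval (Poly_Mapping.single 0 (entries y x)) (entries (A0 + matrix_scale 0 y))) (at 0)" for x
        by (cases x) (auto simp: entries_def matrix_scale_def intro!: derivative_eq_intros)
    qed
    moreover have "A0 + matrix_scale 0 y = A0" by (simp add: vec_eq_iff matrix_scale_def)
    moreover have "(A0 + matrix_scale s y) ** B = mat 1 + matrix_scale s (y ** B)" for s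
    proof -
      have "(A0 + matrix_scale s y) ** B = A0 ** B + matrix_scale s (y ** B)"
        by (simp add: vec_eq_iff matrix_matrix_mult_def matrix_scale_def algebra_simps sum.distrib sum_distrib_left)
      then show ?thesis by (simp add: B)
    qed
    ultimately show "((\<lambda>s. mpoly_eval p (entries (mat 1 + matrix_scale s (y ** B)))) has_field_derivative 0) (at 0)"
      using tang[OF q0] by (simp add: q)
  qed
  \<comment> \<open>The orthogonality is applied to the limit direction itself. As
    \<open>C n\<close> tends to \<open>A0\<close>, the translated vectors tend to \<open>y\<close>,
    so the unit vector \<open>y\<close> would be orthogonal to itself.\<close>
  note Yn = orth[OF this]
  have "inner (Y (\<phi> n)) (y ** B ** C (\<phi> n)) = 0" for n using Yn[of "\<phi> n"] by (simp add: Y_def)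
  moreover have "(\<lambda>n. inner (Y (\<phi> n)) (y ** B ** C (\<phi> n))) \<longlonglongrightarrow> inner y (y ** B ** A0)"
  proof (rule tendsto_inner)
    show "(\<lambda>n. Y (\<phi> n)) \<longlonglongrightarrow> y" using y(3) by (simp add: o_def)
    show "(\<lambda>n. y ** B ** C (\<phi> n)) \<longlonglongrightarrow> y ** B ** A0"
      unfolding matrix_matrix_mult_def by (intro tendsto_intros lims)
  qed
  ultimately have "inner y (y ** B ** A0) = 0" by (simp add: LIMSEQ_const_iff)
  then show False using y(1) B(3) by (simp add: matrix_mul_assoc[symmetric])
qed

section \<open>Functions on the orbit\<close>

text \<open>\<open>rational_rep\<close> speaks of functionals on the whole type, while coordinates
  are linear on an irreducible module only.\<close>

lemma lin_on_extend:
  fixes f :: "'a::complex_vector \<Rightarrow> complex"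
  assumes B: "is_basis B V" and f: "lin_on V f"
  shows "\<exists>\<xi>. Vector_Spaces.linear (*\<^sub>C) (*) \<xi> \<and> (\<forall>u\<in>V. \<xi> u = f u)"
proof -
  interpret vp: vector_space_pair "scaleC :: complex \<Rightarrow> 'a \<Rightarrow> 'a" "(*) :: complex \<Rightarrow> complex \<Rightarrow> complex"
    by unfold_locales (simp_all add: algebra_simps)
  have V: "V = cv.span B" "\<not> cv.dependent B" using B by (auto simp: is_basis_def)
  obtain \<xi> where \<xi>: "Vector_Spaces.linear (*\<^sub>C) (*) \<xi>" "\<forall>x\<in>B. \<xi> x = f x"
    using vp.linear_independent_extend[OF V(2), of f] by blast
  have add: "\<xi> (u + w) = \<xi> u + \<xi> w" and scale: "\<xi> (c *\<^sub>C u) = c * \<xi> u" for u w c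
    using \<xi>(1) vp.linear_add vp.linear_scale by blast+
  have "lin_on V (\<lambda>u. \<xi> u - f u)"
    using f by (simp add: lin_on_def add scale algebra_simps)
  then have "\<xi> u - f u \<in> {0}" if "u \<in> V" for u
    by (rule lin_on_span_into[OF _ _ _ cv.subspace_single_0 _ that[unfolded V(1)]])
      (use V \<xi>(2) cv.span_superset in \<open>auto intro: cv.subspace_span\<close>)
  then show ?thesis using \<xi>(1) by fastforce
qed

lemma mpoly_eval_cong:
  assumes "f \<in> polys Y" "\<And>y. y \<in> Y \<Longrightarrow> v y = w y"
  shows "mpoly_eval f v = mpoly_eval f w"
  using assms(1) by (induction f rule: mpoly_ring_induct) (auto simp: assms(2))

lemma mpoly_eval_power: "mpoly_eval (f ^ k) v = mpoly_eval f v ^ k"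
  by (induction k) simp_all

lemma regular_quotient:
  fixes F :: "complex^'n^'n \<Rightarrow> complex"
  assumes "regular_on_GL F"
  obtains p q :: "('n \<times> 'n) mpoly" where
    "\<And>A. invertible A \<Longrightarrow> F A = mpoly_eval p (entries A) / mpoly_eval q (entries A)"
    "\<And>A :: complex^'n^'n. invertible A \<Longrightarrow> mpoly_eval q (entries A) \<noteq> 0"
proof -
  obtain p :: "('n \<times> 'n) mpoly" and k where p: "\<And>A. invertible A \<Longrightarrow> F A = mpoly_eval p (entries A) / det A ^ k"
    using assms unfolding regular_on_GL_def by blast
  obtain d :: "('n \<times> 'n) mpoly" where d: "\<And>A :: complex^'n^'n. mpoly_eval d (entries A) = det A" using det_poly by blast
  show thesis
    by (rule that[of p "d ^ k"]) (auto simp: p mpoly_eval_power d invertible_det_nz)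
qed

lemma regular_continuous:
  fixes F :: "complex^'n^'n \<Rightarrow> complex"
  assumes "regular_on_GL F" "\<And>A. A \<in> T \<Longrightarrow> invertible A"
  shows "continuous_on T F"
proof -
  obtain p q :: "('n \<times> 'n) mpoly" where pq: "\<And>A. invertible A \<Longrightarrow> F A = mpoly_eval p (entries A) / mpoly_eval q (entries A)"
    "\<And>A :: complex^'n^'n. invertible A \<Longrightarrow> mpoly_eval q (entries A) \<noteq> 0" using regular_quotient[OF assms(1)] by blast
  have c: "continuous_on T (\<lambda>A :: complex^'n^'n. mpoly_eval p (entries A))" for p
    by (rule mpoly_eval_continuous[OF polys_UNIV]) (auto simp: entries_def split: prod.splits intro!: continuous_intros)
  have "continuous_on T (\<lambda>A. mpoly_eval p (entries A) / mpoly_eval q (entries A))"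
    using pq(2) assms(2) by (intro continuous_on_divide c) auto
  then show ?thesis using pq(1) assms(2) by (simp cong: continuous_on_cong)
qed

text \<open>At 1 the derivative of a regular function depends only on the tangent vector. So the
  derivative known along the line \<open>mat 1 + matrix_scale s X\<close> is also that along any
  curve through 1 with this tangent.\<close>

lemma regular_derivative:
  fixes F :: "complex^'n^'n \<Rightarrow> complex"
  assumes F: "regular_on_GL F" and d: "((\<lambda>s. F (mat 1 + matrix_scale s X)) has_field_derivative d) (at 0)"
    and A: "A s0 = mat 1" "\<And>i j. ((\<lambda>s. A s $ i $ j) has_field_derivative X $ i $ j) (at s0)"
    and U: "open U" "s0 \<in> U" "\<And>s. s \<in> U \<Longrightarrow> invertible (A s)"
  shows "((\<lambda>s. F (A s)) has_field_derivative d) (at s0)"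
proof -
  obtain p q :: "('n \<times> 'n) mpoly" where pq: "\<And>A. invertible A \<Longrightarrow> F A = mpoly_eval p (entries A) / mpoly_eval q (entries A)"
    "\<And>A :: complex^'n^'n. invertible A \<Longrightarrow> mpoly_eval q (entries A) \<noteq> 0" using regular_quotient[OF F] by blast
  let ?D = "\<lambda>p. mpoly_eval (deriv_of (\<lambda>x. Poly_Mapping.single 0 (entries X x)) p) (entries (mat 1))"
  let ?e = "\<lambda>p. mpoly_eval p (entries (mat 1))"
  let ?d = "(?D p * ?e q - ?e p * ?D q) / (?e q * ?e q)"
  have i1: "invertible (mat 1 :: complex^'n^'n)" by (simp add: invertible_det_nz)
  have D: "((\<lambda>s. F (B s)) has_field_derivative ?d) (at t)"
    if B1: "B t = mat 1" and B: "\<And>i j. ((\<lambda>s. B s $ i $ j) has_field_derivative X $ i $ j) (at t)"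
      and U: "open U" "t \<in> U" "\<And>s. s \<in> U \<Longrightarrow> invertible (B s)" for B t U
  proof -
    have "((\<lambda>s. mpoly_eval p (entries (B s))) has_field_derivative ?D p) (at t)" for p
    proof -
      have "((\<lambda>s. entries (B s) x) has_field_derivative mpoly_eval (Poly_Mapping.single 0 (entries X x)) (entries (B t))) (at t)" for x
        using B by (cases x) (simp add: entries_def)
      from curve_chain[OF polys_UNIV this, of p] show ?thesis by (simp add: B1)
    qed
    then have "((\<lambda>s. mpoly_eval p (entries (B s)) / mpoly_eval q (entries (B s))) has_field_derivative ?d) (at t)"
      using DERIV_divide[of "\<lambda>s. mpoly_eval p (entries (B s))" "?D p" t UNIV "\<lambda>s. mpoly_eval q (entries (B s))" "?D q"] 
        pq(2)[OF i1] by (simp add: B1)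
    then show ?thesis
      by (rule has_field_derivative_transform_within_open[OF _ U(1,2)]) (simp add: pq(1)[OF U(3)])
  qed
  have l: "(mat 1 + matrix_scale s X) $ i $ j = mat 1 $ i $ j + s * X $ i $ j" for s i j
    by (simp add: matrix_scale_def)
  let ?L = "\<lambda>s. mat 1 + matrix_scale s X"
  have dl: "((\<lambda>s. ?L s $ i $ j) has_field_derivative X $ i $ j) (at s)" for i j s
    unfolding l by (auto intro!: derivative_eq_intros)
  have L0: "?L 0 = mat 1" by (simp add: vec_eq_iff matrix_scale_def)
  have "open {s. det (?L s) \<noteq> 0}"
  proof (rule open_Collect_neq[OF _ continuous_on_const])
    obtain dp :: "('n \<times> 'n) mpoly" where dp: "\<And>A :: complex^'n^'n. mpoly_eval dp (entries A) = det A" using det_poly by blast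
    have "continuous_on UNIV (\<lambda>s. mpoly_eval dp (entries (?L s)))"
      by (rule mpoly_eval_continuous[OF polys_UNIV]) (auto simp: entries_def l split: prod.splits simp del: vector_add_component intro!: continuous_intros)
    then show "continuous_on UNIV (\<lambda>s. det (?L s))" by (simp add: dp)
  qed
  from D[OF L0 dl this] have "((\<lambda>s. F (?L s)) has_field_derivative ?d) (at 0)"
    by (simp add: L0 invertible_det_nz)
  then have "d = ?d" using d DERIV_unique by blast
  then show ?thesis using D[OF A U] by simp
qed

section \<open>The orbit of the sum of the highest weight vectors\<close>

locale group_orbit = embedding D lam m
  for D :: "('g::complex_lie_algebra, 'v::complex_vector) lie_setup" and lam m +
  fixes G :: "(complex^'n^'n) set" and \<iota> :: "'g \<Rightarrow> complex^'n^'n" and R :: "weight \<Rightarrow> complex^'n^'n \<Rightarrow> 'v \<Rightarrow> 'v"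
  assumes algebraic: "linear_algebraic_group G"
    and connected: "connected G"
    and iso: "lie_algebra_iso G \<iota>"
    and rational: "\<And>k. k \<in> dominant_weights D \<Longrightarrow> rational_rep G \<iota> (irrep D k) (action D k) (R k)"
begin

lemma group:
  "mat 1 \<in> G" "A \<in> G \<Longrightarrow> B \<in> G \<Longrightarrow> A ** B \<in> G" "A \<in> G \<Longrightarrow> matrix_inv A \<in> G" "A \<in> G \<Longrightarrow> invertible A"
  using algebraic unfolding linear_algebraic_group_def by blast+

lemma repD:
  assumes "k \<in> Dom" "u \<in> irrep D k"
  shows "A \<in> G \<Longrightarrow> R k A u \<in> irrep D k" "R k (mat 1) u = u"
    "A \<in> G \<Longrightarrow> B \<in> G \<Longrightarrow> R k (A ** B) u = R k A (R k B u)"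
  using rational[OF assms(1)] assms(2) unfolding rational_rep_def by blast+

lemma rep_coord_regular:
  assumes "k \<in> Dom" "u \<in> irrep D k"
  obtains F where "regular_on_GL F" "\<And>A. A \<in> G \<Longrightarrow> vcoord k q (R k A u) = F A"
    "\<And>x. ((\<lambda>s. F (mat 1 + matrix_scale s (\<iota> x))) has_field_derivative vcoord k q (action D k x u)) (at 0)"
proof -
  obtain \<xi> where \<xi>: "Vector_Spaces.linear (*\<^sub>C) (*) \<xi>" "\<And>u. u \<in> irrep D k \<Longrightarrow> \<xi> u = vcoord k q u"
    using lin_on_extend[OF Ess_basis[OF assms(1)] vcoord_lin[OF assms(1)]] by blast
  have "\<exists>F. regular_on_GL F \<and> (\<forall>A\<in>G. \<xi> (R k A u) = F A) \<and>
     (\<forall>x. ((\<lambda>s. F (mat 1 + matrix_scale s (\<iota> x))) has_field_derivative \<xi> (action D k x u)) (at 0))"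
    using rational[OF assms(1)] assms(2) \<xi>(1) unfolding rational_rep_def by blast
  then show thesis using that \<xi>(2) repD(1)[OF assms] lie_moduleD(2)[OF irrep_module[OF assms(1)] assms(2)] by metis
qed

text \<open>The representation is differentiated at 1 only. Around the parameter \<open>s\<close>,
  the factor \<open>E t\<close> is therefore replaced by \<open>E t ** B\<close> with
  \<open>B\<close> inverse to \<open>E s\<close>, a curve through 1 with tangent
  \<open>\<iota> x\<close>, acting on the vector reached at \<open>s\<close>.\<close>

lemma rep_curve_derivative:
  assumes k: "k \<in> Dom" "u \<in> irrep D k" and A: "A \<in> G" and s: "s \<in> ball 0 r"
    and E: "\<And>s. s \<in> ball 0 r \<Longrightarrow> E s \<in> G" 
      "\<And>s i j. ((\<lambda>s. E s $ i $ j) has_field_derivative (\<iota> x ** E s) $ i $ j) (at s)"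
  shows "((\<lambda>s. vcoord k q (R k (E s ** A) u)) has_field_derivative
    vcoord k q (action D k x (R k (E s ** A) u))) (at s)"
proof -
  define w where "w = R k (E s ** A) u"
  define B where "B = matrix_inv (E s)"
  have B: "B \<in> G" "B ** E s = mat 1" "E s ** B = mat 1"
    using group E(1)[OF s] matrix_inv_mult[of "E s"] by (auto simp: B_def)
  have w: "w \<in> irrep D k" using repD(1)[OF k] group(2) E(1)[OF s] A by (simp add: w_def)
  obtain F where F: "regular_on_GL F" "\<And>A. A \<in> G \<Longrightarrow> vcoord k q (R k A w) = F A"
    "\<And>x. ((\<lambda>s. F (mat 1 + matrix_scale s (\<iota> x))) has_field_derivative vcoord k q (action D k x w)) (at 0)"
    using rep_coord_regular[OF k(1) w] by blast
  have "((\<lambda>t. F (E t ** B)) has_field_derivative vcoord k q (action D k x w)) (at s)"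
  proof (rule regular_derivative[where A="\<lambda>t. E t ** B" and U="ball 0 r", OF F(1) F(3) B(3) _ open_ball s])
    have "((\<lambda>t. (E t ** B) $ i $ j) has_field_derivative ((\<iota> x ** E s) ** B) $ i $ j) (at s)" for i j
      unfolding matrix_matrix_mult_def[of _ B] by (auto intro!: derivative_eq_intros E(2))
    then show "((\<lambda>t. (E t ** B) $ i $ j) has_field_derivative \<iota> x $ i $ j) (at s)" for i j
      by (simp add: matrix_mul_assoc[symmetric] B)
  qed (use E(1) B(1) group in blast)
  then have "((\<lambda>t. vcoord k q (R k (E t ** A) u)) has_field_derivative vcoord k q (action D k x w)) (at s)"
  proof (rule has_field_derivative_transform_within_open[OF _ open_ball s])
    fix t :: complex assume t: "t \<in> ball 0 r"
    have "E t ** A = (E t ** B) ** (E s ** A)" by (metis matrix_mul_assoc B(2) matrix_mul_lid)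
    then show "F (E t ** B) = vcoord k q (R k (E t ** A) u)"
      using F(2) repD(3)[OF k] group(2) E(1)[OF t] E(1)[OF s] B(1) A by (simp add: w_def)
  qed
  then show ?thesis by (simp add: w_def)
qed

definition orb :: "complex^'n^'n \<Rightarrow> nat \<Rightarrow> 'v" where
  "orb A = (\<lambda>j. if j < m then R (lam j) A (hw_vector D (lam j)) else 0)"

definition cc :: "complex^'n^'n \<Rightarrow> nat \<times> exponent \<Rightarrow> complex" where
  "cc A = coords D lam (orb A)"

lemma orb_irrep: "A \<in> G \<Longrightarrow> j < m \<Longrightarrow> orb A j \<in> irrep D (lam j)"
  using repD(1)[OF lam] hw_in_irrep[OF lam] by (simp add: orb_def)

lemma cc_eq: "(j, q) \<in> X \<Longrightarrow> cc A (j, q) = vcoord (lam j) q (R (lam j) A (hw_vector D (lam j)))"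
  unfolding cc_def coords_eq by (simp add: orb_def X_iff)

lemma cc_one: "y \<in> X \<Longrightarrow> cc (mat 1) y = vh y"
  using repD(2)[OF lam] hw_in_irrep[OF lam] by (cases y) (simp add: cc_eq vh_def coords_eq X_iff)

lemma cc_continuous: "y \<in> X \<Longrightarrow> continuous_on G (\<lambda>A. cc A y)"
proof -
  assume y: "y \<in> X"
  obtain j q where jq: "y = (j, q)" by (cases y)
  then have j: "j < m" using y by (simp add: X_iff)
  obtain F where F: "regular_on_GL F" "\<And>A. A \<in> G \<Longrightarrow> vcoord (lam j) q (R (lam j) A (hw_vector D (lam j))) = F A"
    using rep_coord_regular[OF lam[OF j] hw_in_irrep[OF lam[OF j]]] by blast
  have "continuous_on G F" by (rule regular_continuous[OF F(1) group(4)])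
  then show ?thesis using F(2) y by (simp add: jq cc_eq cong: continuous_on_cong)
qed

lemma orbit_curve:
  assumes A: "A \<in> G"
  obtains E r where "0 < r" "E 0 = mat 1" "\<And>s i j. ((\<lambda>s. E s $ i $ j) has_field_derivative (\<iota> x ** E s) $ i $ j) (at s)"
    "\<And>s. s \<in> ball 0 r \<Longrightarrow> E s ** A \<in> G" 
    "\<And>s y. s \<in> ball 0 r \<Longrightarrow> y \<in> X \<Longrightarrow>
      ((\<lambda>s. cc (E s ** A) y) has_field_derivative mpoly_eval (\<delta> x y) (cc (E s ** A))) (at s)"
proof -
  have "\<iota> x \<in> lie_algebra_of G" using iso unfolding lie_algebra_iso_def bij_betw_def by blast
  then obtain E r where E: "0 < r" "E 0 = mat 1" "\<And>s. s \<in> ball 0 r \<Longrightarrow> E s \<in> G"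
    "\<And>s i j. ((\<lambda>s. E s $ i $ j) has_field_derivative (\<iota> x ** E s) $ i $ j) (at s)"
    by (rule exp_curve[OF algebraic]) (rule that)
  show thesis
  proof (rule that[OF E(1,2,4)])
    show EA: "E s ** A \<in> G" if "s \<in> ball 0 r" for s :: complex using group(2) E(3)[OF that] A by blast
    fix s :: complex and y assume s: "s \<in> ball 0 r" and y: "y \<in> X"
    obtain j q where jq: "y = (j, q)" by (cases y)
    then have j: "j < m" using y by (simp add: X_iff)
    have "mpoly_eval (\<delta> x y) (cc (E s ** A)) = vcoord (lam j) q (action D (lam j) x (orb (E s ** A) j))"
      unfolding cc_def jq \<delta>_def using linf_eval[where w="orb (E s ** A)", OF j endo_action[OF lam[OF j]] orb_irrep[OF EA[OF s] j]] by simp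
    then show "((\<lambda>s. cc (E s ** A) y) has_field_derivative mpoly_eval (\<delta> x y) (cc (E s ** A))) (at s)"
      using rep_curve_derivative[OF lam[OF j] hw_in_irrep[OF lam[OF j]] A s E(3,4), of q] y j
      by (simp add: jq cc_eq orb_def)
  qed
qed

lemma vanish_Dx:
  assumes f: "f \<in> polys X" and z: "\<And>A. A \<in> G \<Longrightarrow> mpoly_eval f (cc A) = 0" and A: "A \<in> G"
  shows "mpoly_eval (Dx x f) (cc A) = 0"
proof -
  obtain E r where E: "0 < r" "E 0 = mat 1" "\<And>s i j. ((\<lambda>s. E s $ i $ j) has_field_derivative (\<iota> x ** E s) $ i $ j) (at s)"
    "\<And>s. s \<in> ball 0 r \<Longrightarrow> E s ** A \<in> G" 
    "\<And>s y. s \<in> ball 0 r \<Longrightarrow> y \<in> X \<Longrightarrow>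
      ((\<lambda>s. cc (E s ** A) y) has_field_derivative mpoly_eval (\<delta> x y) (cc (E s ** A))) (at s)"
    by (rule orbit_curve[OF A]) (rule that)
  have r: "(0::complex) \<in> ball 0 r" using E(1) by simp
  have "((\<lambda>s. mpoly_eval f (cc (E s ** A))) has_field_derivative mpoly_eval (Dx x f) (cc (E 0 ** A))) (at 0)"
    by (rule curve_chain[OF f E(5)[OF r]])
  moreover have "((\<lambda>s. mpoly_eval f (cc (E s ** A))) has_field_derivative 0) (at 0)"
    by (rule has_field_derivative_transform_within_open[OF _ open_ball r]) (use z E(4) in auto)
  ultimately show ?thesis using DERIV_unique by (fastforce simp: E(2))
qed

lemma fold_Dx_polys: "f \<in> polys X \<Longrightarrow> fold Dx xs f \<in> polys X"
  by (induction xs arbitrary: f) (auto simp: Dx_polys)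

text \<open>Forward: derivatives of a function vanishing on the orbit vanish there. Backward: the
  set \<open>Z\<close> where all iterated derivatives vanish is closed and contains 1; short
  exponential curves do not leave it, so it is also open, and connectedness finishes.\<close>

lemma orbit_vanish_iff:
  assumes f: "f \<in> polys X"
  shows "(\<forall>A\<in>G. mpoly_eval f (cc A) = 0) \<longleftrightarrow> words_vanish f"
proof -
  have one: "mpoly_eval (fold Dx xs f) (cc (mat 1)) = mpoly_eval (fold Dx xs f) vh" for xs
    by (rule mpoly_eval_cong[OF fold_Dx_polys[OF f] cc_one])
  show ?thesis
  proof
    assume z: "\<forall>A\<in>G. mpoly_eval f (cc A) = 0"
    have "\<forall>A\<in>G. mpoly_eval (fold Dx xs f) (cc A) = 0" for xs
      using f z
    proof (induction xs arbitrary: f)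
      case (Cons x xs)
      from Cons.IH[OF Dx_polys[OF Cons.prems(1)]] vanish_Dx[OF Cons.prems(1)] Cons.prems(2) show ?case by simp
    qed simp
    then show "words_vanish f"
      using group(1) one by (simp add: words_vanish_def)
  next
    assume w: "words_vanish f"
    define Z where "Z = {A \<in> G. \<forall>xs. mpoly_eval (fold Dx xs f) (cc A) = 0}"
    have "Z = G \<inter> (\<Inter>xs. {A \<in> G. mpoly_eval (fold Dx xs f) (cc A) = 0})" by (auto simp: Z_def)
    moreover have "closedin (top_of_set G) {A \<in> G. mpoly_eval (fold Dx xs f) (cc A) = 0}" for xs
      by (intro continuous_closedin_preimage_constant mpoly_eval_continuous[OF fold_Dx_polys[OF f]] cc_continuous)
    ultimately have cl: "closedin (top_of_set G) Z" by (auto intro!: closedin_Int closedin_Inter)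
    have "openin (top_of_set G) Z"
    proof (rule exp_invariant_open[OF algebraic cl])
      fix A W assume A: "A \<in> Z" and W: "W \<in> lie_algebra_of G"
      have AG: "A \<in> G" using A by (simp add: Z_def)
      obtain x where x: "W = \<iota> x" using W iso unfolding lie_algebra_iso_def bij_betw_def by blast
      obtain E r where E: "0 < r" "E 0 = mat 1" "\<And>s i j. ((\<lambda>s. E s $ i $ j) has_field_derivative (\<iota> x ** E s) $ i $ j) (at s)"
        "\<And>s. s \<in> ball 0 r \<Longrightarrow> E s ** A \<in> G" 
        "\<And>s y. s \<in> ball 0 r \<Longrightarrow> y \<in> X \<Longrightarrow>
          ((\<lambda>s. cc (E s ** A) y) has_field_derivative mpoly_eval (\<delta> x y) (cc (E s ** A))) (at s)"
        by (rule orbit_curve[OF AG]) (rule that)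
      have "E s ** A \<in> Z" if s: "s \<in> ball 0 r" for s
      proof -
        have "mpoly_eval (fold Dx xs f) (cc (E s ** A)) = 0" for xs
        proof (rule curve_vanish[OF fold_Dx_polys[OF f] \<delta>_polys E(5) _ s])
          fix k
          \<comment> \<open>Further differentiation along \<open>x\<close> only lengthens the word,
            so all derivatives along the curve vanish at its start.\<close>
          have "(Dx x ^^ k) (fold Dx xs f) = fold Dx (xs @ replicate k x) f"
            by (induction k) (simp_all add: replicate_append_same[symmetric] del: replicate.simps)
          then show "mpoly_eval ((Dx x ^^ k) (fold Dx xs f)) (cc (E 0 ** A)) = 0"
            using A by (simp add: E(2) Z_def del: fold_append)
        qed
        then show ?thesis using E(4)[OF s] by (simp add: Z_def)
      qed
      moreover have "((\<lambda>s. E s $ i $ j) has_field_derivative W $ i $ j) (at 0)" for i j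
        using E(3)[of i j 0] by (simp add: E(2) x)
      ultimately show "\<exists>E r. 0 < r \<and> E 0 = mat 1 \<and>
        (\<forall>i j. ((\<lambda>s. E s $ i $ j) has_field_derivative W $ i $ j) (at 0)) \<and> (\<forall>s\<in>ball 0 r. E s ** A \<in> Z)"
        using E(1,2) by blast
    qed
    moreover have "mat 1 \<in> Z"
      using w group(1) one by (simp add: Z_def words_vanish_def)
    ultimately have "Z = G" using connected cl unfolding connected_clopen by blast
    then have "\<forall>A\<in>G. mpoly_eval (fold Dx [] f) (cc A) = 0" unfolding Z_def by blast
    then show "\<forall>A\<in>G. mpoly_eval f (cc A) = 0" by simp
  qed
qed

lemma vanishing_ideal_orbit_closure:
  "vanishing_ideal D lam m (zariski_closure D lam m (orbit D G R lam m)) = {f \<in> polys X. words_vanish f}"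
proof -
  have o: "orbit D G R lam m = orb ` G" by (simp add: orbit_def orb_def)
  have "orb A \<in> direct_sum D lam m" if "A \<in> G" for A
    using orb_irrep[OF that] by (simp add: direct_sum_def orb_def)
  then have "orbit D G R lam m \<subseteq> zariski_closure D lam m (orbit D G R lam m)"
    by (auto simp: o zariski_closure_def vanishing_ideal_def)
  then have "vanishing_ideal D lam m (zariski_closure D lam m (orbit D G R lam m)) = vanishing_ideal D lam m (orbit D G R lam m)"
    by (auto simp: zariski_closure_def vanishing_ideal_def)
  also have "\<dots> = {f \<in> polys X. \<forall>A\<in>G. mpoly_eval f (cc A) = 0}"
    by (simp add: vanishing_ideal_def coord_ring_polys o cc_def)
  finally show ?thesis using orbit_vanish_iff by blast
qed

end

section \<open>Leading terms\<close>

context embedding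
begin

definition ms :: "(nat \<times> exponent \<Rightarrow>\<^sub>0 nat) \<Rightarrow> exponent" where
  "ms a = snd (monomial_sign lam a)"

lemma sign_eq: "monomial_sign lam a = (wt a, ms a)"
  by (simp add: wt_def ms_def)

lemma ms_Tup: "Poly_Mapping.keys a \<subseteq> X \<Longrightarrow> ms a \<in> Tup"
  unfolding ms_def by (rule sign_signature)

lemma cf_simps [simp]:
  "cf p (f + g) = cf p f + cf p g" "cf p (c *\<^sub>C f) = c * cf p f" "cf p 0 = 0" "cf p (f - g) = cf p f - cf p g"
proof -
  show a: "cf p (f + g) = cf p f + cf p g" and s: "cf p (c *\<^sub>C f) = c * cf p f" for f g c
    using cf_lin[of p] by (auto simp: lin_on_def)
  show "cf p 0 = 0" using s[of 0 0] by simp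
  show "cf p (f - g) = cf p f - cf p g" using a[of "f - g" g] by simp
qed

lemma cf_expand: "cf p f = (\<Sum>a\<in>Poly_Mapping.keys f. Poly_Mapping.lookup f a * cf p (Poly_Mapping.single a 1))"
proof -
  have "cf p (\<Sum>a\<in>A. g a) = (\<Sum>a\<in>A. cf p (g a))" for A and g :: "_ \<Rightarrow> (nat \<times> exponent) mpoly"
    by (induction A rule: infinite_finite_induct) simp_all
  from this[of "\<lambda>a. Poly_Mapping.lookup f a *\<^sub>C Poly_Mapping.single a 1" "Poly_Mapping.keys f"]
  show ?thesis by (simp only: mpoly_expand cf_simps)
qed

lemma cf_monomial:
  assumes "Poly_Mapping.keys a \<subseteq> X"
  shows "cf (ms a) (Poly_Mapping.single a 1) = 1" "mless p (ms a) \<Longrightarrow> cf p (Poly_Mapping.single a 1) = 0"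
  using lead_monomial[OF assms] by (auto simp: lead_def ms_def)

lemma cf_Ess:
  assumes "k \<in> Dom" "f \<in> wpoly k" "p \<in> Tup"
  shows "cf p f = (\<Sum>q\<in>Ess k. vcoord k q (vv k p) * cf q f)"
proof (cases "p \<in> Ess k")
  case True
  then show ?thesis by (simp add: vcoord_vv Ess_finite if_distrib[of "\<lambda>x. x * _"] cong: if_cong)
next
  case False
  \<comment> \<open>The expansion of the vector of \<open>p\<close> in the essential basis, written
    as a linear relation with coefficient -1 at \<open>p\<close>.\<close>
  let ?\<gamma> = "\<lambda>q. if q = p then - 1 else vcoord k q (vv k p)"
  have e: "(\<Sum>q\<in>Ess k. ?\<gamma> q *\<^sub>C vv k q) = (\<Sum>q\<in>Ess k. vcoord k q (vv k p) *\<^sub>C vv k q)"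
    "(\<Sum>q\<in>Ess k. ?\<gamma> q * cf q f) = (\<Sum>q\<in>Ess k. vcoord k q (vv k p) * cf q f)"
    using False by (auto intro!: sum.cong)
  have "(\<Sum>q\<in>insert p (Ess k). ?\<gamma> q *\<^sub>C vv k q) = 0"
    unfolding sum.insert[OF Ess_finite False] e using vcoord_sum[OF assms(1) vv_in_irrep[OF assms(1)]] by simp
  then have "(\<Sum>q\<in>insert p (Ess k). ?\<gamma> q * cf q f) = 0"
    by (intro relation_to_cf[OF assms(1,2)]) (use Ess_finite Ess_tuples assms(3) in auto)
  then show ?thesis unfolding sum.insert[OF Ess_finite False] e by simp
qed

text \<open>For nonessential \<open>p\<close>, the functional \<open>cf p\<close> is a combination
  of the essential ones. Those above \<open>p\<close> have coefficient 0 by triangularity, and those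
  below vanish on \<open>f\<close> by assumption.\<close>

lemma leading_Ess:
  assumes "k \<in> Dom" "f \<in> wpoly k" "p \<in> Tup" "cf p f \<noteq> 0" "\<And>q. mless q p \<Longrightarrow> cf q f = 0"
  shows "p \<in> Ess k"
proof (rule ccontr)
  assume "p \<notin> Ess k"
  then have "vcoord k q (vv k p) * cf q f = 0" if "q \<in> Ess k" for q
    using mless_total[OF assms(3) Ess_tuples[OF that]] vcoord_low[OF that] assms(5) that by auto
  then show False using assms(4) cf_Ess[OF assms(1-3)] by (simp add: sum.neutral)
qed

lemma monomial_wpoly: "Poly_Mapping.keys a \<subseteq> X \<Longrightarrow> Poly_Mapping.single a c \<in> wpoly (wt a)"
  by (auto simp: wpoly_def keyed_def)

text \<open>Closure of the essential signatures under addition, in the form needed here: a sum of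
  them is the signature of a monomial, whose lowest exponent is essential.\<close>

lemma ms_Ess: "Poly_Mapping.keys a \<subseteq> X \<Longrightarrow> ms a \<in> Ess (wt a)"
  by (rule leading_Ess[OF _ monomial_wpoly[where c=1]]) (simp_all add: sign_signature ms_Tup cf_monomial)

lemma wpolyD:
  assumes "f \<in> wpoly k"
  shows "f \<in> polys X" "a \<in> Poly_Mapping.keys f \<Longrightarrow> wt a = k" "a \<in> Poly_Mapping.keys f \<Longrightarrow> Poly_Mapping.keys a \<subseteq> X"
  using assms by (auto simp: wpoly_def keyed_def polys_def)

lemma wcomp_of_wpoly:
  assumes "f \<in> wpoly k"
  shows "wcomp l f = (if l = k then f else 0)"
proof (rule poly_mapping_eqI)
  fix a
  have "wt a = k \<or> Poly_Mapping.lookup f a = 0" using wpolyD(2)[OF assms, of a] by (auto simp: in_keys_iff)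
  then show "Poly_Mapping.lookup (wcomp l f) a = Poly_Mapping.lookup (if l = k then f else 0) a"
    by (auto simp: lookup_wcomp)
qed

lemma words_vanish_wpoly: "f \<in> wpoly k \<Longrightarrow> words_vanish f \<longleftrightarrow> (\<forall>p\<in>Tup. cf p f = 0)"
  by (auto simp: words_vanish_iff[OF wpolyD(1)] wcomp_of_wpoly)

lemma words_vanish_wcomp: "f \<in> polys X \<Longrightarrow> words_vanish f \<Longrightarrow> words_vanish (wcomp k f)"
  by (simp add: words_vanish_wpoly[OF wcomp_wpoly] words_vanish_iff)

lemma least_cf:
  assumes "p \<in> Tup" "cf p f \<noteq> 0"
  obtains q where "q \<in> Tup" "cf q f \<noteq> 0" "\<And>r. mless r q \<Longrightarrow> cf r f = 0"
proof -
  have "wf {(p, q). mless p q}" using mless_wf by (simp add: wfp_def)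
  from wfE_min[OF this, of p "{q \<in> Tup. cf q f \<noteq> 0}"] assms obtain q where q: "q \<in> Tup" "cf q f \<noteq> 0"
    "\<And>r. mless r q \<Longrightarrow> r \<notin> {q \<in> Tup. cf q f \<noteq> 0}" by auto
  then show thesis using that[OF q(1,2)] mless_tuples by blast
qed

subsection \<open>The order on signatures\<close>

lemma deglex_total: "k \<noteq> l \<Longrightarrow> deglex_less n k l \<or> deglex_less n l k"
  unfolding deglex_less_def by (meson linorder_less_linear)

lemma deglex_trans: "deglex_less n k l \<Longrightarrow> deglex_less n l r \<Longrightarrow> deglex_less n k r"
  unfolding deglex_less_def by (auto dest: less_trans)

lemma sig_less_eq: "sig_less D (k, p) (l, q) \<longleftrightarrow> deglex_less (rank D) k l \<or> k = l \<and> mless p q"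
  by (auto simp: sig_less_def mless_def)

lemma sig_less_irrefl: "\<not> sig_less D \<sigma> \<sigma>"
  by (cases \<sigma>) (simp add: sig_less_eq)

lemma sig_less_trans: "sig_less D \<sigma> \<tau> \<Longrightarrow> sig_less D \<tau> \<upsilon> \<Longrightarrow> sig_less D \<sigma> \<upsilon>"
  by (cases \<sigma>; cases \<tau>; cases \<upsilon>) (auto simp: sig_less_eq dest: deglex_trans mless_trans)

lemma least_sign_unique:
  assumes "\<sigma> \<in> monomial_sign lam ` Poly_Mapping.keys f"
    and "\<And>a. a \<in> Poly_Mapping.keys f \<Longrightarrow> monomial_sign lam a = \<sigma> \<or> sig_less D \<sigma> (monomial_sign lam a)"
  shows "least_sign D lam f = \<sigma>"
  unfolding least_sign_def
proof (rule the_equality)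
  show "\<sigma> \<in> monomial_sign lam ` Poly_Mapping.keys f \<and> (\<forall>\<tau>\<in>monomial_sign lam ` Poly_Mapping.keys f. \<tau> = \<sigma> \<or> sig_less D \<sigma> \<tau>)"
    using assms by blast
next
  fix \<tau> assume "\<tau> \<in> monomial_sign lam ` Poly_Mapping.keys f \<and>
    (\<forall>\<upsilon>\<in>monomial_sign lam ` Poly_Mapping.keys f. \<upsilon> = \<tau> \<or> sig_less D \<tau> \<upsilon>)"
  then have "\<tau> = \<sigma> \<or> sig_less D \<sigma> \<tau>" "\<sigma> = \<tau> \<or> sig_less D \<tau> \<sigma>" using assms by auto
  then show "\<tau> = \<sigma>" using sig_less_trans[of \<sigma> \<tau> \<sigma>] sig_less_irrefl[of \<sigma>] by auto
qed

lemma least_sign_exists: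
  assumes "f \<in> polys X" "f \<noteq> 0"
  obtains a where "a \<in> Poly_Mapping.keys f" "least_sign D lam f = monomial_sign lam a"
    "\<And>b. b \<in> Poly_Mapping.keys f \<Longrightarrow> monomial_sign lam b = monomial_sign lam a \<or> sig_less D (monomial_sign lam a) (monomial_sign lam b)"
proof -
  have "\<exists>a\<in>A. \<forall>b\<in>A. monomial_sign lam b = monomial_sign lam a \<or> sig_less D (monomial_sign lam a) (monomial_sign lam b)"
    if "finite A" "A \<noteq> {}" "\<And>a. a \<in> A \<Longrightarrow> Poly_Mapping.keys a \<subseteq> X" for A
    using that
  proof (induction A rule: finite_ne_induct)
    case (insert x A)
    then have "\<exists>a\<in>A. \<forall>b\<in>A. monomial_sign lam b = monomial_sign lam a \<or> sig_less D (monomial_sign lam a) (monomial_sign lam b)"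
      by simp
    then obtain a where a: "a \<in> A" "\<And>b. b \<in> A \<Longrightarrow> monomial_sign lam b = monomial_sign lam a \<or> sig_less D (monomial_sign lam a) (monomial_sign lam b)"
      by blast
    have t: "ms x \<in> Tup" "ms a \<in> Tup" using ms_Tup insert.prems a(1) by auto
    have "monomial_sign lam x = monomial_sign lam a \<or> sig_less D (monomial_sign lam a) (monomial_sign lam x) \<or> sig_less D (monomial_sign lam x) (monomial_sign lam a)"
      unfolding sign_eq sig_less_eq using deglex_total[of "wt x" "wt a" "rank D"] mless_total[OF t] by auto
    then show ?case
    proof (elim disjE)
      assume l: "sig_less D (monomial_sign lam x) (monomial_sign lam a)"
      show ?thesis
      proof (intro bexI[of _ x] ballI)
        fix b assume "b \<in> insert x A"
        then show "monomial_sign lam b = monomial_sign lam x \<or> sig_less D (monomial_sign lam x) (monomial_sign lam b)"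
          using a(2)[of b] l sig_less_trans[OF l, of "monomial_sign lam b"] by auto
      qed simp
    qed (use a in blast)+
  qed auto
  from this[of "Poly_Mapping.keys f"] obtain a where a: "a \<in> Poly_Mapping.keys f"
    "\<And>b. b \<in> Poly_Mapping.keys f \<Longrightarrow> monomial_sign lam b = monomial_sign lam a \<or> sig_less D (monomial_sign lam a) (monomial_sign lam b)"
    using assms by (auto simp: polys_def)
  then have "least_sign D lam f = monomial_sign lam a" by (intro least_sign_unique) auto
  then show thesis using that a by blast
qed

abbreviation "sgc \<equiv> sign_component lam"

lemma sgc_lin_ext: "sgc \<sigma> f = lin_ext (\<lambda>a. if monomial_sign lam a = \<sigma> then Poly_Mapping.single a 1 else 0) f"
  unfolding sign_component_def lin_ext_def
  by (rule sum.mono_neutral_cong_left) (auto simp: single_scaleC[symmetric])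

lemma lookup_sgc: "Poly_Mapping.lookup (sgc \<sigma> f) a = (if monomial_sign lam a = \<sigma> then Poly_Mapping.lookup f a else 0)"
proof -
  have "Poly_Mapping.lookup (sgc \<sigma> f) a =
    (\<Sum>b\<in>{b \<in> Poly_Mapping.keys f. monomial_sign lam b = \<sigma>}. if b = a then Poly_Mapping.lookup f a else 0)"
    unfolding sign_component_def lookup_sum by (intro sum.cong refl) (simp add: lookup_single when_def)
  then show ?thesis by (auto simp: in_keys_iff)
qed

lemma sgc_polys: "f \<in> polys X \<Longrightarrow> sgc \<sigma> f \<in> polys X"
  by (auto simp: polys_def in_keys_iff lookup_sgc split: if_splits)

lemma sgc_simps [simp]: "sgc \<sigma> (f + g) = sgc \<sigma> f + sgc \<sigma> g" "sgc \<sigma> (c *\<^sub>C f) = c *\<^sub>C sgc \<sigma> f" "sgc \<sigma> 0 = 0"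
  by (simp_all add: sgc_lin_ext)

lemma sgc_wcomp: "sgc \<sigma> (wcomp (fst \<sigma>) f) = sgc \<sigma> f"
  by (rule poly_mapping_eqI) (auto simp: lookup_sgc lookup_wcomp wt_def)

lemma sgc_monomial_mult: "sgc (monomial_sign lam b + \<tau>) (Poly_Mapping.single b 1 * g) = Poly_Mapping.single b 1 * sgc \<tau> g"
  by (rule mpoly_linear_induct[of g UNIV])
    (auto simp: mult_single sgc_lin_ext monomial_sign_add algebra_simps scaleC_mult)

lemma sgc_monomial_mult_zero:
  assumes "\<And>\<tau>. \<sigma> \<noteq> monomial_sign lam b + \<tau>"
  shows "sgc \<sigma> (Poly_Mapping.single b 1 * g) = 0"
  using assms[symmetric]
  by (intro mpoly_linear_induct[of g UNIV "\<lambda>g. sgc \<sigma> (Poly_Mapping.single b 1 * g) = 0"])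
    (auto simp: mult_single sgc_lin_ext monomial_sign_add algebra_simps scaleC_mult)

subsection \<open>Ideals\<close>

text \<open>The hull is an intersection of ideals; that it stays inside the ring uses that the ring
  is itself an ideal containing \<open>F\<close>.\<close>

lemma ideal_spanned_ideal:
  assumes "F \<subseteq> polys X"
  shows "ideal_in (polys X) (ideal_spanned (polys X) F)" "F \<subseteq> ideal_spanned (polys X) F"
proof -
  show "F \<subseteq> ideal_spanned (polys X) F" unfolding ideal_spanned_def by (rule hull_subset)
  have A: "ideal_in (polys X) (polys X)" by (auto simp: ideal_in_def polys_add polys_mult)
  have "ideal_spanned (polys X) F \<subseteq> polys X" unfolding ideal_spanned_def using assms A by (rule hull_minimal)
  then show "ideal_in (polys X) (ideal_spanned (polys X) F)"
    unfolding ideal_in_def[of _ "ideal_spanned _ _"] unfolding ideal_spanned_def hull_def by (auto simp: ideal_in_def)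
qed

lemma ideal_inD:
  assumes "ideal_in (polys X) I"
  shows "0 \<in> I" "f \<in> I \<Longrightarrow> g \<in> I \<Longrightarrow> f + g \<in> I" "r \<in> polys X \<Longrightarrow> f \<in> I \<Longrightarrow> r * f \<in> I" "f \<in> I \<Longrightarrow> c *\<^sub>C f \<in> I"
    "finite A \<Longrightarrow> (\<And>a. a \<in> A \<Longrightarrow> h a \<in> I) \<Longrightarrow> sum h A \<in> I"
proof -
  show "0 \<in> I" and a: "f \<in> I \<Longrightarrow> g \<in> I \<Longrightarrow> f + g \<in> I" and r: "r \<in> polys X \<Longrightarrow> f \<in> I \<Longrightarrow> r * f \<in> I" for f g r
    using assms by (auto simp: ideal_in_def)
  show "f \<in> I \<Longrightarrow> c *\<^sub>C f \<in> I" unfolding scaleC_mpoly by (intro r polys_single) auto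
  show "finite A \<Longrightarrow> (\<And>a. a \<in> A \<Longrightarrow> h a \<in> I) \<Longrightarrow> sum h A \<in> I"
    by (induction A rule: finite_induct) (use \<open>0 \<in> I\<close> a in auto)
qed

lemma binomial_ideal:
  shows "ideal_in (polys X) (binomial_ideal D lam m)"
    and "Poly_Mapping.keys a \<subseteq> X \<Longrightarrow> Poly_Mapping.keys b \<subseteq> X \<Longrightarrow> monomial_sign lam a = monomial_sign lam b \<Longrightarrow>
      Poly_Mapping.single a 1 - Poly_Mapping.single b 1 \<in> binomial_ideal D lam m"
proof -
  let ?F = "{Poly_Mapping.single a (1::complex) - Poly_Mapping.single b 1 |a b. Poly_Mapping.keys a \<subseteq> X \<and> Poly_Mapping.keys b \<subseteq> X \<and>
    monomial_sign lam a = monomial_sign lam b}"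
  have F: "?F \<subseteq> polys X" using cv.subspace_diff[OF polys_subspace polys_single polys_single] by blast
  show "ideal_in (polys X) (binomial_ideal D lam m)"
    using ideal_spanned_ideal(1)[OF F] by (simp add: binomial_ideal_def coord_ring_polys)
  have "?F \<subseteq> binomial_ideal D lam m"
    using ideal_spanned_ideal(2)[OF F] by (simp add: binomial_ideal_def coord_ring_polys)
  then show "Poly_Mapping.keys a \<subseteq> X \<Longrightarrow> Poly_Mapping.keys b \<subseteq> X \<Longrightarrow> monomial_sign lam a = monomial_sign lam b \<Longrightarrow>
      Poly_Mapping.single a 1 - Poly_Mapping.single b 1 \<in> binomial_ideal D lam m" by blast
qed

text \<open>With coefficient sum 0, the terms of one signature can be rewritten as a combination of
  differences from one fixed monomial \<open>b\<close> among them.\<close>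

lemma zero_sum_binomial:
  assumes f: "f \<in> polys X" and s: "(\<Sum>a\<in>Poly_Mapping.keys (sgc \<sigma> f). Poly_Mapping.lookup f a) = 0"
  shows "sgc \<sigma> f \<in> binomial_ideal D lam m"
proof (cases "sgc \<sigma> f = 0")
  case False
  note J = ideal_inD[OF binomial_ideal(1)]
  let ?K = "Poly_Mapping.keys (sgc \<sigma> f)"
  have K: "Poly_Mapping.keys a \<subseteq> X" "monomial_sign lam a = \<sigma>" "Poly_Mapping.lookup (sgc \<sigma> f) a = Poly_Mapping.lookup f a" if "a \<in> ?K" for a
    using that f by (auto simp: in_keys_iff lookup_sgc polys_def split: if_splits)
  obtain b where b: "b \<in> ?K" using False by (metis keys_eq_empty all_not_in_conv)
  have "sgc \<sigma> f = (\<Sum>a\<in>?K. Poly_Mapping.lookup f a *\<^sub>C Poly_Mapping.single a 1)"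
    using mpoly_expand[of "sgc \<sigma> f"] K(3) by simp
  also have "\<dots> = (\<Sum>a\<in>?K. Poly_Mapping.lookup f a *\<^sub>C (Poly_Mapping.single a 1 - Poly_Mapping.single b 1))"
    using s by (simp only: cv.scale_right_diff_distrib sum_subtractf cv.scale_sum_left[symmetric]) simp
  also have "\<dots> \<in> binomial_ideal D lam m"
    using K b by (intro J(4,5) binomial_ideal(2)) auto
  finally show ?thesis .
qed (simp add: ideal_inD[OF binomial_ideal(1)])

text \<open>Restricted to the terms of weight \<open>k\<close>, the coefficient \<open>cf s\<close> only sees the terms of signature \<open>(k, s)\<close>, the least one.\<close>

lemma cf_least_component:
  assumes f: "f \<in> polys X"
    and min: "\<And>a. a \<in> Poly_Mapping.keys f \<Longrightarrow> wt a = k \<Longrightarrow> ms a = s \<or> mless s (ms a)"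
  shows "cf s (wcomp k f) = (\<Sum>a\<in>Poly_Mapping.keys (sgc (k, s) f). Poly_Mapping.lookup f a)"
proof -
  let ?g = "wcomp k f"
  have "cf s ?g = (\<Sum>a\<in>Poly_Mapping.keys ?g. Poly_Mapping.lookup ?g a * cf s (Poly_Mapping.single a 1))" by (rule cf_expand)
  also have "\<dots> = (\<Sum>a\<in>Poly_Mapping.keys (sgc (k, s) f). Poly_Mapping.lookup f a)"
  proof (rule sum.mono_neutral_cong_right)
    show "Poly_Mapping.keys (sgc (k, s) f) \<subseteq> Poly_Mapping.keys ?g"
      by (auto simp: in_keys_iff lookup_sgc lookup_wcomp wt_def split: if_splits)
    show "\<forall>a\<in>Poly_Mapping.keys ?g - Poly_Mapping.keys (sgc (k, s) f). Poly_Mapping.lookup ?g a * cf s (Poly_Mapping.single a 1) = 0"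
    proof
      fix a assume a: "a \<in> Poly_Mapping.keys ?g - Poly_Mapping.keys (sgc (k, s) f)"
      then have "a \<in> Poly_Mapping.keys f" "wt a = k" "ms a \<noteq> s"
        by (auto simp: in_keys_iff lookup_sgc lookup_wcomp sign_eq split: if_splits)
      then have "mless s (ms a)" "Poly_Mapping.keys a \<subseteq> X" using min f by (auto simp: polys_def)
      then show "Poly_Mapping.lookup ?g a * cf s (Poly_Mapping.single a 1) = 0" using cf_monomial(2) by simp
    qed
    show "Poly_Mapping.lookup ?g a * cf s (Poly_Mapping.single a 1) = Poly_Mapping.lookup f a"
      if "a \<in> Poly_Mapping.keys (sgc (k, s) f)" for a
    proof -
      have "wt a = k" "ms a = s" "a \<in> Poly_Mapping.keys f"
        using that by (auto simp: in_keys_iff lookup_sgc sign_eq split: if_splits)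
      then show ?thesis using cf_monomial(1)[of a] f by (auto simp: lookup_wcomp polys_def)
    qed
  qed simp
  finally show ?thesis .
qed

lemma Sigma_gen_eq: "Sigma_gen D (lam ` {..<m}) = {monomial_sign lam a |a. Poly_Mapping.keys a \<subseteq> X}"
proof -
  have "\<exists>a. \<sigma> = monomial_sign lam a \<and> Poly_Mapping.keys a \<subseteq> X" if \<sigma>: "\<sigma> \<in> Sigma_gen D (lam ` {..<m})" for \<sigma>
  proof -
    obtain xs where xs: "\<sigma> = sum_list xs" "set xs \<subseteq> {\<sigma> \<in> essential D. fst \<sigma> \<in> lam ` {..<m}}"
      using \<sigma> by (auto simp: Sigma_gen_def generated_def)
    have "\<exists>a. sum_list xs = monomial_sign lam a \<and> Poly_Mapping.keys a \<subseteq> X" using xs(2)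
    proof (induction xs)
      case Nil
      show ?case by (intro exI[of _ 0]) simp
    next
      case (Cons \<tau> xs)
      then obtain a where a: "sum_list xs = monomial_sign lam a" "Poly_Mapping.keys a \<subseteq> X" by auto
      obtain j p where j: "j < m" "\<tau> = (lam j, p)" "(lam j, p) \<in> essential D" using Cons.prems by (cases \<tau>) auto
      then have "Poly_Mapping.keys (a + Poly_Mapping.single (j, p) 1) \<subseteq> X"
        using a(2) keys_add[of a "Poly_Mapping.single (j, p) 1"] by (auto simp: coord_vars_def)
      then show ?case using a(1) j(2)
        by (intro exI[of _ "a + Poly_Mapping.single (j, p) 1"]) (simp add: monomial_sign_add add.commute)
    qed
    then show ?thesis using xs(1) by blast
  qed
  moreover have "monomial_sign lam a \<in> Sigma_gen D (lam ` {..<m})" if "Poly_Mapping.keys a \<subseteq> X" for a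
    using that
  proof (induction a rule: monomial_induct)
    case zero
    show ?case unfolding Sigma_gen_def generated_def by (auto intro: exI[of _ "[]"])
  next
    case (var a x)
    then obtain xs where xs: "monomial_sign lam a = sum_list xs" "set xs \<subseteq> {\<sigma> \<in> essential D. fst \<sigma> \<in> lam ` {..<m}}"
      by (auto simp: Sigma_gen_def generated_def)
    obtain j p where j: "x = (j, p)" "j < m" "(lam j, p) \<in> essential D" using var by (cases x) (auto simp: coord_vars_def)
    have "monomial_sign lam (a + Poly_Mapping.single x 1) = sum_list ((lam j, p) # xs)"
      unfolding j(1) monomial_sign_add monomial_sign_single by (simp add: xs(1) add.commute)
    moreover have "set ((lam j, p) # xs) \<subseteq> {\<sigma> \<in> essential D. fst \<sigma> \<in> lam ` {..<m}}" using xs(2) j by auto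
    ultimately show ?case unfolding Sigma_gen_def generated_def by blast
  qed
  ultimately show ?thesis by blast
qed

lemma wt_generated: "Poly_Mapping.keys a \<subseteq> X \<Longrightarrow> wt a \<in> generated (lam ` {..<m})"
proof (induction a rule: monomial_induct)
  case zero
  show ?case unfolding generated_def by (auto intro: exI[of _ "[]"])
next
  case (var a x)
  then obtain xs where xs: "wt a = sum_list xs" "set xs \<subseteq> lam ` {..<m}" by (auto simp: generated_def)
  obtain j p where j: "x = (j, p)" "j < m" using var by (cases x) (auto simp: coord_vars_def)
  have "wt (a + Poly_Mapping.single x 1) = sum_list (lam j # xs)"
    unfolding j(1) wt_simps by (simp add: xs(1) add.commute)
  moreover have "set (lam j # xs) \<subseteq> lam ` {..<m}" using xs(2) j by auto
  ultimately show ?case unfolding generated_def by blast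
qed

lemma Sigma_gen_subset: "Sigma_gen D (lam ` {..<m}) \<subseteq> Sigma_over D (generated (lam ` {..<m}))"
  unfolding Sigma_gen_eq Sigma_over_def using ms_Ess wt_generated by (auto simp: Ess_def sign_eq)

end

section \<open>Subduction, lifting of initial forms, and the criterion\<close>

context group_orbit
begin

abbreviation "orbit_ideal \<equiv> {f \<in> polys X. words_vanish f}"
abbreviation "weight_semigroup \<equiv> generated (lam ` {..<m})"

lemma orbit_ideal_is_ideal: "ideal_in (polys X) orbit_ideal"
proof -
  \<comment> \<open>Closure under products is read off from vanishing on the orbit, where it is
    immediate.\<close>
  have "orbit_ideal = {f \<in> polys X. \<forall>A\<in>G. mpoly_eval f (cc A) = 0}" using orbit_vanish_iff by blast
  then show ?thesis by (auto simp: ideal_in_def polys_add polys_mult)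
qed

lemma lt_ideal:
  shows "ideal_in (polys X) (lt_ideal D lam m orbit_ideal)"
    and "f \<in> orbit_ideal \<Longrightarrow> f \<noteq> 0 \<Longrightarrow> lt D lam f \<in> lt_ideal D lam m orbit_ideal"
    and "ideal_in (polys X) J \<Longrightarrow> (\<And>f. f \<in> orbit_ideal \<Longrightarrow> f \<noteq> 0 \<Longrightarrow> lt D lam f \<in> J) \<Longrightarrow> lt_ideal D lam m orbit_ideal \<subseteq> J"
proof -
  have F: "lt D lam ` (orbit_ideal - {0}) \<subseteq> polys X" by (auto simp: lt_def intro: sgc_polys)
  have e: "lt_ideal D lam m orbit_ideal = ideal_spanned (polys X) (lt D lam ` (orbit_ideal - {0}))" by (simp add: lt_ideal_def coord_ring_polys)
  show "ideal_in (polys X) (lt_ideal D lam m orbit_ideal)" unfolding e by (rule ideal_spanned_ideal(1)[OF F])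
  show "f \<in> orbit_ideal \<Longrightarrow> f \<noteq> 0 \<Longrightarrow> lt D lam f \<in> lt_ideal D lam m orbit_ideal" 
    unfolding e using ideal_spanned_ideal(2)[OF F] by blast
  assume J: "ideal_in (polys X) J" "\<And>f. f \<in> orbit_ideal \<Longrightarrow> f \<noteq> 0 \<Longrightarrow> lt D lam f \<in> J"
  have "lt D lam ` (orbit_ideal - {0}) \<subseteq> J" using J(2) by blast
  then show "lt_ideal D lam m orbit_ideal \<subseteq> J" unfolding e ideal_spanned_def using J(1) by (rule hull_minimal)
qed

lemma lt_ideal_subset: "lt_ideal D lam m orbit_ideal \<subseteq> binomial_ideal D lam m"
proof (rule lt_ideal(3)[OF binomial_ideal(1)])
  fix f assume f: "f \<in> orbit_ideal" "f \<noteq> 0"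
  obtain a where a: "a \<in> Poly_Mapping.keys f" "least_sign D lam f = monomial_sign lam a"
    "\<And>b. b \<in> Poly_Mapping.keys f \<Longrightarrow> monomial_sign lam b = monomial_sign lam a \<or> sig_less D (monomial_sign lam a) (monomial_sign lam b)"
    using least_sign_exists[of f] f by blast
  have "Poly_Mapping.keys a \<subseteq> X" using f(1) a(1) by (auto simp: polys_def)
  then have "cf (ms a) (wcomp (wt a) f) = 0" using f(1) ms_Tup words_vanish_iff by blast
  moreover have "cf (ms a) (wcomp (wt a) f) = (\<Sum>b\<in>Poly_Mapping.keys (sgc (wt a, ms a) f). Poly_Mapping.lookup f b)"
  proof (rule cf_least_component)
    show "ms b = ms a \<or> mless (ms a) (ms b)" if "b \<in> Poly_Mapping.keys f" "wt b = wt a" for b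
      using a(3)[OF that(1)] that(2) by (auto simp: sign_eq sig_less_eq)
  qed (use f in simp)
  ultimately have "(\<Sum>b\<in>Poly_Mapping.keys (sgc (wt a, ms a) f). Poly_Mapping.lookup f b) = 0" by simp
  then show "lt D lam f \<in> binomial_ideal D lam m"
    using f(1) by (simp add: lt_def a(2) sign_eq zero_sum_binomial)
qed

text \<open>Subduction. The lowest exponent \<open>q\<close> of \<open>g\<close> is essential, so by
  hypothesis some monomial of signature \<open>(k, q)\<close> exists, and a multiple of it cancels
  the coefficient at \<open>q\<close>. The number of essential exponents above the current bound
  drops, since \<open>q\<close> becomes the bound.\<close>

lemma reduction:
  assumes \<Sigma>: "Sigma_over D weight_semigroup = Sigma_gen D (lam ` {..<m})" and k: "k \<in> weight_semigroup" "k \<in> Dom"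
    and g: "g \<in> wpoly k" "\<And>q. q = s \<or> mless q s \<Longrightarrow> cf q g = 0" and s: "s \<in> Tup"
  shows "\<exists>r\<in>wpoly k. (\<forall>a\<in>Poly_Mapping.keys r. mless s (ms a)) \<and> words_vanish (g - r)"
  using g s
proof (induction "card {q \<in> Ess k. mless s q}" arbitrary: g s rule: less_induct)
  case less
  show ?case
  proof (cases "\<forall>p\<in>Tup. cf p g = 0")
    case True
    then show ?thesis using less.prems(1) cv.subspace_0[OF wpoly_subspace]
      by (intro bexI[of _ 0]) (simp_all add: words_vanish_wpoly)
  next
    case False
    then obtain q where q: "q \<in> Tup" "cf q g \<noteq> 0" "\<And>r. mless r q \<Longrightarrow> cf r g = 0" using least_cf by blast
    have sq: "mless s q" using mless_total[OF less.prems(3) q(1)] less.prems(2) q(2) by blast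
    have qE: "q \<in> Ess k" by (rule leading_Ess[OF k(2) less.prems(1) q])
    then have "(k, q) \<in> Sigma_gen D (lam ` {..<m})" unfolding \<Sigma>[symmetric] using k(1) by (simp add: Sigma_over_def Ess_def)
    then obtain a where a: "Poly_Mapping.keys a \<subseteq> X" "wt a = k" "ms a = q" by (auto simp: Sigma_gen_eq sign_eq)
    define t where "t = cf q g *\<^sub>C Poly_Mapping.single a (1::complex)"
    have t: "t \<in> wpoly k" using monomial_wpoly[OF a(1), of 1] a(2) cv.subspace_scale[OF wpoly_subspace] by (simp add: t_def)
    have ct: "cf p t = (if p = q then cf q g else 0)" if "p = q \<or> mless p q" for p
      using cf_monomial[OF a(1)] that by (auto simp: t_def a(3))
    have "\<exists>r\<in>wpoly k. (\<forall>a\<in>Poly_Mapping.keys r. mless q (ms a)) \<and> words_vanish (g - t - r)"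
    proof (rule less.hyps)
      show "card {p \<in> Ess k. mless q p} < card {q \<in> Ess k. mless s q}"
      proof (rule psubset_card_mono)
        show "{p \<in> Ess k. mless q p} \<subset> {q \<in> Ess k. mless s q}" using sq qE mless_trans[OF sq] mless_irrefl by blast
      qed (simp add: Ess_finite)
      show "g - t \<in> wpoly k" by (rule cv.subspace_diff[OF wpoly_subspace less.prems(1) t])
      show "cf p (g - t) = 0" if "p = q \<or> mless p q" for p using ct[OF that] that q(3)[of p] by auto
    qed (rule q(1))
    then obtain r where r: "r \<in> wpoly k" "\<And>a. a \<in> Poly_Mapping.keys r \<Longrightarrow> mless q (ms a)" "words_vanish (g - t - r)" by blast
    have "mless s (ms b)" if "b \<in> Poly_Mapping.keys (t + r)" for b
    proof -
      have "b = a \<or> b \<in> Poly_Mapping.keys r"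
        using that keys_add[of t r] keys_scaleC_subset[of "cf q g" "Poly_Mapping.single a 1"] by (auto simp: t_def)
      then show ?thesis using r(2)[of b] sq a(3) mless_trans[OF sq] by blast
    qed
    moreover have "t + r \<in> wpoly k" by (rule cv.subspace_add[OF wpoly_subspace t r(1)])
    moreover have "words_vanish (g - (t + r))" using r(3) by (simp add: diff_diff_eq)
    ultimately show ?thesis by blast
  qed
qed

lemma binomial_ideal_subset:
  assumes \<Sigma>: "Sigma_over D weight_semigroup = Sigma_gen D (lam ` {..<m})"
  shows "binomial_ideal D lam m \<subseteq> lt_ideal D lam m orbit_ideal"
proof -
  let ?x = "\<lambda>a. Poly_Mapping.single a (1::complex)"
  have "?x a - ?x b \<in> lt_ideal D lam m orbit_ideal"
    if a: "Poly_Mapping.keys a \<subseteq> X" and b: "Poly_Mapping.keys b \<subseteq> X" and ab: "monomial_sign lam a = monomial_sign lam b" for a b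
  proof (cases "a = b")
    case False
    have s: "wt b = wt a" "ms b = ms a" using ab by (simp_all add: sign_eq)
    define g where "g = ?x a - ?x b"
    have g: "g \<in> wpoly (wt a)"
      unfolding g_def using monomial_wpoly[OF a] monomial_wpoly[OF b] s by (intro cv.subspace_diff[OF wpoly_subspace]) auto
    \<comment> \<open>Both monomials have the same lowest exponent with coefficient 1, so the
      difference starts strictly later and the correction \<open>r\<close> has only larger
      signatures. The binomial is therefore the least component of \<open>g - r\<close>.\<close>
    have "cf q g = 0" if "q = ms a \<or> mless q (ms a)" for q
      using that cf_monomial[OF a] cf_monomial[OF b] s by (auto simp: g_def)
    then obtain r where r: "r \<in> wpoly (wt a)" "\<And>c. c \<in> Poly_Mapping.keys r \<Longrightarrow> mless (ms a) (ms c)" "words_vanish (g - r)"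
      using reduction[OF \<Sigma> wt_generated[OF a] sign_signature(1)[OF a] g _ ms_Tup[OF a]] by blast
    have r0: "Poly_Mapping.lookup r c = 0" if "ms c = ms a" for c
      using r(2)[of c] that mless_irrefl by (auto simp: in_keys_iff)
    have g0: "Poly_Mapping.lookup g c = 0" if "c \<noteq> a" "c \<noteq> b" for c
      using that by (simp add: g_def lookup_minus lookup_single)
    have ga: "Poly_Mapping.lookup (g - r) a = 1" using False r0[of a] by (simp add: g_def lookup_minus lookup_single)
    have "least_sign D lam (g - r) = monomial_sign lam a"
    proof (rule least_sign_unique)
      show "monomial_sign lam a \<in> monomial_sign lam ` Poly_Mapping.keys (g - r)" using ga by (auto simp: in_keys_iff)
      fix c assume "c \<in> Poly_Mapping.keys (g - r)"
      then have "c = a \<or> c = b \<or> c \<in> Poly_Mapping.keys r" using g0[of c] by (auto simp: in_keys_iff lookup_minus)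
      then show "monomial_sign lam c = monomial_sign lam a \<or> sig_less D (monomial_sign lam a) (monomial_sign lam c)"
        using ab r(2)[of c] wpolyD(2)[OF r(1), of c] by (auto simp: sign_eq sig_less_eq)
    qed
    then have "lt D lam (g - r) = sgc (wt a, ms a) (g - r)" by (simp add: lt_def sign_eq)
    also have "\<dots> = g"
    proof (rule poly_mapping_eqI)
      fix c show "Poly_Mapping.lookup (sgc (wt a, ms a) (g - r)) c = Poly_Mapping.lookup g c"
        using r0[of c] g0[of c] s by (auto simp: lookup_sgc sign_eq lookup_minus)
    qed
    finally have "lt D lam (g - r) = g" .
    moreover have "g - r \<in> orbit_ideal" using r(3) wpolyD(1)[OF cv.subspace_diff[OF wpoly_subspace g r(1)]] by blast
    moreover have "g - r \<noteq> 0" using ga by auto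
    ultimately show ?thesis using lt_ideal(2)[of "g - r"] by (simp add: g_def)
  qed (simp add: ideal_inD[OF lt_ideal(1)])
  then show ?thesis
    unfolding binomial_ideal_def ideal_spanned_def coord_ring_polys
    by (intro hull_minimal lt_ideal(1)) blast
qed

text \<open>Every homogeneous component, zero components included, must be the component of an
  element of the orbit ideal of the same weight without smaller terms. In this componentwise form
  the property defines an ideal, so it extends from least components to the ideal they
  generate.\<close>

definition liftable :: "(nat \<times> exponent) mpoly set" where
  "liftable = {g \<in> polys X. \<forall>\<sigma>. \<exists>f\<in>wpoly (fst \<sigma>). words_vanish f \<and>
    (\<forall>a\<in>Poly_Mapping.keys f. ms a = snd \<sigma> \<or> mless (snd \<sigma>) (ms a)) \<and> sgc \<sigma> f = sgc \<sigma> g}"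

lemma liftableI:
  assumes "g \<in> polys X" and "\<And>\<sigma>. \<exists>f\<in>wpoly (fst \<sigma>). words_vanish f \<and>
    (\<forall>a\<in>Poly_Mapping.keys f. ms a = snd \<sigma> \<or> mless (snd \<sigma>) (ms a)) \<and> sgc \<sigma> f = sgc \<sigma> g"
  shows "g \<in> liftable"
  using assms unfolding liftable_def by blast

lemma liftableE:
  assumes "g \<in> liftable"
  obtains f where "f \<in> wpoly (fst \<sigma>)" "f \<in> orbit_ideal" "\<And>a. a \<in> Poly_Mapping.keys f \<Longrightarrow> ms a = snd \<sigma> \<or> mless (snd \<sigma>) (ms a)"
    "sgc \<sigma> f = sgc \<sigma> g"
proof -
  have "\<exists>f\<in>wpoly (fst \<sigma>). words_vanish f \<and>
    (\<forall>a\<in>Poly_Mapping.keys f. ms a = snd \<sigma> \<or> mless (snd \<sigma>) (ms a)) \<and> sgc \<sigma> f = sgc \<sigma> g"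
    using assms unfolding liftable_def by blast
  then show thesis using that wpolyD(1) by blast
qed

lemma liftable_ideal: "ideal_in (polys X) liftable"
proof -
  note orbit_ideal = ideal_inD[OF orbit_ideal_is_ideal]
  have zero: "0 \<in> liftable"
    using orbit_ideal(1) cv.subspace_0[OF wpoly_subspace] by (intro liftableI bexI[of _ 0]) auto
  have add: "g + h \<in> liftable" if g: "g \<in> liftable" and h: "h \<in> liftable" for g h
  proof (rule liftableI)
    show "g + h \<in> polys X" using g h by (auto simp: liftable_def polys_add)
    fix \<sigma>
    obtain f where f: "f \<in> wpoly (fst \<sigma>)" "f \<in> orbit_ideal" "\<And>a. a \<in> Poly_Mapping.keys f \<Longrightarrow> ms a = snd \<sigma> \<or> mless (snd \<sigma>) (ms a)"
      "sgc \<sigma> f = sgc \<sigma> g" using liftableE[OF g] by blast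
    obtain f' where f': "f' \<in> wpoly (fst \<sigma>)" "f' \<in> orbit_ideal" "\<And>a. a \<in> Poly_Mapping.keys f' \<Longrightarrow> ms a = snd \<sigma> \<or> mless (snd \<sigma>) (ms a)"
      "sgc \<sigma> f' = sgc \<sigma> h" using liftableE[OF h] by blast
    show "\<exists>f\<in>wpoly (fst \<sigma>). words_vanish f \<and>
      (\<forall>a\<in>Poly_Mapping.keys f. ms a = snd \<sigma> \<or> mless (snd \<sigma>) (ms a)) \<and> sgc \<sigma> f = sgc \<sigma> (g + h)"
    proof (intro bexI[of _ "f + f'"] conjI ballI)
      show "words_vanish (f + f')" using orbit_ideal(2)[OF f(2) f'(2)] by simp
      show "sgc \<sigma> (f + f') = sgc \<sigma> (g + h)" using f(4) f'(4) by simp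
      show "ms a = snd \<sigma> \<or> mless (snd \<sigma>) (ms a)" if "a \<in> Poly_Mapping.keys (f + f')" for a
        using that keys_add[of f f'] f(3)[of a] f'(3)[of a] by blast
    qed (rule cv.subspace_add[OF wpoly_subspace f(1) f'(1)])
  qed
  have scale: "c *\<^sub>C g \<in> liftable" if g: "g \<in> liftable" for c g
  proof (rule liftableI)
    show "c *\<^sub>C g \<in> polys X" using g by (auto simp: liftable_def polys_scale)
    fix \<sigma>
    obtain f where f: "f \<in> wpoly (fst \<sigma>)" "f \<in> orbit_ideal" "\<And>a. a \<in> Poly_Mapping.keys f \<Longrightarrow> ms a = snd \<sigma> \<or> mless (snd \<sigma>) (ms a)"
      "sgc \<sigma> f = sgc \<sigma> g" using liftableE[OF g] by blast
    show "\<exists>f\<in>wpoly (fst \<sigma>). words_vanish f \<and>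
      (\<forall>a\<in>Poly_Mapping.keys f. ms a = snd \<sigma> \<or> mless (snd \<sigma>) (ms a)) \<and> sgc \<sigma> f = sgc \<sigma> (c *\<^sub>C g)"
    proof (intro bexI[of _ "c *\<^sub>C f"] conjI ballI)
      show "words_vanish (c *\<^sub>C f)" using orbit_ideal(4)[OF f(2)] by simp
      show "sgc \<sigma> (c *\<^sub>C f) = sgc \<sigma> (c *\<^sub>C g)" using f(4) by simp
      show "ms a = snd \<sigma> \<or> mless (snd \<sigma>) (ms a)" if "a \<in> Poly_Mapping.keys (c *\<^sub>C f)" for a
        using that keys_scaleC_subset[of c f] f(3)[of a] by blast
    qed (rule cv.subspace_scale[OF wpoly_subspace f(1)])
  qed
  have mult: "Poly_Mapping.single b 1 * g \<in> liftable" if g: "g \<in> liftable" and b: "Poly_Mapping.keys b \<subseteq> X" for b g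
  proof (rule liftableI)
    let ?b = "Poly_Mapping.single b (1::complex)"
    show "?b * g \<in> polys X" using g b by (auto simp: liftable_def polys_mult polys_single)
    fix \<sigma>
    show "\<exists>f\<in>wpoly (fst \<sigma>). words_vanish f \<and>
      (\<forall>a\<in>Poly_Mapping.keys f. ms a = snd \<sigma> \<or> mless (snd \<sigma>) (ms a)) \<and> sgc \<sigma> f = sgc \<sigma> (?b * g)"
    \<comment> \<open>Multiplication by a monomial shifts signatures; a component whose signature is
      not reached by the shift is 0 and is lifted by 0.\<close>
    proof (cases "\<exists>\<tau>. \<sigma> = monomial_sign lam b + \<tau>")
      case True
      then obtain \<tau> where \<tau>: "\<sigma> = monomial_sign lam b + \<tau>" by blast
      obtain f where f: "f \<in> wpoly (fst \<tau>)" "f \<in> orbit_ideal" "\<And>a. a \<in> Poly_Mapping.keys f \<Longrightarrow> ms a = snd \<tau> \<or> mless (snd \<tau>) (ms a)"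
        "sgc \<tau> f = sgc \<tau> g" using liftableE[OF g] by blast
      have k: "\<exists>c\<in>Poly_Mapping.keys f. a = b + c" if "a \<in> Poly_Mapping.keys (?b * f)" for a
        using that keys_mult[of ?b f] by (auto split: if_splits)
      show ?thesis
      proof (intro bexI[of _ "?b * f"] conjI ballI)
        show "words_vanish (?b * f)" using orbit_ideal(3)[OF polys_single[OF b] f(2)] by simp
        show "sgc \<sigma> (?b * f) = sgc \<sigma> (?b * g)" unfolding \<tau> sgc_monomial_mult f(4) ..
        show "ms a = snd \<sigma> \<or> mless (snd \<sigma>) (ms a)" if a: "a \<in> Poly_Mapping.keys (?b * f)" for a
        proof -
          obtain c where c: "c \<in> Poly_Mapping.keys f" "a = b + c" using k[OF a] by blast
          then show ?thesis using f(3)[OF c(1)] mless_add[of "snd \<tau>" "ms c", OF _ ms_Tup[OF b]]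
            by (auto simp: \<tau> ms_def monomial_sign_add add.commute[of "snd (monomial_sign lam b)"])
        qed
        show "?b * f \<in> wpoly (fst \<sigma>)"
          unfolding wpoly_def keyed_def
        proof (intro CollectI subsetI)
          fix a assume "a \<in> Poly_Mapping.keys (?b * f)"
          then obtain c where c: "c \<in> Poly_Mapping.keys f" "a = b + c" using k by blast
          then show "Poly_Mapping.keys a \<subseteq> X \<and> wt a = fst \<sigma>"
            using wpolyD(2,3)[OF f(1) c(1)] b keys_add[of b c] by (auto simp: \<tau> wt_def[of b])
        qed
      qed
    next
      case False
      then have "sgc \<sigma> (?b * g) = 0" by (intro sgc_monomial_mult_zero) blast
      then show ?thesis using orbit_ideal(1) cv.subspace_0[OF wpoly_subspace] by (intro bexI[of _ 0]) auto
    qed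
  qed
  have "r * g \<in> liftable" if r: "r \<in> polys X" and g: "g \<in> liftable" for r g
    using r[unfolded polys_keys]
  proof (induction r rule: mpoly_linear_induct)
    case (single a)
    then show ?case using mult[OF g] by simp
  qed (auto simp: zero add scale algebra_simps scaleC_mult)
  then show ?thesis using zero add by (auto simp: ideal_in_def liftable_def)
qed

text \<open>The least component of \<open>f\<close> is lifted by the weight component of
  \<open>f\<close>, which vanishes on the orbit as well; the other components of a least component
  are 0.\<close>

lemma lt_ideal_liftable: "lt_ideal D lam m orbit_ideal \<subseteq> liftable"
proof (rule lt_ideal(3)[OF liftable_ideal], rule liftableI)
  fix f \<sigma> assume f: "f \<in> orbit_ideal" "f \<noteq> 0"
  show "lt D lam f \<in> polys X" using f(1) sgc_polys by (simp add: lt_def)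
  obtain a where a: "a \<in> Poly_Mapping.keys f" "least_sign D lam f = monomial_sign lam a"
    "\<And>b. b \<in> Poly_Mapping.keys f \<Longrightarrow> monomial_sign lam b = monomial_sign lam a \<or> sig_less D (monomial_sign lam a) (monomial_sign lam b)"
    using least_sign_exists[of f] f by blast
  have ss: "sgc \<sigma> (lt D lam f) = (if \<sigma> = monomial_sign lam a then sgc \<sigma> f else 0)"
    by (rule poly_mapping_eqI) (auto simp: lt_def a(2) lookup_sgc)
  show "\<exists>g\<in>wpoly (fst \<sigma>). words_vanish g \<and>
      (\<forall>a\<in>Poly_Mapping.keys g. ms a = snd \<sigma> \<or> mless (snd \<sigma>) (ms a)) \<and> sgc \<sigma> g = sgc \<sigma> (lt D lam f)"
  proof (cases "\<sigma> = monomial_sign lam a")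
    case True
    show ?thesis
    proof (intro bexI[of _ "wcomp (fst \<sigma>) f"] conjI ballI)
      show "wcomp (fst \<sigma>) f \<in> wpoly (fst \<sigma>)" "words_vanish (wcomp (fst \<sigma>) f)"
        using f(1) wcomp_wpoly words_vanish_wcomp by auto
      show "sgc \<sigma> (wcomp (fst \<sigma>) f) = sgc \<sigma> (lt D lam f)" using ss True by (simp add: sgc_wcomp)
      fix b assume "b \<in> Poly_Mapping.keys (wcomp (fst \<sigma>) f)"
      then have "b \<in> Poly_Mapping.keys f" "wt b = wt a" by (auto simp: in_keys_iff lookup_wcomp True sign_eq split: if_splits)
      then show "ms b = snd \<sigma> \<or> mless (snd \<sigma>) (ms b)"
        using a(3)[of b] by (auto simp: True sign_eq sig_less_eq)
    qed
  next
    case False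
    then show ?thesis using ss ideal_inD(1)[OF orbit_ideal_is_ideal] cv.subspace_0[OF wpoly_subspace] by (intro bexI[of _ 0]) auto
  qed
qed

text \<open>On polynomials of weight \<open>k\<close> the essential coefficient functionals are
  independent, since a relation would pass to the basis of \<open>V(k)\<close>. The dual vector at
  \<open>p\<close> then also has no smaller nonessential coefficients, by triangularity.\<close>

lemma cf_dual:
  assumes k: "k \<in> weight_semigroup" and p: "p \<in> Ess k"
  obtains f where "f \<in> wpoly k" "cf p f \<noteq> 0" "\<And>q. mless q p \<Longrightarrow> cf q f = 0"
proof -
  have kD: "k \<in> Dom" using p by (simp add: Ess_iff)
  have "\<exists>v. \<forall>q\<in>Ess k. v q \<in> wpoly k \<and> (\<forall>r\<in>Ess k. cf q (v r) = (if q = r then 1 else 0))"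
  proof (rule dual_vectors[OF Ess_finite wpoly_subspace])
    show "lin_on (wpoly k) (cf q)" for q using cf_lin[of q] by (simp add: lin_on_def)
    fix \<gamma> q assume \<gamma>: "\<And>f. f \<in> wpoly k \<Longrightarrow> (\<Sum>q\<in>Ess k. \<gamma> q * cf q f) = 0" and q: "q \<in> Ess k"
    have "(\<Sum>q\<in>Ess k. \<gamma> q *\<^sub>C vv k q) = 0"
      using Ess_tuples by (intro cf_to_relation[OF kD k Ess_finite _ \<gamma>]) auto
    moreover have "vcoord k q (\<Sum>r\<in>Ess k. \<gamma> r *\<^sub>C vv k r) = (\<Sum>r\<in>Ess k. \<gamma> r *\<^sub>C vcoord k q (vv k r))"
      by (rule lin_on_sum_scale[OF vcoord_lin[OF kD] irrep_subspace[OF kD] vv_in_irrep[OF kD]])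
    moreover have "vcoord k q 0 = 0" using lin_on_zero[OF vcoord_lin[OF kD]] irrep_subspace[OF kD] cv.subspace_0 by blast
    ultimately show "\<gamma> q = 0" using q by (simp add: vcoord_vv Ess_finite if_distrib[of "\<lambda>x. _ * x"] cong: if_cong)
  qed
  then obtain v where v: "\<And>q. q \<in> Ess k \<Longrightarrow> v q \<in> wpoly k" "\<And>q r. q \<in> Ess k \<Longrightarrow> r \<in> Ess k \<Longrightarrow> cf q (v r) = (if q = r then 1 else 0)"
    by blast
  show thesis
  proof (rule that[OF v(1)[OF p]])
    show "cf p (v p) \<noteq> 0" using v(2)[OF p p] by simp
    fix q assume q: "mless q p"
    then have "cf q (v p) = (\<Sum>r\<in>Ess k. vcoord k r (vv k q) * (if r = p then 1 else 0))"
      using mless_tuples v(2) p by (subst cf_Ess[OF kD v(1)[OF p]]) (auto intro!: sum.cong)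
    also have "\<dots> = vcoord k p (vv k q)" using p by (simp add: Ess_finite if_distrib[of "\<lambda>x. _ * x"] cong: if_cong)
    finally show "cf q (v p) = 0" using vcoord_low[OF p q] by simp
  qed
qed

text \<open>If no monomial has signature \<open>(k, p)\<close>, any \<open>f\<close> with lowest
  exponent \<open>p\<close> must begin with terms of smaller signature that cancel along the orbit.
  Lifting their sum to an element of the orbit ideal and subtracting it keeps all coefficients and
  raises the least signature, which cannot go on forever.\<close>

lemma Sigma_over_subset:
  assumes J: "binomial_ideal D lam m \<subseteq> lt_ideal D lam m orbit_ideal"
  shows "Sigma_over D weight_semigroup \<subseteq> Sigma_gen D (lam ` {..<m})"
proof (rule ccontr)
  assume "\<not> ?thesis"
  then obtain k p where "(k, p) \<in> Sigma_over D weight_semigroup" and n: "(k, p) \<notin> Sigma_gen D (lam ` {..<m})" by auto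
  then have k: "k \<in> weight_semigroup" and p: "p \<in> Ess k" by (auto simp: Sigma_over_def Ess_def)
  have kD: "k \<in> Dom" using p by (simp add: Ess_iff)
  obtain f where f: "f \<in> wpoly k" "cf p f \<noteq> 0" "\<And>q. mless q p \<Longrightarrow> cf q f = 0" using cf_dual[OF k p] by metis
  \<comment> \<open>The descent measure: the essential exponents not below all terms of
    \<open>f\<close>. It loses the exponent of the least term at every step.\<close>
  define up where "up f = {q \<in> Ess k. \<exists>a\<in>Poly_Mapping.keys f. q = ms a \<or> mless (ms a) q}" for f :: "(nat \<times> exponent) mpoly"
  show False
    using f
  proof (induction "card (up f)" arbitrary: f rule: less_induct)
    case less
    note f = less.prems
    have "f \<noteq> 0" using f(2) by auto
    then obtain a where a: "a \<in> Poly_Mapping.keys f"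
      "\<And>b. b \<in> Poly_Mapping.keys f \<Longrightarrow> monomial_sign lam b = monomial_sign lam a \<or> sig_less D (monomial_sign lam a) (monomial_sign lam b)"
      using least_sign_exists[OF wpolyD(1)[OF f(1)]] by blast
    have aX: "Poly_Mapping.keys a \<subseteq> X" "wt a = k" using wpolyD[OF f(1)] a(1) by auto
    have min: "ms b = ms a \<or> mless (ms a) (ms b)" if "b \<in> Poly_Mapping.keys f" for b
      using a(2)[OF that] wpolyD(2)[OF f(1) that] aX(2) by (auto simp: sign_eq sig_less_eq)
    \<comment> \<open>The least exponent is not \<open>p\<close> by the choice of
      \<open>(k, p)\<close>, and if it were larger, no term of \<open>f\<close> could contribute to
      \<open>cf p f\<close>.\<close>
    have ap: "mless (ms a) p"
    proof (rule ccontr)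
      assume "\<not> mless (ms a) p"
      moreover have "ms a \<noteq> p" using n aX by (auto simp: Sigma_gen_eq sign_eq)
      ultimately have pa: "mless p (ms a)" using mless_total[OF ms_Tup[OF aX(1)] Ess_tuples[OF p]] by blast
      have "cf p f = (\<Sum>b\<in>Poly_Mapping.keys f. Poly_Mapping.lookup f b * cf p (Poly_Mapping.single b 1))" by (rule cf_expand)
      also have "\<dots> = 0"
      proof (rule sum.neutral, rule ballI)
        fix b assume b: "b \<in> Poly_Mapping.keys f"
        have "mless p (ms b)" using min[OF b] pa mless_trans[OF pa] by auto
        then show "Poly_Mapping.lookup f b * cf p (Poly_Mapping.single b 1) = 0"
          using cf_monomial(2)[OF wpolyD(3)[OF f(1) b]] by simp
      qed
      finally show False using f(2) by simp
    qed
    let ?\<sigma> = "(k, ms a)"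
    have "cf (ms a) f = (\<Sum>b\<in>Poly_Mapping.keys (sgc ?\<sigma> f). Poly_Mapping.lookup f b)"
      using cf_least_component[OF wpolyD(1)[OF f(1)] min, of k] by (simp add: wcomp_of_wpoly[OF f(1)])
    then have "sgc ?\<sigma> f \<in> binomial_ideal D lam m"
      using f(3)[OF ap] by (intro zero_sum_binomial wpolyD(1)[OF f(1)]) simp
    then have "sgc ?\<sigma> f \<in> liftable" using J lt_ideal_liftable by blast
    then obtain h where h: "h \<in> wpoly k" "h \<in> orbit_ideal" "\<And>b. b \<in> Poly_Mapping.keys h \<Longrightarrow> ms b = ms a \<or> mless (ms a) (ms b)"
      "sgc ?\<sigma> h = sgc ?\<sigma> (sgc ?\<sigma> f)" using liftableE[of "sgc ?\<sigma> f" ?\<sigma>] by auto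
    have cfh: "cf q (f - h) = cf q f" if "q \<in> Tup" for q using h(1,2) that by (simp add: words_vanish_wpoly)
    \<comment> \<open>The terms of exponent \<open>ms a\<close> cancel because the least components
      of \<open>f\<close> and \<open>h\<close> agree, and neither has smaller terms.\<close>
    have up: "mless (ms a) (ms b)" if b: "b \<in> Poly_Mapping.keys (f - h)" for b
    proof (rule ccontr)
      assume nl: "\<not> mless (ms a) (ms b)"
      have bfh: "b \<in> Poly_Mapping.keys f \<or> b \<in> Poly_Mapping.keys h" using b by (auto simp: in_keys_iff lookup_minus)
      then have "ms b = ms a" "wt b = k" using nl min h(3) wpolyD(2)[OF f(1)] wpolyD(2)[OF h(1)] by blast+
      then have "Poly_Mapping.lookup h b = Poly_Mapping.lookup f b"
        using arg_cong[OF h(4), of "\<lambda>g. Poly_Mapping.lookup g b"] by (simp add: lookup_sgc sign_eq)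
      then show False using b by (simp add: in_keys_iff lookup_minus)
    qed
    show False
    proof (rule less.hyps[of "f - h"])
      show "f - h \<in> wpoly k" by (rule cv.subspace_diff[OF wpoly_subspace f(1) h(1)])
      show "cf p (f - h) \<noteq> 0" using f(2) cfh[OF Ess_tuples[OF p]] by simp
      show "cf q (f - h) = 0" if "mless q p" for q using f(3)[OF that] cfh mless_tuples[OF that] by simp
      show "card (up (f - h)) < card (up f)"
      proof (rule psubset_card_mono)
        show "finite (up f)" using Ess_finite by (simp add: up_def)
        have aE: "ms a \<in> up f" using a(1) ms_Ess[OF aX(1)] aX(2) by (auto simp: up_def)
        have "ms a \<notin> up (f - h)" using up mless_irrefl mless_asym by (fastforce simp: up_def)
        moreover have "up (f - h) \<subseteq> up f"
        proof
          fix q assume "q \<in> up (f - h)"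
          then obtain b where "q \<in> Ess k" "b \<in> Poly_Mapping.keys (f - h)" "q = ms b \<or> mless (ms b) q" by (auto simp: up_def)
          then have "q \<in> Ess k" "mless (ms a) q" using up[of b] mless_trans by blast+
          then show "q \<in> up f" using a(1) by (auto simp: up_def)
        qed
        ultimately show "up (f - h) \<subset> up f" using aE by blast
      qed
    qed
  qed
qed

lemma Sigma_eq_iff_lt_ideal_eq: "Sigma_over D weight_semigroup = Sigma_gen D (lam ` {..<m}) \<longleftrightarrow> lt_ideal D lam m orbit_ideal = binomial_ideal D lam m"
  using lt_ideal_subset binomial_ideal_subset Sigma_over_subset Sigma_gen_subset by blast

end

theorem proposition4:
  fixes D :: "('g::complex_lie_algebra, 'v::complex_vector) lie_setup"
    and G :: "(complex^'n^'n) set"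
    and \<iota> :: "'g \<Rightarrow> complex^'n^'n"
    and R :: "weight \<Rightarrow> complex^'n^'n \<Rightarrow> 'v \<Rightarrow> 'v"
    and lam :: "nat \<Rightarrow> weight"
    and m :: nat
    and S :: "weight set"
    and X :: "(nat \<Rightarrow> 'v) set"
    and I :: "(nat \<times> exponent) mpoly set"
  assumes "simple_lie_algebra TYPE('g)"
    and "root_setup D"
    and "monomial_order (num_pos D) (mon_order D)"
    and "module_setup D"
    and "linear_algebraic_group G"
    and "simply_connected G"
    and "lie_algebra_iso G \<iota>"
    and "\<And>k. k \<in> dominant_weights D \<Longrightarrow> rational_rep G \<iota> (irrep D k) (action D k) (R k)"
    and "\<And>j. j < m \<Longrightarrow> lam j \<in> dominant_weights D"
    and "S = generated (lam ` {..<m})"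
    and "X = zariski_closure D lam m (orbit D G R lam m)"
    and "I = vanishing_ideal D lam m X"
  shows "Sigma_over D S = Sigma_gen D (lam ` {..<m}) \<longleftrightarrow>
         lt_ideal D lam m I = binomial_ideal D lam m"
proof -
  interpret group_orbit D lam m G \<iota> R
    by unfold_locales (use assms simply_connected_imp_connected in blast)+
  show ?thesis unfolding assms(10-12) vanishing_ideal_orbit_closure by (rule Sigma_eq_iff_lt_ideal_eq)
qed

end
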